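(* The compactification $\widehat{\mathrm{Spec}\,\mathbb{Z}}=\varprojlim_{N>1}\widehat{\mathrm{Spec}\,\mathbb{Z}}^{(N)}$ is a projective pro-scheme over $\mathbb{F}_1$; that is, it is a filtered projective limit (in the category of pro-generalized schemes) of generalized schemes over $\mathbb{F}_1$ each of which is isomorphic to the projective spectrum $\mathrm{Proj}\,R$ of an $\mathbb{N}$-graded generalized ring $R$.
   Context: **Generalized rings.** A monad on sets is an endofunctor $\Sigma$ of the category of sets with natural transformations $\mu:\Sigma^2\to\Sigma$, $\epsilon:\mathrm{id}\to\Sigma$ satisfying the usual associativity and unit axioms. It is algebraic if $\Sigma$ commutes with filtered inductive limits. Put $\mathbf{n}=\{1,\dots,n\}$; elements of $\Sigma(\mathbf{n})$ are $n$-ary operations (constants for $n=0$), and $|\Sigma|=\Sigma(\mathbf{1})$ is a monoid under composition of unary operations. A $\Sigma$-module is a set $X$ with $\alpha:\Sigma(X)\to X$ such that $\alpha\circ\mu_X=\alpha\circ\Sigma(\alpha)$ and $\alpha\circ\epsilon_X=\mathrm{id}$; $t\in\Sigma(\mathbf{n})$ acts by $t(x_1,\dots,x_n)=\alpha(\Sigma(x)(t))$ where $x:\mathbf{n}\to X$, $k\mapsto x_k$. Operations $t\in\Sigma(\mathbf{n})$, $s\in\Sigma(\mathbf{m})$ commute if on every $n\times m$ matrix of elements of every $\Sigma$-module, applying $s$ to each row and then $t$ to the results equals applying $t$ to each column and then $s$ to the results. A generalized ring is an algebraic monad on sets all of whose operations commute pairwise. A commutative ring $R$ is identified with the monad $\Sigma_R$,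 $\Sigma_R(X)=$ finite formal $R$-linear combinations of elements of $X$. $\mathbb{F}_1$ is the generalized ring $\mathbb{F}_1(X)=X\sqcup\{0\}$ (free algebraic monad on one constant). $\mathbb{Z}_\infty\subset\mathbb{R}$ is the submonad of combinations $\sum\lambda_i\{x_i\}$ with $\sum|\lambda_i|\le1$, and $\mathbb{Z}_{(\infty)}=\mathbb{Z}_\infty\cap\mathbb{Q}$. For an integer $N>1$: $B_N=\mathbb{Z}[1/N]$ and $A_N=B_N\cap\mathbb{Z}_{(\infty)}$, so $A_N(\mathbf{n})=\{(\lambda_1,\dots,\lambda_n)\in B_N^n:\sum|\lambda_i|\le1\}$. **Spectra and schemes.** For a generalized ring $A$ and a submonoid $S\subset|A|$, $A[S^{-1}]$ is the universal generalized ring under $A$ in which elements of $S$ become invertible; $A[S^{-1}](\mathbf{n})$ is the set of classes of pairs $(a,s)\in A(\mathbf{n})\times S$ with $(x,s)\sim(y,t)$ iff $utx=usy$ for some $u\in S$. Write $A_f=A[f^{-1}]$ if $S$ is generated by $f$. An ideal of $A$ is an $A$-submodule of $|A|$; it is prime if its complement in $|A|$ is a submonoid. $\mathrm{Spec}\,A$ is the set of primes with the topology having basis $D(f)=\{\mathfrak{p}:f\notin\mathfrak{p}\}$, with the structure sheaf of generalized rings given by $\Gamma(D(f),\mathcal{O})=A_f$. A generalized scheme is a space with a sheaf of generalized rings locally isomorphic to such spectra (morphisms are locally induced by morphisms of generalized rings); it is a scheme over $\mathbb{F}_1$ if $\Gamma(X,\mathcal{O}_X(\mathbf{0}))\ne\emptyset$.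 **The compactification.** One has $B_N=\mathbb{Z}[N^{-1}]=A_N[(1/N)^{-1}]$, so $\mathrm{Spec}\,B_N$ is a principal open subscheme of both $\mathrm{Spec}\,\mathbb{Z}$ and $\mathrm{Spec}\,A_N$. Define $\widehat{\mathrm{Spec}\,\mathbb{Z}}^{(N)}$ as the gluing of $\mathrm{Spec}\,\mathbb{Z}$ and $\mathrm{Spec}\,A_N$ along $\mathrm{Spec}\,B_N$. For $N,M>1$, the morphism $f_N^{NM}:\widehat{\mathrm{Spec}\,\mathbb{Z}}^{(NM)}\to\widehat{\mathrm{Spec}\,\mathbb{Z}}^{(N)}$ is the identity on the open subscheme $\mathrm{Spec}\,\mathbb{Z}$, and on the open subscheme $V_2=\mathrm{Spec}\,A_{NM}\cup\mathrm{Spec}\,B_N$ (where $\mathrm{Spec}\,B_N\subset\mathrm{Spec}\,\mathbb{Z}$) it is the morphism to $\mathrm{Spec}\,A_N$ corresponding to the identity $A_N\to\Gamma(V_2,\mathcal{O})=A_{NM}\cap B_N=A_N$. Order the integers $>1$ by divisibility; these morphisms (with $f_N^N=\mathrm{id}$) form a filtered projective system, and $\widehat{\mathrm{Spec}\,\mathbb{Z}}$ is its projective limit in the category of pro-generalized schemes (pro-objects). **Proj.** An $\mathbb{N}$-graded generalized ring $R$ is a family of algebraic endofunctors $(R_d)_{d\ge0}$ of sets with $\epsilon:\mathrm{id}\to R_0$ and multiplications $R_d(\mathbf{k})\times R_e(\mathbf{n})^k\to R_{d+e}(\mathbf{n})$ satisfying the graded versions of the axioms of an algebraic monad and such that all operations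 commute; $|R|=\bigsqcup_d R_d(\mathbf{1})$, and $|R|^+$ is the set of elements of positive degree. For $f\in|R|^+$, $R_{(f)}$ is the degree-$0$ part of the localization $R[f^{-1}]$ and $D_+(f)=\mathrm{Spec}\,R_{(f)}$. $\mathrm{Proj}\,R$ is the generalized scheme obtained by gluing the $D_+(f)$, $f\in|R|^+$, along $D_+(f)\cap D_+(g)\cong D_+(fg)$. *)

theory Defs
  imports "HOL-Analysis.Analysis"
begin

section \<open>Generalized rings\<close>

text \<open>
  An algebraic monad \<open>\<Sigma>\<close> on sets is determined by the sets \<open>\<Sigma>(n)\<close> of \<open>n\<close>-ary operations, the
  unit \<open>\<epsilon>\<close>, i.e. the elements \<open>{i} \<in> \<Sigma>(n)\<close>, and the substitution maps
  \<open>\<Sigma>(k) \<times> \<Sigma>(n)\<^sup>k \<rightarrow> \<Sigma>(n)\<close>, \<open>(t, x) \<mapsto> t(x\<^sub>1,\<dots>,x\<^sub>k)\<close>. A map \<open>u : k \<rightarrow> n\<close> acts by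
  \<open>\<Sigma>(u)(t) = t({u(1)},\<dots>,{u(k)})\<close>. HOL cannot quantify over endofunctors of the category of sets,
  so monads are represented by these data.

  \<open>car A n\<close> is \<open>\<Sigma>(n)\<close>, \<open>var A n i\<close> (for \<open>i < n\<close>) is the basis element with (0-based) index \<open>i\<close> and
  \<open>app A n t xs\<close> is \<open>t(xs) \<in> \<Sigma>(n)\<close>, where the arity of \<open>t\<close> is \<open>length xs\<close>. Values outside the
  carriers are irrelevant.
\<close>

record 'a monad =
  car :: "nat \<Rightarrow> 'a set"
  var :: "nat \<Rightarrow> nat \<Rightarrow> 'a"
  app :: "nat \<Rightarrow> 'a \<Rightarrow> 'a list \<Rightarrow> 'a"

definition algebraic_monad :: "'a monad \<Rightarrow> bool" where
  "algebraic_monad A \<longleftrightarrow>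
     (\<forall>n i. i < n \<longrightarrow> var A n i \<in> car A n) \<and>
     (\<forall>n t xs. t \<in> car A (length xs) \<and> set xs \<subseteq> car A n \<longrightarrow> app A n t xs \<in> car A n) \<and>
     (\<forall>n xs i. set xs \<subseteq> car A n \<and> i < length xs \<longrightarrow> app A n (var A (length xs) i) xs = xs ! i) \<and>
     (\<forall>n t. t \<in> car A n \<longrightarrow> app A n t (map (var A n) [0..<n]) = t) \<and>
     (\<forall>m n t xs ys. t \<in> car A (length xs) \<and> set xs \<subseteq> car A m \<and> length ys = m \<and> set ys \<subseteq> car A n \<longrightarrow>
        app A n (app A m t xs) ys = app A n t (map (\<lambda>x. app A n x ys) xs))"

record ('a, 'x) gr_module =
  mcar :: "'x set"
  act :: "'a \<Rightarrow> 'x list \<Rightarrow> 'x"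

definition is_module :: "'a monad \<Rightarrow> ('a, 'x) gr_module \<Rightarrow> bool" where
  "is_module A M \<longleftrightarrow>
     (\<forall>t xs. t \<in> car A (length xs) \<and> set xs \<subseteq> mcar M \<longrightarrow> act M t xs \<in> mcar M) \<and>
     (\<forall>xs i. set xs \<subseteq> mcar M \<and> i < length xs \<longrightarrow> act M (var A (length xs) i) xs = xs ! i) \<and>
     (\<forall>m t us xs. t \<in> car A (length us) \<and> set us \<subseteq> car A m \<and> length xs = m \<and> set xs \<subseteq> mcar M \<longrightarrow>
        act M (app A m t us) xs = act M t (map (\<lambda>u. act M u xs) us))"

definition free_module :: "'a monad \<Rightarrow> nat \<Rightarrow> ('a, 'a) gr_module" where
  "free_module A n = \<lparr>mcar = car A n, act = app A n\<rparr>"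

definition submodule :: "'a monad \<Rightarrow> ('a, 'x) gr_module \<Rightarrow> 'x set \<Rightarrow> bool" where
  "submodule A M S \<longleftrightarrow> S \<subseteq> mcar M \<and>
     (\<forall>t xs. t \<in> car A (length xs) \<and> set xs \<subseteq> S \<longrightarrow> act M t xs \<in> S)"

text \<open>
  Commutation of \<open>t \<in> \<Sigma>(n)\<close> and \<open>s \<in> \<Sigma>(m)\<close>, tested on all modules whose underlying set lives in the
  type \<open>'a\<close> of elements of the monad. These include the free module \<open>\<Sigma>(nm)\<close> with its generic
  \<open>n \<times> m\<close> matrix, so restricting the universe loses nothing.
\<close>

definition ops_commute :: "'a monad \<Rightarrow> nat \<Rightarrow> 'a \<Rightarrow> nat \<Rightarrow> 'a \<Rightarrow> bool" where
  "ops_commute A n t m s \<longleftrightarrow>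
     (\<forall>(M :: ('a, 'a) gr_module) x. is_module A M \<and> (\<forall>i<n. \<forall>j<m. x i j \<in> mcar M) \<longrightarrow>
        act M t (map (\<lambda>i. act M s (map (\<lambda>j. x i j) [0..<m])) [0..<n]) =
        act M s (map (\<lambda>j. act M t (map (\<lambda>i. x i j) [0..<n])) [0..<m]))"

definition generalized_ring :: "'a monad \<Rightarrow> bool" where
  "generalized_ring A \<longleftrightarrow> algebraic_monad A \<and>
     (\<forall>n m. \<forall>t\<in>car A n. \<forall>s\<in>car A m. ops_commute A n t m s)"

definition ring_morphism :: "'a monad \<Rightarrow> 'b monad \<Rightarrow> (nat \<Rightarrow> 'a \<Rightarrow> 'b) \<Rightarrow> bool" where
  "ring_morphism A B \<phi> \<longleftrightarrow>
     (\<forall>n. \<forall>t\<in>car A n. \<phi> n t \<in> car B n) \<and>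
     (\<forall>n i. i < n \<longrightarrow> \<phi> n (var A n i) = var B n i) \<and>
     (\<forall>n t xs. t \<in> car A (length xs) \<and> set xs \<subseteq> car A n \<longrightarrow>
        \<phi> n (app A n t xs) = app B n (\<phi> (length xs) t) (map (\<phi> n) xs))"

text \<open>The monoid \<open>|A|\<close> and its action on \<open>\<Sigma>(n)\<close>, by composition \<open>u \<circ> x = u(x)\<close>.\<close>

definition munit :: "'a monad \<Rightarrow> 'a" where
  "munit A = var A 1 0"

definition mscale :: "'a monad \<Rightarrow> nat \<Rightarrow> 'a \<Rightarrow> 'a \<Rightarrow> 'a" where
  "mscale A n u x = app A n u [x]"

definition submonoid :: "'a monad \<Rightarrow> 'a set \<Rightarrow> bool" where
  "submonoid A S \<longleftrightarrow> S \<subseteq> car A 1 \<and> munit A \<in> S \<and> (\<forall>s\<in>S. \<forall>t\<in>S. mscale A 1 s t \<in> S)"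

fun mpow :: "'a monad \<Rightarrow> 'a \<Rightarrow> nat \<Rightarrow> 'a" where
  "mpow A f 0 = munit A"
| "mpow A f (Suc k) = mscale A 1 f (mpow A f k)"


section \<open>Localization\<close>

text \<open>The class \<open>x/s\<close> in \<open>A[S\<^sup>-\<^sup>1](n)\<close>.\<close>

definition lfrac :: "'a monad \<Rightarrow> 'a set \<Rightarrow> nat \<Rightarrow> 'a \<Rightarrow> 'a \<Rightarrow> ('a \<times> 'a) set" where
  "lfrac A S n x s = {(y, t). y \<in> car A n \<and> t \<in> S \<and>
     (\<exists>u\<in>S. mscale A n u (mscale A n t x) = mscale A n u (mscale A n s y))}"

text \<open>
  Substitution in \<open>A[S\<^sup>-\<^sup>1]\<close> is defined after bringing the arguments to a common denominator:
  \<open>(a/s)(b\<^sub>1/t,\<dots>,b\<^sub>k/t) = a(b\<^sub>1,\<dots>,b\<^sub>k)/(st)\<close>.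
\<close>

definition localization :: "'a monad \<Rightarrow> 'a set \<Rightarrow> ('a \<times> 'a) set monad" where
  "localization A S =
     \<lparr>car = (\<lambda>n. {lfrac A S n x s | x s. x \<in> car A n \<and> s \<in> S}),
      var = (\<lambda>n i. lfrac A S n (var A n i) (munit A)),
      app = (\<lambda>n c cs. SOME c'. \<exists>a s bs t.
         a \<in> car A (length cs) \<and> s \<in> S \<and> set bs \<subseteq> car A n \<and> t \<in> S \<and>
         c = lfrac A S (length cs) a s \<and> cs = map (\<lambda>b. lfrac A S n b t) bs \<and>
         c' = lfrac A S n (app A n a bs) (mscale A 1 s t))\<rparr>"

text \<open>The map \<open>A[S\<^sup>-\<^sup>1] \<rightarrow> B[T\<^sup>-\<^sup>1]\<close>, \<open>x/s \<mapsto> \<phi>(x)/\<phi>(s)\<close>, induced by \<open>\<phi> : A \<rightarrow> B\<close> with \<open>\<phi>(S) \<subseteq> T\<close>.\<close>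

definition localization_map ::
    "'b monad \<Rightarrow> 'b set \<Rightarrow> (nat \<Rightarrow> 'a \<Rightarrow> 'b) \<Rightarrow> nat \<Rightarrow> ('a \<times> 'a) set \<Rightarrow> ('b \<times> 'b) set" where
  "localization_map B T \<phi> n c =
     (let z = SOME z. z \<in> c in lfrac B T n (\<phi> n (fst z)) (\<phi> 1 (snd z)))"


section \<open>Spaces with a sheaf of generalized rings\<close>

text \<open>\<open>sec X U\<close> is \<open>\<Gamma>(U, \<O>)\<close> and \<open>res X U V n\<close> is the restriction \<open>\<Gamma>(U, \<O>(n)) \<rightarrow> \<Gamma>(V, \<O>(n))\<close>; only
  open \<open>V \<subseteq> U\<close> are relevant.\<close>

record ('p, 's) gspace =
  topo :: "'p topology"
  sec :: "'p set \<Rightarrow> 's monad"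
  res :: "'p set \<Rightarrow> 'p set \<Rightarrow> nat \<Rightarrow> 's \<Rightarrow> 's"

definition ringed_space :: "('p, 's) gspace \<Rightarrow> bool" where
  "ringed_space X \<longleftrightarrow>
     (\<forall>U. openin (topo X) U \<longrightarrow> generalized_ring (sec X U)) \<and>
     (\<forall>U V. openin (topo X) U \<and> openin (topo X) V \<and> V \<subseteq> U \<longrightarrow>
        ring_morphism (sec X U) (sec X V) (res X U V)) \<and>
     (\<forall>U n. \<forall>s\<in>car (sec X U) n. openin (topo X) U \<longrightarrow> res X U U n s = s) \<and>
     (\<forall>U V W n. \<forall>s\<in>car (sec X U) n.
        openin (topo X) U \<and> openin (topo X) V \<and> openin (topo X) W \<and> V \<subseteq> U \<and> W \<subseteq> V \<longrightarrow>
        res X V W n (res X U V n s) = res X U W n s) \<and>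
     (\<forall>\<U> n s. (\<forall>V\<in>\<U>. openin (topo X) V \<and> s V \<in> car (sec X V) n) \<and>
        (\<forall>V\<in>\<U>. \<forall>W\<in>\<U>. res X V (V \<inter> W) n (s V) = res X W (V \<inter> W) n (s W)) \<longrightarrow>
        (\<exists>!t. t \<in> car (sec X (\<Union>\<U>)) n \<and> (\<forall>V\<in>\<U>. res X (\<Union>\<U>) V n t = s V)))"

definition open_subspace :: "('p, 's) gspace \<Rightarrow> 'p set \<Rightarrow> ('p, 's) gspace" where
  "open_subspace X U = \<lparr>topo = subtopology (topo X) U, sec = sec X, res = res X\<rparr>"

text \<open>A morphism \<open>X \<rightarrow> Y\<close>: a map on points, and maps \<open>\<Gamma>(V, \<O>\<^sub>Y(n)) \<rightarrow> \<Gamma>(f\<^sup>-\<^sup>1V, \<O>\<^sub>X(n))\<close>.\<close>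

record ('p, 's, 'q, 't) gmor =
  pt :: "'p \<Rightarrow> 'q"
  sh :: "'q set \<Rightarrow> nat \<Rightarrow> 't \<Rightarrow> 's"

definition preim :: "('p, 's) gspace \<Rightarrow> ('p, 's, 'q, 't) gmor \<Rightarrow> 'q set \<Rightarrow> 'p set" where
  "preim X f V = {x \<in> topspace (topo X). pt f x \<in> V}"

definition space_morphism ::
    "('p, 's) gspace \<Rightarrow> ('q, 't) gspace \<Rightarrow> ('p, 's, 'q, 't) gmor \<Rightarrow> bool" where
  "space_morphism X Y f \<longleftrightarrow> continuous_map (topo X) (topo Y) (pt f) \<and>
     (\<forall>V. openin (topo Y) V \<longrightarrow> ring_morphism (sec Y V) (sec X (preim X f V)) (sh f V)) \<and>
     (\<forall>V W n. \<forall>s\<in>car (sec Y V) n. openin (topo Y) V \<and> openin (topo Y) W \<and> W \<subseteq> V \<longrightarrow>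
        sh f W n (res Y V W n s) = res X (preim X f V) (preim X f W) n (sh f V n s))"

definition mor_eq ::
    "('p, 's) gspace \<Rightarrow> ('q, 't) gspace \<Rightarrow> ('p, 's, 'q, 't) gmor \<Rightarrow> ('p, 's, 'q, 't) gmor \<Rightarrow> bool" where
  "mor_eq X Y f g \<longleftrightarrow> (\<forall>x\<in>topspace (topo X). pt f x = pt g x) \<and>
     (\<forall>V n. \<forall>s\<in>car (sec Y V) n. openin (topo Y) V \<longrightarrow> sh f V n s = sh g V n s)"

definition id_mor :: "('p, 's, 'p, 's) gmor" where
  "id_mor = \<lparr>pt = (\<lambda>x. x), sh = (\<lambda>V n s. s)\<rparr>"

text \<open>\<open>comp_mor Y g f\<close> is the composite of \<open>f : X \<rightarrow> Y\<close> and \<open>g : Y \<rightarrow> Z\<close>.\<close>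

definition comp_mor ::
    "('q, 't) gspace \<Rightarrow> ('q, 't, 'r, 'u) gmor \<Rightarrow> ('p, 's, 'q, 't) gmor \<Rightarrow> ('p, 's, 'r, 'u) gmor" where
  "comp_mor Y g f =
     \<lparr>pt = (\<lambda>x. pt g (pt f x)), sh = (\<lambda>V n s. sh f (preim Y g V) n (sh g V n s))\<rparr>"

text \<open>Restriction of \<open>f\<close> to an open \<open>U \<subseteq> X\<close>, as a morphism from \<open>U\<close> to any open subspace of the
  target containing \<open>f(U)\<close>.\<close>

definition restrict_mor ::
    "('p, 's) gspace \<Rightarrow> ('p, 's, 'q, 't) gmor \<Rightarrow> 'p set \<Rightarrow> ('p, 's, 'q, 't) gmor" where
  "restrict_mor X f U =
     \<lparr>pt = pt f, sh = (\<lambda>W n s. res X (preim X f W) (U \<inter> preim X f W) n (sh f W n s))\<rparr>"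

definition space_iso ::
    "('p, 's) gspace \<Rightarrow> ('q, 't) gspace \<Rightarrow> ('p, 's, 'q, 't) gmor \<Rightarrow> bool" where
  "space_iso X Y f \<longleftrightarrow> space_morphism X Y f \<and>
     (\<exists>g. space_morphism Y X g \<and>
        mor_eq X X (comp_mor Y g f) id_mor \<and> mor_eq Y Y (comp_mor X f g) id_mor)"


section \<open>Spectra and generalized schemes\<close>

definition prime_ideal :: "'a monad \<Rightarrow> 'a set \<Rightarrow> bool" where
  "prime_ideal A P \<longleftrightarrow> submodule A (free_module A 1) P \<and> submonoid A (car A 1 - P)"

definition prime_ideals :: "'a monad \<Rightarrow> 'a set set" where
  "prime_ideals A = {P. prime_ideal A P}"

definition basic_open :: "'a monad \<Rightarrow> 'a \<Rightarrow> 'a set set" where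
  "basic_open A f = {P \<in> prime_ideals A. f \<notin> P}"

definition spec_topology :: "'a monad \<Rightarrow> 'a set topology" where
  "spec_topology A = topology (arbitrary union_of (\<lambda>U. \<exists>f\<in>car A 1. U = basic_open A f))"

text \<open>
  The stalk \<open>A\<^sub>P\<close> at \<open>P\<close> is the localization of \<open>A\<close> at the complement of \<open>P\<close>.
\<close>

abbreviation stalk :: "'a monad \<Rightarrow> 'a set \<Rightarrow> ('a \<times> 'a) set monad" where
  "stalk A P \<equiv> localization A (car A 1 - P)"

abbreviation germ :: "'a monad \<Rightarrow> 'a set \<Rightarrow> nat \<Rightarrow> 'a \<Rightarrow> 'a \<Rightarrow> ('a \<times> 'a) set" where
  "germ A P n x s \<equiv> lfrac A (car A 1 - P) n x s"

text \<open>
  The structure sheaf is the sheaf associated with \<open>D(f) \<mapsto> A\<^sub>f\<close>: a section over \<open>U\<close> is a family of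
  elements of the stalks which near every point comes from a fraction \<open>x/g\<^sup>k\<close> in some
  \<open>A\<^sub>g\<close> with \<open>D(g) \<subseteq> U\<close>. Sections over \<open>U\<close> are extensional functions, so that equality in HOL is
  equality of sections.
\<close>

definition spec_sections :: "'a monad \<Rightarrow> 'a set set \<Rightarrow> nat \<Rightarrow> ('a set \<Rightarrow> ('a \<times> 'a) set) set" where
  "spec_sections A U n = {s \<in> (\<Pi>\<^sub>E P\<in>U. car (stalk A P) n).
     \<forall>P\<in>U. \<exists>g\<in>car A 1. g \<notin> P \<and> basic_open A g \<subseteq> U \<and>
       (\<exists>x\<in>car A n. \<exists>k. \<forall>Q\<in>basic_open A g. s Q = germ A Q n x (mpow A g k))}"

definition Spec :: "'a monad \<Rightarrow> ('a set, 'a set \<Rightarrow> ('a \<times> 'a) set) gspace" where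
  "Spec A =
     \<lparr>topo = spec_topology A,
      sec = (\<lambda>U. \<lparr>car = spec_sections A U,
        var = (\<lambda>n i. \<lambda>P\<in>U. var (stalk A P) n i),
        app = (\<lambda>n t xs. \<lambda>P\<in>U. app (stalk A P) n (t P) (map (\<lambda>x. x P) xs))\<rparr>),
      res = (\<lambda>U V n s. restrict s V)\<rparr>"

text \<open>The morphism \<open>Spec B \<rightarrow> Spec A\<close> induced by \<open>\<phi> : A \<rightarrow> B\<close>.\<close>

definition Spec_mor :: "'a monad \<Rightarrow> 'b monad \<Rightarrow> (nat \<Rightarrow> 'a \<Rightarrow> 'b) \<Rightarrow>
    ('b set, 'b set \<Rightarrow> ('b \<times> 'b) set, 'a set, 'a set \<Rightarrow> ('a \<times> 'a) set) gmor" where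
  "Spec_mor A B \<phi> =
     (let f = (\<lambda>P. {a \<in> car A 1. \<phi> 1 a \<in> P}) in
      \<lparr>pt = f,
       sh = (\<lambda>V n s. \<lambda>P\<in>{P \<in> prime_ideals B. f P \<in> V}. localization_map B (car B 1 - P) \<phi> n (s (f P)))\<rparr>)"

text \<open>The global section of \<open>Spec A\<close> defined by \<open>a \<in> A(n)\<close>.\<close>

definition global_section :: "'a monad \<Rightarrow> nat \<Rightarrow> 'a \<Rightarrow> 'a set \<Rightarrow> ('a \<times> 'a) set" where
  "global_section A n a = (\<lambda>P\<in>prime_ideals A. germ A P n a (munit A))"

text \<open>
  In the next two definitions the elements of the rings \<open>A\<close>, \<open>B\<close> are taken from the type of sections
  of the space. As a ring with \<open>U \<cong> Spec A\<close> is isomorphic to \<open>\<Gamma>(U, \<O>)\<close>, this is no restriction.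
\<close>

definition generalized_scheme :: "('p, 's) gspace \<Rightarrow> bool" where
  "generalized_scheme X \<longleftrightarrow> ringed_space X \<and>
     (\<forall>x\<in>topspace (topo X). \<exists>U (A :: 's monad) \<alpha>. openin (topo X) U \<and> x \<in> U \<and>
        generalized_ring A \<and> space_iso (open_subspace X U) (Spec A) \<alpha>)"

definition scheme_morphism ::
    "('p, 's) gspace \<Rightarrow> ('q, 't) gspace \<Rightarrow> ('p, 's, 'q, 't) gmor \<Rightarrow> bool" where
  "scheme_morphism X Y f \<longleftrightarrow> space_morphism X Y f \<and>
     (\<forall>x\<in>topspace (topo X). \<exists>U V (A :: 's monad) (B :: 't monad) \<alpha> \<beta> \<phi>.
        openin (topo X) U \<and> x \<in> U \<and> openin (topo Y) V \<and> pt f ` U \<subseteq> V \<and>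
        generalized_ring A \<and> generalized_ring B \<and> ring_morphism B A \<phi> \<and>
        space_iso (open_subspace X U) (Spec A) \<alpha> \<and> space_iso (open_subspace Y V) (Spec B) \<beta> \<and>
        mor_eq (open_subspace X U) (Spec B)
          (comp_mor (open_subspace Y V) \<beta> (restrict_mor X f U))
          (comp_mor (Spec A) (Spec_mor B A \<phi>) \<alpha>))"

definition schemes_isomorphic :: "('p, 's) gspace \<Rightarrow> ('q, 't) gspace \<Rightarrow> bool" where
  "schemes_isomorphic X Y \<longleftrightarrow> (\<exists>f g. scheme_morphism X Y f \<and> scheme_morphism Y X g \<and>
     mor_eq X X (comp_mor Y g f) id_mor \<and> mor_eq Y Y (comp_mor X f g) id_mor)"

definition scheme_over_F1 :: "('p, 's) gspace \<Rightarrow> bool" where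
  "scheme_over_F1 X \<longleftrightarrow> generalized_scheme X \<and> car (sec X (topspace (topo X))) 0 \<noteq> {}"


section \<open>Gluing\<close>

text \<open>
  Gluing of spaces \<open>X i\<close> (\<open>i \<in> I\<close>) along a family of overlaps \<open>W k\<close> (\<open>k \<in> K\<close>) which are given together
  with open immersions \<open>j1 k : W k \<rightarrow> X (src k)\<close> and \<open>j2 k : W k \<rightarrow> X (tgt k)\<close>. The points \<open>j1 k w\<close> and
  \<open>j2 k w\<close> are identified, a set is open iff its trace on every \<open>X i\<close> is, and a section is a family
  of sections over the traces which agree on the overlaps.
\<close>

definition glue_points :: "'i set \<Rightarrow> ('i \<Rightarrow> ('p, 's) gspace) \<Rightarrow> ('i \<times> 'p) set" where
  "glue_points I X = (SIGMA i:I. topspace (topo (X i)))"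

definition glue_rel :: "'k set \<Rightarrow> ('k \<Rightarrow> ('q, 't) gspace) \<Rightarrow> ('k \<Rightarrow> 'i) \<Rightarrow> ('k \<Rightarrow> 'i) \<Rightarrow>
    ('k \<Rightarrow> ('q, 't, 'p, 's) gmor) \<Rightarrow> ('k \<Rightarrow> ('q, 't, 'p, 's) gmor) \<Rightarrow> (('i \<times> 'p) \<times> ('i \<times> 'p)) set" where
  "glue_rel K W src tgt j1 j2 =
     {((src k, pt (j1 k) w), (tgt k, pt (j2 k) w)) | k w. k \<in> K \<and> w \<in> topspace (topo (W k))}"

definition glue_class :: "'k set \<Rightarrow> ('k \<Rightarrow> ('q, 't) gspace) \<Rightarrow> ('k \<Rightarrow> 'i) \<Rightarrow> ('k \<Rightarrow> 'i) \<Rightarrow>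
    ('k \<Rightarrow> ('q, 't, 'p, 's) gmor) \<Rightarrow> ('k \<Rightarrow> ('q, 't, 'p, 's) gmor) \<Rightarrow> 'i \<Rightarrow> 'p \<Rightarrow> ('i \<times> 'p) set" where
  "glue_class K W src tgt j1 j2 i x =
     (let r = glue_rel K W src tgt j1 j2 in (r \<union> r\<inverse>)\<^sup>* `` {(i, x)})"

definition glue :: "'i set \<Rightarrow> ('i \<Rightarrow> ('p, 's) gspace) \<Rightarrow> 'k set \<Rightarrow> ('k \<Rightarrow> ('q, 't) gspace) \<Rightarrow>
    ('k \<Rightarrow> 'i) \<Rightarrow> ('k \<Rightarrow> 'i) \<Rightarrow>
    ('k \<Rightarrow> ('q, 't, 'p, 's) gmor) \<Rightarrow> ('k \<Rightarrow> ('q, 't, 'p, 's) gmor) \<Rightarrow>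
    (('i \<times> 'p) set, 'i \<Rightarrow> 's) gspace" where
  "glue I X K W src tgt j1 j2 =
     (let cl = glue_class K W src tgt j1 j2;
          trace = (\<lambda>U i. {x \<in> topspace (topo (X i)). cl i x \<in> U}) in
      \<lparr>topo = topology (\<lambda>U. U \<subseteq> (\<lambda>(i, x). cl i x) ` glue_points I X \<and>
               (\<forall>i\<in>I. openin (topo (X i)) (trace U i))),
       sec = (\<lambda>U.
         \<lparr>car = (\<lambda>n. {s \<in> (\<Pi>\<^sub>E i\<in>I. car (sec (X i) (trace U i)) n).
             \<forall>k\<in>K. sh (j1 k) (trace U (src k)) n (s (src k)) = sh (j2 k) (trace U (tgt k)) n (s (tgt k))}),
          var = (\<lambda>n m. \<lambda>i\<in>I. var (sec (X i) (trace U i)) n m),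
          app = (\<lambda>n t xs. \<lambda>i\<in>I. app (sec (X i) (trace U i)) n (t i) (map (\<lambda>x. x i) xs))\<rparr>),
       res = (\<lambda>U V n s. \<lambda>i\<in>I. res (X i) (trace U i) (trace V i) n (s i))\<rparr>)"

text \<open>The canonical morphism from \<open>X i\<close> to the space obtained by gluing.\<close>

definition glue_incl :: "'k set \<Rightarrow> ('k \<Rightarrow> ('q, 't) gspace) \<Rightarrow> ('k \<Rightarrow> 'i) \<Rightarrow> ('k \<Rightarrow> 'i) \<Rightarrow>
    ('k \<Rightarrow> ('q, 't, 'p, 's) gmor) \<Rightarrow> ('k \<Rightarrow> ('q, 't, 'p, 's) gmor) \<Rightarrow> 'i \<Rightarrow>
    ('p, 's, ('i \<times> 'p) set, 'i \<Rightarrow> 's) gmor" where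
  "glue_incl K W src tgt j1 j2 i =
     \<lparr>pt = glue_class K W src tgt j1 j2 i, sh = (\<lambda>U n s. s i)\<rparr>"


section \<open>Proj\<close>

text \<open>
  Graded generalized rings, presented as above: \<open>gcar R d n\<close> is \<open>R\<^sub>d(n)\<close>, \<open>gvar R n i \<in> R\<^sub>0(n)\<close> is the
  unit and \<open>gapp R d e n t xs \<in> R\<^sub>d\<^sub>+\<^sub>e(n)\<close> is \<open>t(xs)\<close> for \<open>t \<in> R\<^sub>d(k)\<close> and \<open>xs \<in> R\<^sub>e(n)\<^sup>k\<close>. The functor \<open>R\<^sub>d\<close>
  acts on a map \<open>u : k \<rightarrow> n\<close> by \<open>t \<mapsto> t({u(1)},\<dots>,{u(k)})\<close>.
\<close>

record 'r graded =
  gcar :: "nat \<Rightarrow> nat \<Rightarrow> 'r set"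
  gvar :: "nat \<Rightarrow> nat \<Rightarrow> 'r"
  gapp :: "nat \<Rightarrow> nat \<Rightarrow> nat \<Rightarrow> 'r \<Rightarrow> 'r list \<Rightarrow> 'r"

definition graded_generalized_ring :: "'r graded \<Rightarrow> bool" where
  "graded_generalized_ring R \<longleftrightarrow>
     (\<forall>n i. i < n \<longrightarrow> gvar R n i \<in> gcar R 0 n) \<and>
     (\<forall>d e n t xs. t \<in> gcar R d (length xs) \<and> set xs \<subseteq> gcar R e n \<longrightarrow>
        gapp R d e n t xs \<in> gcar R (d + e) n) \<and>
     (\<forall>e n xs i. set xs \<subseteq> gcar R e n \<and> i < length xs \<longrightarrow>
        gapp R 0 e n (gvar R (length xs) i) xs = xs ! i) \<and>
     (\<forall>d n t. t \<in> gcar R d n \<longrightarrow> gapp R d 0 n t (map (gvar R n) [0..<n]) = t) \<and>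
     (\<forall>d e c m n t xs ys. t \<in> gcar R d (length xs) \<and> set xs \<subseteq> gcar R e m \<and>
        length ys = m \<and> set ys \<subseteq> gcar R c n \<longrightarrow>
        gapp R (d + e) c n (gapp R d e m t xs) ys =
        gapp R d (e + c) n t (map (\<lambda>x. gapp R e c n x ys) xs)) \<and>
     (\<forall>d e c n m l t s x. t \<in> gcar R d n \<and> s \<in> gcar R e m \<and>
        (\<forall>i<n. \<forall>j<m. x i j \<in> gcar R c l) \<longrightarrow>
        gapp R d (e + c) l t (map (\<lambda>i. gapp R e c l s (map (\<lambda>j. x i j) [0..<m])) [0..<n]) =
        gapp R e (d + c) l s (map (\<lambda>j. gapp R d c l t (map (\<lambda>i. x i j) [0..<n])) [0..<m]))"

text \<open>Elements of \<open>|R|\<close> are pairs of a degree and an element of that degree.\<close>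

definition positive_elements :: "'r graded \<Rightarrow> (nat \<times> 'r) set" where
  "positive_elements R = {(d, f). 0 < d \<and> f \<in> gcar R d 1}"

definition gmult :: "'r graded \<Rightarrow> nat \<times> 'r \<Rightarrow> nat \<times> 'r \<Rightarrow> nat \<times> 'r" where
  "gmult R f g = (fst f + fst g, gapp R (fst f) (fst g) 1 (snd f) [snd g])"

text \<open>\<open>gpow_scale R f k e n x\<close> is \<open>f\<^sup>k x\<close> for \<open>x \<in> R\<^sub>e(n)\<close>.\<close>

fun gpow_scale :: "'r graded \<Rightarrow> nat \<times> 'r \<Rightarrow> nat \<Rightarrow> nat \<Rightarrow> nat \<Rightarrow> 'r \<Rightarrow> 'r" where
  "gpow_scale R f 0 e n x = x"
| "gpow_scale R f (Suc k) e n x =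
     gapp R (fst f) (k * fst f + e) n (snd f) [gpow_scale R f k e n x]"

text \<open>
  The class of \<open>x/f\<^sup>k\<close> in \<open>R\<^sub>(\<^sub>f\<^sub>)(n)\<close>, for \<open>x \<in> R\<^sub>k\<^sub>d(n)\<close>, \<open>d = deg f > 0\<close>. The denominator \<open>f\<^sup>k\<close> is
  recorded by its exponent (its degree \<open>kd\<close> determines \<open>k\<close>).
\<close>

definition gfrac :: "'r graded \<Rightarrow> nat \<times> 'r \<Rightarrow> nat \<Rightarrow> 'r \<Rightarrow> nat \<Rightarrow> ('r \<times> nat) set" where
  "gfrac R f n x k = {(y, l). y \<in> gcar R (l * fst f) n \<and>
     (\<exists>m. gpow_scale R f m ((l + k) * fst f) n (gpow_scale R f l (k * fst f) n x) =
          gpow_scale R f m ((k + l) * fst f) n (gpow_scale R f k (l * fst f) n y))}"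

definition hom_localization :: "'r graded \<Rightarrow> nat \<times> 'r \<Rightarrow> ('r \<times> nat) set monad" where
  "hom_localization R f =
     \<lparr>car = (\<lambda>n. {gfrac R f n x k | x k. x \<in> gcar R (k * fst f) n}),
      var = (\<lambda>n i. gfrac R f n (gvar R n i) 0),
      app = (\<lambda>n c cs. SOME c'. \<exists>a k bs l.
         a \<in> gcar R (k * fst f) (length cs) \<and> set bs \<subseteq> gcar R (l * fst f) n \<and>
         c = gfrac R f (length cs) a k \<and> cs = map (\<lambda>b. gfrac R f n b l) bs \<and>
         c' = gfrac R f n (gapp R (k * fst f) (l * fst f) n a bs) (k + l))\<rparr>"

text \<open>The canonical map \<open>R\<^sub>(\<^sub>f\<^sub>) \<rightarrow> R\<^sub>(\<^sub>f\<^sub>g\<^sub>)\<close>, \<open>x/f\<^sup>k \<mapsto> g\<^sup>k x/(fg)\<^sup>k\<close>; here \<open>h = fg = gf\<close>.\<close>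

definition hom_localization_map :: "'r graded \<Rightarrow> nat \<times> 'r \<Rightarrow> nat \<times> 'r \<Rightarrow> nat \<Rightarrow>
    ('r \<times> nat) set \<Rightarrow> ('r \<times> nat) set" where
  "hom_localization_map R g h n c =
     (let (x, k) = (SOME z. z \<in> c); d = fst h - fst g in
      gfrac R h n (gpow_scale R g k (k * d) n x) k)"

type_synonym 'r proj_point = "((nat \<times> 'r) \<times> ('r \<times> nat) set set) set"

type_synonym 'r proj_section = "(nat \<times> 'r) \<Rightarrow>
  ('r \<times> nat) set set \<Rightarrow> (('r \<times> nat) set \<times> ('r \<times> nat) set) set"

definition Proj :: "'r graded \<Rightarrow> ('r proj_point, 'r proj_section) gspace" where
  "Proj R =
     glue (positive_elements R) (\<lambda>f. Spec (hom_localization R f))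
       (positive_elements R \<times> positive_elements R)
       (\<lambda>(f, g). Spec (hom_localization R (gmult R f g)))
       fst snd
       (\<lambda>(f, g). Spec_mor (hom_localization R f) (hom_localization R (gmult R f g))
          (hom_localization_map R g (gmult R f g)))
       (\<lambda>(f, g). Spec_mor (hom_localization R g) (hom_localization R (gmult R f g))
          (hom_localization_map R f (gmult R f g)))"


section \<open>The schemes \<open>Spec Z\<^sup>(\<^sup>N\<^sup>)\<close>\<close>

text \<open>
  The submonad of formal linear combinations whose coefficient vectors in arity \<open>n\<close> are the lists in
  \<open>C n\<close>. For a subring \<open>K\<close>, \<open>ring_monad K\<close> is the monad \<open>\<Sigma>\<^sub>K\<close>.
\<close>

definition linear_monad :: "(nat \<Rightarrow> 'a::comm_ring_1 list set) \<Rightarrow> 'a list monad" where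
  "linear_monad C =
     \<lparr>car = C,
      var = (\<lambda>n i. map (\<lambda>j. if j = i then 1 else 0) [0..<n]),
      app = (\<lambda>n t xs. map (\<lambda>j. \<Sum>i<length xs. t ! i * (xs ! i) ! j) [0..<n])\<rparr>"

definition coeff_lists :: "'a set \<Rightarrow> nat \<Rightarrow> 'a list set" where
  "coeff_lists K n = {v. length v = n \<and> set v \<subseteq> K}"

definition ring_monad :: "'a::comm_ring_1 set \<Rightarrow> 'a list monad" where
  "ring_monad K = linear_monad (coeff_lists K)"

definition Z_ring :: "rat list monad" where
  "Z_ring = ring_monad \<int>"

definition Z_inverted :: "nat \<Rightarrow> rat set" where
  "Z_inverted N = {of_int a / of_nat N ^ k | a k. True}"

definition B_ring :: "nat \<Rightarrow> rat list monad" where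
  "B_ring N = ring_monad (Z_inverted N)"

text \<open>The carriers of \<open>Z\<^sub>(\<^sub>\<infinity>\<^sub>) = Z\<^sub>\<infinity> \<inter> Q\<close>.\<close>

definition Zinf_lists :: "nat \<Rightarrow> rat list set" where
  "Zinf_lists n = {v. length v = n \<and> (\<Sum>i<n. \<bar>v ! i\<bar>) \<le> 1}"

definition A_ring :: "nat \<Rightarrow> rat list monad" where
  "A_ring N = linear_monad (\<lambda>n. coeff_lists (Z_inverted N) n \<inter> Zinf_lists n)"

datatype chart = FinChart | InfChart

type_synonym q_point = "rat list set"
type_synonym q_section = "rat list set \<Rightarrow> (rat list \<times> rat list) set"
type_synonym hat_point = "(chart \<times> q_point) set"
type_synonym hat_section = "chart \<Rightarrow> q_section"
type_synonym hat_mor = "(hat_point, hat_section, hat_point, hat_section) gmor"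

fun chart_ring :: "nat \<Rightarrow> chart \<Rightarrow> rat list monad" where
  "chart_ring N FinChart = Z_ring"
| "chart_ring N InfChart = A_ring N"

text \<open>The open immersions of \<open>Spec B\<^sub>N\<close> into the two charts, induced by the inclusions of rings.\<close>

definition overlap_mor :: "nat \<Rightarrow> chart \<Rightarrow> (q_point, q_section, q_point, q_section) gmor" where
  "overlap_mor N c = Spec_mor (chart_ring N c) (B_ring N) (\<lambda>n x. x)"

definition SpecZhat :: "nat \<Rightarrow> (hat_point, hat_section) gspace" where
  "SpecZhat N = glue UNIV (\<lambda>c. Spec (chart_ring N c)) (UNIV :: unit set) (\<lambda>_. Spec (B_ring N))
     (\<lambda>_. FinChart) (\<lambda>_. InfChart) (\<lambda>_. overlap_mor N FinChart) (\<lambda>_. overlap_mor N InfChart)"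

definition chart_incl :: "nat \<Rightarrow> chart \<Rightarrow> (q_point, q_section, hat_point, hat_section) gmor" where
  "chart_incl N = glue_incl (UNIV :: unit set) (\<lambda>_. Spec (B_ring N))
     (\<lambda>_. FinChart) (\<lambda>_. InfChart) (\<lambda>_. overlap_mor N FinChart) (\<lambda>_. overlap_mor N InfChart)"

text \<open>
  \<open>chart_open N\<close> is \<open>Spec A\<^sub>N\<close> as an open subset of \<open>SpecZhat N\<close>, and \<open>V2 N M\<close> is
  \<open>Spec A\<^sub>N\<^sub>M \<union> Spec B\<^sub>N \<subseteq> SpecZhat (NM)\<close>, with \<open>Spec B\<^sub>N \<subseteq> Spec Z\<close>.
\<close>

definition chart_open :: "nat \<Rightarrow> hat_point set" where
  "chart_open N = pt (chart_incl N InfChart) ` prime_ideals (A_ring N)"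

definition BN_incl :: "nat \<Rightarrow> nat \<Rightarrow> (q_point, q_section, hat_point, hat_section) gmor" where
  "BN_incl N M = comp_mor (Spec Z_ring) (chart_incl (N * M) FinChart) (overlap_mor N FinChart)"

definition V2 :: "nat \<Rightarrow> nat \<Rightarrow> hat_point set" where
  "V2 N M = chart_open (N * M) \<union> pt (BN_incl N M) ` prime_ideals (B_ring N)"

text \<open>
  The morphism \<open>f\<close> from \<open>SpecZhat (NM)\<close> to \<open>SpecZhat N\<close> is the identity on \<open>Spec Z\<close> and maps \<open>V2 N M\<close> to
  \<open>Spec A\<^sub>N\<close> in such a way that \<open>A\<^sub>N = \<Gamma>(Spec A\<^sub>N, \<O>) \<rightarrow> \<Gamma>(V2 N M, \<O>) = A\<^sub>N\<^sub>M \<inter> B\<^sub>N\<close> is the identity: the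
  image of the section \<open>a\<close> restricts to the section \<open>a\<close> both on \<open>Spec A\<^sub>N\<^sub>M\<close> and on \<open>Spec B\<^sub>N\<close>.
\<close>

definition is_transition :: "nat \<Rightarrow> nat \<Rightarrow> hat_mor \<Rightarrow> bool" where
  "is_transition N M f \<longleftrightarrow>
     scheme_morphism (SpecZhat (N * M)) (SpecZhat N) f \<and>
     mor_eq (Spec Z_ring) (SpecZhat N)
       (comp_mor (SpecZhat (N * M)) f (chart_incl (N * M) FinChart)) (chart_incl N FinChart) \<and>
     pt f ` V2 N M \<subseteq> chart_open N \<and>
     (\<forall>n. \<forall>a\<in>car (A_ring N) n. \<forall>s\<in>car (sec (SpecZhat N) (chart_open N)) n.
        sh (chart_incl N InfChart) (chart_open N) n s = global_section (A_ring N) n a \<longrightarrow>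
        (let s' = sh (restrict_mor (SpecZhat (N * M)) f (V2 N M)) (chart_open N) n s in
         sh (chart_incl (N * M) InfChart) (V2 N M) n s' = global_section (A_ring (N * M)) n a \<and>
         sh (BN_incl N M) (V2 N M) n s' = global_section (B_ring N) n a))"

text \<open>\<open>is_transition\<close> determines \<open>f\<close> up to \<open>mor_eq\<close>.\<close>

definition transition :: "nat \<Rightarrow> nat \<Rightarrow> hat_mor" where
  "transition N N' = (if N' = N then id_mor else SOME f. is_transition N (N' div N) f)"


section \<open>Pro-generalized schemes\<close>

text \<open>
  Projective systems of generalized schemes indexed by a directed set; \<open>tr D i j\<close> is the transition
  morphism from \<open>obj D j\<close> to \<open>obj D i\<close>, for \<open>i \<le> j\<close>. A pro-generalized scheme is such a system, the
  morphisms from \<open>P\<close> to \<open>Y\<close> being the elements of \<open>lim\<^sub>i colim\<^sub>k Hom(P\<^sub>k, Y\<^sub>i)\<close>.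
\<close>

record ('i, 'p, 's) prosys =
  idx :: "'i set"
  le :: "'i \<Rightarrow> 'i \<Rightarrow> bool"
  obj :: "'i \<Rightarrow> ('p, 's) gspace"
  tr :: "'i \<Rightarrow> 'i \<Rightarrow> ('p, 's, 'p, 's) gmor"

definition pro_object :: "('i, 'p, 's) prosys \<Rightarrow> bool" where
  "pro_object D \<longleftrightarrow>
     idx D \<noteq> {} \<and>
     (\<forall>i\<in>idx D. le D i i) \<and>
     (\<forall>i\<in>idx D. \<forall>j\<in>idx D. \<forall>k\<in>idx D. le D i j \<and> le D j k \<longrightarrow> le D i k) \<and>
     (\<forall>i\<in>idx D. \<forall>j\<in>idx D. \<exists>k\<in>idx D. le D i k \<and> le D j k) \<and>
     (\<forall>i\<in>idx D. generalized_scheme (obj D i)) \<and>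
     (\<forall>i\<in>idx D. \<forall>j\<in>idx D. le D i j \<longrightarrow> scheme_morphism (obj D j) (obj D i) (tr D i j)) \<and>
     (\<forall>i\<in>idx D. mor_eq (obj D i) (obj D i) (tr D i i) id_mor) \<and>
     (\<forall>i\<in>idx D. \<forall>j\<in>idx D. \<forall>k\<in>idx D. le D i j \<and> le D j k \<longrightarrow>
        mor_eq (obj D k) (obj D i) (comp_mor (obj D j) (tr D i j) (tr D j k)) (tr D i k))"

text \<open>Equality in \<open>colim\<^sub>k Hom(P\<^sub>k, Y)\<close> of the elements represented by \<open>g : P\<^sub>k \<rightarrow> Y\<close> and \<open>g' : P\<^sub>k\<^sub>' \<rightarrow> Y\<close>.\<close>

definition colim_eq :: "('k, 'p, 's) prosys \<Rightarrow> ('q, 't) gspace \<Rightarrow>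
    'k \<times> ('p, 's, 'q, 't) gmor \<Rightarrow> 'k \<times> ('p, 's, 'q, 't) gmor \<Rightarrow> bool" where
  "colim_eq P Y = (\<lambda>(k, g) (k', g'). \<exists>l\<in>idx P. le P k l \<and> le P k' l \<and>
     mor_eq (obj P l) Y (comp_mor (obj P k) g (tr P k l)) (comp_mor (obj P k') g' (tr P k' l)))"

type_synonym ('k, 'p, 's, 'i, 'q, 't) promor = "'i \<Rightarrow> 'k \<times> ('p, 's, 'q, 't) gmor"

definition pro_morphism :: "('k, 'p, 's) prosys \<Rightarrow> ('i, 'q, 't) prosys \<Rightarrow>
    ('k, 'p, 's, 'i, 'q, 't) promor \<Rightarrow> bool" where
  "pro_morphism P Y \<phi> \<longleftrightarrow>
     (\<forall>i\<in>idx Y. case \<phi> i of (k, g) \<Rightarrow> k \<in> idx P \<and> scheme_morphism (obj P k) (obj Y i) g) \<and>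
     (\<forall>i\<in>idx Y. \<forall>j\<in>idx Y. le Y i j \<longrightarrow>
        colim_eq P (obj Y i) (\<phi> i)
          (case \<phi> j of (k, g) \<Rightarrow> (k, comp_mor (obj Y j) (tr Y i j) g)))"

definition pro_eq :: "('k, 'p, 's) prosys \<Rightarrow> ('i, 'q, 't) prosys \<Rightarrow>
    ('k, 'p, 's, 'i, 'q, 't) promor \<Rightarrow> ('k, 'p, 's, 'i, 'q, 't) promor \<Rightarrow> bool" where
  "pro_eq P Y \<phi> \<psi> \<longleftrightarrow> (\<forall>i\<in>idx Y. colim_eq P (obj Y i) (\<phi> i) (\<psi> i))"

text \<open>\<open>pro_comp Y \<psi> \<phi>\<close> is the composite of \<open>\<phi> : P \<rightarrow> Y\<close> and \<open>\<psi> : Y \<rightarrow> Z\<close>.\<close>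

definition pro_comp :: "('i, 'q, 't) prosys \<Rightarrow> ('i, 'q, 't, 'j, 'r, 'u) promor \<Rightarrow>
    ('k, 'p, 's, 'i, 'q, 't) promor \<Rightarrow> ('k, 'p, 's, 'j, 'r, 'u) promor" where
  "pro_comp Y \<psi> \<phi> =
     (\<lambda>l. case \<psi> l of (i, h) \<Rightarrow> case \<phi> i of (k, g) \<Rightarrow> (k, comp_mor (obj Y i) h g))"

text \<open>A generalized scheme, and a morphism of generalized schemes, in the category of
  pro-generalized schemes.\<close>

definition const_pro :: "('p, 's) gspace \<Rightarrow> (unit, 'p, 's) prosys" where
  "const_pro X = \<lparr>idx = UNIV, le = (\<lambda>_ _. True), obj = (\<lambda>_. X), tr = (\<lambda>_ _. id_mor)\<rparr>"

definition const_mor :: "('p, 's, 'q, 't) gmor \<Rightarrow> (unit, 'p, 's, unit, 'q, 't) promor" where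
  "const_mor f = (\<lambda>_. ((), f))"

text \<open>\<open>pro_cone D P \<pi>\<close>: the \<open>\<pi> i : P \<rightarrow> obj D i\<close> are compatible morphisms of pro-generalized schemes.\<close>

definition pro_cone :: "('i, 'q, 't) prosys \<Rightarrow> ('k, 'p, 's) prosys \<Rightarrow>
    ('i \<Rightarrow> ('k, 'p, 's, unit, 'q, 't) promor) \<Rightarrow> bool" where
  "pro_cone D P \<pi> \<longleftrightarrow>
     (\<forall>i\<in>idx D. pro_morphism P (const_pro (obj D i)) (\<pi> i)) \<and>
     (\<forall>i\<in>idx D. \<forall>j\<in>idx D. le D i j \<longrightarrow>
        pro_eq P (const_pro (obj D i)) (\<pi> i)
          (pro_comp (const_pro (obj D j)) (const_mor (tr D i j)) (\<pi> j)))"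

text \<open>
  \<open>P\<close> with the projections \<open>\<pi>\<close> is the projective limit of the system \<open>D\<close> of generalized schemes in the
  category of pro-generalized schemes. The test objects \<open>T\<close> range over all pro-generalized schemes with
  index, point and section types \<open>'k\<close>, \<open>'r\<close>, \<open>'u\<close>; these types are arbitrary.
\<close>

definition is_pro_limit :: "('k \<times> 'r \<times> 'u) itself \<Rightarrow> ('i, 'q, 't) prosys \<Rightarrow> ('j, 'p, 's) prosys \<Rightarrow>
    ('i \<Rightarrow> ('j, 'p, 's, unit, 'q, 't) promor) \<Rightarrow> bool" where
  "is_pro_limit _ D P \<pi> \<longleftrightarrow> pro_object P \<and> pro_cone D P \<pi> \<and>
     (\<forall>(T :: ('k, 'r, 'u) prosys) \<tau>. pro_object T \<and> pro_cone D T \<tau> \<longrightarrow>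
        (\<exists>u. pro_morphism T P u \<and>
           (\<forall>i\<in>idx D. pro_eq T (const_pro (obj D i)) (pro_comp P (\<pi> i) u) (\<tau> i)) \<and>
           (\<forall>v. pro_morphism T P v \<and>
              (\<forall>i\<in>idx D. pro_eq T (const_pro (obj D i)) (pro_comp P (\<pi> i) v) (\<tau> i)) \<longrightarrow>
              pro_eq T P v u)))"

text \<open>A generalized scheme over \<open>F\<^sub>1\<close> isomorphic to \<open>Proj R\<close>, for a graded ring \<open>R\<close> with elements in the
  type \<open>'r\<close>.\<close>

definition projective_scheme_over_F1 :: "'r itself \<Rightarrow> ('p, 's) gspace \<Rightarrow> bool" where
  "projective_scheme_over_F1 _ X \<longleftrightarrow> scheme_over_F1 X \<and>
     (\<exists>R :: 'r graded. graded_generalized_ring R \<and> schemes_isomorphic X (Proj R))"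

text \<open>
  \<open>P\<close> is a projective pro-scheme over \<open>F\<^sub>1\<close>, as witnessed by the filtered projective system \<open>D\<close> and
  the projections \<open>\<pi>\<close>.
\<close>

definition projective_pro_scheme_over_F1 :: "'r itself \<Rightarrow> ('k \<times> 'v \<times> 'u) itself \<Rightarrow>
    ('i, 'q, 't) prosys \<Rightarrow> ('i \<Rightarrow> ('j, 'p, 's, unit, 'q, 't) promor) \<Rightarrow> ('j, 'p, 's) prosys \<Rightarrow> bool" where
  "projective_pro_scheme_over_F1 R T D \<pi> P \<longleftrightarrow>
     pro_object D \<and> (\<forall>i\<in>idx D. projective_scheme_over_F1 R (obj D i)) \<and> is_pro_limit T D P \<pi>"

text \<open>
  The projective system \<open>(SpecZhat N)\<close>, \<open>N > 1\<close>, ordered by divisibility. It is at the same time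
  the pro-generalized scheme \<open>SpecZhat = lim SpecZhat N\<close>, whose projection to \<open>SpecZhat N\<close> is represented by
  the identity.
\<close>

definition compactification :: "(nat, hat_point, hat_section) prosys" where
  "compactification =
     \<lparr>idx = {N. 1 < N}, le = (\<lambda>N N'. N dvd N'), obj = SpecZhat, tr = transition\<rparr>"

definition compactification_proj ::
    "nat \<Rightarrow> (nat, hat_point, hat_section, unit, hat_point, hat_section) promor" where
  "compactification_proj N = (\<lambda>_. (N, id_mor))"

end

theory Submission
  imports Defs
begin

text \<open>
  All schemes in question are integral with generic stalk \<open>\<Sigma>\<^sub>\<rat>\<close>. Such a scheme is determined by the set of
  its local rings, regarded as submonads of \<open>\<Sigma>\<^sub>\<rat>\<close>: a set of points is open iff with each local ring \<open>L\<close> it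
  contains all the local rings in which finitely many chosen elements of \<open>L\<close> lie, a section over
  \<open>U\<close> is a vector lying in all the local rings at points of \<open>U\<close>, and a morphism compatible with the generic
  stalks is determined by its effect on points. Gluing amounts to identifying points with equal local
  rings.

  Besides the localizations of \<open>Z\<close>, the scheme \<open>SpecZhat N\<close> has a single local ring, \<open>A\<^sub>N\<close> itself at the point at
  infinity \<open>{\<bar>r\<bar> < 1}\<close>. The transition morphisms preserve the local rings over \<open>Z\<close> and map infinity to infinity;
  nothing else is possible since a local ring over \<open>Z\<close> contains the operation \<open>(1, 1)\<close>, which is
  not in \<open>A\<^sub>N\<^sub>M\<close>. For the graded ring \<open>R\<^sub>d(n) = {v \<in> Z\<^sup>n. \<Sum>\<bar>v\<^sub>i\<bar> \<le> N\<^sup>d}\<close> and \<open>a \<noteq> 0\<close> of degree \<open>d\<close>, the ring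
  \<open>R\<^sub>(\<^sub>a\<^sub>)\<close> is \<open>Z[1/a]\<close> if \<open>\<bar>a\<bar> < N\<^sup>d\<close> and \<open>A\<^sub>N\<close> if \<open>\<bar>a\<bar> = N\<^sup>d\<close>, so \<open>Proj R\<close> has the same local rings as \<open>SpecZhat N\<close>.
\<close>

section \<open>Submonads of the rational numbers and their local rings\<close>

text \<open>The obstacle is the shape of the data. Sections of \<open>Spec\<close>, of a gluing and
  of \<open>Proj\<close> are families of sets of fractions, substitution in a localization is a
  choice among representatives, and every space has its own points and sections. Each space is
  therefore given an evaluation of sections in rational vectors, and the sheaf arguments are carried
  out once, in the locale \<open>zspace\<close>, which sees only values and local rings. They become
  short because every nonempty open set contains the point with local ring \<open>qfull\<close>: a
  section has one value on its whole domain and is determined by it.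

  Two further points shape the proof. The morphism \<open>transition\<close> is itself a choice, so
  it must be shown both that a morphism satisfying \<open>is_transition\<close> exists and that
  every such morphism has the expected effect on local rings. And the positive elements of a graded
  ring include \<open>0\<close>, whose charts in \<open>Proj\<close> are not spectra of submonads of
  \<open>\<Sigma>_\<rat>\<close>; they are shown to be empty and are carried along as such.\<close>

definition qlin :: "nat \<Rightarrow> rat list \<Rightarrow> rat list list \<Rightarrow> rat list" where
  "qlin n t xs = map (\<lambda>j. \<Sum>i<length xs. t ! i * (xs ! i) ! j) [0..<n]"

definition qvar :: "nat \<Rightarrow> nat \<Rightarrow> rat list" where
  "qvar n i = map (\<lambda>j. if j = i then 1 else 0) [0..<n]"

definition qscale :: "rat \<Rightarrow> rat list \<Rightarrow> rat list" where
  "qscale r v = map ((*) r) v"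

lemma length_qlin [simp]: "length (qlin n t xs) = n"
  by (simp add: qlin_def)

lemma length_qvar [simp]: "length (qvar n i) = n"
  by (simp add: qvar_def)

lemma length_qscale [simp]: "length (qscale r v) = length v"
  by (simp add: qscale_def)

lemma nth_qlin [simp]: "j < n \<Longrightarrow> qlin n t xs ! j = (\<Sum>i<length xs. t ! i * (xs ! i) ! j)"
  by (simp add: qlin_def)

lemma nth_qvar [simp]: "j < n \<Longrightarrow> qvar n i ! j = (if j = i then 1 else 0)"
  by (simp add: qvar_def)

lemma nth_qscale [simp]: "j < length v \<Longrightarrow> qscale r v ! j = r * v ! j"
  by (simp add: qscale_def)

lemma qscale_1 [simp]: "qscale 1 v = v"
  by (simp add: qscale_def map_idI)

lemma qscale_qscale [simp]: "qscale r (qscale s v) = qscale (r * s) v"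
  by (simp add: qscale_def comp_def mult.assoc)

lemma qscale_single [simp]: "qscale r [s] = [r * s]"
  by (simp add: qscale_def)

lemma qlin_var: "i < length xs \<Longrightarrow> length (xs ! i) = n \<Longrightarrow> qlin n (qvar (length xs) i) xs = xs ! i"
  by (rule nth_equalityI) (simp_all add: if_distrib[of "\<lambda>x. x * _"] cong: if_cong)

lemma qlin_vars: "length t = n \<Longrightarrow> qlin n t (map (qvar n) [0..<n]) = t"
  by (rule nth_equalityI) (simp_all add: if_distrib cong: if_cong)

lemma qlin_assoc:
  assumes "length ys = m"
  shows "qlin n (qlin m t xs) ys = qlin n t (map (\<lambda>x. qlin n x ys) xs)"
proof (rule nth_equalityI)
  fix j assume j: "j < length (qlin n (qlin m t xs) ys)"
  have "qlin n (qlin m t xs) ys ! j = (\<Sum>i<m. (\<Sum>k<length xs. t ! k * xs ! k ! i) * ys ! i ! j)"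
    using j assms by simp
  also have "\<dots> = (\<Sum>i<m. \<Sum>k<length xs. t ! k * (xs ! k ! i * ys ! i ! j))"
    by (simp add: sum_distrib_right mult.assoc)
  also have "\<dots> = (\<Sum>k<length xs. \<Sum>i<m. t ! k * (xs ! k ! i * ys ! i ! j))"
    by (rule sum.swap)
  also have "\<dots> = qlin n t (map (\<lambda>x. qlin n x ys) xs) ! j"
    using j assms by (simp add: sum_distrib_left)
  finally show "qlin n (qlin m t xs) ys ! j = qlin n t (map (\<lambda>x. qlin n x ys) xs) ! j" .
qed simp

lemma qlin_commute:
  "qlin l t (map (\<lambda>i. qlin l s (map (\<lambda>j. x i j) [0..<m])) [0..<n]) =
   qlin l s (map (\<lambda>j. qlin l t (map (\<lambda>i. x i j) [0..<n])) [0..<m])" (is "?L = ?R")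
proof (rule nth_equalityI)
  fix k assume k: "k < length ?L"
  have "?L ! k = (\<Sum>i<n. \<Sum>j<m. t ! i * (s ! j * x i j ! k))"
    using k by (simp add: sum_distrib_left)
  also have "\<dots> = (\<Sum>j<m. \<Sum>i<n. t ! i * (s ! j * x i j ! k))"
    by (rule sum.swap)
  also have "\<dots> = ?R ! k"
    using k by (simp add: sum_distrib_left mult.left_commute)
  finally show "?L ! k = ?R ! k" .
qed simp

lemma qlin_single: "length v = n \<Longrightarrow> qlin n [r] [v] = qscale r v"
  by (rule nth_equalityI) simp_all

lemma qlin_qscale:
  assumes "length t = length xs" "\<And>x. x \<in> set xs \<Longrightarrow> length x = n"
  shows "qlin n (qscale a t) (map (qscale b) xs) = qscale (a * b) (qlin n t xs)"
  by (rule nth_equalityI) (use assms in \<open>simp_all add: sum_distrib_left ac_simps\<close>)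

definition qnum :: "(nat \<Rightarrow> rat list set) \<Rightarrow> rat set" where
  "qnum C = {r. [r] \<in> C 1}"

text \<open>The last condition says that \<open>\<Sigma>\<^sub>\<rat>\<close> is the total ring of fractions of \<open>C\<close>.\<close>

definition qmonad :: "(nat \<Rightarrow> rat list set) \<Rightarrow> bool" where
  "qmonad C \<longleftrightarrow>
     (\<forall>n. \<forall>v\<in>C n. length v = n) \<and>
     (\<forall>n i. i < n \<longrightarrow> qvar n i \<in> C n) \<and>
     (\<forall>n t xs. t \<in> C (length xs) \<and> set xs \<subseteq> C n \<longrightarrow> qlin n t xs \<in> C n) \<and>
     [] \<in> C 0 \<and>
     (\<forall>v. \<exists>s\<in>qnum C. s \<noteq> 0 \<and> qscale s v \<in> C (length v))"

definition qprime :: "(nat \<Rightarrow> rat list set) \<Rightarrow> rat set \<Rightarrow> bool" where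
  "qprime C p \<longleftrightarrow> p \<subseteq> qnum C \<and>
     (\<forall>t rs. t \<in> C (length rs) \<and> set rs \<subseteq> p \<longrightarrow> (\<Sum>i<length rs. t ! i * rs ! i) \<in> p) \<and>
     1 \<notin> p \<and> (\<forall>r\<in>qnum C - p. \<forall>s\<in>qnum C - p. r * s \<notin> p)"

definition qstalk :: "(nat \<Rightarrow> rat list set) \<Rightarrow> rat set \<Rightarrow> nat \<Rightarrow> rat list set" where
  "qstalk C p n = {qscale (inverse s) x | x s. x \<in> C n \<and> s \<in> qnum C - p}"

definition qunits :: "(nat \<Rightarrow> rat list set) \<Rightarrow> rat set" where
  "qunits C = {r \<in> qnum C. r \<noteq> 0 \<and> inverse r \<in> qnum C}"

definition qlocal :: "(nat \<Rightarrow> rat list set) \<Rightarrow> bool" where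
  "qlocal C \<longleftrightarrow> qmonad C \<and> qprime C (qnum C - qunits C)"

definition stalks :: "(nat \<Rightarrow> rat list set) \<Rightarrow> (nat \<Rightarrow> rat list set) set" where
  "stalks C = {qstalk C p | p. qprime C p}"

definition qfull :: "nat \<Rightarrow> rat list set" where
  "qfull n = {v. length v = n}"

context
  fixes C assumes C: "qmonad C"
begin

lemma qmonad_length: "v \<in> C n \<Longrightarrow> length v = n"
  using C by (simp add: qmonad_def)

lemma qmonad_var: "i < n \<Longrightarrow> qvar n i \<in> C n"
  using C by (simp add: qmonad_def)

lemma qmonad_lin: "t \<in> C k \<Longrightarrow> length xs = k \<Longrightarrow> set xs \<subseteq> C n \<Longrightarrow> qlin n t xs \<in> C n"
  using C by (auto simp add: qmonad_def)

lemma qmonad_nil: "[] \<in> C 0"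
  using C by (simp add: qmonad_def)

lemma qmonad_frac: "\<exists>s\<in>qnum C. s \<noteq> 0 \<and> qscale s v \<in> C (length v)"
  using C by (simp add: qmonad_def)

lemma qmonad_qscale: "s \<in> qnum C \<Longrightarrow> v \<in> C n \<Longrightarrow> qscale s v \<in> C n"
  using qmonad_lin[of "[s]" 1 "[v]" n] qlin_single[of v n s] qmonad_length[of v n]
  by (simp add: qnum_def)

lemma qnum_one: "1 \<in> qnum C"
  using qmonad_var[of 0 1] by (simp add: qnum_def qvar_def)

lemma qnum_mult: "r \<in> qnum C \<Longrightarrow> s \<in> qnum C \<Longrightarrow> r * s \<in> qnum C"
  using qmonad_qscale[of r "[s]" 1] by (simp add: qnum_def)

lemma qnum_power: "r \<in> qnum C \<Longrightarrow> r ^ k \<in> qnum C"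
  by (induction k) (auto simp: qnum_one qnum_mult)

text \<open>The nullary operation \<open>[]\<close>, applied to no arguments, is the zero vector of
  every arity; this is how the constant makes \<open>0\<close> an element of
  \<open>qnum C\<close>.\<close>

lemma qmonad_replicate_0: "replicate n 0 \<in> C n"
proof -
  have "qlin n [] [] = replicate n 0" by (rule nth_equalityI) simp_all
  then show ?thesis using qmonad_lin[of "[]" 0 "[]" n] qmonad_nil by simp
qed

lemma qnum_zero: "0 \<in> qnum C"
  using qmonad_replicate_0[of 1] by (simp add: qnum_def)

lemma qnum_sum:
  assumes "t \<in> C (length rs)" "set rs \<subseteq> qnum C"
  shows "(\<Sum>i<length rs. t ! i * rs ! i) \<in> qnum C"
proof -
  have "qlin 1 t (map (\<lambda>r. [r]) rs) \<in> C 1"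
    using assms by (intro qmonad_lin[of t "length rs"]) (auto simp: qnum_def)
  moreover have "qlin 1 t (map (\<lambda>r. [r]) rs) = [\<Sum>i<length rs. t ! i * rs ! i]"
    by (simp add: qlin_def)
  ultimately show ?thesis by (simp add: qnum_def)
qed

end

section \<open>Localization at a prime\<close>

context
  fixes C p assumes C: "qmonad C" and p: "qprime C p"
begin

lemma qprime_subset: "r \<in> p \<Longrightarrow> r \<in> qnum C"
  using p by (auto simp: qprime_def)

lemma qprime_sum: "t \<in> C (length rs) \<Longrightarrow> set rs \<subseteq> p \<Longrightarrow> (\<Sum>i<length rs. t ! i * rs ! i) \<in> p"
  using p by (simp add: qprime_def)

lemma qprime_one: "1 \<in> qnum C - p"
  using p qnum_one[OF C] by (simp add: qprime_def)

lemma qprime_mult: "r \<in> qnum C - p \<Longrightarrow> s \<in> qnum C - p \<Longrightarrow> r * s \<in> qnum C - p"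
  using p qnum_mult[OF C] by (simp add: qprime_def)

lemma qprime_zero: "0 \<in> p"
  using qprime_sum[of "[]" "[]"] qmonad_nil[OF C] by simp

lemma qprime_absorb: "r \<in> qnum C \<Longrightarrow> s \<in> p \<Longrightarrow> r * s \<in> p"
  using qprime_sum[of "[r]" "[s]"] by (simp add: qnum_def)

lemma qprime_nonzero: "s \<in> qnum C - p \<Longrightarrow> s \<noteq> 0"
  using qprime_zero by auto

lemma qstalk_mem: "x \<in> C n \<Longrightarrow> s \<in> qnum C - p \<Longrightarrow> qscale (inverse s) x \<in> qstalk C p n"
  by (auto simp: qstalk_def)

lemma subset_qstalk: "C n \<subseteq> qstalk C p n"
  using qstalk_mem[OF _ qprime_one] by auto

lemma qstalk_iff: "v \<in> qstalk C p n \<longleftrightarrow> (\<exists>s\<in>qnum C - p. qscale s v \<in> C n)"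
proof
  assume "v \<in> qstalk C p n"
  then obtain x s where *: "v = qscale (inverse s) x" "x \<in> C n" "s \<in> qnum C - p"
    by (auto simp: qstalk_def)
  then show "\<exists>s\<in>qnum C - p. qscale s v \<in> C n"
    using qprime_nonzero[of s] by (auto intro!: bexI[of _ s])
next
  assume "\<exists>s\<in>qnum C - p. qscale s v \<in> C n"
  then obtain s where s: "s \<in> qnum C - p" "qscale s v \<in> C n" by blast
  then show "v \<in> qstalk C p n"
    using qstalk_mem[OF s(2,1)] qprime_nonzero[of s] by simp
qed

text \<open>Numbers outside \<open>p\<close> are closed under products, so finitely many fractions
  share a denominator; this lets operations be computed on numerators.\<close>

lemma common_denominator:
  "set vs \<subseteq> qstalk C p n \<Longrightarrow> \<exists>s\<in>qnum C - p. \<forall>v\<in>set vs. qscale s v \<in> C n"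
proof (induction vs)
  case Nil
  then show ?case using qprime_one by auto
next
  case (Cons v vs)
  then obtain s where s: "s \<in> qnum C - p" "\<forall>v\<in>set vs. qscale s v \<in> C n" by auto
  from Cons.prems obtain t where t: "t \<in> qnum C - p" "qscale t v \<in> C n"
    by (auto simp: qstalk_iff)
  have "qscale (s * t) w \<in> C n" if "w \<in> set vs" for w
    using qmonad_qscale[OF C, of t "qscale s w" n] s t that by (simp add: mult.commute)
  moreover have "qscale (s * t) v \<in> C n"
    using qmonad_qscale[OF C, of s "qscale t v" n] s t by simp
  ultimately show ?case using qprime_mult[OF s(1) t(1)] by auto
qed

lemma qnum_qstalk: "r \<in> qnum (qstalk C p) \<longleftrightarrow> (\<exists>s\<in>qnum C - p. s * r \<in> qnum C)"
  using qstalk_iff[of "[r]" 1] by (simp add: qnum_def)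

lemma qstalk_qmonad: "qmonad (qstalk C p)"
  unfolding qmonad_def
proof (intro conjI allI impI ballI)
  fix n v assume "v \<in> qstalk C p n"
  then show "length v = n" using qmonad_length[OF C] by (auto simp: qstalk_def)
next
  fix n i :: nat assume "i < n"
  then show "qvar n i \<in> qstalk C p n" using qmonad_var[OF C] subset_qstalk by auto
next
  fix n t xs assume *: "t \<in> qstalk C p (length xs) \<and> set xs \<subseteq> qstalk C p n"
  then obtain s where s: "s \<in> qnum C - p" "\<forall>v\<in>set xs. qscale s v \<in> C n"
    using common_denominator by blast
  from * obtain u where u: "u \<in> qnum C - p" "qscale u t \<in> C (length xs)"
    by (auto simp: qstalk_iff)
  have "qlin n (qscale u t) (map (qscale s) xs) \<in> C n"
    using s u by (intro qmonad_lin[OF C]) auto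
  moreover have "qlin n (qscale u t) (map (qscale s) xs) = qscale (u * s) (qlin n t xs)"
    using qmonad_length[OF C] u(2) s(2) by (intro qlin_qscale) (force, metis length_qscale)
  ultimately show "qlin n t xs \<in> qstalk C p n"
    using qprime_mult[OF u(1) s(1)] by (auto simp: qstalk_iff)
next
  show "[] \<in> qstalk C p 0" using qmonad_nil[OF C] subset_qstalk by auto
next
  fix v
  obtain s where "s\<in>qnum C" "s \<noteq> 0" "qscale s v \<in> C (length v)" using qmonad_frac[OF C] by blast
  then show "\<exists>s\<in>qnum (qstalk C p). s \<noteq> 0 \<and> qscale s v \<in> qstalk C p (length v)"
    using subset_qstalk by (auto simp: qnum_def)
qed

text \<open>A prime is the contraction of the nonunits of its own localization. It can thus be read
  off from its local ring, and a spectrum has no two points with the same local ring.\<close>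

lemma qprime_iff_nonunit: "r \<in> p \<longleftrightarrow> r \<in> qnum C - qunits (qstalk C p)"
proof
  assume r: "r \<in> p"
  have "r \<notin> qunits (qstalk C p)"
  proof
    assume "r \<in> qunits (qstalk C p)"
    then obtain s where "r \<noteq> 0" "s \<in> qnum C - p" "s * inverse r \<in> qnum C"
      by (auto simp: qunits_def qnum_qstalk)
    \<comment> \<open>If \<open>s\<close> is a denominator of \<open>1/r\<close>, then
      \<open>s = (s/r) * r\<close> would lie in \<open>p\<close>.\<close>
    then show False using qprime_absorb[of "s * inverse r" r] r by (simp add: mult.assoc)
  qed
  then show "r \<in> qnum C - qunits (qstalk C p)" using r qprime_subset by auto
next
  assume r: "r \<in> qnum C - qunits (qstalk C p)"
  show "r \<in> p"
  proof (rule ccontr)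
    assume "r \<notin> p"
    then have "r \<in> qnum C - p" using r by auto
    then have "r \<noteq> 0" "inverse r \<in> qnum (qstalk C p)"
      using qprime_nonzero qnum_one[OF C] by (auto simp: qnum_qstalk intro!: bexI[of _ r])
    moreover have "r \<in> qnum (qstalk C p)" using r subset_qstalk by (auto simp: qnum_def)
    ultimately show False using r by (auto simp: qunits_def)
  qed
qed

text \<open>Invertibility of a fraction is decided by its numerator; this reduces closure of the
  nonunits under operations to closure of \<open>p\<close>.\<close>

lemma qstalk_nonunit_iff:
  assumes "r \<in> qnum (qstalk C p)"
  shows "r \<notin> qunits (qstalk C p) \<longleftrightarrow> (\<exists>s\<in>qnum C - p. s * r \<in> p)"
proof
  obtain s where s: "s\<in>qnum C - p" "s * r \<in> qnum C" using assms qnum_qstalk by auto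
  assume r: "r \<notin> qunits (qstalk C p)"
  have "s * r \<in> p"
  proof (rule ccontr)
    assume "s * r \<notin> p"
    then have sr: "s * r \<in> qnum C - p" using s by auto
    then have "r \<noteq> 0" using qprime_nonzero by fastforce
    moreover have "inverse r \<in> qnum (qstalk C p)"
      unfolding qnum_qstalk using sr s \<open>r \<noteq> 0\<close>
      by (intro bexI[of _ "s * r"]) (auto simp: mult.assoc)
    ultimately show False using r assms by (auto simp: qunits_def)
  qed
  then show "\<exists>s\<in>qnum C - p. s * r \<in> p" using s by auto
next
  assume "\<exists>s\<in>qnum C - p. s * r \<in> p"
  then obtain s where s: "s \<in> qnum C - p" "s * r \<in> p" by blast
  show "r \<notin> qunits (qstalk C p)"
  proof
    assume "r \<in> qunits (qstalk C p)"
    then obtain u where u: "r \<noteq> 0" "u \<in> qnum C - p" "u * inverse r \<in> qnum C"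
      by (auto simp: qunits_def qnum_qstalk)
    then have "(u * inverse r) * (s * r) \<in> p" using qprime_absorb s by blast
    then have "u * s \<in> p" using u by (simp add: field_simps)
    then show False using qprime_mult[OF u(2) s(1)] by auto
  qed
qed

lemma common_denominator_nonunits:
  "set rs \<subseteq> qnum (qstalk C p) - qunits (qstalk C p) \<Longrightarrow> \<exists>s\<in>qnum C - p. \<forall>r\<in>set rs. s * r \<in> p"
proof (induction rs)
  case Nil
  then show ?case using qprime_one by auto
next
  case (Cons v vs)
  then obtain s where s: "s \<in> qnum C - p" "\<forall>v\<in>set vs. s * v \<in> p" by auto
  from Cons.prems obtain t where t: "t \<in> qnum C - p" "t * v \<in> p"
    using qstalk_nonunit_iff[of v] by auto
  have "(s * t) * w \<in> p" if "w \<in> set vs" for w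
    using qprime_absorb[of t "s * w"] s t that by (simp add: ac_simps)
  moreover have "(s * t) * v \<in> p"
    using qprime_absorb[of s "t * v"] s t by (simp add: ac_simps)
  ultimately show ?case using qprime_mult[OF s(1) t(1)] by auto
qed

lemma qstalk_qlocal: "qlocal (qstalk C p)"
  unfolding qlocal_def qprime_def
proof (intro conjI allI impI ballI)
  let ?O = "qstalk C p"
  note O = qstalk_qmonad
  show "qmonad ?O" by (rule O)
  show "qnum ?O - qunits ?O \<subseteq> qnum ?O" by auto
  show "1 \<notin> qnum ?O - qunits ?O" using qnum_one[OF O] by (auto simp: qunits_def)
  fix r s assume "r \<in> qnum ?O - (qnum ?O - qunits ?O)" "s \<in> qnum ?O - (qnum ?O - qunits ?O)"
  then show "r * s \<notin> qnum ?O - qunits ?O"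
    using qnum_mult[OF O] by (auto simp: qunits_def)
next
  let ?O = "qstalk C p"
  fix t rs assume *: "t \<in> ?O (length rs) \<and> set rs \<subseteq> qnum ?O - qunits ?O"
  then obtain s where s: "s \<in> qnum C - p" "\<forall>r\<in>set rs. s * r \<in> p"
    using common_denominator_nonunits by blast
  from * obtain u where u: "u \<in> qnum C - p" "qscale u t \<in> C (length rs)"
    by (auto simp: qstalk_iff)
  have "length t = length rs" using * qmonad_length[OF qstalk_qmonad] by blast
  moreover have "(\<Sum>i<length (map ((*) s) rs). qscale u t ! i * map ((*) s) rs ! i) \<in> p"
    using s u by (intro qprime_sum) auto
  ultimately have "(u * s) * (\<Sum>i<length rs. t ! i * rs ! i) \<in> p"
    by (simp add: sum_distrib_left ac_simps)
  moreover have "(\<Sum>i<length rs. t ! i * rs ! i) \<in> qnum ?O"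
    using * by (intro qnum_sum[OF qstalk_qmonad]) auto
  ultimately show "(\<Sum>i<length rs. t ! i * rs ! i) \<in> qnum ?O - qunits ?O"
    using qstalk_nonunit_iff qprime_mult[OF u(1) s(1)] by auto
qed

end

lemma stalks_qlocal: "qmonad C \<Longrightarrow> L \<in> stalks C \<Longrightarrow> qlocal L"
  using qstalk_qlocal by (auto simp: stalks_def)

lemma stalks_superset: "qmonad C \<Longrightarrow> L \<in> stalks C \<Longrightarrow> C n \<subseteq> L n"
  using subset_qstalk by (auto simp: stalks_def)

lemma qlocal_qmonad: "qlocal L \<Longrightarrow> qmonad L"
  by (simp add: qlocal_def)

lemma qlocal_units_mult: "qlocal L \<Longrightarrow> r \<in> qunits L \<Longrightarrow> s \<in> qunits L \<Longrightarrow> r * s \<in> qunits L"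
  using qnum_mult[OF qlocal_qmonad] by (auto simp: qunits_def)

text \<open>The center of \<open>L\<close> on \<open>C\<close>, that is, the contraction of the
  nonunits of \<open>L\<close>. It inherits the ideal property from the nonunits of
  \<open>L\<close>, and its complement consists of units of \<open>L\<close>, which are closed under
  products.\<close>

lemma qlocal_center_qprime:
  assumes "qlocal L" "qmonad C" "\<And>n. C n \<subseteq> L n"
  shows "qprime C (qnum C - qunits L)"
  unfolding qprime_def
proof (intro conjI allI impI ballI)
  have sub: "qnum C \<subseteq> qnum L" using assms(3) by (auto simp: qnum_def)
  note p = assms(1)[unfolded qlocal_def, THEN conjunct2]
  note L = qlocal_qmonad[OF assms(1)]
  show "qnum C - qunits L \<subseteq> qnum C" by auto
  show "1 \<notin> qnum C - qunits L" using qprime_one[OF L p] by auto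
  { fix r s assume "r \<in> qnum C - (qnum C - qunits L)" "s \<in> qnum C - (qnum C - qunits L)"
    then show "r * s \<notin> qnum C - qunits L" using qlocal_units_mult[OF assms(1)] by auto }
  fix t rs assume *: "t \<in> C (length rs) \<and> set rs \<subseteq> qnum C - qunits L"
  then have "(\<Sum>i<length rs. t ! i * rs ! i) \<in> qnum L - qunits L"
    using assms(3) sub by (intro qprime_sum[OF L p]) auto
  moreover have "(\<Sum>i<length rs. t ! i * rs ! i) \<in> qnum C"
    using * by (intro qnum_sum[OF assms(2)]) auto
  ultimately show "(\<Sum>i<length rs. t ! i * rs ! i) \<in> qnum C - qunits L" by auto
qed

lemma qprime_eq_center: "qmonad C \<Longrightarrow> qprime C p \<Longrightarrow> p = qnum C - qunits (qstalk C p)"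
  using qprime_iff_nonunit by blast

lemma stalks_eq_center: "qmonad C \<Longrightarrow> L \<in> stalks C \<Longrightarrow> L = qstalk C (qnum C - qunits L)"
  using qprime_eq_center by (fastforce simp: stalks_def)

text \<open>The tool for comparing two affine charts. Elements of \<open>D\<close> become elements
  of \<open>C\<close> after multiplication by numbers of \<open>C\<close> that are units in
  \<open>L\<close>, so localizing \<open>C\<close> at the center of \<open>L\<close> reaches every
  fraction that localizing \<open>D\<close> reaches. No inclusion between \<open>C\<close> and
  \<open>D\<close> is assumed, so the lemma applies in both directions to \<open>Z\<close> and
  \<open>A_N\<close>.\<close>

lemma stalks_transfer:
  assumes C: "qmonad C" and D: "qmonad D" and L: "L \<in> stalks D" and sub: "\<And>n. C n \<subseteq> L n"
    and frac: "\<And>n d. d \<in> D n \<Longrightarrow> \<exists>s\<in>qnum C \<inter> qunits L. qscale s d \<in> C n"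
  shows "L \<in> stalks C"
proof -
  note loc = stalks_qlocal[OF D L]
  have p: "qprime C (qnum C - qunits L)" by (rule qlocal_center_qprime[OF loc C sub])
  have eq: "qnum C - (qnum C - qunits L) = qnum C \<inter> qunits L" by auto
  have "L n = qstalk C (qnum C - qunits L) n" for n
  proof (intro equalityI subsetI)
    fix v assume "v \<in> qstalk C (qnum C - qunits L) n"
    then obtain x s where v: "v = qscale (inverse s) x" "x \<in> C n" "s \<in> qunits L"
      by (auto simp: qstalk_def)
    then have "inverse s \<in> qnum L" by (auto simp: qunits_def)
    then show "v \<in> L n" using v subsetD[OF sub v(2)] qmonad_qscale[OF qlocal_qmonad[OF loc]] by simp
  next
    fix v assume v: "v \<in> L n"
    have "L = qstalk D (qnum D - qunits L)" by (rule stalks_eq_center[OF D L])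
    then have "v \<in> qstalk D (qnum D - qunits L) n" using v by simp
    then obtain s where s: "s \<in> qnum D" "s \<in> qunits L" "qscale s v \<in> D n"
      using qstalk_iff[OF D qlocal_center_qprime[OF loc D stalks_superset[OF D L]], of v n] by auto
    obtain u where u: "u \<in> qnum C \<inter> qunits L" "qscale u (qscale s v) \<in> C n" using frac s by blast
    \<comment> \<open>The denominator \<open>s\<close> comes from \<open>D\<close> and may lie
      outside \<open>C\<close>; applying \<open>frac\<close> to the unary vector \<open>[s]\<close>
      corrects it to \<open>w * s\<close>.\<close>
    obtain w where w: "w \<in> qnum C \<inter> qunits L" "qscale w [s] \<in> C 1"
      using frac[of "[s]" 1] s by (auto simp: qnum_def)
    have "qscale (w * (u * s)) v \<in> C n"
      using qmonad_qscale[OF C, of w "qscale u (qscale s v)" n] w u by simp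
    moreover have "u * (w * s) \<in> qnum C \<inter> qunits L"
    proof
      have "w * s \<in> qnum C" using w by (simp add: qnum_def)
      then show "u * (w * s) \<in> qnum C" using u qnum_mult[OF C] by auto
      show "u * (w * s) \<in> qunits L" using u w s qlocal_units_mult[OF loc] by auto
    qed
    ultimately show "v \<in> qstalk C (qnum C - qunits L) n"
      unfolding qstalk_iff[OF C p] by (intro bexI[of _ "u * (w * s)"]) (auto simp: ac_simps)
  qed
  then show ?thesis using p unfolding stalks_def by blast
qed

text \<open>The zero ideal is prime because the rationals have no zero divisors. By the last clause
  of \<open>qmonad\<close> every vector has a nonzero denominator in \<open>C\<close>, so
  localization at this prime gives everything: the generic point.\<close>

lemma qfull_in_stalks:
  assumes C: "qmonad C"
  shows "qfull \<in> stalks C"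
proof -
  have p: "qprime C {0}"
    unfolding qprime_def using qnum_zero[OF C]
    by (auto intro!: sum.neutral) (metis nth_mem singletonD subsetD)
  have "qstalk C {0} n = qfull n" for n
  proof (intro equalityI subsetI)
    fix v assume "v \<in> qfull n"
    then show "v \<in> qstalk C {0} n"
      unfolding qstalk_iff[OF C p] using qmonad_frac[OF C, of v] by (auto simp: qfull_def)
  qed (use qmonad_length[OF qstalk_qmonad[OF C p]] in \<open>auto simp: qfull_def\<close>)
  then have "qfull = qstalk C {0}" by auto
  then show ?thesis using p by (auto simp: stalks_def)
qed

lemma qmonad_subset_qfull: "qmonad C \<Longrightarrow> C n \<subseteq> qfull n"
  using qmonad_length by (auto simp: qfull_def)

section \<open>Spaces described by their local rings\<close>

text \<open>It suffices to test commutation in free modules: a matrix \<open>x\<close> in any module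
  is the image of the generic matrix of variables in arity \<open>n * m\<close>, and acting on a
  module is compatible with \<open>app\<close>.\<close>

lemma generalized_ringI:
  assumes A: "algebraic_monad A"
    and comm: "\<And>n m l t s x. t \<in> car A n \<Longrightarrow> s \<in> car A m \<Longrightarrow> (\<forall>i<n. \<forall>j<m. x i j \<in> car A l) \<Longrightarrow>
      app A l t (map (\<lambda>i. app A l s (map (\<lambda>j. x i j) [0..<m])) [0..<n]) =
      app A l s (map (\<lambda>j. app A l t (map (\<lambda>i. x i j) [0..<n])) [0..<m])"
  shows "generalized_ring A"
  unfolding generalized_ring_def ops_commute_def
proof (intro conjI allI ballI impI, rule A, elim conjE)
  fix n m t s and M :: "('a, 'a) gr_module" and x :: "nat \<Rightarrow> nat \<Rightarrow> 'a"
  assume t: "t \<in> car A n" and s: "s \<in> car A m" and M: "is_module A M"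
    and x: "\<forall>i<n. \<forall>j<m. x i j \<in> mcar M"
  \<comment> \<open>The matrix \<open>x\<close> read row by row as one list; \<open>v i j\<close> is
    the variable at the matching position \<open>i * m + j\<close>, so that acting on
    \<open>xs\<close> sends \<open>v i j\<close> to \<open>x i j\<close>.\<close>
  define xs where "xs = map (\<lambda>k. x (k div m) (k mod m)) [0..<n * m]"
  define v where "v = (\<lambda>i j. var A (n * m) (i * m + j))"
  have idx: "i * m + j < n * m" if "i < n" "j < m" for i j
  proof -
    have "i * m + j < (i + 1) * m" using that by simp
    also have "\<dots> \<le> n * m" using that by (intro mult_right_mono) auto
    finally show ?thesis .
  qed
  have xs: "set xs \<subseteq> mcar M" "length xs = n * m"
  proof -
    have "k mod m < m \<and> k div m < n" if "k < n * m" for k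
      using that by (cases "m = 0") (auto simp: less_mult_imp_div_less)
    then show "set xs \<subseteq> mcar M" using x by (auto simp: xs_def)
  qed (simp add: xs_def)
  have v: "v i j \<in> car A (n * m)" if "i < n" "j < m" for i j
    using A idx[OF that] by (simp add: algebraic_monad_def v_def)
  have act_v: "act M (v i j) xs = x i j" if "i < n" "j < m" for i j
  proof -
    have "act M (var A (length xs) (i * m + j)) xs = xs ! (i * m + j)"
      using M idx[OF that] xs unfolding is_module_def by metis
    then show ?thesis using idx[OF that] that by (simp add: v_def xs_def)
  qed
  have app: "app A l u us \<in> car A l" if "u \<in> car A (length us)" "set us \<subseteq> car A l" for l u us
    using A that by (simp add: algebraic_monad_def)
  have act_app: "act M (app A (n * m) u us) xs = act M u (map (\<lambda>w. act M w xs) us)"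
    if "u \<in> car A (length us)" "set us \<subseteq> car A (n * m)" for u us
    using M that xs unfolding is_module_def by metis
  have row: "app A (n * m) s (map (v i) [0..<m]) \<in> car A (n * m)"
    "act M (app A (n * m) s (map (v i) [0..<m])) xs = act M s (map (x i) [0..<m])" if i: "i < n" for i
  proof -
    have sub: "set (map (v i) [0..<m]) \<subseteq> car A (n * m)" using v i by auto
    then show "app A (n * m) s (map (v i) [0..<m]) \<in> car A (n * m)" using s by (intro app) auto
    have "map (\<lambda>w. act M w xs) (map (v i) [0..<m]) = map (x i) [0..<m]" using act_v i by auto
    then show "act M (app A (n * m) s (map (v i) [0..<m])) xs = act M s (map (x i) [0..<m])"
      using act_app[OF _ sub] s by (simp del: map_map)
  qed
  have col: "app A (n * m) t (map (\<lambda>i. v i j) [0..<n]) \<in> car A (n * m)"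
    "act M (app A (n * m) t (map (\<lambda>i. v i j) [0..<n])) xs = act M t (map (\<lambda>i. x i j) [0..<n])"
    if j: "j < m" for j
  proof -
    have sub: "set (map (\<lambda>i. v i j) [0..<n]) \<subseteq> car A (n * m)" using v j by auto
    then show "app A (n * m) t (map (\<lambda>i. v i j) [0..<n]) \<in> car A (n * m)" using t by (intro app) auto
    have "map (\<lambda>w. act M w xs) (map (\<lambda>i. v i j) [0..<n]) = map (\<lambda>i. x i j) [0..<n]" using act_v j by auto
    then show "act M (app A (n * m) t (map (\<lambda>i. v i j) [0..<n])) xs = act M t (map (\<lambda>i. x i j) [0..<n])"
      using act_app[OF _ sub] t by (simp del: map_map)
  qed
  have L: "act M (app A (n * m) t (map (\<lambda>i. app A (n * m) s (map (v i) [0..<m])) [0..<n])) xs =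
      act M t (map (\<lambda>i. act M s (map (x i) [0..<m])) [0..<n])"
  proof -
    have sub: "set (map (\<lambda>i. app A (n * m) s (map (v i) [0..<m])) [0..<n]) \<subseteq> car A (n * m)" using row by auto
    have "map (\<lambda>w. act M w xs) (map (\<lambda>i. app A (n * m) s (map (v i) [0..<m])) [0..<n]) =
        map (\<lambda>i. act M s (map (x i) [0..<m])) [0..<n]" using row by auto
    then show ?thesis using act_app[OF _ sub] t by (simp del: map_map)
  qed
  have R: "act M (app A (n * m) s (map (\<lambda>j. app A (n * m) t (map (\<lambda>i. v i j) [0..<n])) [0..<m])) xs =
      act M s (map (\<lambda>j. act M t (map (\<lambda>i. x i j) [0..<n])) [0..<m])"
  proof -
    have sub: "set (map (\<lambda>j. app A (n * m) t (map (\<lambda>i. v i j) [0..<n])) [0..<m]) \<subseteq> car A (n * m)" using col by auto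
    have "map (\<lambda>w. act M w xs) (map (\<lambda>j. app A (n * m) t (map (\<lambda>i. v i j) [0..<n])) [0..<m]) =
        map (\<lambda>j. act M t (map (\<lambda>i. x i j) [0..<n])) [0..<m]" using col by auto
    then show ?thesis using act_app[OF _ sub] s by (simp del: map_map)
  qed
  show "act M t (map (\<lambda>i. act M s (map (x i) [0..<m])) [0..<n]) =
      act M s (map (\<lambda>j. act M t (map (\<lambda>i. x i j) [0..<n])) [0..<m])"
    using comm[OF t s, of v "n * m"] v L R by simp
qed

text \<open>The maps \<open>e p\<close> are homomorphisms to \<open>\<Sigma>_\<rat>\<close> which
  together separate elements, so all identities satisfied by \<open>qlin\<close> are inherited. For
  sections over an open set \<open>U\<close> is that set; for a ring with a single injective value
  map it is a singleton.\<close>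

lemma generalized_ring_separated:
  fixes A :: "'a monad" and e :: "'p \<Rightarrow> nat \<Rightarrow> 'a \<Rightarrow> rat list"
  assumes var_car: "\<And>n i. i < n \<Longrightarrow> var A n i \<in> car A n"
    and e_var: "\<And>p n i. p \<in> U \<Longrightarrow> i < n \<Longrightarrow> e p n (var A n i) = qvar n i"
    and app_car: "\<And>n k t xs. t \<in> car A k \<Longrightarrow> length xs = k \<Longrightarrow> set xs \<subseteq> car A n \<Longrightarrow> app A n t xs \<in> car A n"
    and e_app: "\<And>p n k t xs. t \<in> car A k \<Longrightarrow> length xs = k \<Longrightarrow> set xs \<subseteq> car A n \<Longrightarrow> p \<in> U \<Longrightarrow>
      e p n (app A n t xs) = qlin n (e p k t) (map (e p n) xs)"
    and len: "\<And>p n x. x \<in> car A n \<Longrightarrow> p \<in> U \<Longrightarrow> length (e p n x) = n"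
    and sep: "\<And>n x y. x \<in> car A n \<Longrightarrow> y \<in> car A n \<Longrightarrow> (\<And>p. p \<in> U \<Longrightarrow> e p n x = e p n y) \<Longrightarrow> x = y"
  shows "generalized_ring A"
proof (rule generalized_ringI)
  show "algebraic_monad A"
    unfolding algebraic_monad_def
  proof (intro conjI allI impI; (elim conjE)?)
    show "var A n i \<in> car A n" if "i < n" for n i by (rule var_car[OF that])
    show "app A n t xs \<in> car A n" if "t \<in> car A (length xs)" "set xs \<subseteq> car A n" for n t xs
      by (rule app_car[OF that(1) refl that(2)])
    show "app A n (var A (length xs) i) xs = xs ! i" if xs: "set xs \<subseteq> car A n" and i: "i < length xs" for n xs i
    proof (rule sep[OF app_car[OF var_car[OF i] refl xs]])
      show s: "xs ! i \<in> car A n" using xs i by auto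
      fix p assume p: "p \<in> U"
      show "e p n (app A n (var A (length xs) i) xs) = e p n (xs ! i)"
        using qlin_var[of i "map (e p n) xs" n] i
        by (simp add: e_app[OF var_car[OF i] refl xs p] e_var[OF p i] len[OF s p])
    qed
    show "app A n t (map (var A n) [0..<n]) = t" if t: "t \<in> car A n" for n t
    proof -
      have sub: "set (map (var A n) [0..<n]) \<subseteq> car A n" using var_car by auto
      show ?thesis
      proof (rule sep[OF app_car[OF t _ sub] t])
        fix p assume p: "p \<in> U"
        have "map (e p n) (map (var A n) [0..<n]) = map (qvar n) [0..<n]" using e_var[OF p] by simp
        then show "e p n (app A n t (map (var A n) [0..<n])) = e p n t"
          using qlin_vars[OF len[OF t p]] by (simp add: e_app[OF t _ sub p] del: map_map)
      qed simp
    qed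
    fix m n t xs ys
    assume t: "t \<in> car A (length xs)" and xs: "set xs \<subseteq> car A m" and l: "length ys = m" and ys: "set ys \<subseteq> car A n"
    have sub: "set (map (\<lambda>x. app A n x ys) xs) \<subseteq> car A n" using app_car[OF _ l ys] xs by auto
    note tx = app_car[OF t refl xs]
    show "app A n (app A m t xs) ys = app A n t (map (\<lambda>x. app A n x ys) xs)"
    proof (rule sep[OF app_car[OF tx l ys] app_car[OF t _ sub]])
      fix p assume p: "p \<in> U"
      have "map (\<lambda>x. qlin n x (map (e p n) ys)) (map (e p m) xs) = map (e p n) (map (\<lambda>x. app A n x ys) xs)"
        using e_app[OF _ l ys p] xs by auto
      then show "e p n (app A n (app A m t xs) ys) = e p n (app A n t (map (\<lambda>x. app A n x ys) xs))"
        using qlin_assoc[of "map (e p n) ys" m n "e p (length xs) t" "map (e p m) xs"] l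
        by (simp add: e_app[OF t _ sub p] e_app[OF tx l ys p] e_app[OF t refl xs p] del: map_map)
    qed simp
  qed
  fix n m l t s x
  assume t: "t \<in> car A n" and s: "s \<in> car A m" and x: "\<forall>i<n. \<forall>j<m. x i j \<in> car A l"
  let ?xs = "\<lambda>i. map (\<lambda>j. x i j) [0..<m]" and ?ys = "\<lambda>j. map (\<lambda>i. x i j) [0..<n]"
  have xs: "set (?xs i) \<subseteq> car A l" if "i < n" for i using x that by auto
  have ys: "set (?ys j) \<subseteq> car A l" if "j < m" for j using x that by auto
  have sx: "set (map (\<lambda>i. app A l s (?xs i)) [0..<n]) \<subseteq> car A l" using app_car[OF s _ xs] by auto
  have ty: "set (map (\<lambda>j. app A l t (?ys j)) [0..<m]) \<subseteq> car A l" using app_car[OF t _ ys] by auto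
  show "app A l t (map (\<lambda>i. app A l s (?xs i)) [0..<n]) = app A l s (map (\<lambda>j. app A l t (?ys j)) [0..<m])"
  proof (rule sep[OF app_car[OF t _ sx] app_car[OF s _ ty]])
    fix p assume p: "p \<in> U"
    have 1: "map (e p l) (map (\<lambda>i. app A l s (?xs i)) [0..<n]) =
        map (\<lambda>i. qlin l (e p m s) (map (\<lambda>j. e p l (x i j)) [0..<m])) [0..<n]"
      using e_app[OF s _ xs p] by (simp add: comp_def)
    have 2: "map (e p l) (map (\<lambda>j. app A l t (?ys j)) [0..<m]) =
        map (\<lambda>j. qlin l (e p n t) (map (\<lambda>i. e p l (x i j)) [0..<n])) [0..<m]"
      using e_app[OF t _ ys p] by (simp add: comp_def)
    have "e p l (app A l t (map (\<lambda>i. app A l s (?xs i)) [0..<n])) =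
        qlin l (e p n t) (map (e p l) (map (\<lambda>i. app A l s (?xs i)) [0..<n]))"
      by (rule e_app[OF t _ sx p]) simp
    moreover have "e p l (app A l s (map (\<lambda>j. app A l t (?ys j)) [0..<m])) =
        qlin l (e p m s) (map (e p l) (map (\<lambda>j. app A l t (?ys j)) [0..<m]))"
      by (rule e_app[OF s _ ty p]) simp
    ultimately show "e p l (app A l t (map (\<lambda>i. app A l s (?xs i)) [0..<n])) =
        e p l (app A l s (map (\<lambda>j. app A l t (?ys j)) [0..<m]))"
      unfolding 1 2 by (simp only: qlin_commute[of l "e p n t" "e p m s" "\<lambda>i j. e p l (x i j)" m n])
  qed simp_all
qed

section \<open>Spaces with local rings inside the rationals\<close>

abbreviation pts :: "('p, 's) gspace \<Rightarrow> 'p set" where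
  "pts X \<equiv> topspace (topo X)"

text \<open>\<open>F\<close> consists of pairs of an arity and a vector, so one finite set can
  combine conditions in several arities. On a spectrum, \<open>F = {(1, [1/g])}\<close> describes
  the principal open set of a nonzero \<open>g\<close>.\<close>

definition zopen :: "'p set \<Rightarrow> ('p \<Rightarrow> nat \<Rightarrow> rat list set) \<Rightarrow> 'p set \<Rightarrow> bool" where
  "zopen T St U \<longleftrightarrow> U \<subseteq> T \<and>
     (\<forall>x\<in>U. \<exists>F. finite F \<and> F \<subseteq> Sigma UNIV (St x) \<and> (\<forall>y\<in>T. F \<subseteq> Sigma UNIV (St y) \<longrightarrow> y \<in> U))"

text \<open>\<open>St x\<close> is the local ring at \<open>x\<close> and \<open>ev n s x\<close> is the value at \<open>x\<close> of a section \<open>s\<close> of \<open>\<O>(n)\<close>.\<close>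

locale zspace =
  fixes X :: "('p, 's) gspace" and ev :: "nat \<Rightarrow> 's \<Rightarrow> 'p \<Rightarrow> rat list"
    and St :: "'p \<Rightarrow> nat \<Rightarrow> rat list set"
  assumes inj_St: "inj_on St (pts X)"
    and qlocal_St: "x \<in> pts X \<Longrightarrow> qlocal (St x)"
    and generic: "pts X \<noteq> {} \<Longrightarrow> qfull \<in> St ` pts X"
    and openin_zopen: "openin (topo X) U \<longleftrightarrow> zopen (pts X) St U"
    and sec_const: "openin (topo X) U \<Longrightarrow> s \<in> car (sec X U) n \<Longrightarrow>
          \<exists>v. \<forall>x\<in>U. v \<in> St x n \<and> ev n s x = v"
    and sec_eqI: "openin (topo X) U \<Longrightarrow> s \<in> car (sec X U) n \<Longrightarrow> s' \<in> car (sec X U) n \<Longrightarrow>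
          (\<And>x. x \<in> U \<Longrightarrow> ev n s x = ev n s' x) \<Longrightarrow> s = s'"
    and sec_ex: "openin (topo X) U \<Longrightarrow> (\<And>x. x \<in> U \<Longrightarrow> v \<in> St x n) \<Longrightarrow>
          \<exists>s\<in>car (sec X U) n. \<forall>x\<in>U. ev n s x = v"
    and sec_var: "openin (topo X) U \<Longrightarrow> i < n \<Longrightarrow>
          var (sec X U) n i \<in> car (sec X U) n \<and> (\<forall>x\<in>U. ev n (var (sec X U) n i) x = qvar n i)"
    and sec_app: "openin (topo X) U \<Longrightarrow> t \<in> car (sec X U) (length ss) \<Longrightarrow> set ss \<subseteq> car (sec X U) n \<Longrightarrow>
          app (sec X U) n t ss \<in> car (sec X U) n \<and>
          (\<forall>x\<in>U. ev n (app (sec X U) n t ss) x = qlin n (ev (length ss) t x) (map (\<lambda>s. ev n s x) ss))"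
    and sec_res: "openin (topo X) U \<Longrightarrow> openin (topo X) V \<Longrightarrow> V \<subseteq> U \<Longrightarrow> s \<in> car (sec X U) n \<Longrightarrow>
          res X U V n s \<in> car (sec X V) n \<and> (\<forall>x\<in>V. ev n (res X U V n s) x = ev n s x)"
begin

lemma open_sub: "openin (topo X) U \<Longrightarrow> x \<in> U \<Longrightarrow> x \<in> pts X"
  using openin_subset by blast

lemma ev_St: "openin (topo X) U \<Longrightarrow> s \<in> car (sec X U) n \<Longrightarrow> x \<in> U \<Longrightarrow> ev n s x \<in> St x n"
  using sec_const by metis

lemma ev_const: "openin (topo X) U \<Longrightarrow> s \<in> car (sec X U) n \<Longrightarrow> x \<in> U \<Longrightarrow> y \<in> U \<Longrightarrow> ev n s x = ev n s y"
  using sec_const by metis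

lemma length_ev: "openin (topo X) U \<Longrightarrow> s \<in> car (sec X U) n \<Longrightarrow> x \<in> U \<Longrightarrow> length (ev n s x) = n"
  using ev_St[of U s n x] open_sub qmonad_length[OF qlocal_qmonad[OF qlocal_St]] by blast

lemma var_car: "openin (topo X) U \<Longrightarrow> i < n \<Longrightarrow> var (sec X U) n i \<in> car (sec X U) n"
  and ev_var: "openin (topo X) U \<Longrightarrow> i < n \<Longrightarrow> x \<in> U \<Longrightarrow> ev n (var (sec X U) n i) x = qvar n i"
  using sec_var by auto

lemma app_car: "openin (topo X) U \<Longrightarrow> t \<in> car (sec X U) k \<Longrightarrow> length ss = k \<Longrightarrow> set ss \<subseteq> car (sec X U) n \<Longrightarrow>
          app (sec X U) n t ss \<in> car (sec X U) n"
  and ev_app: "openin (topo X) U \<Longrightarrow> t \<in> car (sec X U) k \<Longrightarrow> length ss = k \<Longrightarrow> set ss \<subseteq> car (sec X U) n \<Longrightarrow>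
     x \<in> U \<Longrightarrow> ev n (app (sec X U) n t ss) x = qlin n (ev k t x) (map (\<lambda>s. ev n s x) ss)"
  using sec_app by auto

lemma res_car: "openin (topo X) U \<Longrightarrow> openin (topo X) V \<Longrightarrow> V \<subseteq> U \<Longrightarrow> s \<in> car (sec X U) n \<Longrightarrow>
          res X U V n s \<in> car (sec X V) n"
  and ev_res: "openin (topo X) U \<Longrightarrow> openin (topo X) V \<Longrightarrow> V \<subseteq> U \<Longrightarrow> s \<in> car (sec X U) n \<Longrightarrow>
          x \<in> V \<Longrightarrow> ev n (res X U V n s) x = ev n s x"
  using sec_res by auto

lemma sec_generalized_ring:
  assumes U: "openin (topo X) U"
  shows "generalized_ring (sec X U)"
  by (rule generalized_ring_separated[where U = U and e = "\<lambda>x n s. ev n s x"])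
    (auto intro: var_car[OF U] app_car[OF U] ev_var[OF U] ev_app[OF U] length_ev[OF U] sec_eqI[OF U])

text \<open>The finite set that witnesses openness at a point \<open>x\<close> lies in
  \<open>St x\<close>, hence in \<open>qfull\<close>, so the generic point satisfies the same
  condition.\<close>

lemma generic_open:
  assumes "openin (topo X) U" "U \<noteq> {}"
  obtains z where "z \<in> U" "St z = qfull"
proof -
  obtain x where x: "x \<in> U" using assms by blast
  then obtain F where F: "F \<subseteq> Sigma UNIV (St x)" "\<forall>y\<in>pts X. F \<subseteq> Sigma UNIV (St y) \<longrightarrow> y \<in> U"
    using assms(1) unfolding openin_zopen zopen_def by blast
  have "pts X \<noteq> {}" using open_sub[OF assms(1) x] by auto
  then obtain z where z: "z \<in> pts X" "St z = qfull" using generic by (metis imageE)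
  have "St x n \<subseteq> qfull n" for n
    using qmonad_subset_qfull[OF qlocal_qmonad[OF qlocal_St[OF open_sub[OF assms(1) x]]]] .
  then have "Sigma UNIV (St x) \<subseteq> Sigma UNIV (St z)" unfolding z(2) by (intro Sigma_mono) auto
  then have "z \<in> U" using F z by (meson subset_trans)
  then show ?thesis using that z by blast
qed

lemma generic_eq:
  assumes "z \<in> pts X" "St z = qfull" "w \<in> pts X" "St w = qfull"
  shows "z = w"
  using assms inj_St by (metis inj_onD)

text \<open>Any two nonempty members of the cover meet in the generic point. Agreement on
  intersections therefore forces one common value for all members, and the section with this value
  glues the family.\<close>

lemma sec_glue:
  assumes op: "\<forall>V\<in>\<U>. openin (topo X) V \<and> s V \<in> car (sec X V) n"
    and agree: "\<forall>V\<in>\<U>. \<forall>W\<in>\<U>. res X V (V \<inter> W) n (s V) = res X W (V \<inter> W) n (s W)"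
  shows "\<exists>!t. t \<in> car (sec X (\<Union>\<U>)) n \<and> (\<forall>V\<in>\<U>. res X (\<Union>\<U>) V n t = s V)"
proof -
  have U: "openin (topo X) (\<Union>\<U>)" using op by blast
  have same: "ev n (s V) x = ev n (s W) y" if V: "V \<in> \<U>" "x \<in> V" and W: "W \<in> \<U>" "y \<in> W" for V W x y
  proof -
    have oV: "openin (topo X) V" "s V \<in> car (sec X V) n" using op V by auto
    have oW: "openin (topo X) W" "s W \<in> car (sec X W) n" using op W by auto
    have oVW: "openin (topo X) (V \<inter> W)" using oV oW by blast
    obtain z where z: "z \<in> V" "St z = qfull" using generic_open[OF oV(1)] V by blast
    obtain z' where z': "z' \<in> W" "St z' = qfull" using generic_open[OF oW(1)] W by blast
    have "z = z'" using generic_eq z z' open_sub[OF oV(1)] open_sub[OF oW(1)] by blast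
    then have zz: "z \<in> V \<inter> W" using z z' by auto
    have "ev n (s V) z = ev n (s W) z"
      using agree V(1) W(1) ev_res[OF oV(1) oVW _ oV(2) zz] ev_res[OF oW(1) oVW _ oW(2) zz] by auto
    then show ?thesis using ev_const[OF oV V(2) z(1)] ev_const[OF oW W(2) z'(1)] \<open>z = z'\<close> by simp
  qed
  \<comment> \<open>If all members of the cover are empty, any \<open>v\<close> will do.\<close>
  obtain v where v: "\<And>V x. V \<in> \<U> \<Longrightarrow> x \<in> V \<Longrightarrow> ev n (s V) x = v"
  proof (cases "\<Union>\<U> = {}")
    case True
    then show ?thesis using that by blast
  next
    case False
    then obtain W y where "W \<in> \<U>" "y \<in> W" by blast
    then show ?thesis using that[of "ev n (s W) y"] same by blast
  qed
  have "\<exists>t\<in>car (sec X (\<Union>\<U>)) n. \<forall>x\<in>\<Union>\<U>. ev n t x = v"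
  proof (rule sec_ex[OF U])
    fix x assume "x \<in> \<Union>\<U>"
    then obtain V where "V \<in> \<U>" "x \<in> V" by blast
    then show "v \<in> St x n" using ev_St[of V "s V" n x] op v by auto
  qed
  then obtain t where t: "t \<in> car (sec X (\<Union>\<U>)) n" "\<forall>x\<in>\<Union>\<U>. ev n t x = v" by blast
  show ?thesis
  proof (rule ex1I[of _ t], intro conjI ballI)
    show "t \<in> car (sec X (\<Union>\<U>)) n" by (rule t)
    fix V assume V: "V \<in> \<U>"
    then have oV: "openin (topo X) V" "V \<subseteq> \<Union>\<U>" "s V \<in> car (sec X V) n" using op by auto
    show "res X (\<Union>\<U>) V n t = s V"
      using t v V oV by (intro sec_eqI[OF oV(1) res_car[OF U oV(1,2) t(1)] oV(3)])
        (auto simp: ev_res[OF U oV(1,2) t(1)])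
  next
    fix t' assume t': "t' \<in> car (sec X (\<Union>\<U>)) n \<and> (\<forall>V\<in>\<U>. res X (\<Union>\<U>) V n t' = s V)"
    show "t' = t"
    proof (rule sec_eqI[OF U _ t(1)])
      fix x assume "x \<in> \<Union>\<U>"
      then obtain V where V: "V \<in> \<U>" "x \<in> V" by blast
      then have "V \<subseteq> \<Union>\<U>" by blast
      then have "ev n t' x = ev n (s V) x"
        using t' op ev_res[of "\<Union>\<U>" V t' n x] U V by auto
      then show "ev n t' x = ev n t x" using t v V by auto
    qed (use t' in blast)
  qed
qed

lemma ringed_space: "ringed_space X"
  unfolding ringed_space_def
proof (intro conjI allI impI ballI; (elim conjE)?)
  show "generalized_ring (sec X U)" if "openin (topo X) U" for U
    by (rule sec_generalized_ring[OF that])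
  show "ring_morphism (sec X U) (sec X V) (res X U V)"
    if U: "openin (topo X) U" and V: "openin (topo X) V" and sub: "V \<subseteq> U" for U V
    unfolding ring_morphism_def
  proof (intro conjI allI impI ballI; (elim conjE)?)
    note rc = res_car[OF U V sub] and er = ev_res[OF U V sub]
    show "res X U V n t \<in> car (sec X V) n" if "t \<in> car (sec X U) n" for n t
      by (rule rc[OF that])
    show "res X U V n (var (sec X U) n i) = var (sec X V) n i" if i: "i < n" for n i
      using sub by (intro sec_eqI[OF V rc[OF var_car[OF U i]] var_car[OF V i]])
        (auto simp: er[OF var_car[OF U i]] ev_var[OF U i] ev_var[OF V i])
    fix n t xs assume t: "t \<in> car (sec X U) (length xs)" and xs: "set xs \<subseteq> car (sec X U) n"
    have xs': "set (map (res X U V n) xs) \<subseteq> car (sec X V) n" using rc xs by auto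
    show "res X U V n (app (sec X U) n t xs) = app (sec X V) n (res X U V (length xs) t) (map (res X U V n) xs)"
    proof (rule sec_eqI[OF V rc[OF app_car[OF U t refl xs]] app_car[OF V rc[OF t] _ xs']])
      fix x assume x: "x \<in> V"
      have "map (\<lambda>s. ev n s x) (map (res X U V n) xs) = map (\<lambda>s. ev n s x) xs"
        using er[OF _ x] xs by auto
      then show "ev n (res X U V n (app (sec X U) n t xs)) x =
          ev n (app (sec X V) n (res X U V (length xs) t) (map (res X U V n) xs)) x"
        using x sub by (simp add: er[OF app_car[OF U t refl xs] x] ev_app[OF U t refl xs]
          ev_app[OF V rc[OF t] _ xs' x] er[OF t x] subset_iff del: map_map)
    qed simp
  qed
  show "res X U U n s = s" if "s \<in> car (sec X U) n" "openin (topo X) U" for U n s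
    using that by (intro sec_eqI[of U _ n] res_car) (auto simp: ev_res[OF that(2,2) subset_refl that(1)])
  show "res X V W n (res X U V n s) = res X U W n s"
    if s: "s \<in> car (sec X U) n" and U: "openin (topo X) U" and V: "openin (topo X) V" and W: "openin (topo X) W"
      and VU: "V \<subseteq> U" and WV: "W \<subseteq> V" for U V W n s
  proof -
    have WU: "W \<subseteq> U" using VU WV by blast
    note sV = res_car[OF U V VU s]
    show ?thesis
      using WV by (intro sec_eqI[OF W res_car[OF V W WV sV] res_car[OF U W WU s]])
        (auto simp: ev_res[OF V W WV sV] ev_res[OF U W WU s] ev_res[OF U V VU s])
  qed
  show "\<exists>!t. t \<in> car (sec X (\<Union>\<U>)) n \<and> (\<forall>V\<in>\<U>. res X (\<Union>\<U>) V n t = s V)"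
    if "\<forall>V\<in>\<U>. openin (topo X) V \<and> s V \<in> car (sec X V) n"
      "\<forall>V\<in>\<U>. \<forall>W\<in>\<U>. res X V (V \<inter> W) n (s V) = res X W (V \<inter> W) n (s W)" for \<U> n s
    by (rule sec_glue[OF that])
qed

lemma zopenI:
  assumes "U \<subseteq> pts X"
    and "\<And>x. x \<in> U \<Longrightarrow> \<exists>F. finite F \<and> F \<subseteq> Sigma UNIV (St x) \<and>
      (\<forall>y\<in>pts X. F \<subseteq> Sigma UNIV (St y) \<longrightarrow> y \<in> U)"
  shows "openin (topo X) U"
  using assms unfolding openin_zopen zopen_def by blast

lemma zopenE:
  assumes "openin (topo X) U" "x \<in> U"
  obtains F where "finite F" "F \<subseteq> Sigma UNIV (St x)"
    "\<And>y. y \<in> pts X \<Longrightarrow> F \<subseteq> Sigma UNIV (St y) \<Longrightarrow> y \<in> U"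
proof -
  have "\<exists>F. finite F \<and> F \<subseteq> Sigma UNIV (St x) \<and> (\<forall>y\<in>pts X. F \<subseteq> Sigma UNIV (St y) \<longrightarrow> y \<in> U)"
    using assms unfolding openin_zopen zopen_def by simp
  then show thesis using that by (elim exE conjE) simp
qed

text \<open>The domain of definition of \<open>v\<close>. Finite intersections of such sets form a
  base of the topology.\<close>

lemma openin_dom: "openin (topo X) {x \<in> pts X. v \<in> St x n}"
proof (rule zopenI)
  fix x assume "x \<in> {x \<in> pts X. v \<in> St x n}"
  then show "\<exists>F. finite F \<and> F \<subseteq> Sigma UNIV (St x) \<and>
      (\<forall>y\<in>pts X. F \<subseteq> Sigma UNIV (St y) \<longrightarrow> y \<in> {x \<in> pts X. v \<in> St x n})"
    by (intro exI[of _ "{(n, v)}"]) auto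
qed auto

lemma zspace_open_subspace:
  assumes U: "openin (topo X) U"
  shows "zspace (open_subspace X U) ev St"
proof
  let ?Y = "open_subspace X U"
  have top: "pts ?Y = U" using openin_subset[OF U] by (auto simp: open_subspace_def)
  have op: "openin (topo ?Y) V \<longleftrightarrow> openin (topo X) V \<and> V \<subseteq> U" for V
    using U by (simp add: open_subspace_def openin_open_subtopology)
  have sec: "sec ?Y = sec X" "res ?Y = res X" by (simp_all add: open_subspace_def)
  show "inj_on St (pts ?Y)" using inj_St openin_subset[OF U] top by (auto intro: inj_on_subset)
  show "qlocal (St x)" if "x \<in> pts ?Y" for x
    using that qlocal_St open_sub[OF U] top by auto
  show "qfull \<in> St ` pts ?Y" if "pts ?Y \<noteq> {}"
    using generic_open[OF U] that top by (metis image_eqI)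
  show "openin (topo ?Y) V = zopen (pts ?Y) St V" for V
  proof
    assume V: "openin (topo ?Y) V"
    show "zopen (pts ?Y) St V"
      unfolding zopen_def top
    proof (intro conjI ballI)
      show "V \<subseteq> U" using V op by simp
      fix x assume "x \<in> V"
      then obtain F where "finite F" "F \<subseteq> Sigma UNIV (St x)"
         "\<And>y. y \<in> pts X \<Longrightarrow> F \<subseteq> Sigma UNIV (St y) \<Longrightarrow> y \<in> V"
        using zopenE V op by metis
      then show "\<exists>F. finite F \<and> F \<subseteq> Sigma UNIV (St x) \<and> (\<forall>y\<in>U. F \<subseteq> Sigma UNIV (St y) \<longrightarrow> y \<in> V)"
        using open_sub[OF U] by (intro exI[of _ F]) simp
    qed
  next
    assume V: "zopen (pts ?Y) St V"
    have VU: "V \<subseteq> U" using V top by (simp add: zopen_def)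
    have "openin (topo X) V"
    proof (rule zopenI)
      show "V \<subseteq> pts X" using VU openin_subset[OF U] by blast
      fix x assume x: "x \<in> V"
      obtain F where F: "finite F" "F \<subseteq> Sigma UNIV (St x)" "\<forall>y\<in>U. F \<subseteq> Sigma UNIV (St y) \<longrightarrow> y \<in> V"
        using V x unfolding zopen_def top by blast
      obtain G where G: "finite G" "G \<subseteq> Sigma UNIV (St x)"
         "\<And>y. y \<in> pts X \<Longrightarrow> G \<subseteq> Sigma UNIV (St y) \<Longrightarrow> y \<in> U"
        using zopenE[OF U subsetD[OF VU x]] by metis
      show "\<exists>F. finite F \<and> F \<subseteq> Sigma UNIV (St x) \<and>
          (\<forall>y\<in>pts X. F \<subseteq> Sigma UNIV (St y) \<longrightarrow> y \<in> V)"
        \<comment> \<open>\<open>F\<close> cuts out \<open>V\<close> inside \<open>U\<close>, and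
          \<open>G\<close> keeps the point inside \<open>U\<close>.\<close>
        using F G by (intro exI[of _ "F \<union> G"]) auto
    qed
    then show "openin (topo ?Y) V" using VU op by simp
  qed
  fix W assume W: "openin (topo ?Y) W"
  then have W': "openin (topo X) W" using op by simp
  show "\<exists>v. \<forall>x\<in>W. v \<in> St x n \<and> ev n s x = v" if "s \<in> car (sec ?Y W) n" for s n
    using sec_const[OF W'] that by (simp add: sec)
  show "s = s'" if "s \<in> car (sec ?Y W) n" "s' \<in> car (sec ?Y W) n" "\<And>x. x \<in> W \<Longrightarrow> ev n s x = ev n s' x" for s s' n
    using sec_eqI[OF W' _ _ that(3)] that(1,2) by (simp add: sec)
  show "\<exists>s\<in>car (sec ?Y W) n. \<forall>x\<in>W. ev n s x = v" if "\<And>x. x \<in> W \<Longrightarrow> v \<in> St x n" for v n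
    using sec_ex[OF W' that] by (simp add: sec)
  show "var (sec ?Y W) n i \<in> car (sec ?Y W) n \<and> (\<forall>x\<in>W. ev n (var (sec ?Y W) n i) x = qvar n i)" if "i < n" for n i
    using sec_var[OF W' that] by (simp add: sec)
  show "app (sec ?Y W) n t ss \<in> car (sec ?Y W) n \<and>
      (\<forall>x\<in>W. ev n (app (sec ?Y W) n t ss) x = qlin n (ev (length ss) t x) (map (\<lambda>s. ev n s x) ss))"
    if "t \<in> car (sec ?Y W) (length ss)" "set ss \<subseteq> car (sec ?Y W) n" for n t ss
    using sec_app[OF W'] that by (simp add: sec)
  show "res ?Y W V n s \<in> car (sec ?Y V) n \<and> (\<forall>x\<in>V. ev n (res ?Y W V n s) x = ev n s x)"
    if "openin (topo ?Y) V" "V \<subseteq> W" "s \<in> car (sec ?Y W) n" for V n s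
    using sec_res[OF W' _ that(2)] that by (simp add: sec op)
qed

end

text \<open>Morphisms that leave the rational values of sections unchanged. Between
  \<open>zspace\<close>s, compatibility of \<open>sh\<close> with operations and restrictions is a
  consequence, since sections are determined by their values.\<close>

definition zmor :: "('p, 's) gspace \<Rightarrow> (nat \<Rightarrow> 's \<Rightarrow> 'p \<Rightarrow> rat list) \<Rightarrow>
    ('q, 't) gspace \<Rightarrow> (nat \<Rightarrow> 't \<Rightarrow> 'q \<Rightarrow> rat list) \<Rightarrow> ('p, 's, 'q, 't) gmor \<Rightarrow> bool" where
  "zmor X evX Y evY f \<longleftrightarrow> continuous_map (topo X) (topo Y) (pt f) \<and>
     (\<forall>V n. \<forall>s\<in>car (sec Y V) n. openin (topo Y) V \<longrightarrow>
        sh f V n s \<in> car (sec X (preim X f V)) n \<and>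
        (\<forall>x\<in>preim X f V. evX n (sh f V n s) x = evY n s (pt f x)))"

lemma zmor_cont: "zmor X evX Y evY f \<Longrightarrow> continuous_map (topo X) (topo Y) (pt f)"
  by (simp add: zmor_def)

lemma zmor_pt: "zmor X evX Y evY f \<Longrightarrow> x \<in> pts X \<Longrightarrow> pt f x \<in> pts Y"
  using continuous_map_image_subset_topspace[OF zmor_cont] by blast

lemma zmor_sh: "zmor X evX Y evY f \<Longrightarrow> openin (topo Y) V \<Longrightarrow> s \<in> car (sec Y V) n \<Longrightarrow>
    sh f V n s \<in> car (sec X (preim X f V)) n"
  by (simp add: zmor_def)

lemma zmor_ev: "zmor X evX Y evY f \<Longrightarrow> openin (topo Y) V \<Longrightarrow> s \<in> car (sec Y V) n \<Longrightarrow>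
    x \<in> preim X f V \<Longrightarrow> evX n (sh f V n s) x = evY n s (pt f x)"
  by (simp add: zmor_def)

lemma openin_preim: "continuous_map (topo X) (topo Y) (pt f) \<Longrightarrow> openin (topo Y) V \<Longrightarrow> openin (topo X) (preim X f V)"
  unfolding preim_def by (rule openin_continuous_map_preimage)

lemma zmor_preim: "zmor X evX Y evY f \<Longrightarrow> openin (topo Y) V \<Longrightarrow> openin (topo X) (preim X f V)"
  by (rule openin_preim[OF zmor_cont])

lemma zmor_comp:
  assumes f: "zmor X evX Y evY f" and g: "zmor Y evY Z evZ g"
  shows "zmor X evX Z evZ (comp_mor Y g f)"
  unfolding zmor_def
proof (intro conjI allI ballI impI)
  show "continuous_map (topo X) (topo Z) (pt (comp_mor Y g f))"
    using continuous_map_compose[OF zmor_cont[OF f] zmor_cont[OF g]] by (simp add: comp_mor_def comp_def)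
  fix V n s assume s: "s \<in> car (sec Z V) n" and V: "openin (topo Z) V"
  have pre: "preim X (comp_mor Y g f) V = preim X f (preim Y g V)"
    using zmor_pt[OF f] unfolding preim_def comp_mor_def by auto
  note gV = zmor_preim[OF g V] and gs = zmor_sh[OF g V s]
  show "sh (comp_mor Y g f) V n s \<in> car (sec X (preim X (comp_mor Y g f) V)) n"
    using zmor_sh[OF f gV gs] unfolding pre by (simp add: comp_mor_def)
  fix x assume x: "x \<in> preim X (comp_mor Y g f) V"
  then have "pt f x \<in> preim Y g V" unfolding pre by (simp add: preim_def)
  then show "evX n (sh (comp_mor Y g f) V n s) x = evZ n s (pt (comp_mor Y g f) x)"
    using zmor_ev[OF f gV gs, of x] zmor_ev[OF g V s, of "pt f x"] x pre by (simp add: comp_mor_def)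
qed

lemma zmor_id: "zmor X evX X evX id_mor"
proof -
  have "preim X id_mor V = V" if "openin (topo X) V" for V
    using openin_subset[OF that] by (auto simp: preim_def id_mor_def)
  then show ?thesis by (simp add: zmor_def id_mor_def)
qed

locale zspace_pair = X: zspace X evX StX + Y: zspace Y evY StY
  for X :: "('p, 's) gspace" and evX StX and Y :: "('q, 't) gspace" and evY StY
begin

lemma zmor_space_morphism:
  assumes f: "zmor X evX Y evY f"
  shows "space_morphism X Y f"
  unfolding space_morphism_def
proof (intro conjI allI impI ballI; (elim conjE)?)
  show "continuous_map (topo X) (topo Y) (pt f)" by (rule zmor_cont[OF f])
  note fx = zmor_pt[OF f]
  show "ring_morphism (sec Y V) (sec X (preim X f V)) (sh f V)" if V: "openin (topo Y) V" for V
    unfolding ring_morphism_def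
  proof (intro conjI allI impI ballI; (elim conjE)?)
    note U = zmor_preim[OF f V] and sh = zmor_sh[OF f V] and evs = zmor_ev[OF f V]
    have fV: "pt f x \<in> V" if "x \<in> preim X f V" for x using that by (simp add: preim_def)
    show "sh f V n t \<in> car (sec X (preim X f V)) n" if "t \<in> car (sec Y V) n" for n t by (rule sh[OF that])
    show "sh f V n (var (sec Y V) n i) = var (sec X (preim X f V)) n i" if i: "i < n" for n i
      by (intro X.sec_eqI[OF U sh[OF Y.var_car[OF V i]] X.var_car[OF U i]])
        (simp add: evs[OF Y.var_car[OF V i]] X.ev_var[OF U i] Y.ev_var[OF V i] fV)
    fix n t xs assume t: "t \<in> car (sec Y V) (length xs)" and xs: "set xs \<subseteq> car (sec Y V) n"
    have xs': "set (map (sh f V n) xs) \<subseteq> car (sec X (preim X f V)) n" using sh xs by auto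
    show "sh f V n (app (sec Y V) n t xs) =
        app (sec X (preim X f V)) n (sh f V (length xs) t) (map (sh f V n) xs)"
    proof (rule X.sec_eqI[OF U sh[OF Y.app_car[OF V t refl xs]] X.app_car[OF U sh[OF t] _ xs']])
      fix x assume x: "x \<in> preim X f V"
      have "map (\<lambda>s. evX n s x) (map (sh f V n) xs) = map (\<lambda>s. evY n s (pt f x)) xs"
        using evs[OF _ x] xs by auto
      then show "evX n (sh f V n (app (sec Y V) n t xs)) x =
          evX n (app (sec X (preim X f V)) n (sh f V (length xs) t) (map (sh f V n) xs)) x"
        by (simp add: evs[OF Y.app_car[OF V t refl xs] x] Y.ev_app[OF V t refl xs fV[OF x]]
          X.ev_app[OF U sh[OF t] _ xs' x] evs[OF t x] del: map_map)
    qed simp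
  qed
  fix V W n s assume s: "s \<in> car (sec Y V) n" and V: "openin (topo Y) V" and W: "openin (topo Y) W" and WV: "W \<subseteq> V"
  have sub: "preim X f W \<subseteq> preim X f V" using WV by (auto simp: preim_def)
  note UV = zmor_preim[OF f V] and UW = zmor_preim[OF f W]
  show "sh f W n (res Y V W n s) = res X (preim X f V) (preim X f W) n (sh f V n s)"
  proof (rule X.sec_eqI[OF UW zmor_sh[OF f W Y.res_car[OF V W WV s]] X.res_car[OF UV UW sub zmor_sh[OF f V s]]])
    fix x assume x: "x \<in> preim X f W"
    then have "pt f x \<in> W" "x \<in> preim X f V" using sub by (auto simp: preim_def)
    then show "evX n (sh f W n (res Y V W n s)) x = evX n (res X (preim X f V) (preim X f W) n (sh f V n s)) x"
      by (simp add: zmor_ev[OF f W Y.res_car[OF V W WV s] x] Y.ev_res[OF V W WV s]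
        X.ev_res[OF UV UW sub zmor_sh[OF f V s] x] zmor_ev[OF f V s])
  qed
qed

text \<open>Both pullbacks of a section keep its value, and a section is determined by its value, so
  two such morphisms can differ only on points.\<close>

lemma zmor_eqI:
  assumes f: "zmor X evX Y evY f" and g: "zmor X evX Y evY g"
    and eq: "\<And>x. x \<in> pts X \<Longrightarrow> pt f x = pt g x"
  shows "mor_eq X Y f g"
  unfolding mor_eq_def
proof (intro conjI allI impI ballI)
  fix V n s assume s: "s \<in> car (sec Y V) n" and V: "openin (topo Y) V"
  have pre: "preim X g V = preim X f V" using eq by (auto simp: preim_def)
  have sub: "x \<in> pts X" if "x \<in> preim X f V" for x using that by (simp add: preim_def)
  show "sh f V n s = sh g V n s"
    using zmor_ev[OF f V s] zmor_ev[OF g V s] eq sub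
    by (intro X.sec_eqI[OF zmor_preim[OF f V] zmor_sh[OF f V s] zmor_sh[OF g V s, unfolded pre]])
      (auto simp: pre)
qed (use eq in blast)

text \<open>An element of the local ring at the image point extends to a section over its domain of
  definition; the pullback of this section has the same value at \<open>x\<close>.\<close>

lemma zmor_St:
  assumes f: "zmor X evX Y evY f" and x: "x \<in> pts X"
  shows "StY (pt f x) n \<subseteq> StX x n"
proof
  fix v assume v: "v \<in> StY (pt f x) n"
  let ?V = "{y \<in> pts Y. v \<in> StY y n}"
  note V = Y.openin_dom[of v n]
  obtain s where s: "s \<in> car (sec Y ?V) n" "\<forall>y\<in>?V. evY n s y = v"
    using Y.sec_ex[OF V, of v n] by auto
  have "x \<in> preim X f ?V" using x v zmor_pt[OF f x] by (simp add: preim_def)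
  then have "evX n (sh f ?V n s) x = v" "evX n (sh f ?V n s) x \<in> StX x n"
    using zmor_ev[OF f V s(1)] s(2) zmor_pt[OF f x] v X.ev_St[OF zmor_preim[OF f V] zmor_sh[OF f V s(1)]]
    by auto
  then show "v \<in> StX x n" by simp
qed

text \<open>A converse to \<open>zmor_St\<close>: a section with value \<open>v\<close> has to be
  pulled back to the section with value \<open>v\<close> over the preimage, which exists because
  inclusions of local rings put \<open>v\<close> in every local ring there.\<close>

lemma zmor_ex:
  assumes cont: "continuous_map (topo X) (topo Y) h"
    and sub: "\<And>x n. x \<in> pts X \<Longrightarrow> StY (h x) n \<subseteq> StX x n"
  obtains f where "zmor X evX Y evY f" "pt f = h"
proof -
  let ?P = "\<lambda>V n s s'. s' \<in> car (sec X {x \<in> pts X. h x \<in> V}) n \<and>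
     (\<forall>x\<in>{x \<in> pts X. h x \<in> V}. evX n s' x = evY n s (h x))"
  have ex: "\<exists>s'. ?P V n s s'" if V: "openin (topo Y) V" and s: "s \<in> car (sec Y V) n" for V n s
  proof -
    obtain v where v: "\<forall>y\<in>V. v \<in> StY y n \<and> evY n s y = v" using Y.sec_const[OF V s] by blast
    then show ?thesis
      using X.sec_ex[OF openin_continuous_map_preimage[OF cont V], of v n] sub by force
  qed
  define f where "f = \<lparr>pt = h, sh = (\<lambda>V n s. SOME s'. ?P V n s s')\<rparr>"
  have "zmor X evX Y evY f"
    unfolding zmor_def
  proof (intro conjI allI ballI impI)
    show "continuous_map (topo X) (topo Y) (pt f)" using cont by (simp add: f_def)
    fix V n s assume *: "s \<in> car (sec Y V) n" "openin (topo Y) V"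
    have "?P V n s (sh f V n s)" using someI_ex[OF ex[OF *(2,1)]] by (simp add: f_def)
    then show "sh f V n s \<in> car (sec X (preim X f V)) n"
      "\<And>x. x \<in> preim X f V \<Longrightarrow> evX n (sh f V n s) x = evY n s (pt f x)"
      by (simp_all add: preim_def f_def)
  qed
  then show ?thesis using that by (simp add: f_def)
qed

text \<open>Openness is expressed by local rings alone, so a finite set that witnesses openness of
  \<open>V\<close> at \<open>h x\<close> also witnesses openness of the preimage at
  \<open>x\<close>.\<close>

lemma stalk_map_continuous:
  assumes h: "\<And>x. x \<in> pts X \<Longrightarrow> h x \<in> pts Y \<and> StY (h x) = StX x"
  shows "continuous_map (topo X) (topo Y) h"
  unfolding continuous_map
proof (intro conjI allI impI)
  show "h ` pts X \<subseteq> pts Y" using h by blast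
  fix V assume V: "openin (topo Y) V"
  show "openin (topo X) {x \<in> pts X. h x \<in> V}"
  proof (rule X.zopenI)
    fix x assume x: "x \<in> {x \<in> pts X. h x \<in> V}"
    obtain F where F: "finite F" "F \<subseteq> Sigma UNIV (StY (h x))"
      "\<And>y. y \<in> pts Y \<Longrightarrow> F \<subseteq> Sigma UNIV (StY y) \<Longrightarrow> y \<in> V"
      using Y.zopenE[OF V] x by blast
    then show "\<exists>F. finite F \<and> F \<subseteq> Sigma UNIV (StX x) \<and> (\<forall>y\<in>pts X.
        F \<subseteq> Sigma UNIV (StX y) \<longrightarrow> y \<in> {x \<in> pts X. h x \<in> V})"
      using x h by (intro exI[of _ F]) auto
  qed blast
qed

lemma stalk_map_ex:
  assumes "StX ` pts X \<subseteq> StY ` pts Y"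
  obtains f where "zmor X evX Y evY f" "\<And>x. x \<in> pts X \<Longrightarrow> StY (pt f x) = StX x"
proof -
  define h where "h x = (SOME y. y \<in> pts Y \<and> StY y = StX x)" for x
  have h: "h x \<in> pts Y \<and> StY (h x) = StX x" if "x \<in> pts X" for x
  proof -
    have "\<exists>y. y \<in> pts Y \<and> StY y = StX x"
    proof -
      have "StX x \<in> StY ` pts Y" using assms that by blast
      then show ?thesis by force
    qed
    then show ?thesis unfolding h_def by (rule someI_ex)
  qed
  then show ?thesis using zmor_ex[OF stalk_map_continuous[of h]] that by (metis subset_refl)
qed

lemma zmor_restrict:
  assumes f: "zmor X evX Y evY f" and U: "openin (topo X) U" and V: "openin (topo Y) V" and fU: "pt f ` U \<subseteq> V"
  shows "zmor (open_subspace X U) evX (open_subspace Y V) evY (restrict_mor X f U)"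
  unfolding zmor_def
proof (intro conjI allI ballI impI)
  show "continuous_map (topo (open_subspace X U)) (topo (open_subspace Y V)) (pt (restrict_mor X f U))"
    using zmor_cont[OF f] fU
    by (auto simp: open_subspace_def restrict_mor_def continuous_map_in_subtopology
      intro: continuous_map_from_subtopology)
  fix W n s assume s: "s \<in> car (sec (open_subspace Y V) W) n" and "openin (topo (open_subspace Y V)) W"
  then have W: "openin (topo Y) W" and s: "s \<in> car (sec Y W) n"
    using V by (auto simp: open_subspace_def openin_open_subtopology)
  have pre: "preim (open_subspace X U) (restrict_mor X f U) W = U \<inter> preim X f W"
    by (auto simp: preim_def open_subspace_def restrict_mor_def)
  note P = zmor_preim[OF f W]
  have UP: "openin (topo X) (U \<inter> preim X f W)" using U P by blast
  show "sh (restrict_mor X f U) W n s \<in> car (sec (open_subspace X U) (preim (open_subspace X U) (restrict_mor X f U) W)) n"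
    unfolding pre using X.res_car[OF P UP _ zmor_sh[OF f W s]] by (simp add: open_subspace_def restrict_mor_def)
  fix x assume "x \<in> preim (open_subspace X U) (restrict_mor X f U) W"
  then have x: "x \<in> U \<inter> preim X f W" unfolding pre .
  then show "evX n (sh (restrict_mor X f U) W n s) x = evY n s (pt (restrict_mor X f U) x)"
    using X.ev_res[OF P UP _ zmor_sh[OF f W s] x] zmor_ev[OF f W s, of x] by (simp add: restrict_mor_def)
qed

text \<open>The composite preserves local rings, and these determine the points.\<close>

lemma stalk_maps_inverse:
  assumes f: "zmor X evX Y evY f" "\<And>x. x \<in> pts X \<Longrightarrow> StY (pt f x) = StX x"
    and g: "zmor Y evY X evX g" "\<And>y. y \<in> pts Y \<Longrightarrow> StX (pt g y) = StY y"
  shows "mor_eq X X (comp_mor Y g f) id_mor"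
proof -
  interpret XX: zspace_pair X evX StX X evX StX by unfold_locales
  show ?thesis
  proof (rule XX.zmor_eqI[OF zmor_comp[OF f(1) g(1)] zmor_id])
    fix x assume x: "x \<in> pts X"
    have "pt g (pt f x) = x"
      using inj_onD[OF X.inj_St, of "pt g (pt f x)" x] g(2)[OF zmor_pt[OF f(1) x]] f(2)[OF x]
        zmor_pt[OF g(1) zmor_pt[OF f(1) x]] x by simp
    then show "pt (comp_mor Y g f) x = pt id_mor x" by (simp add: comp_mor_def id_mor_def)
  qed
qed

end

lemma (in zspace_pair) zmor_space_iso:
  assumes f: "zmor X evX Y evY f" and St: "\<And>x. x \<in> pts X \<Longrightarrow> StY (pt f x) = StX x"
    and sub: "StY ` pts Y \<subseteq> StX ` pts X"
  shows "space_iso X Y f"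
proof -
  interpret YX: zspace_pair Y evY StY X evX StX by unfold_locales
  obtain g where g: "zmor Y evY X evX g" "\<And>y. y \<in> pts Y \<Longrightarrow> StX (pt g y) = StY y"
    using YX.stalk_map_ex[OF sub] by blast
  have "mor_eq X X (comp_mor Y g f) id_mor" by (rule stalk_maps_inverse[OF f St g])
  moreover have "mor_eq Y Y (comp_mor X f g) id_mor" by (rule YX.stalk_maps_inverse[OF g f St])
  ultimately show ?thesis
    unfolding space_iso_def using zmor_space_morphism[OF f] YX.zmor_space_morphism[OF g(1)] by blast
qed

section \<open>Spectra of submonads of the rational numbers\<close>

declare One_nat_def [simp del]

text \<open>The value of a germ is computed from an arbitrary representative \<open>(x, s)\<close>
  as the rational vector \<open>x/s\<close>; that the choice does not matter is the content of
  \<open>fractions_some\<close>.\<close>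

definition spec_ev :: "(nat \<Rightarrow> 'a \<Rightarrow> rat list) \<Rightarrow> nat \<Rightarrow> ('a set \<Rightarrow> ('a \<times> 'a) set) \<Rightarrow> 'a set \<Rightarrow> rat list" where
  "spec_ev val n s P = (let z = SOME z. z \<in> s P in qscale (inverse (hd (val 1 (snd z)))) (val n (fst z)))"

definition spec_St :: "(nat \<Rightarrow> 'a \<Rightarrow> rat list) \<Rightarrow> (nat \<Rightarrow> rat list set) \<Rightarrow> 'a set \<Rightarrow> nat \<Rightarrow> rat list set" where
  "spec_St val C P = qstalk C ((\<lambda>a. hd (val 1 a)) ` P)"

lemma topology_base:
  assumes "\<And>S T. Q S \<Longrightarrow> Q T \<Longrightarrow> Q (S \<inter> T)"
  shows "openin (topology (arbitrary union_of Q)) U \<longleftrightarrow> (\<forall>x\<in>U. \<exists>V. Q V \<and> x \<in> V \<and> V \<subseteq> U)"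
proof -
  have "istopology (arbitrary union_of Q)"
    unfolding istopology_base_eq using assms by (simp add: arbitrary_union_of_inc)
  then show ?thesis by (simp add: arbitrary_union_of_alt)
qed

text \<open>An isomorphism, through \<open>val\<close>, of \<open>A\<close> with a submonad
  \<open>C\<close> of \<open>\<Sigma>_\<rat>\<close>. The elements of \<open>A\<close> themselves
  can be of any kind, for instance classes of fractions in a homogeneous localization.\<close>

locale qring =
  fixes A :: "'a monad" and val :: "nat \<Rightarrow> 'a \<Rightarrow> rat list" and C :: "nat \<Rightarrow> rat list set"
  assumes C: "qmonad C"
    and bij: "bij_betw (val n) (car A n) (C n)"
    and car_var: "i < n \<Longrightarrow> var A n i \<in> car A n"
    and val_var: "i < n \<Longrightarrow> val n (var A n i) = qvar n i"
    and car_app': "t \<in> car A (length xs) \<Longrightarrow> set xs \<subseteq> car A n \<Longrightarrow> app A n t xs \<in> car A n"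
    and val_app': "t \<in> car A (length xs) \<Longrightarrow> set xs \<subseteq> car A n \<Longrightarrow>
          val n (app A n t xs) = qlin n (val (length xs) t) (map (val n) xs)"
begin

lemma val_C: "x \<in> car A n \<Longrightarrow> val n x \<in> C n"
  using bij bij_betwE by blast

lemma val_inj: "x \<in> car A n \<Longrightarrow> y \<in> car A n \<Longrightarrow> val n x = val n y \<Longrightarrow> x = y"
  using bij by (meson bij_betw_imp_inj_on inj_onD)

lemma val_surj: "v \<in> C n \<Longrightarrow> \<exists>x\<in>car A n. val n x = v"
  using bij by (metis bij_betw_imp_surj_on imageE)

lemma length_val: "x \<in> car A n \<Longrightarrow> length (val n x) = n"
  using val_C qmonad_length[OF C] by blast

lemma car_app: "t \<in> car A k \<Longrightarrow> length xs = k \<Longrightarrow> set xs \<subseteq> car A n \<Longrightarrow> app A n t xs \<in> car A n"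
  using car_app' by blast

lemma val_app: "t \<in> car A k \<Longrightarrow> length xs = k \<Longrightarrow> set xs \<subseteq> car A n \<Longrightarrow>
          val n (app A n t xs) = qlin n (val k t) (map (val n) xs)"
  using val_app' by blast

lemma generalized_ring: "generalized_ring A"
  by (rule generalized_ring_separated[where U = "UNIV :: unit set" and e = "\<lambda>_. val"])
    (auto intro: car_var val_var car_app val_app length_val val_inj)

abbreviation num :: "'a \<Rightarrow> rat" where
  "num a \<equiv> hd (val 1 a)"

abbreviation St :: "'a set \<Rightarrow> nat \<Rightarrow> rat list set" where
  "St \<equiv> spec_St val C"

lemma val_num: "a \<in> car A 1 \<Longrightarrow> val 1 a = [num a]"
  using length_val[of a 1] by (cases "val 1 a") auto

lemma num_qnum: "a \<in> car A 1 \<Longrightarrow> num a \<in> qnum C"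
  using val_C[of a 1] val_num by (simp add: qnum_def)

lemma num_inj: "a \<in> car A 1 \<Longrightarrow> b \<in> car A 1 \<Longrightarrow> num a = num b \<Longrightarrow> a = b"
  using val_inj[of a 1 b] val_num[of a] val_num[of b] by simp

lemma num_surj: "r \<in> qnum C \<Longrightarrow> \<exists>a\<in>car A 1. num a = r"
  using val_surj[of "[r]" 1] unfolding qnum_def by force

lemma munit: "munit A \<in> car A 1" "num (munit A) = 1"
  using car_var[of 0 1] val_var[of 0 1] by (simp_all add: munit_def qvar_def One_nat_def)

lemma mscale: "a \<in> car A 1 \<Longrightarrow> x \<in> car A n \<Longrightarrow> mscale A n a x \<in> car A n"
  "a \<in> car A 1 \<Longrightarrow> x \<in> car A n \<Longrightarrow> val n (mscale A n a x) = qscale (num a) (val n x)"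
  using car_app[of a 1 "[x]" n] val_app[of a 1 "[x]" n] val_num[of a] qlin_single[OF length_val[of x n], of "num a"]
  by (simp_all add: mscale_def)

lemma num_mscale: "a \<in> car A 1 \<Longrightarrow> b \<in> car A 1 \<Longrightarrow> num (mscale A 1 a b) = num a * num b"
  using mscale(2)[of a b 1] val_num[of b] by (metis list.sel(1) qscale_single)

lemma mem_image_num: "P \<subseteq> car A 1 \<Longrightarrow> a \<in> car A 1 \<Longrightarrow> num a \<in> num ` P \<longleftrightarrow> a \<in> P"
  using num_inj by (auto simp: subset_iff)

lemma prime_subset: "P \<in> prime_ideals A \<Longrightarrow> P \<subseteq> car A 1"
  by (simp add: prime_ideals_def prime_ideal_def submodule_def free_module_def)

lemma mem_prime: "P \<in> prime_ideals A \<Longrightarrow> a \<in> car A 1 \<Longrightarrow> num a \<in> num ` P \<longleftrightarrow> a \<in> P"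
  using mem_image_num prime_subset by blast

lemma val_app_1:
  assumes "t \<in> car A (length as)" "set as \<subseteq> car A 1"
  shows "num (app A 1 t as) = (\<Sum>i<length as. val (length as) t ! i * map num as ! i)"
proof -
  have "val 1 (app A 1 t as) = qlin 1 (val (length as) t) (map (val 1) as)"
    by (rule val_app'[OF assms])
  also have "\<dots> = [\<Sum>i<length as. val (length as) t ! i * map num as ! i]"
  proof -
    have "val 1 (as ! i) ! 0 = num (as ! i)" if "i < length as" for i
      using val_num[of "as ! i"] assms(2) that by (metis nth_Cons_0 nth_mem subset_iff)
    then show ?thesis by (simp add: qlin_def upt_rec[of 0 1])
  qed
  finally show ?thesis by simp
qed

lemma prime_qprime:
  assumes P: "P \<in> prime_ideals A"
  shows "qprime C (num ` P)"
  unfolding qprime_def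
proof (intro conjI allI impI ballI)
  note sub = prime_subset[OF P]
  show "num ` P \<subseteq> qnum C" using sub num_qnum by auto
  have P': "app A 1 t as \<in> P" if "t \<in> car A (length as)" "set as \<subseteq> P" for t as
    using P that by (auto simp: prime_ideals_def prime_ideal_def submodule_def free_module_def)
  have sm: "submonoid A (car A 1 - P)" using P by (simp add: prime_ideals_def prime_ideal_def)
  { fix t rs assume *: "t \<in> C (length rs) \<and> set rs \<subseteq> num ` P"
    then obtain a where a: "a \<in> car A (length rs)" "val (length rs) a = t" using val_surj by blast
    have "\<exists>as. set as \<subseteq> P \<and> rs = map num as"
    proof -
      have "rs \<in> map num ` lists P" using * by (auto simp: lists_image[symmetric])
      then show ?thesis by auto
    qed
    then obtain as where as: "set as \<subseteq> P" "rs = map num as" by blast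
    have "num (app A 1 a as) = (\<Sum>i<length rs. t ! i * rs ! i)"
      using val_app_1[of a as] a as sub by auto
    then show "(\<Sum>i<length rs. t ! i * rs ! i) \<in> num ` P"
      using P'[of a as] a as by (metis imageI length_map) }
  show "1 \<notin> num ` P" using sm mem_prime[OF P munit(1)] munit(2) by (simp add: submonoid_def)
  fix r s assume "r \<in> qnum C - num ` P" "s \<in> qnum C - num ` P"
  then obtain a b where ab: "a \<in> car A 1" "b \<in> car A 1" "num a = r" "num b = s" using num_surj by (metis DiffD1)
  then have "a \<notin> P" "b \<notin> P" using \<open>r \<in> _\<close> \<open>s \<in> _\<close> by auto
  then have "mscale A 1 a b \<in> car A 1 - P" using sm ab unfolding submonoid_def by blast
  then show "r * s \<notin> num ` P" using mem_prime[OF P, of "mscale A 1 a b"] num_mscale ab by auto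
qed

lemma qprime_prime:
  assumes p: "qprime C p"
  shows "{a \<in> car A 1. num a \<in> p} \<in> prime_ideals A" and "num ` {a \<in> car A 1. num a \<in> p} = p"
proof -
  let ?P = "{a \<in> car A 1. num a \<in> p}"
  have "submodule A (free_module A 1) ?P"
    unfolding submodule_def free_module_def
  proof (intro conjI allI impI; simp only: gr_module.simps)
    fix t as assume *: "t \<in> car A (length as) \<and> set as \<subseteq> ?P"
    then have sub: "set as \<subseteq> car A 1" by auto
    have "(\<Sum>i<length (map num as). val (length as) t ! i * map num as ! i) \<in> p"
      using * val_C by (intro qprime_sum[OF C p]) auto
    then show "app A 1 t as \<in> ?P" using val_app_1[of t as] car_app'[of t as 1] * sub by auto
  qed auto
  moreover have "submonoid A (car A 1 - ?P)"
    unfolding submonoid_def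
    using munit mscale(1)[of _ _ 1] qprime_one[OF C p] qprime_mult[OF C p] num_mscale num_qnum by auto
  ultimately show "?P \<in> prime_ideals A" by (simp add: prime_ideals_def prime_ideal_def)
  show "num ` ?P = p" using num_surj qprime_subset[OF C p] by force
qed

lemma St_stalks: "St ` prime_ideals A = stalks C"
proof
  show "St ` prime_ideals A \<subseteq> stalks C" using prime_qprime by (auto simp: spec_St_def stalks_def)
  show "stalks C \<subseteq> St ` prime_ideals A"
  proof
    fix L assume "L \<in> stalks C"
    then obtain p where p: "qprime C p" "L = qstalk C p" by (auto simp: stalks_def)
    then have "L = St {a \<in> car A 1. num a \<in> p}" using qprime_prime(2)[OF p(1)] by (simp add: spec_St_def)
    then show "L \<in> St ` prime_ideals A" using qprime_prime(1)[OF p(1)] by blast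
  qed
qed

text \<open>Recovers a point from its local ring, whence the injectivity of
  \<open>St\<close>.\<close>

lemma prime_eq_St:
  assumes P: "P \<in> prime_ideals A"
  shows "P = {a \<in> car A 1. num a \<notin> qunits (St P)}"
proof -
  have "num ` P = qnum C - qunits (St P)"
    unfolding spec_St_def by (rule qprime_eq_center[OF C prime_qprime[OF P]])
  then show ?thesis using mem_prime[OF P] prime_subset[OF P] num_qnum by blast
qed

lemma St_inj: "inj_on St (prime_ideals A)"
proof (rule inj_onI)
  fix P Q assume "P \<in> prime_ideals A" "Q \<in> prime_ideals A" "St P = St Q"
  then show "P = Q" using prime_eq_St[of P] prime_eq_St[of Q] by simp
qed

lemma basic_open_iff: "g \<in> car A 1 \<Longrightarrow> P \<in> basic_open A g \<longleftrightarrow> P \<in> prime_ideals A \<and> num g \<in> qnum C - num ` P"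
  using mem_prime num_qnum by (auto simp: basic_open_def)

lemma basic_open_mscale:
  assumes "f \<in> car A 1" "g \<in> car A 1"
  shows "basic_open A (mscale A 1 f g) = basic_open A f \<inter> basic_open A g"
proof -
  have "P \<in> basic_open A (mscale A 1 f g) \<longleftrightarrow> P \<in> basic_open A f \<inter> basic_open A g" if P: "P \<in> prime_ideals A" for P
  proof -
    note p = prime_qprime[OF P]
    show ?thesis
      unfolding Int_iff basic_open_iff[OF assms(1)] basic_open_iff[OF assms(2)]
        basic_open_iff[OF mscale(1)[OF assms]] num_mscale[OF assms]
      using P qprime_mult[OF C p, of "num f" "num g"] qprime_absorb[OF C p, of "num f" "num g"]
        qprime_absorb[OF C p, of "num g" "num f"] num_qnum assms by (auto simp: mult.commute)
  qed
  then show ?thesis by (auto simp: basic_open_def)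
qed

section \<open>Topology of the spectrum\<close>

lemma openin_spec:
  "openin (spec_topology A) U \<longleftrightarrow> U \<subseteq> prime_ideals A \<and> (\<forall>P\<in>U. \<exists>g\<in>car A 1. P \<in> basic_open A g \<and> basic_open A g \<subseteq> U)"
proof -
  have "openin (spec_topology A) U \<longleftrightarrow> (\<forall>P\<in>U. \<exists>V. (\<exists>f\<in>car A 1. V = basic_open A f) \<and> P \<in> V \<and> V \<subseteq> U)"
    unfolding spec_topology_def by (rule topology_base) (metis basic_open_mscale mscale(1))
  also have "\<dots> \<longleftrightarrow> (\<forall>P\<in>U. P \<in> prime_ideals A \<and> (\<exists>g\<in>car A 1. P \<in> basic_open A g \<and> basic_open A g \<subseteq> U))"
  proof -
    have "basic_open A f \<subseteq> prime_ideals A" for f by (auto simp: basic_open_def)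
    then show ?thesis by (intro ball_cong refl) blast
  qed
  finally show ?thesis by blast
qed

lemma openin_primes: "openin (spec_topology A) (prime_ideals A)"
  unfolding openin_spec
proof (intro conjI ballI bexI[of _ "munit A"])
  fix P assume P: "P \<in> prime_ideals A"
  then show "P \<in> basic_open A (munit A)"
    using qprime_one[OF C prime_qprime[OF P]] munit by (simp add: basic_open_iff)
qed (auto simp: basic_open_def munit)

lemma topspace_spec: "topspace (spec_topology A) = prime_ideals A"
  using openin_primes openin_spec by (metis openin_subset openin_topspace subset_antisym)

text \<open>For nonzero \<open>g\<close>, \<open>D(g)\<close> consists of the primes whose local
  ring contains \<open>1/g\<close>. Conversely, if \<open>v\<close> has denominator \<open>s\<close>
  at a point, then all local rings at points of \<open>D(s)\<close> contain
  \<open>v\<close>.\<close>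

lemma openin_spec_zopen: "openin (spec_topology A) U \<longleftrightarrow> zopen (prime_ideals A) St U"
proof
  assume U: "openin (spec_topology A) U"
  show "zopen (prime_ideals A) St U"
    unfolding zopen_def
  proof (intro conjI ballI)
    show "U \<subseteq> prime_ideals A" using U openin_spec by simp
    fix P assume P: "P \<in> U"
    then obtain g where g: "g \<in> car A 1" "P \<in> basic_open A g" "basic_open A g \<subseteq> U" using U openin_spec by blast
    have PP: "P \<in> prime_ideals A" using g by (simp add: basic_open_def)
    note p = prime_qprime[OF PP]
    have gn: "num g \<in> qnum C - num ` P" using g basic_open_iff by simp
    then have g0: "num g \<noteq> 0" using qprime_nonzero[OF C p] by blast
    have 1: "[inverse (num g)] \<in> St P 1"
      unfolding spec_St_def qstalk_iff[OF C p] using gn g0 qnum_one[OF C]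
      by (intro bexI[of _ "num g"]) (auto simp: qnum_def)
    have 2: "Q \<in> U" if Q: "Q \<in> prime_ideals A" "[inverse (num g)] \<in> St Q 1" for Q
    proof -
      note q = prime_qprime[OF Q(1)]
      have "num g \<in> qunits (St Q)"
        using Q(2) g0 gn subset_qstalk[OF C q, of 1] by (auto simp: qunits_def qnum_def spec_St_def)
      then have "g \<notin> Q" using prime_eq_St[OF Q(1)] by blast
      then show ?thesis using g Q by (auto simp: basic_open_def)
    qed
    show "\<exists>F. finite F \<and> F \<subseteq> Sigma UNIV (St P) \<and>
        (\<forall>Q\<in>prime_ideals A. F \<subseteq> Sigma UNIV (St Q) \<longrightarrow> Q \<in> U)"
      using 1 2 by (intro exI[of _ "{(1, [inverse (num g)])}"]) auto
  qed
next
  assume U: "zopen (prime_ideals A) St U"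
  show "openin (spec_topology A) U"
    unfolding openin_spec
  proof (intro conjI ballI)
    show sub: "U \<subseteq> prime_ideals A" using U by (simp add: zopen_def)
    fix P assume P: "P \<in> U"
    then obtain F where F: "finite F" "F \<subseteq> Sigma UNIV (St P)"
        "\<forall>Q\<in>prime_ideals A. F \<subseteq> Sigma UNIV (St Q) \<longrightarrow> Q \<in> U"
      using U unfolding zopen_def by blast
    have PP: "P \<in> prime_ideals A" using P sub by blast
    note p = prime_qprime[OF PP]
    have "\<exists>g\<in>car A 1. P \<in> basic_open A g \<and> (\<forall>Q\<in>basic_open A g. F \<subseteq> Sigma UNIV (St Q))"
      using F(1,2)
    proof (induction F)
      case empty
      then show ?case
        using munit PP qprime_one[OF C p] by (intro bexI[of _ "munit A"]) (auto simp: basic_open_iff)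
    next
      case (insert w F)
      then obtain g where g: "g \<in> car A 1" "P \<in> basic_open A g" "\<forall>Q\<in>basic_open A g. F \<subseteq> Sigma UNIV (St Q)" by auto
      obtain n v where w: "w = (n, v)" by force
      then obtain s where s: "s \<in> qnum C - num ` P" "qscale s v \<in> C n"
        using insert.prems unfolding spec_St_def by (auto simp: qstalk_iff[OF C p])
      then obtain h where h: "h \<in> car A 1" "num h = s" using num_surj by blast
      have "v \<in> St Q n" if "Q \<in> basic_open A h" for Q
        using that h s prime_qprime[of Q] by (auto simp: basic_open_iff spec_St_def qstalk_iff[OF C])
      moreover have "P \<in> basic_open A h" using h s PP by (auto simp: basic_open_iff)
      \<comment> \<open>The product of the denominators handles all elements of the finite set at
        once.\<close>
      ultimately show ?case
        using g h w by (intro bexI[of _ "mscale A 1 g h"]) (auto simp: basic_open_mscale mscale)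
    qed
    then show "\<exists>g\<in>car A 1. P \<in> basic_open A g \<and> basic_open A g \<subseteq> U"
      using F(3) by (metis (no_types, lifting) basic_open_def mem_Collect_eq subsetI)
  qed
qed

section \<open>Stalks and sections of the structure sheaf\<close>

definition fraction :: "nat \<Rightarrow> 'a \<Rightarrow> 'a \<Rightarrow> rat list" where
  "fraction n y t = qscale (inverse (num t)) (val n y)"

definition fractions :: "'a set \<Rightarrow> nat \<Rightarrow> rat list \<Rightarrow> ('a \<times> 'a) set" where
  "fractions P n v = {(y, t). y \<in> car A n \<and> t \<in> car A 1 - P \<and> fraction n y t = v}"

context
  fixes P assumes P: "P \<in> prime_ideals A"
begin

lemma num_outside: "t \<in> car A 1 - P \<Longrightarrow> num t \<in> qnum C - num ` P" "t \<in> car A 1 - P \<Longrightarrow> num t \<noteq> 0"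
  using num_qnum mem_prime[OF P] qprime_nonzero[OF C prime_qprime[OF P]] by auto

lemma munit_outside: "munit A \<in> car A 1 - P"
  using P by (simp add: prime_ideals_def prime_ideal_def submonoid_def)

lemma mscale_outside: "s \<in> car A 1 - P \<Longrightarrow> t \<in> car A 1 - P \<Longrightarrow> mscale A 1 s t \<in> car A 1 - P"
  using P by (auto simp: prime_ideals_def prime_ideal_def submonoid_def)

lemma fraction_St: "y \<in> car A n \<Longrightarrow> t \<in> car A 1 - P \<Longrightarrow> fraction n y t \<in> St P n"
  unfolding fraction_def spec_St_def
  by (rule qstalk_mem[OF C prime_qprime[OF P]]) (use val_C num_outside in auto)

lemma St_fraction: "v \<in> St P n \<Longrightarrow> \<exists>y t. y \<in> car A n \<and> t \<in> car A 1 - P \<and> fraction n y t = v"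
proof -
  assume "v \<in> St P n"
  then obtain x s where "v = qscale (inverse s) x" "x \<in> C n" "s \<in> qnum C - num ` P"
    by (auto simp: spec_St_def qstalk_def)
  moreover obtain y where "y \<in> car A n" "val n y = x" using val_surj \<open>x \<in> C n\<close> by blast
  moreover obtain t where "t \<in> car A 1" "num t = s" using num_surj \<open>s \<in> _\<close> by blast
  ultimately show ?thesis unfolding fraction_def by blast
qed

text \<open>Elements outside \<open>P\<close> have nonzero value and can be cancelled, so the class
  of a fraction consists of all fractions with the same rational value.\<close>

lemma germ_fractions:
  assumes x: "x \<in> car A n" and s: "s \<in> car A 1 - P"
  shows "germ A P n x s = fractions P n (fraction n x s)"
proof -
  have "(\<exists>u\<in>car A 1 - P. mscale A n u (mscale A n t x) = mscale A n u (mscale A n s y)) \<longleftrightarrow>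
      fraction n y t = fraction n x s" if y: "y \<in> car A n" and t: "t \<in> car A 1 - P" for y t
  proof -
    have car: "mscale A n t x \<in> car A n" "mscale A n s y \<in> car A n" using mscale x y s t by auto
    have eq: "mscale A n u (mscale A n t x) = mscale A n u (mscale A n s y) \<longleftrightarrow>
        qscale (num u * num t) (val n x) = qscale (num u * num s) (val n y)" if u: "u \<in> car A 1 - P" for u
    proof -
      have "mscale A n u (mscale A n t x) \<in> car A n" "mscale A n u (mscale A n s y) \<in> car A n"
        "val n (mscale A n u (mscale A n t x)) = qscale (num u * num t) (val n x)"
        "val n (mscale A n u (mscale A n s y)) = qscale (num u * num s) (val n y)"
        using u s t x y car mscale[of u] mscale(2)[of t x n] mscale(2)[of s y n] by simp_all
      then show ?thesis using val_inj by metis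
    qed
    have "qscale (num u * num t) (val n x) = qscale (num u * num s) (val n y) \<longleftrightarrow> fraction n y t = fraction n x s"
      if u: "u \<in> car A 1 - P" for u
    proof
      assume "qscale (num u * num t) (val n x) = qscale (num u * num s) (val n y)"
      then have "qscale (inverse (num u * num t * num s)) (qscale (num u * num t) (val n x)) =
          qscale (inverse (num u * num t * num s)) (qscale (num u * num s) (val n y))" by simp
      then show "fraction n y t = fraction n x s"
        unfolding fraction_def using num_outside(2)[OF u] num_outside(2)[OF s] num_outside(2)[OF t]
        by (simp add: field_simps)
    next
      assume "fraction n y t = fraction n x s"
      then have "qscale (num u * num t * num s) (fraction n y t) = qscale (num u * num t * num s) (fraction n x s)" by simp
      then show "qscale (num u * num t) (val n x) = qscale (num u * num s) (val n y)"
        unfolding fraction_def using num_outside(2)[OF u] num_outside(2)[OF s] num_outside(2)[OF t]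
        by (simp add: field_simps)
    qed
    then show ?thesis using eq munit_outside by blast
  qed
  then show ?thesis unfolding lfrac_def fractions_def by auto
qed

lemma fractions_inj: "v \<in> St P n \<Longrightarrow> fractions P n v = fractions P n w \<Longrightarrow> v = w"
  using St_fraction[of v n] unfolding fractions_def by blast

lemma fractions_some: "v \<in> St P n \<Longrightarrow> s P = fractions P n v \<Longrightarrow> spec_ev val n s P = v"
proof -
  assume v: "v \<in> St P n" and s: "s P = fractions P n v"
  have "\<exists>z. z \<in> s P" using St_fraction[OF v] unfolding s fractions_def by blast
  then have "(SOME z. z \<in> s P) \<in> fractions P n v" using someI_ex[of "\<lambda>z. z \<in> s P"] s by simp
  then obtain y t where "(SOME z. z \<in> s P) = (y, t)" "fraction n y t = v" unfolding fractions_def by auto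
  then show ?thesis by (simp add: spec_ev_def fraction_def)
qed

lemma car_stalk: "car (stalk A P) n = fractions P n ` St P n"
proof (intro equalityI subsetI)
  fix c assume "c \<in> car (stalk A P) n"
  then obtain x s where "x \<in> car A n" "s \<in> car A 1 - P" "c = germ A P n x s"
    by (auto simp: localization_def)
  then show "c \<in> fractions P n ` St P n" using germ_fractions fraction_St by blast
next
  fix c assume "c \<in> fractions P n ` St P n"
  then obtain v where v: "v \<in> St P n" "c = fractions P n v" by blast
  then obtain x s where "x \<in> car A n" "s \<in> car A 1 - P" "fraction n x s = v" using St_fraction by blast
  then have "c = germ A P n x s \<and> x \<in> car A n \<and> s \<in> car A 1 - P" using germ_fractions v by simp
  then show "c \<in> car (stalk A P) n" unfolding localization_def by auto
qed

lemma var_stalk: "i < n \<Longrightarrow> var (stalk A P) n i = fractions P n (qvar n i)"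
  unfolding localization_def using germ_fractions[OF car_var[of i n] munit_outside] val_var[of i n] munit
  by (simp add: fraction_def)

text \<open>Substitution in a localization is a choice, so two things are shown: every admissible
  representation by numerators and denominators leads to the same value, and one exists, because the
  arguments have a common denominator.\<close>

lemma app_stalk:
  assumes t: "t \<in> St P (length vs)" and vs: "set vs \<subseteq> St P n"
  shows "app (stalk A P) n (fractions P (length vs) t) (map (fractions P n) vs) = fractions P n (qlin n t vs)"
proof -
  let ?c = "fractions P (length vs) t" and ?cs = "map (fractions P n) vs" and ?S = "car A 1 - P"
  let ?R = "\<lambda>c'. \<exists>a s bs d. a \<in> car A (length ?cs) \<and> s \<in> ?S \<and> set bs \<subseteq> car A n \<and> d \<in> ?S \<and>
         ?c = germ A P (length ?cs) a s \<and> ?cs = map (\<lambda>b. germ A P n b d) bs \<and>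
         c' = germ A P n (app A n a bs) (mscale A 1 s d)"
  have val: "germ A P n (app A n a bs) (mscale A 1 s d) = fractions P n (qlin n (fraction (length bs) a s) (map (\<lambda>b. fraction n b d) bs))"
    if a: "a \<in> car A (length bs)" and s: "s \<in> ?S" and bs: "set bs \<subseteq> car A n" and d: "d \<in> ?S" for a s bs d
  proof -
    have "qlin n (fraction (length bs) a s) (map (\<lambda>b. fraction n b d) bs) =
       qlin n (qscale (inverse (num s)) (val (length bs) a)) (map (qscale (inverse (num d))) (map (val n) bs))"
      by (simp add: fraction_def comp_def)
    also have "\<dots> = qscale (inverse (num s) * inverse (num d)) (qlin n (val (length bs) a) (map (val n) bs))"
      using a bs length_val by (intro qlin_qscale) auto
    finally have "fraction n (app A n a bs) (mscale A 1 s d) =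
        qlin n (fraction (length bs) a s) (map (\<lambda>b. fraction n b d) bs)"
      using val_app'[OF a bs] num_mscale[of s d] s d by (simp add: fraction_def)
    then show ?thesis using germ_fractions[OF car_app'[OF a bs] mscale_outside[OF s d]] by simp
  qed
  have uniq: "c' = fractions P n (qlin n t vs)" if "?R c'" for c'
  proof -
    obtain a s bs d where *: "a \<in> car A (length vs)" "s \<in> ?S" "set bs \<subseteq> car A n" "d \<in> ?S"
         "?c = germ A P (length vs) a s" "?cs = map (\<lambda>b. germ A P n b d) bs"
         "c' = germ A P n (app A n a bs) (mscale A 1 s d)"
      using \<open>?R c'\<close> by auto
    have l: "length bs = length vs" using arg_cong[OF *(6), of length] by simp
    have t_eq: "t = fraction (length vs) a s"
      using fractions_inj[OF t] germ_fractions[OF *(1,2)] *(5) by simp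
    have vs_eq: "vs = map (\<lambda>b. fraction n b d) bs"
    proof (rule nth_equalityI)
      fix i assume i: "i < length vs"
      then have "fractions P n (vs ! i) = germ A P n (bs ! i) d"
        using arg_cong[OF *(6), of "\<lambda>xs. xs ! i"] l by simp
      also have "\<dots> = fractions P n (fraction n (bs ! i) d)"
        using *(3,4) i l by (intro germ_fractions) auto
      finally have "vs ! i = fraction n (bs ! i) d"
        by (rule fractions_inj[OF subsetD[OF vs nth_mem[OF i]]])
      then show "vs ! i = map (\<lambda>b. fraction n b d) bs ! i" using i l by simp
    qed (simp add: l)
    have "a \<in> car A (length bs)" using *(1) l by simp
    then show ?thesis
      unfolding arg_cong2[OF t_eq vs_eq, of "qlin n"] *(7) using val[OF _ *(2,3,4), of a] l by simp
  qed
  have "\<exists>c'. ?R c'"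
  proof -
    obtain a s where as: "a \<in> car A (length vs)" "s \<in> ?S" "fraction (length vs) a s = t"
      using St_fraction[OF t] by blast
    obtain r where r: "r \<in> qnum C - num ` P" "\<forall>v\<in>set vs. qscale r v \<in> C n"
      using common_denominator[OF C prime_qprime[OF P]] vs unfolding spec_St_def by blast
    then obtain d where d: "d \<in> car A 1" "num d = r" using num_surj by blast
    then have dS: "d \<in> ?S" using r by auto
    define b where "b v = (SOME y. y \<in> car A n \<and> val n y = qscale r v)" for v
    have b: "b v \<in> car A n \<and> val n (b v) = qscale r v" if "v \<in> set vs" for v
    proof -
      have "\<exists>y. y \<in> car A n \<and> val n y = qscale r v" using val_surj r that by blast
      then show ?thesis unfolding b_def by (rule someI_ex)
    qed
    have "fractions P n v = germ A P n (b v) d" if "v \<in> set vs" for v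
      using germ_fractions[of "b v" n d] b[OF that] dS num_outside(2)[OF dS] d by (simp add: fraction_def)
    then have "?cs = map (\<lambda>y. germ A P n y d) (map b vs)" by simp
    moreover have "?c = germ A P (length vs) a s" using germ_fractions[OF as(1,2)] as(3) by simp
    moreover have "set (map b vs) \<subseteq> car A n" using b by auto
    ultimately show ?thesis using as dS by (metis length_map)
  qed
  then have "?R (SOME c'. ?R c')" by (rule someI_ex)
  then have "(SOME c'. ?R c') = fractions P n (qlin n t vs)" by (rule uniq)
  then show ?thesis unfolding localization_def by simp
qed

end

definition gsec :: "'a set set \<Rightarrow> nat \<Rightarrow> rat list \<Rightarrow> 'a set \<Rightarrow> ('a \<times> 'a) set" where
  "gsec U n v = (\<lambda>P\<in>U. fractions P n v)"

lemma spec_ev_gsec: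
  "U \<subseteq> prime_ideals A \<Longrightarrow> P \<in> U \<Longrightarrow> v \<in> St P n \<Longrightarrow> spec_ev val n (gsec U n v) P = v"
  by (rule fractions_some) (auto simp: gsec_def)

lemma mpow: "g \<in> car A 1 \<Longrightarrow> mpow A g k \<in> car A 1"
  by (induction k) (auto simp: munit mscale)

lemma num_mpow: "g \<in> car A 1 \<Longrightarrow> num (mpow A g k) = num g ^ k"
  using munit(2) num_mscale mpow by (induction k) auto

text \<open>The generic point of \<open>Spec A\<close>, at which the values of sections are compared
  below.\<close>

lemma zero_prime: "{a \<in> car A 1. num a = 0} \<in> prime_ideals A"
proof -
  have "qprime C {0}"
    unfolding qprime_def using qnum_zero[OF C]
    by (auto intro!: sum.neutral) (metis nth_mem singletonD subsetD)
  from qprime_prime(1)[OF this] show ?thesis by simp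
qed

text \<open>Near each point a section is a fraction \<open>x/g^k\<close> over some
  \<open>D(g)\<close>, and a nonempty \<open>D(g)\<close> contains the zero ideal. All these
  fractions thus have the value of the section at the zero ideal.\<close>

lemma spec_sections_eq:
  assumes U: "openin (spec_topology A) U"
  shows "spec_sections A U n = {gsec U n v | v. \<forall>P\<in>U. v \<in> St P n}"
proof (intro equalityI subsetI)
  have sub: "U \<subseteq> prime_ideals A" using U openin_spec by blast
  fix s assume s: "s \<in> {gsec U n v | v. \<forall>P\<in>U. v \<in> St P n}"
  then obtain v where v: "s = gsec U n v" "\<forall>P\<in>U. v \<in> St P n" by blast
  show "s \<in> spec_sections A U n"
    unfolding spec_sections_def
  proof (intro CollectI conjI ballI)
    show "s \<in> (\<Pi>\<^sub>E P\<in>U. car (stalk A P) n)"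
      using v sub by (auto simp: gsec_def car_stalk)
    fix P assume P: "P \<in> U"
    then have PP: "P \<in> prime_ideals A" using sub by blast
    obtain x t where xt: "x \<in> car A n" "t \<in> car A 1 - P" "fraction n x t = v"
      using St_fraction[OF PP, of v n] v P by blast
    obtain h where h: "h \<in> car A 1" "P \<in> basic_open A h" "basic_open A h \<subseteq> U"
      using U P unfolding openin_spec by blast
    \<comment> \<open>For a denominator \<open>t\<close> of \<open>v\<close> the set
      \<open>D(t)\<close> may leave \<open>U\<close>; multiplying by \<open>h\<close> confines it to
      \<open>U\<close>, and \<open>v = h x / (h t)\<close> has the required form with exponent
      \<open>1\<close>.\<close>
    let ?g = "mscale A 1 h t"
    have g: "?g \<in> car A 1" "basic_open A ?g = basic_open A h \<inter> basic_open A t"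
      using h xt mscale basic_open_mscale by auto
    have "P \<in> basic_open A ?g" using g h xt PP by (simp add: basic_open_def)
    have "s Q = germ A Q n (mscale A n h x) (mpow A ?g 1)" if Q: "Q \<in> basic_open A ?g" for Q
    proof -
      have QQ: "Q \<in> prime_ideals A" "Q \<in> U" "h \<in> car A 1 - Q" "t \<in> car A 1 - Q"
        using Q g h xt by (auto simp: basic_open_def)
      have "mpow A ?g 1 = mscale A 1 ?g (munit A)" by (simp add: One_nat_def)
      then have m: "mpow A ?g 1 \<in> car A 1 - Q"
        using mscale_outside[OF QQ(1) mscale_outside[OF QQ(1,3,4)] munit_outside[OF QQ(1)]] by simp
      have nm: "num (mpow A ?g 1) = num h * num t"
        using num_mpow[OF g(1), of 1] num_mscale[of h t] QQ by simp
      have "fraction n (mscale A n h x) (mpow A ?g 1) = v"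
        using xt nm mscale(2)[of h x n] QQ num_outside(2)[OF QQ(1,3)]
        unfolding fraction_def by (simp add: field_simps)
      then show ?thesis
        using germ_fractions[OF QQ(1) mscale(1)[OF h(1) xt(1)] m] v QQ by (simp add: gsec_def)
    qed
    then have "\<exists>x\<in>car A n. \<exists>k. \<forall>Q\<in>basic_open A ?g. s Q = germ A Q n x (mpow A ?g k)"
      using mscale(1)[OF h(1) xt(1)] by blast
    moreover have "?g \<notin> P" using \<open>P \<in> basic_open A ?g\<close> by (simp add: basic_open_def)
    moreover have "basic_open A ?g \<subseteq> U" using g(2) h(3) by blast
    ultimately show "\<exists>g\<in>car A 1. g \<notin> P \<and> basic_open A g \<subseteq> U \<and>
       (\<exists>x\<in>car A n. \<exists>k. \<forall>Q\<in>basic_open A g. s Q = germ A Q n x (mpow A g k))"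
      using g(1) by blast
  qed
next
  have sub: "U \<subseteq> prime_ideals A" using U openin_spec by blast
  fix s assume s: "s \<in> spec_sections A U n"
  let ?z = "{a \<in> car A 1. num a = 0}"
  have loc: "\<exists>v. v \<in> St P n \<and> s P = fractions P n v \<and> ?z \<in> U \<and> s ?z = fractions ?z n v \<and> v \<in> St ?z n"
    if P: "P \<in> U" for P
  proof -
    have PP: "P \<in> prime_ideals A" using P sub by blast
    have "\<exists>g\<in>car A 1. g \<notin> P \<and> basic_open A g \<subseteq> U \<and>
       (\<exists>x\<in>car A n. \<exists>k. \<forall>Q\<in>basic_open A g. s Q = germ A Q n x (mpow A g k))"
      using s P by (simp add: spec_sections_def)
    then obtain g where g1: "g \<in> car A 1" and "g \<notin> P \<and> basic_open A g \<subseteq> U \<and>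
       (\<exists>x\<in>car A n. \<exists>k. \<forall>Q\<in>basic_open A g. s Q = germ A Q n x (mpow A g k))"
      by (rule bexE)
    then obtain x k where g: "g \<in> car A 1" "g \<notin> P" "basic_open A g \<subseteq> U" "x \<in> car A n"
      "\<forall>Q\<in>basic_open A g. s Q = germ A Q n x (mpow A g k)"
      using that g1 by (elim conjE bexE exE)
    have *: "s Q = fractions Q n (fraction n x (mpow A g k)) \<and> fraction n x (mpow A g k) \<in> St Q n"
      if Q: "Q \<in> basic_open A g" for Q
    proof -
      have QQ: "Q \<in> prime_ideals A" "g \<in> car A 1 - Q" using Q g by (auto simp: basic_open_def)
      have "mpow A g k \<in> car A 1 - Q"
        using QQ mscale_outside munit_outside by (induction k) auto
      then show ?thesis using g(5) Q germ_fractions[OF QQ(1) g(4)] fraction_St[OF QQ(1) g(4)] by simp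
    qed
    have "num g \<noteq> 0" using num_outside(2)[OF PP, of g] g by blast
    then have "?z \<in> basic_open A g" using zero_prime by (simp add: basic_open_def)
    moreover have "P \<in> basic_open A g" using PP g by (simp add: basic_open_def)
    ultimately show ?thesis using * g(3) by blast
  qed
  have ext: "s \<in> extensional U" using s by (simp add: spec_sections_def PiE_def)
  show "s \<in> {gsec U n v | v. \<forall>P\<in>U. v \<in> St P n}"
  proof (cases "U = {}")
    case True
    then show ?thesis using ext by (auto simp: gsec_def restrict_def)
  next
    case False
    then obtain P where "P \<in> U" by blast
    then obtain v where v: "s ?z = fractions ?z n v" "v \<in> St ?z n" using loc by blast
    have "s Q = fractions Q n v \<and> v \<in> St Q n" if Q: "Q \<in> U" for Q
    proof -
      obtain w where w: "w \<in> St Q n" "s Q = fractions Q n w" "s ?z = fractions ?z n w" using loc[OF Q] by blast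
      have "v = w" by (rule fractions_inj[OF zero_prime v(2)]) (use v w in simp)
      then show ?thesis using w by simp
    qed
    then have "s = gsec U n v" "\<forall>P\<in>U. v \<in> St P n"
      using ext by (auto simp: gsec_def extensional_def fun_eq_iff)
    then show ?thesis by blast
  qed
qed

lemma spec_sec:
  assumes "openin (topo (Spec A)) U"
  shows "car (sec (Spec A) U) n = {gsec U n v | v. \<forall>P\<in>U. v \<in> St P n}"
  using spec_sections_eq[of U n] assms by (simp add: Spec_def)

lemma topspace_Spec [simp]: "pts (Spec A) = prime_ideals A"
  by (simp add: Spec_def topspace_spec)

lemma zspace_Spec: "zspace (Spec A) (spec_ev val) St"
proof
  have op: "openin (topo (Spec A)) = openin (spec_topology A)" by (simp add: Spec_def)
  show "inj_on St (pts (Spec A))" by (simp add: St_inj)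
  show "qlocal (St x)" if "x \<in> pts (Spec A)" for x
    using that St_stalks stalks_qlocal[OF C] by auto
  show "qfull \<in> St ` pts (Spec A)" using qfull_in_stalks[OF C] St_stalks by simp
  show "openin (topo (Spec A)) U = zopen (pts (Spec A)) St U" for U
    by (simp add: op openin_spec_zopen)
  fix U assume U: "openin (topo (Spec A)) U"
  have sub: "U \<subseteq> prime_ideals A" using U op openin_spec by simp
  note sec = spec_sec[OF U] and ev = spec_ev_gsec[OF sub]
  show "\<exists>v. \<forall>x\<in>U. v \<in> St x n \<and> spec_ev val n s x = v" if "s \<in> car (sec (Spec A) U) n" for s n
    using that ev unfolding sec by blast
  show "s = s'" if "s \<in> car (sec (Spec A) U) n" "s' \<in> car (sec (Spec A) U) n"
    "\<And>x. x \<in> U \<Longrightarrow> spec_ev val n s x = spec_ev val n s' x" for s s' n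
  proof -
    note mem = that(1,2) and eq = that(3)
    obtain v w where vw: "s = gsec U n v" "\<forall>P\<in>U. v \<in> St P n" "s' = gsec U n w" "\<forall>P\<in>U. w \<in> St P n"
      using mem unfolding sec by blast
    then have "v = w" if "P \<in> U" for P
      using eq[OF that] ev[OF that] that by simp
    then show ?thesis using vw by (cases "U = {}") (auto simp: gsec_def)
  qed
  show "\<exists>s\<in>car (sec (Spec A) U) n. \<forall>x\<in>U. spec_ev val n s x = v" if "\<And>x. x \<in> U \<Longrightarrow> v \<in> St x n" for v n
    using that ev unfolding sec by (intro bexI[of _ "gsec U n v"]) auto
  have loc: "qmonad (St P)" if "P \<in> U" for P
    using that sub stalks_qlocal[OF C] St_stalks qlocal_qmonad by blast
  show "var (sec (Spec A) U) n i \<in> car (sec (Spec A) U) n \<and>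
      (\<forall>x\<in>U. spec_ev val n (var (sec (Spec A) U) n i) x = qvar n i)" if i: "i < n" for n i
  proof -
    have "var (sec (Spec A) U) n i = gsec U n (qvar n i)"
      using sub var_stalk[OF _ i] by (auto simp: Spec_def gsec_def fun_eq_iff)
    then show ?thesis using ev qmonad_var[OF loc i] unfolding sec by auto
  qed
  show "app (sec (Spec A) U) n t ss \<in> car (sec (Spec A) U) n \<and> (\<forall>x\<in>U. spec_ev val n (app (sec (Spec A) U) n t ss) x =
      qlin n (spec_ev val (length ss) t x) (map (\<lambda>s. spec_ev val n s x) ss))"
    if t: "t \<in> car (sec (Spec A) U) (length ss)" and ss: "set ss \<subseteq> car (sec (Spec A) U) n" for n t ss
  proof -
    obtain w where w: "t = gsec U (length ss) w" "\<forall>P\<in>U. w \<in> St P (length ss)" using t unfolding sec by blast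
    have "\<exists>vs. ss = map (gsec U n) vs \<and> set vs \<subseteq> {v. \<forall>P\<in>U. v \<in> St P n}"
    proof -
      have "set ss \<subseteq> gsec U n ` {v. \<forall>P\<in>U. v \<in> St P n}" using ss unfolding sec by auto
      then have "ss \<in> map (gsec U n) ` lists {v. \<forall>P\<in>U. v \<in> St P n}" by (auto simp: lists_image[symmetric])
      then show ?thesis by auto
    qed
    then obtain vs where vs: "ss = map (gsec U n) vs" "set vs \<subseteq> {v. \<forall>P\<in>U. v \<in> St P n}" by blast
    have app: "app (sec (Spec A) U) n t ss = gsec U n (qlin n w vs)"
    proof
      fix P show "app (sec (Spec A) U) n t ss P = gsec U n (qlin n w vs) P"
      proof (cases "P \<in> U")
        case True
        then have "map (\<lambda>x. x P) ss = map (fractions P n) vs" by (simp add: vs(1) gsec_def comp_def)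
        moreover have "t P = fractions P (length vs) w" using True w(1) vs(1) by (simp add: gsec_def)
        ultimately have "app (sec (Spec A) U) n t ss P = app (stalk A P) n (fractions P (length vs) w) (map (fractions P n) vs)"
          using True by (simp add: Spec_def)
        also have "\<dots> = fractions P n (qlin n w vs)"
          using True w vs sub by (intro app_stalk) auto
        finally show ?thesis using True by (simp add: gsec_def)
      qed (simp add: Spec_def gsec_def)
    qed
    have St: "qlin n w vs \<in> St P n" if "P \<in> U" for P
      using w vs that by (intro qmonad_lin[OF loc[OF that], of _ "length ss"]) auto
    have "map (\<lambda>s. spec_ev val n s P) ss = vs" if "P \<in> U" for P
      using ev[OF that] vs that by (auto simp: comp_def intro!: map_idI)
    then show ?thesis using app ev St w unfolding sec by auto
  qed
  show "res (Spec A) U V n s \<in> car (sec (Spec A) V) n \<and> (\<forall>x\<in>V. spec_ev val n (res (Spec A) U V n s) x = spec_ev val n s x)"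
    if V: "openin (topo (Spec A)) V" and VU: "V \<subseteq> U" and s: "s \<in> car (sec (Spec A) U) n" for V n s
  proof -
    obtain v where v: "s = gsec U n v" "\<forall>P\<in>U. v \<in> St P n" using s unfolding sec by blast
    then have "res (Spec A) U V n s = gsec V n v" using VU by (auto simp: Spec_def gsec_def fun_eq_iff restrict_def)
    moreover have "spec_ev val n (gsec V n v) P = spec_ev val n (gsec U n v) P" if "P \<in> V" for P
      using spec_ev_gsec[of V P v n] ev[of P v n] v VU sub that by (simp add: subset_iff)
    ultimately show ?thesis using v VU unfolding spec_sec[OF V] by auto
  qed
qed

lemma global_section_gsec: "a \<in> car A n \<Longrightarrow> global_section A n a = gsec (prime_ideals A) n (val n a)"
  unfolding global_section_def gsec_def
  using germ_fractions[OF _ _ munit_outside] munit by (auto simp: fraction_def fun_eq_iff restrict_def)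

lemma val_St: "a \<in> car A n \<Longrightarrow> P \<in> prime_ideals A \<Longrightarrow> val n a \<in> St P n"
  using subset_qstalk[OF C prime_qprime] val_C unfolding spec_St_def by blast

lemma global_section:
  assumes a: "a \<in> car A n"
  shows "global_section A n a \<in> car (sec (Spec A) (prime_ideals A)) n"
    and "P \<in> prime_ideals A \<Longrightarrow> spec_ev val n (global_section A n a) P = val n a"
proof -
  have op: "openin (topo (Spec A)) (prime_ideals A)" by (simp add: Spec_def openin_primes)
  show "global_section A n a \<in> car (sec (Spec A) (prime_ideals A)) n"
    unfolding spec_sec[OF op] global_section_gsec[OF a] using val_St[OF a] by blast
  show "P \<in> prime_ideals A \<Longrightarrow> spec_ev val n (global_section A n a) P = val n a"
    unfolding global_section_gsec[OF a] using val_St[OF a] spec_ev_gsec by blast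
qed

end

text \<open>For the charts of \<open>Proj\<close> given by a positive element equal to
  \<open>0\<close>. Without points the choice of \<open>val\<close> and \<open>C\<close> is
  immaterial.\<close>

lemma zspace_Spec_empty:
  assumes "prime_ideals A = {}"
  shows "zspace (Spec A) (spec_ev val) (spec_St val C)"
    and "pts (Spec A) = {}"
proof -
  have "openin (spec_topology A) U \<longleftrightarrow> (\<forall>P\<in>U. \<exists>V. (\<exists>f\<in>car A 1. V = basic_open A f) \<and> P \<in> V \<and> V \<subseteq> U)" for U
    unfolding spec_topology_def by (rule topology_base) (use assms in \<open>auto simp: basic_open_def\<close>)
  then have op: "openin (topo (Spec A)) U \<longleftrightarrow> U = {}" for U
    using assms by (auto simp: basic_open_def Spec_def)
  then show top: "pts (Spec A) = {}" by (metis openin_topspace)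
  have sec: "car (sec (Spec A) {}) n = {\<lambda>_. undefined}" for n
    by (auto simp: Spec_def spec_sections_def)
  show "zspace (Spec A) (spec_ev val) (spec_St val C)"
    by unfold_locales (auto simp: op top sec zopen_def, auto simp: Spec_def)
qed

text \<open>Preserving values means that \<open>\<phi>\<close> is the inclusion of \<open>C\<close>
  in \<open>D\<close>, seen through the two encodings.\<close>

locale qring_mor = A: qring A valA C + B: qring B valB D
  for A :: "'a monad" and valA C and B :: "'b monad" and valB D +
  fixes \<phi> :: "nat \<Rightarrow> 'a \<Rightarrow> 'b"
  assumes \<phi>_car: "x \<in> car A n \<Longrightarrow> \<phi> n x \<in> car B n"
    and \<phi>_val: "x \<in> car A n \<Longrightarrow> valB n (\<phi> n x) = valA n x"
begin

lemma C_subset_D: "C n \<subseteq> D n"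
  using A.val_surj B.val_C \<phi>_car \<phi>_val by (metis subsetI)

lemma ring_morphism: "ring_morphism A B \<phi>"
  unfolding ring_morphism_def
proof (intro conjI allI impI ballI; (elim conjE)?)
  show "\<phi> n t \<in> car B n" if "t \<in> car A n" for n t by (rule \<phi>_car[OF that])
  show "\<phi> n (var A n i) = var B n i" if i: "i < n" for n i
    using A.car_var[OF i] A.val_var[OF i] B.val_var[OF i] \<phi>_val
    by (intro B.val_inj[OF \<phi>_car B.car_var[OF i]]) auto
  fix n t xs assume t: "t \<in> car A (length xs)" and xs: "set xs \<subseteq> car A n"
  have sub: "set (map (\<phi> n) xs) \<subseteq> car B n" using xs \<phi>_car by auto
  have "map (valB n) (map (\<phi> n) xs) = map (valA n) xs" using xs \<phi>_val by auto
  then show "\<phi> n (app A n t xs) = app B n (\<phi> (length xs) t) (map (\<phi> n) xs)"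
    using A.val_app'[OF t xs] \<phi>_val[OF A.car_app'[OF t xs]] B.val_app[OF \<phi>_car[OF t] _ sub] \<phi>_val[OF t]
    by (intro B.val_inj[OF \<phi>_car[OF A.car_app'[OF t xs]] B.car_app[OF \<phi>_car[OF t] _ sub]]) (simp_all del: map_map)
qed

abbreviation f where "f \<equiv> pt (Spec_mor A B \<phi>)"

lemma num_\<phi>: "a \<in> car A 1 \<Longrightarrow> B.num (\<phi> 1 a) = A.num a"
  using \<phi>_val[of a 1] by simp

lemma f_eq: "P \<in> prime_ideals B \<Longrightarrow> f P = {a \<in> car A 1. A.num a \<in> qnum C - qunits (B.St P)}"
proof -
  assume P: "P \<in> prime_ideals B"
  have "\<phi> 1 a \<in> P \<longleftrightarrow> A.num a \<notin> qunits (B.St P)" if "a \<in> car A 1" for a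
    using \<phi>_car[OF that] num_\<phi>[OF that] arg_cong[OF B.prime_eq_St[OF P], of "\<lambda>P. \<phi> 1 a \<in> P"] by simp
  then show ?thesis using A.num_qnum by (auto simp: Spec_mor_def)
qed

lemma f_prime:
  assumes P: "P \<in> prime_ideals B"
  shows "f P \<in> prime_ideals A" and "A.St (f P) = qstalk C (qnum C - qunits (B.St P))"
proof -
  have "B.St P \<in> stalks D" using P B.St_stalks by blast
  then have "qprime C (qnum C - qunits (B.St P))"
    using C_subset_D stalks_superset[OF B.C] by (intro qlocal_center_qprime stalks_qlocal[OF B.C] A.C) blast+
  from A.qprime_prime[OF this] show "f P \<in> prime_ideals A" "A.St (f P) = qstalk C (qnum C - qunits (B.St P))"
    unfolding f_eq[OF P] by (simp_all add: spec_St_def)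
qed

text \<open>In general the local ring at \<open>f P\<close> is the localization of \<open>C\<close>
  at the center of the local ring at \<open>P\<close>. If the latter already is a local ring of
  \<open>C\<close>, it coincides with that localization.\<close>

lemma St_f: "P \<in> prime_ideals B \<Longrightarrow> B.St P \<in> stalks C \<Longrightarrow> A.St (f P) = B.St P"
  using f_prime(2) stalks_eq_center[OF A.C] by simp

lemma zmor_Spec_mor: "zmor (Spec B) (spec_ev valB) (Spec A) (spec_ev valA) (Spec_mor A B \<phi>)"
  unfolding zmor_def
proof (intro conjI allI ballI impI)
  interpret SA: zspace "Spec A" "spec_ev valA" A.St by (rule A.zspace_Spec)
  interpret SB: zspace "Spec B" "spec_ev valB" B.St by (rule B.zspace_Spec)
  have f_mem: "a \<in> f P \<longleftrightarrow> \<phi> 1 a \<in> P" if "a \<in> car A 1" for a P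
    using that by (simp add: Spec_mor_def)
  show cont: "continuous_map (topo (Spec B)) (topo (Spec A)) f"
    unfolding continuous_map
  proof (intro conjI allI impI)
    show "f ` pts (Spec B) \<subseteq> pts (Spec A)" using f_prime by auto
    fix V assume V: "openin (topo (Spec A)) V"
    have "openin (spec_topology B) {P \<in> prime_ideals B. f P \<in> V}"
      unfolding B.openin_spec
    proof (intro conjI ballI)
      fix P assume P: "P \<in> {P \<in> prime_ideals B. f P \<in> V}"
      then obtain g where g: "g \<in> car A 1" "f P \<in> basic_open A g" "basic_open A g \<subseteq> V"
        using V by (auto simp: Spec_def A.openin_spec)
      have "P \<in> basic_open B (\<phi> 1 g)" using g P f_mem by (auto simp: basic_open_def)
      moreover have "basic_open B (\<phi> 1 g) \<subseteq> {P \<in> prime_ideals B. f P \<in> V}"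
        using g f_mem f_prime(1) by (auto simp: basic_open_def)
      ultimately show "\<exists>h\<in>car B 1. P \<in> basic_open B h \<and> basic_open B h \<subseteq> {P \<in> prime_ideals B. f P \<in> V}"
        using \<phi>_car[OF g(1)] by blast
    qed blast
    then show "openin (topo (Spec B)) {x \<in> pts (Spec B). f x \<in> V}" by (simp add: Spec_def B.topspace_spec)
  qed
  fix V n s assume s: "s \<in> car (sec (Spec A) V) n" and V: "openin (topo (Spec A)) V"
  let ?W = "preim (Spec B) (Spec_mor A B \<phi>) V"
  have W: "?W = {P \<in> prime_ideals B. f P \<in> V}" by (simp add: preim_def)
  have oW: "openin (topo (Spec B)) ?W" by (rule openin_preim[OF cont V])
  obtain v where v: "s = A.gsec V n v" "\<forall>P\<in>V. v \<in> A.St P n" using s unfolding A.spec_sec[OF V] by blast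
  have loc: "localization_map B (car B 1 - P) \<phi> n (s (f P)) = B.fractions P n v \<and> v \<in> B.St P n" if P: "P \<in> ?W" for P
  proof -
    have PP: "P \<in> prime_ideals B" "f P \<in> V" using P W by auto
    have sf: "s (f P) = A.fractions (f P) n v" using v PP by (simp add: A.gsec_def)
    have "\<exists>z. z \<in> s (f P)"
      using A.St_fraction[OF f_prime(1)[OF PP(1)], of v n] v PP unfolding sf A.fractions_def by blast
    then have "(SOME z. z \<in> s (f P)) \<in> A.fractions (f P) n v" unfolding sf by (rule someI_ex)
    then obtain y t where z: "(SOME z. z \<in> s (f P)) = (y, t)" and yt: "y \<in> car A n" "t \<in> car A 1 - f P" "A.fraction n y t = v"
      unfolding A.fractions_def by auto
    have t: "\<phi> 1 t \<in> car B 1 - P" using yt f_mem \<phi>_car by auto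
    have fr: "B.fraction n (\<phi> n y) (\<phi> 1 t) = v"
      using yt num_\<phi> \<phi>_val by (simp add: A.fraction_def B.fraction_def)
    show ?thesis
      using B.germ_fractions[OF PP(1) \<phi>_car[OF yt(1)] t] B.fraction_St[OF PP(1) \<phi>_car[OF yt(1)] t] fr z
      by (simp add: localization_map_def)
  qed
  have eq: "sh (Spec_mor A B \<phi>) V n s = B.gsec ?W n v"
    using loc unfolding W by (auto simp: Spec_mor_def Let_def B.gsec_def fun_eq_iff restrict_def)
  show "sh (Spec_mor A B \<phi>) V n s \<in> car (sec (Spec B) ?W) n"
    unfolding B.spec_sec[OF oW] eq using loc by blast
  fix P assume P: "P \<in> ?W"
  have "spec_ev valB n (B.gsec ?W n v) P = v"
    using loc P by (intro B.spec_ev_gsec) (auto simp: W)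
  moreover have "spec_ev valA n s (f P) = v"
    using P v openin_subset[OF V] unfolding v(1) by (intro A.spec_ev_gsec) (auto simp: W)
  ultimately show "spec_ev valB n (sh (Spec_mor A B \<phi>) V n s) P = spec_ev valA n s (f P)" by (simp add: eq)
qed

end

text \<open>For the overlaps of \<open>Proj\<close> in which one of the two elements is
  \<open>0\<close>.\<close>

lemma Spec_mor_empty:
  assumes "prime_ideals B = {}"
  shows "sh (Spec_mor A B \<phi>) V n s \<in> car (sec (Spec B) (preim (Spec B) (Spec_mor A B \<phi>) V)) n"
    and "preim (Spec B) (Spec_mor A B \<phi>) V = {}"
proof -
  show *: "preim (Spec B) (Spec_mor A B \<phi>) V = {}"
    using zspace_Spec_empty(2)[OF assms] by (simp add: preim_def)
  show "sh (Spec_mor A B \<phi>) V n s \<in> car (sec (Spec B) (preim (Spec B) (Spec_mor A B \<phi>) V)) n"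
    unfolding * using assms by (auto simp: Spec_mor_def Let_def Spec_def spec_sections_def)
qed

section \<open>Affine charts and gluing\<close>

text \<open>The notions of scheme and of scheme morphism ask for rings whose elements have the type
  of sections; \<open>C\<close> is copied into this type along an injection
  \<open>\<iota>\<close>.\<close>

definition transport_monad :: "(rat list \<Rightarrow> 's) \<Rightarrow> (nat \<Rightarrow> rat list set) \<Rightarrow> 's monad" where
  "transport_monad \<iota> C =
     \<lparr>car = (\<lambda>n. \<iota> ` C n), var = (\<lambda>n i. \<iota> (qvar n i)),
      app = (\<lambda>n t xs. \<iota> (qlin n (inv \<iota> t) (map (inv \<iota>) xs)))\<rparr>"

lemma qring_transport:
  assumes "inj \<iota>" and C: "qmonad C"
  shows "qring (transport_monad \<iota> C) (\<lambda>_. inv \<iota>) C"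
proof
  show "qmonad C" by (rule C)
  show "bij_betw (inv \<iota>) (car (transport_monad \<iota> C) n) (C n)" for n
    using assms(1) by (intro bij_betwI[of _ _ _ \<iota>]) (auto simp: transport_monad_def)
  show "app (transport_monad \<iota> C) n t xs \<in> car (transport_monad \<iota> C) n"
    if "t \<in> car (transport_monad \<iota> C) (length xs)" "set xs \<subseteq> car (transport_monad \<iota> C) n" for n t xs
    using that assms(1) qmonad_lin[OF C, of "inv \<iota> t" "length xs" "map (inv \<iota>) xs" n]
    by (force simp: transport_monad_def)
qed (use assms qmonad_var in \<open>auto simp: transport_monad_def\<close>)

context zspace
begin

definition chart_dom :: "(nat \<Rightarrow> rat list set) \<Rightarrow> 'p set" where
  "chart_dom C = {x \<in> pts X. St x \<in> stalks C}"

text \<open>What makes the points with a local ring of \<open>C\<close> an open copy of the spectrum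
  of \<open>C\<close>.\<close>

definition chart :: "(nat \<Rightarrow> rat list set) \<Rightarrow> bool" where
  "chart C \<longleftrightarrow> qmonad C \<and> openin (topo X) (chart_dom C) \<and> stalks C \<subseteq> St ` pts X"

lemma chart_iso:
  assumes C: "chart C" and A: "qring A val C"
  obtains \<alpha> where "zmor (open_subspace X (chart_dom C)) ev (Spec A) (spec_ev val) \<alpha>"
    "space_iso (open_subspace X (chart_dom C)) (Spec A) \<alpha>"
    "\<And>x. x \<in> chart_dom C \<Longrightarrow> spec_St val C (pt \<alpha> x) = St x"
proof -
  let ?U = "chart_dom C"
  interpret A: qring A val C by (rule A)
  have U: "openin (topo X) ?U" using C by (simp add: chart_def)
  interpret U: zspace "open_subspace X ?U" ev St by (rule zspace_open_subspace[OF U])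
  interpret S: zspace "Spec A" "spec_ev val" A.St by (rule A.zspace_Spec)
  interpret P: zspace_pair "open_subspace X ?U" ev St "Spec A" "spec_ev val" A.St by unfold_locales
  have top: "pts (open_subspace X ?U) = ?U"
    using openin_subset[OF U] by (auto simp: open_subspace_def)
  have img: "St ` pts (open_subspace X ?U) = A.St ` pts (Spec A)"
    unfolding top A.topspace_Spec A.St_stalks using C by (auto simp: chart_dom_def chart_def)
  then obtain \<alpha> where \<alpha>: "zmor (open_subspace X ?U) ev (Spec A) (spec_ev val) \<alpha>"
      "\<And>x. x \<in> pts (open_subspace X ?U) \<Longrightarrow> A.St (pt \<alpha> x) = St x"
    using P.stalk_map_ex by (metis subset_refl)
  show thesis
    using that[OF \<alpha>(1) P.zmor_space_iso[OF \<alpha>]] \<alpha>(2) img top by blast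
qed

lemma generalized_scheme:
  fixes \<iota> :: "rat list \<Rightarrow> 's"
  assumes "inj \<iota>" and ch: "\<And>x. x \<in> pts X \<Longrightarrow> \<exists>C. chart C \<and> x \<in> chart_dom C"
  shows "generalized_scheme X"
  unfolding generalized_scheme_def
proof (intro conjI ballI)
  show "ringed_space X" by (rule ringed_space)
  fix x assume "x \<in> pts X"
  then obtain C where C: "chart C" "x \<in> chart_dom C" using ch by blast
  then have A: "qring (transport_monad \<iota> C) (\<lambda>_. inv \<iota>) C"
    using qring_transport[OF assms(1)] by (simp add: chart_def)
  obtain \<alpha> where "space_iso (open_subspace X (chart_dom C)) (Spec (transport_monad \<iota> C)) \<alpha>"
    using chart_iso[OF C(1) A] by blast
  then show "\<exists>U (A :: 's monad) \<alpha>. openin (topo X) U \<and> x \<in> U \<and>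
        Defs.generalized_ring A \<and> space_iso (open_subspace X U) (Spec A) \<alpha>"
    using C qring.generalized_ring[OF A] unfolding chart_def by blast
qed

end

context zspace_pair
begin

text \<open>The inclusion of local rings from \<open>zmor_St\<close> need not be a local
  homomorphism. The condition on units says that it is one as far as numbers of \<open>D\<close> are
  concerned; then \<open>f\<close> is given on the charts by contracting primes along
  \<open>D \<subseteq> C\<close>.\<close>

lemma zmor_scheme_morphism:
  fixes \<iota>X :: "rat list \<Rightarrow> 's" and \<iota>Y :: "rat list \<Rightarrow> 't"
  assumes f: "zmor X evX Y evY f" and inj: "inj \<iota>X" "inj \<iota>Y"
    and ch: "\<And>x. x \<in> pts X \<Longrightarrow> \<exists>C D. X.chart C \<and> Y.chart D \<and> x \<in> X.chart_dom C \<and>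
      (\<forall>n. D n \<subseteq> C n) \<and> (\<forall>y\<in>X.chart_dom C. pt f y \<in> Y.chart_dom D \<and>
      qnum D \<inter> qunits (StX y) \<subseteq> qunits (StY (pt f y)))"
  shows "scheme_morphism X Y f"
  unfolding scheme_morphism_def
proof (intro conjI ballI)
  show "space_morphism X Y f" by (rule zmor_space_morphism[OF f])
  fix x assume "x \<in> pts X"
  then obtain C D where C: "X.chart C" "x \<in> X.chart_dom C" and D: "Y.chart D" and DC: "\<And>n. D n \<subseteq> C n"
    and loc: "\<And>y. y \<in> X.chart_dom C \<Longrightarrow> pt f y \<in> Y.chart_dom D"
      "\<And>y. y \<in> X.chart_dom C \<Longrightarrow> qnum D \<inter> qunits (StX y) \<subseteq> qunits (StY (pt f y))"
    using ch by metis
  let ?A = "transport_monad \<iota>X C" and ?B = "transport_monad \<iota>Y D"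
  let ?vA = "\<lambda>_::nat. inv \<iota>X" and ?vB = "\<lambda>_::nat. inv \<iota>Y"
  let ?\<phi> = "\<lambda>_::nat. \<lambda>b. \<iota>X (inv \<iota>Y b)"
  let ?U = "X.chart_dom C" and ?V = "Y.chart_dom D"
  interpret A: qring ?A ?vA C using qring_transport[OF inj(1)] C by (simp add: X.chart_def)
  interpret B: qring ?B ?vB D using qring_transport[OF inj(2)] D by (simp add: Y.chart_def)
  interpret \<phi>: qring_mor ?B ?vB D ?A ?vA C ?\<phi>
    by unfold_locales (use inj subsetD[OF DC] in \<open>auto simp: transport_monad_def\<close>)
  have U: "openin (topo X) ?U" and V: "openin (topo Y) ?V" using C D by (simp_all add: X.chart_def Y.chart_def)
  obtain \<alpha> where \<alpha>: "zmor (open_subspace X ?U) evX (Spec ?A) (spec_ev ?vA) \<alpha>"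
    "space_iso (open_subspace X ?U) (Spec ?A) \<alpha>" "\<And>x. x \<in> ?U \<Longrightarrow> A.St (pt \<alpha> x) = StX x"
    using X.chart_iso[OF C(1) A.qring_axioms] by blast
  obtain \<beta> where \<beta>: "zmor (open_subspace Y ?V) evY (Spec ?B) (spec_ev ?vB) \<beta>"
    "space_iso (open_subspace Y ?V) (Spec ?B) \<beta>" "\<And>x. x \<in> ?V \<Longrightarrow> B.St (pt \<beta> x) = StY x"
    using Y.chart_iso[OF D B.qring_axioms] by blast
  have fU: "pt f ` ?U \<subseteq> ?V" using loc by blast
  have "zspace_pair (open_subspace X ?U) evX StX (Spec ?B) (spec_ev ?vB) B.St"
    using X.zspace_open_subspace[OF U] B.zspace_Spec by (simp add: zspace_pair_def)
  then interpret P: zspace_pair "open_subspace X ?U" evX StX "Spec ?B" "spec_ev ?vB" B.St .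
  have topU: "pts (open_subspace X ?U) = ?U"
    using openin_subset[OF U] by (auto simp: open_subspace_def)
  have topV: "pts (open_subspace Y ?V) = ?V"
    using openin_subset[OF V] by (auto simp: open_subspace_def)
  have "mor_eq (open_subspace X ?U) (Spec ?B)
          (comp_mor (open_subspace Y ?V) \<beta> (restrict_mor X f ?U))
          (comp_mor (Spec ?A) (Spec_mor ?B ?A ?\<phi>) \<alpha>)"
  proof (rule P.zmor_eqI[OF zmor_comp[OF zmor_restrict[OF f U V fU] \<beta>(1)] zmor_comp[OF \<alpha>(1) \<phi>.zmor_Spec_mor]])
    fix y assume "y \<in> pts (open_subspace X ?U)"
    then have y: "y \<in> ?U" using topU by simp
    have fy: "pt f y \<in> ?V" using y fU by blast
    have b: "pt \<beta> (pt f y) \<in> prime_ideals ?B" using zmor_pt[OF \<beta>(1)] fy topV by simp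
    have a: "pt \<alpha> y \<in> prime_ideals ?A" using zmor_pt[OF \<alpha>(1)] y topU by simp
    have "StY (pt f y) n \<subseteq> StX y n" for n
      using zmor_St[OF f] y openin_subset[OF U] by blast
    then have "qunits (StY (pt f y)) \<subseteq> qunits (StX y)" by (auto simp: qunits_def qnum_def)
    then have units: "r \<in> qunits (StY (pt f y)) \<longleftrightarrow> r \<in> qunits (StX y)" if "r \<in> qnum D" for r
      using loc(2)[OF y] that by blast
    \<comment> \<open>Both points consist of the elements of \<open>D\<close> that are not
      invertible in the local ring at \<open>y\<close>.\<close>
    have "pt \<beta> (pt f y) = {b \<in> car ?B 1. B.num b \<notin> qunits (StY (pt f y))}"
      using B.prime_eq_St[OF b] \<beta>(3)[OF fy] by simp
    also have "\<dots> = {b \<in> car ?B 1. B.num b \<in> qnum D - qunits (StX y)}"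
      using units B.num_qnum by blast
    also have "\<dots> = pt (Spec_mor ?B ?A ?\<phi>) (pt \<alpha> y)"
      using \<phi>.f_eq[OF a] \<alpha>(3)[OF y] by simp
    finally show "pt (comp_mor (open_subspace Y ?V) \<beta> (restrict_mor X f ?U)) y =
        pt (comp_mor (Spec ?A) (Spec_mor ?B ?A ?\<phi>) \<alpha>) y"
      by (simp add: comp_mor_def restrict_mor_def)
  qed
  then show "\<exists>U V (A :: 's monad) (B :: 't monad) \<alpha> \<beta> \<phi>.
        openin (topo X) U \<and> x \<in> U \<and> openin (topo Y) V \<and> pt f ` U \<subseteq> V \<and>
        generalized_ring A \<and> generalized_ring B \<and> Defs.ring_morphism B A \<phi> \<and>
        space_iso (open_subspace X U) (Spec A) \<alpha> \<and> space_iso (open_subspace Y V) (Spec B) \<beta> \<and>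
        mor_eq (open_subspace X U) (Spec B)
          (comp_mor (open_subspace Y V) \<beta> (restrict_mor X f U))
          (comp_mor (Spec A) (Spec_mor B A \<phi>) \<alpha>)"
    using U C(2) V fU A.generalized_ring B.generalized_ring \<phi>.ring_morphism \<alpha>(2) \<beta>(2) by blast
qed

text \<open>The maps that match points with equal local rings are inverse to each other. They
  preserve units of local rings, so the same chart can be used on both sides.\<close>

lemma zspaces_isomorphic:
  fixes \<iota>X :: "rat list \<Rightarrow> 's" and \<iota>Y :: "rat list \<Rightarrow> 't"
  assumes inj: "inj \<iota>X" "inj \<iota>Y" and St: "StX ` pts X = StY ` pts Y"
    and ch: "\<And>x. x \<in> pts X \<Longrightarrow> \<exists>C. X.chart C \<and> Y.chart C \<and> x \<in> X.chart_dom C"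
  shows "schemes_isomorphic X Y"
proof -
  interpret YX: zspace_pair Y evY StY X evX StX by unfold_locales
  obtain f where f: "zmor X evX Y evY f" "\<And>x. x \<in> pts X \<Longrightarrow> StY (pt f x) = StX x"
    using stalk_map_ex St by (metis subset_refl)
  obtain g where g: "zmor Y evY X evX g" "\<And>x. x \<in> pts Y \<Longrightarrow> StX (pt g x) = StY x"
    using YX.stalk_map_ex St by (metis subset_refl)
  have "scheme_morphism X Y f"
  proof (rule zmor_scheme_morphism[OF f(1) inj])
    fix x assume "x \<in> pts X"
    then obtain C where C: "X.chart C" "Y.chart C" "x \<in> X.chart_dom C" using ch by blast
    moreover have "pt f y \<in> Y.chart_dom C \<and> qnum C \<inter> qunits (StX y) \<subseteq> qunits (StY (pt f y))"
      if "y \<in> X.chart_dom C" for y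
      using that f zmor_pt[OF f(1)] by (simp add: X.chart_dom_def Y.chart_dom_def)
    ultimately show "\<exists>C D. X.chart C \<and> Y.chart D \<and> x \<in> X.chart_dom C \<and>
      (\<forall>n. D n \<subseteq> C n) \<and> (\<forall>y\<in>X.chart_dom C. pt f y \<in> Y.chart_dom D \<and>
      qnum D \<inter> qunits (StX y) \<subseteq> qunits (StY (pt f y)))"
      by (intro exI[of _ C]) blast
  qed
  moreover have "scheme_morphism Y X g"
  proof (rule YX.zmor_scheme_morphism[OF g(1) inj(2,1)])
    fix y assume y: "y \<in> pts Y"
    then obtain C where C: "X.chart C" "Y.chart C" "pt g y \<in> X.chart_dom C"
      using ch zmor_pt[OF g(1) y] by blast
    moreover have "y \<in> Y.chart_dom C" using C(3) y g(2) by (simp add: X.chart_dom_def Y.chart_dom_def)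
    moreover have "pt g z \<in> X.chart_dom C \<and> qnum C \<inter> qunits (StY z) \<subseteq> qunits (StX (pt g z))"
      if "z \<in> Y.chart_dom C" for z
      using that g zmor_pt[OF g(1)] by (simp add: X.chart_dom_def Y.chart_dom_def)
    ultimately show "\<exists>C D. Y.chart C \<and> X.chart D \<and> y \<in> Y.chart_dom C \<and>
      (\<forall>n. D n \<subseteq> C n) \<and> (\<forall>z\<in>Y.chart_dom C. pt g z \<in> X.chart_dom D \<and>
      qnum D \<inter> qunits (StY z) \<subseteq> qunits (StX (pt g z)))"
      by (intro exI[of _ C]) blast
  qed
  moreover have "mor_eq X X (comp_mor Y g f) id_mor" by (rule stalk_maps_inverse[OF f g])
  moreover have "mor_eq Y Y (comp_mor X f g) id_mor" by (rule YX.stalk_maps_inverse[OF g f])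
  ultimately show ?thesis unfolding schemes_isomorphic_def by blast
qed

end

text \<open>Conditions under which gluing amounts to identifying points with equal local rings: the
  overlap maps preserve local rings, points of different charts with equal local rings are linked by
  an overlap, and finitely many elements of a local ring in a chart force every local ring that
  contains them to occur in that chart.\<close>

locale glue_data =
  fixes I :: "'i set" and X :: "'i \<Rightarrow> ('p, 's) gspace" and K :: "'k set" and W :: "'k \<Rightarrow> ('q, 't) gspace"
    and src tgt :: "'k \<Rightarrow> 'i" and j1 j2 :: "'k \<Rightarrow> ('q, 't, 'p, 's) gmor"
    and ev :: "'i \<Rightarrow> nat \<Rightarrow> 's \<Rightarrow> 'p \<Rightarrow> rat list" and St :: "'i \<Rightarrow> 'p \<Rightarrow> nat \<Rightarrow> rat list set"
    and evW :: "'k \<Rightarrow> nat \<Rightarrow> 't \<Rightarrow> 'q \<Rightarrow> rat list" and StW :: "'k \<Rightarrow> 'q \<Rightarrow> nat \<Rightarrow> rat list set"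
  assumes X: "i \<in> I \<Longrightarrow> zspace (X i) (ev i) (St i)"
    and W: "k \<in> K \<Longrightarrow> zspace (W k) (evW k) (StW k)"
    and src_tgt: "k \<in> K \<Longrightarrow> src k \<in> I" "k \<in> K \<Longrightarrow> tgt k \<in> I"
    and j1: "k \<in> K \<Longrightarrow> zmor (W k) (evW k) (X (src k)) (ev (src k)) (j1 k)"
    and j2: "k \<in> K \<Longrightarrow> zmor (W k) (evW k) (X (tgt k)) (ev (tgt k)) (j2 k)"
    and St1: "k \<in> K \<Longrightarrow> w \<in> pts (W k) \<Longrightarrow> St (src k) (pt (j1 k) w) = StW k w"
    and St2: "k \<in> K \<Longrightarrow> w \<in> pts (W k) \<Longrightarrow> St (tgt k) (pt (j2 k) w) = StW k w"
    and overlap: "i \<in> I \<Longrightarrow> j \<in> I \<Longrightarrow> x \<in> pts (X i) \<Longrightarrow> y \<in> pts (X j) \<Longrightarrow>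
      St i x = St j y \<Longrightarrow> i = j \<or> (\<exists>k\<in>K. \<exists>w\<in>pts (W k). StW k w = St i x \<and>
        (src k = i \<and> tgt k = j \<or> src k = j \<and> tgt k = i))"
    and chart_open: "i \<in> I \<Longrightarrow> x \<in> pts (X i) \<Longrightarrow>
      \<exists>F. finite F \<and> F \<subseteq> Sigma UNIV (St i x) \<and> (\<forall>j\<in>I. \<forall>y\<in>pts (X j).
        F \<subseteq> Sigma UNIV (St j y) \<longrightarrow> St j y \<in> St i ` pts (X i))"
begin

definition G where "G = glue I X K W src tgt j1 j2"

definition cl where "cl = glue_class K W src tgt j1 j2"

definition trace where "trace U i = {x \<in> pts (X i). cl i x \<in> U}"

definition points where "points = (\<lambda>(i, x). cl i x) ` glue_points I X"

text \<open>All members of a class have the same local ring, so an arbitrary one is used; likewise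
  for the values in \<open>gev\<close>.\<close>

definition gSt :: "('i \<times> 'p) set \<Rightarrow> nat \<Rightarrow> rat list set" where
  "gSt m = (let (i, x) = (SOME z. z \<in> m) in St i x)"

definition gev :: "nat \<Rightarrow> ('i \<Rightarrow> 's) \<Rightarrow> ('i \<times> 'p) set \<Rightarrow> rat list" where
  "gev n s m = (let (i, x) = (SOME z. z \<in> m) in ev i n (s i) x)"

lemma inj_St: "i \<in> I \<Longrightarrow> x \<in> pts (X i) \<Longrightarrow> y \<in> pts (X i) \<Longrightarrow> St i x = St i y \<Longrightarrow> x = y"
  using zspace.inj_St[OF X] by (meson inj_onD)

lemma overlap_points:
  assumes "i \<in> I" "j \<in> I" "x \<in> pts (X i)" "y \<in> pts (X j)" "St i x = St j y"
  shows "(i = j \<and> x = y) \<or> (\<exists>k\<in>K. \<exists>w\<in>pts (W k).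
     (i, x) = (src k, pt (j1 k) w) \<and> (j, y) = (tgt k, pt (j2 k) w) \<or>
     (j, y) = (src k, pt (j1 k) w) \<and> (i, x) = (tgt k, pt (j2 k) w))"
  using overlap[OF assms]
proof (elim disjE bexE)
  assume "i = j" then show ?thesis using inj_St assms by blast
next
  fix k w assume k: "k \<in> K" and w: "w \<in> pts (W k)" and
    *: "StW k w = St i x \<and> (src k = i \<and> tgt k = j \<or> src k = j \<and> tgt k = i)"
  note p = zmor_pt[OF j1[OF k] w] zmor_pt[OF j2[OF k] w] St1[OF k w] St2[OF k w]
  from * show ?thesis
  proof (elim conjE disjE)
    assume eq: "StW k w = St i x" "src k = i" "tgt k = j"
    then have "pt (j1 k) w = x" "pt (j2 k) w = y" using p assms inj_St by auto
    then show ?thesis using eq k w by blast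
  next
    assume eq: "StW k w = St i x" "src k = j" "tgt k = i"
    then have "pt (j1 k) w = y" "pt (j2 k) w = x" using p assms inj_St by auto
    then show ?thesis using eq k w by blast
  qed
qed

text \<open>Each generating pair preserves local rings. Conversely, distinct points with equal local
  rings are linked by a single generating pair, so the closure is reached in one step.\<close>

lemma cl_eq:
  assumes i: "i \<in> I" and x: "x \<in> pts (X i)"
  shows "cl i x = {(j, y). j \<in> I \<and> y \<in> pts (X j) \<and> St j y = St i x}"
proof -
  let ?r = "glue_rel K W src tgt j1 j2"
  have step: "j' \<in> I \<and> y' \<in> pts (X j') \<and> St j' y' = St j y" if "((j, y), (j', y')) \<in> ?r \<union> ?r\<inverse>" for j y j' y'
    using that src_tgt zmor_pt[OF j1] zmor_pt[OF j2] St1 St2 unfolding glue_rel_def by auto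
  have "j \<in> I \<and> y \<in> pts (X j) \<and> St j y = St i x" if "((i, x), (j, y)) \<in> (?r \<union> ?r\<inverse>)\<^sup>*" for j y
    using that
  proof (induction rule: rtrancl_induct2)
    case refl
    then show ?case using i x by simp
  next
    case (step j y j' y')
    then show ?case using \<open>\<And>j y j' y'. ((j, y), (j', y')) \<in> ?r \<union> ?r\<inverse> \<Longrightarrow> _\<close>[of j y j' y'] by simp
  qed
  moreover have "((i, x), (j, y)) \<in> (?r \<union> ?r\<inverse>)\<^sup>*" if "j \<in> I" "y \<in> pts (X j)" "St j y = St i x" for j y
  proof -
    have r: "((src k, pt (j1 k) w), (tgt k, pt (j2 k) w)) \<in> ?r" if "k \<in> K" "w \<in> pts (W k)" for k w
      using that unfolding glue_rel_def by blast
    have "St i x = St j y" using that by simp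
    from overlap_points[OF i that(1) x that(2) this]
    have "(i = j \<and> x = y) \<or> ((i, x), (j, y)) \<in> ?r \<union> ?r\<inverse>"
      using r by (metis UnI1 UnI2 converseI)
    then show ?thesis by (metis r_into_rtrancl rtrancl.rtrancl_refl)
  qed
  ultimately have "((i, x), z) \<in> (?r \<union> ?r\<inverse>)\<^sup>* \<longleftrightarrow> z \<in> {(j, y). j \<in> I \<and> y \<in> pts (X j) \<and> St j y = St i x}" for z
    by (cases z) blast
  then show ?thesis unfolding cl_def glue_class_def Let_def Image_singleton by blast
qed

lemma mem_cl: "i \<in> I \<Longrightarrow> x \<in> pts (X i) \<Longrightarrow> (i, x) \<in> cl i x"
  by (simp add: cl_eq)

lemma cl_eq_iff:
  assumes "i \<in> I" "x \<in> pts (X i)" "j \<in> I" "y \<in> pts (X j)"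
  shows "cl i x = cl j y \<longleftrightarrow> St i x = St j y"
  using assms mem_cl[OF assms(1,2)] by (auto simp: cl_eq)

lemma some_cl:
  assumes "i \<in> I" "x \<in> pts (X i)"
  obtains j y where "(SOME z. z \<in> cl i x) = (j, y)" "j \<in> I" "y \<in> pts (X j)" "St j y = St i x"
proof -
  have "(SOME z. z \<in> cl i x) \<in> cl i x" using mem_cl[OF assms] by (rule someI)
  then show ?thesis using that unfolding cl_eq[OF assms] by (cases "SOME z. z \<in> cl i x") auto
qed

lemma gSt_cl: "i \<in> I \<Longrightarrow> x \<in> pts (X i) \<Longrightarrow> gSt (cl i x) = St i x"
  by (erule (1) some_cl) (simp add: gSt_def)

lemma pointsE:
  assumes "m \<in> points" obtains i x where "i \<in> I" "x \<in> pts (X i)" "m = cl i x"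
  using assms by (auto simp: points_def glue_points_def)

lemma cl_points: "i \<in> I \<Longrightarrow> x \<in> pts (X i) \<Longrightarrow> cl i x \<in> points"
  by (auto simp: points_def glue_points_def)

lemma openin_G: "openin (topo G) U \<longleftrightarrow> U \<subseteq> points \<and> (\<forall>i\<in>I. openin (topo (X i)) (trace U i))"
proof -
  have "istopology (\<lambda>U. U \<subseteq> points \<and> (\<forall>i\<in>I. openin (topo (X i)) (trace U i)))"
    unfolding istopology_def
  proof (intro conjI allI impI)
    fix S T assume "S \<subseteq> points \<and> (\<forall>i\<in>I. openin (topo (X i)) (trace S i))"
      "T \<subseteq> points \<and> (\<forall>i\<in>I. openin (topo (X i)) (trace T i))"
    moreover have "trace (S \<inter> T) i = trace S i \<inter> trace T i" for i by (auto simp: trace_def)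
    ultimately show "S \<inter> T \<subseteq> points" "\<forall>i\<in>I. openin (topo (X i)) (trace (S \<inter> T) i)" by auto
  next
    fix \<K> assume "\<forall>U\<in>\<K>. U \<subseteq> points \<and> (\<forall>i\<in>I. openin (topo (X i)) (trace U i))"
    moreover have "trace (\<Union>\<K>) i = \<Union>((\<lambda>U. trace U i) ` \<K>)" for i by (auto simp: trace_def)
    ultimately show "\<Union>\<K> \<subseteq> points" "\<forall>i\<in>I. openin (topo (X i)) (trace (\<Union>\<K>) i)" by auto
  qed
  then show ?thesis by (simp add: G_def glue_def Let_def trace_def points_def cl_def)
qed

lemma topspace_G: "pts G = points"
proof -
  have "trace points i = pts (X i)" if "i \<in> I" for i
    using cl_points that by (auto simp: trace_def)
  then have "openin (topo G) points" by (simp add: openin_G)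
  then show ?thesis using openin_G by (metis openin_subset openin_topspace subset_antisym)
qed

lemma openin_trace: "openin (topo G) U \<Longrightarrow> i \<in> I \<Longrightarrow> openin (topo (X i)) (trace U i)"
  by (simp add: openin_G)

lemma gSt_image: "gSt ` pts G = (\<Union>i\<in>I. St i ` pts (X i))"
proof (intro equalityI subsetI)
  fix L assume "L \<in> gSt ` pts G"
  then show "L \<in> (\<Union>i\<in>I. St i ` pts (X i))"
    using gSt_cl by (auto simp: topspace_G elim!: pointsE)
next
  fix L assume "L \<in> (\<Union>i\<in>I. St i ` pts (X i))"
  then obtain i x where "i \<in> I" "x \<in> pts (X i)" "L = St i x" by blast
  then have "L = gSt (cl i x)" "cl i x \<in> points" using gSt_cl cl_points by simp_all
  then show "L \<in> gSt ` pts G" unfolding topspace_G by (rule image_eqI)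
qed

lemma openin_G_zopen: "openin (topo G) U \<longleftrightarrow> zopen (pts G) gSt U"
proof
  assume U: "openin (topo G) U"
  show "zopen (pts G) gSt U"
    unfolding zopen_def
  proof (intro conjI ballI)
    show "U \<subseteq> pts G" using U by (rule openin_subset)
    fix m assume m: "m \<in> U"
    then have "m \<in> points" using U openin_G by blast
    then obtain i x where ix: "i \<in> I" "x \<in> pts (X i)" "m = cl i x" by (rule pointsE)
    obtain F where F: "finite F" "F \<subseteq> Sigma UNIV (St i x)"
      "\<And>y. y \<in> pts (X i) \<Longrightarrow> F \<subseteq> Sigma UNIV (St i y) \<Longrightarrow> y \<in> trace U i"
      using zspace.zopenE[OF X[OF ix(1)] openin_trace[OF U ix(1)], of x] m ix by (auto simp: trace_def)
    obtain F' where F': "finite F'" "F' \<subseteq> Sigma UNIV (St i x)" "\<forall>j\<in>I. \<forall>y\<in>pts (X j).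
        F' \<subseteq> Sigma UNIV (St j y) \<longrightarrow> St j y \<in> St i ` pts (X i)"
      using chart_open[OF ix(1,2)] by blast
    \<comment> \<open>\<open>F\<close> places points of chart \<open>i\<close> in the trace of
      \<open>U\<close>; \<open>F'\<close> forces a point of any other chart to be identified with a
      point of chart \<open>i\<close>.\<close>
    have "m' \<in> U" if m': "m' \<in> points" "F \<union> F' \<subseteq> Sigma UNIV (gSt m')" for m'
    proof -
      obtain j y where jy: "j \<in> I" "y \<in> pts (X j)" "m' = cl j y" using m'(1) by (rule pointsE)
      then have sub: "F \<subseteq> Sigma UNIV (St j y)" "F' \<subseteq> Sigma UNIV (St j y)" using m'(2) gSt_cl by auto
      then have "St j y \<in> St i ` pts (X i)" using F'(3) jy by blast
      then obtain z where z: "z \<in> pts (X i)" "St j y = St i z" by blast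
      then have "z \<in> trace U i" using F(3) sub by simp
      moreover have "cl j y = cl i z" using cl_eq_iff jy ix z by simp
      ultimately show ?thesis using jy by (simp add: trace_def)
    qed
    then show "\<exists>F. finite F \<and> F \<subseteq> Sigma UNIV (gSt m) \<and>
        (\<forall>y\<in>pts G. F \<subseteq> Sigma UNIV (gSt y) \<longrightarrow> y \<in> U)"
      using F F' gSt_cl[OF ix(1,2)] ix(3) unfolding topspace_G
      by (intro exI[of _ "F \<union> F'"]) auto
  qed
next
  assume U: "zopen (pts G) gSt U"
  show "openin (topo G) U"
    unfolding openin_G
  proof (intro conjI ballI)
    show "U \<subseteq> points" using U unfolding zopen_def topspace_G by blast
    fix i assume i: "i \<in> I"
    show "openin (topo (X i)) (trace U i)"
    proof (rule zspace.zopenI[OF X[OF i]])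
      fix x assume "x \<in> trace U i"
      then have x: "x \<in> pts (X i)" "cl i x \<in> U" by (auto simp: trace_def)
      obtain F where F: "finite F" "F \<subseteq> Sigma UNIV (gSt (cl i x))"
        "\<forall>y\<in>pts G. F \<subseteq> Sigma UNIV (gSt y) \<longrightarrow> y \<in> U"
        using U x(2) unfolding zopen_def by metis
      have "y \<in> trace U i" if y: "y \<in> pts (X i)" "F \<subseteq> Sigma UNIV (St i y)" for y
        using F(3) cl_points[OF i y(1)] gSt_cl[OF i y(1)] y unfolding topspace_G trace_def by auto
      then show "\<exists>F. finite F \<and> F \<subseteq> Sigma UNIV (St i x) \<and>
          (\<forall>y\<in>pts (X i). F \<subseteq> Sigma UNIV (St i y) \<longrightarrow> y \<in> trace U i)"
        using F(1,2) gSt_cl[OF i x(1)] by (intro exI[of _ F]) auto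
    qed (auto simp: trace_def)
  qed
qed

lemma car_G: "car (sec G U) n = {s \<in> (\<Pi>\<^sub>E i\<in>I. car (sec (X i) (trace U i)) n).
    \<forall>k\<in>K. sh (j1 k) (trace U (src k)) n (s (src k)) = sh (j2 k) (trace U (tgt k)) n (s (tgt k))}"
  by (simp add: G_def glue_def Let_def trace_def cl_def)

lemma var_G: "var (sec G U) n m = (\<lambda>i\<in>I. var (sec (X i) (trace U i)) n m)"
  by (simp add: G_def glue_def Let_def trace_def cl_def)

lemma app_G: "app (sec G U) n t xs = (\<lambda>i\<in>I. app (sec (X i) (trace U i)) n (t i) (map (\<lambda>x. x i) xs))"
  by (simp add: G_def glue_def Let_def trace_def cl_def)

lemma res_G: "res G U V n s = (\<lambda>i\<in>I. res (X i) (trace U i) (trace V i) n (s i))"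
  by (simp add: G_def glue_def Let_def trace_def cl_def)

lemma preim_trace:
  assumes "k \<in> K"
  shows "preim (W k) (j2 k) (trace U (tgt k)) = preim (W k) (j1 k) (trace U (src k))"
proof -
  have "cl (src k) (pt (j1 k) w) = cl (tgt k) (pt (j2 k) w)" if "w \<in> pts (W k)" for w
    using that zmor_pt[OF j1] zmor_pt[OF j2] St1 St2 src_tgt assms by (simp add: cl_eq_iff)
  then show ?thesis
    using zmor_pt[OF j1[OF assms]] zmor_pt[OF j2[OF assms]] by (auto simp: preim_def trace_def)
qed

context
  fixes U assumes U: "openin (topo G) U"
begin

lemma trace_open: "i \<in> I \<Longrightarrow> openin (topo (X i)) (trace U i)"
  by (rule openin_trace[OF U])

lemma sec_i: "s \<in> car (sec G U) n \<Longrightarrow> i \<in> I \<Longrightarrow> s i \<in> car (sec (X i) (trace U i)) n"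
  by (auto simp: car_G)

text \<open>The components of a section of the gluing have equal pullbacks to the overlaps, and
  pullbacks preserve values.\<close>

lemma ev_compat:
  assumes s: "s \<in> car (sec G U) n" and i: "i \<in> I" "x \<in> trace U i" and j: "j \<in> I" "y \<in> trace U j"
    and eq: "St i x = St j y"
  shows "ev i n (s i) x = ev j n (s j) y"
proof -
  have glue: "ev (src k) n (s (src k)) (pt (j1 k) w) = ev (tgt k) n (s (tgt k)) (pt (j2 k) w)"
    if k: "k \<in> K" and w: "w \<in> pts (W k)" and "pt (j1 k) w \<in> trace U (src k)" for k w
  proof -
    have w1: "w \<in> preim (W k) (j1 k) (trace U (src k))" using that by (simp add: preim_def)
    then have w2: "w \<in> preim (W k) (j2 k) (trace U (tgt k))" using preim_trace[OF k] by simp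
    have "sh (j1 k) (trace U (src k)) n (s (src k)) = sh (j2 k) (trace U (tgt k)) n (s (tgt k))"
      using s k by (simp add: car_G)
    then show ?thesis
      using zmor_ev[OF j1[OF k] trace_open[OF src_tgt(1)[OF k]] sec_i[OF s src_tgt(1)[OF k]] w1]
        zmor_ev[OF j2[OF k] trace_open[OF src_tgt(2)[OF k]] sec_i[OF s src_tgt(2)[OF k]] w2] by simp
  qed
  have xy: "x \<in> pts (X i)" "y \<in> pts (X j)" using i j by (auto simp: trace_def)
  from overlap_points[OF i(1) j(1) xy eq] show ?thesis
  proof (elim disjE bexE conjE)
    fix k w assume "k \<in> K" "w \<in> pts (W k)" "(i, x) = (src k, pt (j1 k) w)" "(j, y) = (tgt k, pt (j2 k) w)"
    then show ?thesis using glue[of k w] i by auto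
  next
    fix k w assume "k \<in> K" "w \<in> pts (W k)" "(j, y) = (src k, pt (j1 k) w)" "(i, x) = (tgt k, pt (j2 k) w)"
    then show ?thesis using glue[of k w] j by auto
  qed simp
qed

lemma gev_cl:
  assumes s: "s \<in> car (sec G U) n" and i: "i \<in> I" "x \<in> trace U i"
  shows "gev n s (cl i x) = ev i n (s i) x"
proof -
  have x: "x \<in> pts (X i)" using i by (simp add: trace_def)
  obtain j y where *: "(SOME z. z \<in> cl i x) = (j, y)" "j \<in> I" "y \<in> pts (X j)" "St j y = St i x"
    using some_cl[OF i(1) x] .
  then have "cl j y = cl i x" using i x by (simp add: cl_eq_iff)
  then have "y \<in> trace U j" using i * by (simp add: trace_def)
  then show ?thesis using ev_compat[OF s *(2) _ i *(4)] * by (simp add: gev_def)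
qed

lemma U_E:
  assumes "m \<in> U" obtains i x where "i \<in> I" "x \<in> trace U i" "m = cl i x" "x \<in> pts (X i)"
    "gSt m = St i x"
proof -
  have "m \<in> points" using assms U openin_G by blast
  then obtain i x where "i \<in> I" "x \<in> pts (X i)" "m = cl i x" by (rule pointsE)
  then show ?thesis using that assms gSt_cl by (simp add: trace_def)
qed

text \<open>Values in different charts are compared at the generic points of the charts, which are
  identified since they have the same local ring.\<close>

lemma sec_G_const:
  assumes s: "s \<in> car (sec G U) n"
  shows "\<exists>v. \<forall>m\<in>U. v \<in> gSt m n \<and> gev n s m = v"
proof (cases "U = {}")
  case False
  then obtain m0 where "m0 \<in> U" by blast
  have same: "gev n s m = gev n s m'" if m: "m \<in> U" and m': "m' \<in> U" for m m'
  proof -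
    obtain i x where ix: "i \<in> I" "x \<in> trace U i" "m = cl i x" using U_E[OF m] .
    obtain j y where jy: "j \<in> I" "y \<in> trace U j" "m' = cl j y" using U_E[OF m'] .
    interpret Xi: zspace "X i" "ev i" "St i" by (rule X[OF ix(1)])
    interpret Xj: zspace "X j" "ev j" "St j" by (rule X[OF jy(1)])
    obtain z where z: "z \<in> trace U i" "St i z = qfull" using Xi.generic_open[OF trace_open[OF ix(1)]] ix by blast
    obtain z' where z': "z' \<in> trace U j" "St j z' = qfull" using Xj.generic_open[OF trace_open[OF jy(1)]] jy by blast
    have "ev i n (s i) x = ev i n (s i) z"
      by (rule Xi.ev_const[OF trace_open[OF ix(1)] sec_i[OF s ix(1)] ix(2) z(1)])
    also have "\<dots> = ev j n (s j) z'" using ev_compat[OF s ix(1) z(1) jy(1) z'(1)] z z' by simp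
    also have "\<dots> = ev j n (s j) y"
      by (rule Xj.ev_const[OF trace_open[OF jy(1)] sec_i[OF s jy(1)] z'(1) jy(2)])
    finally show ?thesis using gev_cl[OF s] ix jy by simp
  qed
  have "gev n s m \<in> gSt m n" if m: "m \<in> U" for m
  proof -
    obtain i x where ix: "i \<in> I" "x \<in> trace U i" "m = cl i x" "gSt m = St i x" using U_E[OF m] .
    then show ?thesis using zspace.ev_St[OF X[OF ix(1)] trace_open[OF ix(1)] sec_i[OF s ix(1)] ix(2)] gev_cl[OF s] by simp
  qed
  then show ?thesis using same \<open>m0 \<in> U\<close> by metis
qed simp

text \<open>If all components have the same value, so do their pullbacks to an overlap, where
  sections are determined by values; the gluing condition is then automatic.\<close>

lemma sec_G_I:
  assumes s: "s \<in> (\<Pi>\<^sub>E i\<in>I. car (sec (X i) (trace U i)) n)"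
    and v: "\<And>i x. i \<in> I \<Longrightarrow> x \<in> trace U i \<Longrightarrow> ev i n (s i) x = v"
  shows "s \<in> car (sec G U) n" "\<And>m. m \<in> U \<Longrightarrow> gev n s m = v"
proof -
  show car: "s \<in> car (sec G U) n"
    unfolding car_G
  proof (intro CollectI conjI ballI s)
    fix k assume k: "k \<in> K"
    note st = src_tgt(1)[OF k] src_tgt(2)[OF k]
    have si: "s i \<in> car (sec (X i) (trace U i)) n" if "i \<in> I" for i using s that by auto
    note z1 = zmor_preim[OF j1[OF k] trace_open[OF st(1)]] zmor_sh[OF j1[OF k] trace_open[OF st(1)] si[OF st(1)]]
    note z2 = zmor_sh[OF j2[OF k] trace_open[OF st(2)] si[OF st(2)], unfolded preim_trace[OF k]]
    show "sh (j1 k) (trace U (src k)) n (s (src k)) = sh (j2 k) (trace U (tgt k)) n (s (tgt k))"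
    proof (rule zspace.sec_eqI[OF W[OF k] z1 z2])
      fix w assume w: "w \<in> preim (W k) (j1 k) (trace U (src k))"
      then have w': "w \<in> preim (W k) (j2 k) (trace U (tgt k))" using preim_trace[OF k] by simp
      show "evW k n (sh (j1 k) (trace U (src k)) n (s (src k))) w = evW k n (sh (j2 k) (trace U (tgt k)) n (s (tgt k))) w"
        using zmor_ev[OF j1[OF k] trace_open[OF st(1)] si[OF st(1)] w]
          zmor_ev[OF j2[OF k] trace_open[OF st(2)] si[OF st(2)] w'] v[OF st(1)] v[OF st(2)] w w'
        by (simp add: preim_def)
    qed
  qed
  show "gev n s m = v" if m: "m \<in> U" for m
  proof -
    obtain i x where "i \<in> I" "x \<in> trace U i" "m = cl i x" using U_E[OF m] .
    then show ?thesis using gev_cl[OF car] v by simp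
  qed
qed

end

lemma St_trace: "i \<in> I \<Longrightarrow> x \<in> trace U i \<Longrightarrow> cl i x \<in> U \<and> gSt (cl i x) = St i x"
  by (simp add: trace_def gSt_cl)

lemma zspace_glue: "zspace G gev gSt"
proof
  show "inj_on gSt (pts G)"
  proof (rule inj_onI)
    fix m m' assume m: "m \<in> pts G" and m': "m' \<in> pts G" and eq: "gSt m = gSt m'"
    obtain i x where ix: "i \<in> I" "x \<in> pts (X i)" "m = cl i x"
      using m pointsE unfolding topspace_G by blast
    obtain j y where jy: "j \<in> I" "y \<in> pts (X j)" "m' = cl j y"
      using m' pointsE unfolding topspace_G by blast
    show "m = m'" using eq ix jy by (simp add: gSt_cl cl_eq_iff)
  qed
  show "qlocal (gSt m)" if "m \<in> pts G" for m
    using that zspace.qlocal_St[OF X] by (auto simp: topspace_G gSt_cl elim!: pointsE)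
  show "qfull \<in> gSt ` pts G" if ne: "pts G \<noteq> {}"
  proof -
    obtain i x where "i \<in> I" "x \<in> pts (X i)" using ne pointsE unfolding topspace_G by blast
    then show ?thesis using zspace.generic[OF X] unfolding gSt_image by blast
  qed
  show "openin (topo G) U = zopen (pts G) gSt U" for U by (rule openin_G_zopen)
  fix U assume U: "openin (topo G) U"
  note tr = trace_open[OF U]
  show "\<exists>v. \<forall>x\<in>U. v \<in> gSt x n \<and> gev n s x = v" if "s \<in> car (sec G U) n" for s n
    by (rule sec_G_const[OF U that])
  show "s = s'" if s: "s \<in> car (sec G U) n" and s': "s' \<in> car (sec G U) n"
    and eq: "\<And>m. m \<in> U \<Longrightarrow> gev n s m = gev n s' m" for s s' n
  proof
    fix i show "s i = s' i"
    proof (cases "i \<in> I")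
      case True
      show ?thesis
      proof (rule zspace.sec_eqI[OF X[OF True] tr[OF True] sec_i[OF U s True] sec_i[OF U s' True]])
        fix x assume x: "x \<in> trace U i"
        then show "ev i n (s i) x = ev i n (s' i) x"
          using eq[of "cl i x"] gev_cl[OF U s True x] gev_cl[OF U s' True x] by (simp add: trace_def)
      qed
    next
      case False
      then show ?thesis using s s' by (auto simp: car_G PiE_def extensional_def)
    qed
  qed
  show "\<exists>s\<in>car (sec G U) n. \<forall>m\<in>U. gev n s m = v" if v: "\<And>m. m \<in> U \<Longrightarrow> v \<in> gSt m n" for v n
  proof -
    have "\<exists>s\<in>car (sec (X i) (trace U i)) n. \<forall>x\<in>trace U i. ev i n s x = v" if i: "i \<in> I" for i
      by (rule zspace.sec_ex[OF X[OF i] tr[OF i]]) (use v St_trace[OF i] in fastforce)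
    then obtain f where f: "\<And>i. i \<in> I \<Longrightarrow> f i \<in> car (sec (X i) (trace U i)) n"
      "\<And>i x. i \<in> I \<Longrightarrow> x \<in> trace U i \<Longrightarrow> ev i n (f i) x = v" by metis
    have *: "restrict f I \<in> (\<Pi>\<^sub>E i\<in>I. car (sec (X i) (trace U i)) n)" using f by auto
    have **: "\<And>i x. i \<in> I \<Longrightarrow> x \<in> trace U i \<Longrightarrow> ev i n (restrict f I i) x = v" using f by simp
    show ?thesis using sec_G_I[OF U * **] by blast
  qed
  show "var (sec G U) n i \<in> car (sec G U) n \<and> (\<forall>x\<in>U. gev n (var (sec G U) n i) x = qvar n i)" if i: "i < n" for n i
  proof -
    have *: "var (sec G U) n i \<in> (\<Pi>\<^sub>E j\<in>I. car (sec (X j) (trace U j)) n)"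
      using zspace.var_car[OF X tr i] by (auto simp: var_G)
    have **: "\<And>j x. j \<in> I \<Longrightarrow> x \<in> trace U j \<Longrightarrow> ev j n (var (sec G U) n i j) x = qvar n i"
      using zspace.ev_var[OF X tr i] by (simp add: var_G)
    show ?thesis using sec_G_I[OF U * **] by blast
  qed
  show "app (sec G U) n t ss \<in> car (sec G U) n \<and>
      (\<forall>m\<in>U. gev n (app (sec G U) n t ss) m = qlin n (gev (length ss) t m) (map (\<lambda>s. gev n s m) ss))"
    if t: "t \<in> car (sec G U) (length ss)" and ss: "set ss \<subseteq> car (sec G U) n" for n t ss
  proof -
    have ssi: "set (map (\<lambda>x. x i) ss) \<subseteq> car (sec (X i) (trace U i)) n" if "i \<in> I" for i
      using ss sec_i[OF U _ that] by auto
    note ti = sec_i[OF U t]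
    have *: "app (sec G U) n t ss \<in> (\<Pi>\<^sub>E j\<in>I. car (sec (X j) (trace U j)) n)"
      using zspace.app_car[OF X tr ti _ ssi] by (auto simp: app_G)
    have evi: "ev i n (app (sec G U) n t ss i) x = qlin n (gev (length ss) t (cl i x)) (map (\<lambda>s. gev n s (cl i x)) ss)"
      if i: "i \<in> I" and x: "x \<in> trace U i" for i x
    proof -
      have "map (\<lambda>s. ev i n s x) (map (\<lambda>s. s i) ss) = map (\<lambda>s. gev n s (cl i x)) ss"
        using gev_cl[OF U _ i x] ss by auto
      moreover have "ev i n (app (sec G U) n t ss i) x =
          qlin n (ev i (length ss) (t i) x) (map (\<lambda>s. ev i n s x) (map (\<lambda>s. s i) ss))"
        using zspace.ev_app[OF X[OF i] tr[OF i] ti[OF i] _ ssi[OF i] x] i by (simp add: app_G)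
      ultimately show ?thesis using gev_cl[OF U t i x] by (simp del: map_map)
    qed
    \<comment> \<open>One value for all points, as \<open>sec_G_I\<close> asks; over the empty set
      any \<open>v\<close> will do.\<close>
    obtain v where v: "\<forall>m\<in>U. qlin n (gev (length ss) t m) (map (\<lambda>s. gev n s m) ss) = v"
    proof (cases "U = {}")
      case False
      then obtain m0 where m0: "m0 \<in> U" by blast
      have "gev k s m = gev k s m0" if "m \<in> U" "s \<in> car (sec G U) k" for m s k
        using sec_G_const[OF U that(2)] that(1) m0 by metis
      then have same: "gev (length ss) t m = gev (length ss) t m0" "map (\<lambda>s. gev n s m) ss = map (\<lambda>s. gev n s m0) ss"
        if "m \<in> U" for m
        using t ss that by (auto simp: subset_iff)
      then have "\<forall>m\<in>U. qlin n (gev (length ss) t m) (map (\<lambda>s. gev n s m) ss) =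
          qlin n (gev (length ss) t m0) (map (\<lambda>s. gev n s m0) ss)"
        by (intro ballI) (simp only: same)
      then show ?thesis by (rule that)
    qed (use that in blast)
    have **: "\<And>i x. i \<in> I \<Longrightarrow> x \<in> trace U i \<Longrightarrow> ev i n (app (sec G U) n t ss i) x = v"
      using evi v St_trace by simp
    show ?thesis using sec_G_I[OF U * **] v by simp
  qed
  show "res G U V n s \<in> car (sec G V) n \<and> (\<forall>x\<in>V. gev n (res G U V n s) x = gev n s x)"
    if V: "openin (topo G) V" and VU: "V \<subseteq> U" and s: "s \<in> car (sec G U) n" for V n s
  proof -
    have sub: "trace V i \<subseteq> trace U i" for i using VU by (auto simp: trace_def)
    note tV = trace_open[OF V] and si = sec_i[OF U s]
    have *: "res G U V n s \<in> (\<Pi>\<^sub>E j\<in>I. car (sec (X j) (trace V j)) n)"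
      using zspace.res_car[OF X tr tV sub si] by (auto simp: res_G)
    obtain v where v: "\<forall>m\<in>U. gev n s m = v" using sec_G_const[OF U s] by blast
    have **: "ev i n (res G U V n s i) x = v" if i: "i \<in> I" and x: "x \<in> trace V i" for i x
    proof -
      have xU: "x \<in> trace U i" using x sub by blast
      have "ev i n (res G U V n s i) x = ev i n (s i) x"
        using zspace.ev_res[OF X[OF i] tr[OF i] tV[OF i] sub si[OF i] x] i by (simp add: res_G)
      also have "\<dots> = gev n s (cl i x)" using gev_cl[OF U s i xU] by simp
      finally show ?thesis using v St_trace[OF i xU] by simp
    qed
    show ?thesis using sec_G_I[OF V * **] v VU by auto
  qed
qed

lemma zmor_glue_incl:
  assumes i: "i \<in> I"
  shows "zmor (X i) (ev i) G gev (glue_incl K W src tgt j1 j2 i)"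
    and "\<And>x. x \<in> pts (X i) \<Longrightarrow> gSt (pt (glue_incl K W src tgt j1 j2 i) x) = St i x"
proof -
  have pt: "pt (glue_incl K W src tgt j1 j2 i) = cl i" by (simp add: glue_incl_def cl_def)
  have pre: "preim (X i) (glue_incl K W src tgt j1 j2 i) U = trace U i" for U
    by (simp add: preim_def pt trace_def)
  show "gSt (pt (glue_incl K W src tgt j1 j2 i) x) = St i x" if "x \<in> pts (X i)" for x
    using gSt_cl[OF i that] pt by simp
  show "zmor (X i) (ev i) G gev (glue_incl K W src tgt j1 j2 i)"
    unfolding zmor_def
  proof (intro conjI allI ballI impI)
    show "continuous_map (topo (X i)) (topo G) (pt (glue_incl K W src tgt j1 j2 i))"
      unfolding continuous_map pt
      using openin_trace[OF _ i] cl_points[OF i] by (auto simp: topspace_G trace_def)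
    fix V n s assume s: "s \<in> car (sec G V) n" and V: "openin (topo G) V"
    show "sh (glue_incl K W src tgt j1 j2 i) V n s \<in> car (sec (X i) (preim (X i) (glue_incl K W src tgt j1 j2 i) V)) n"
      using sec_i[OF V s i] by (simp add: pre) (simp add: glue_incl_def)
    show "ev i n (sh (glue_incl K W src tgt j1 j2 i) V n s) x = gev n s (pt (glue_incl K W src tgt j1 j2 i) x)"
      if "x \<in> preim (X i) (glue_incl K W src tgt j1 j2 i) V" for x
      using gev_cl[OF V s i] that unfolding pre pt by (simp add: glue_incl_def)
  qed
qed

end

section \<open>The local rings of Z and of its variants\<close>

definition B_coeffs :: "nat \<Rightarrow> nat \<Rightarrow> rat list set" where
  "B_coeffs N = coeff_lists (Z_inverted N)"

definition A_coeffs :: "nat \<Rightarrow> nat \<Rightarrow> rat list set" where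
  "A_coeffs N n = coeff_lists (Z_inverted N) n \<inter> Zinf_lists n"

definition Z_coeffs :: "nat \<Rightarrow> rat list set" where
  "Z_coeffs = coeff_lists \<int>"

lemma Z_inverted_iff:
  assumes "N \<ge> 1"
  shows "x \<in> Z_inverted N \<longleftrightarrow> (\<exists>k. x * of_nat N ^ k \<in> \<int>)"
proof
  assume "x \<in> Z_inverted N"
  then obtain a k where "x = of_int a / of_nat N ^ k" by (auto simp: Z_inverted_def)
  then have "x * of_nat N ^ k = of_int a" using assms by simp
  then show "\<exists>k. x * of_nat N ^ k \<in> \<int>" by (metis Ints_of_int)
next
  assume "\<exists>k. x * of_nat N ^ k \<in> \<int>"
  then obtain a k where "x * of_nat N ^ k = of_int a" by (auto elim: Ints_cases)
  then have "x = of_int a / of_nat N ^ k" using assms by (simp add: field_simps)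
  then show "x \<in> Z_inverted N" by (auto simp: Z_inverted_def)
qed

lemma Ints_power_mono:
  fixes x :: rat
  assumes "x * of_nat N ^ k \<in> \<int>" "k \<le> l"
  shows "x * of_nat N ^ l \<in> \<int>"
proof -
  have "x * of_nat N ^ l = (x * of_nat N ^ k) * of_nat (N ^ (l - k))"
    using assms(2) by (simp add: mult.assoc flip: power_add)
  then show ?thesis using assms(1) by (metis Ints_mult Ints_of_nat)
qed

lemma Z_inverted_1: "Z_inverted 1 = \<int>"
  using Z_inverted_iff[of 1] by auto

text \<open>Lets \<open>Z\<close> be treated as the ring \<open>B_1\<close>.\<close>

lemma B_coeffs_1: "B_coeffs 1 = Z_coeffs"
  by (simp add: B_coeffs_def Z_coeffs_def Z_inverted_1 fun_eq_iff)

lemma Ints_Z_inverted: "x \<in> \<int> \<Longrightarrow> x \<in> Z_inverted N"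
proof -
  assume "x \<in> \<int>"
  then obtain z where "x = of_int z / of_nat N ^ 0" by (auto elim: Ints_cases)
  then show ?thesis unfolding Z_inverted_def by blast
qed

lemma Z_inverted_closed:
  assumes N: "N \<ge> 1" and x: "x \<in> Z_inverted N" and y: "y \<in> Z_inverted N"
  shows "x + y \<in> Z_inverted N" "x * y \<in> Z_inverted N"
proof -
  obtain k l where k: "x * of_nat N ^ k \<in> \<int>" and l: "y * of_nat N ^ l \<in> \<int>"
    using x y Z_inverted_iff[OF N] by blast
  have "x * of_nat N ^ (k + l) \<in> \<int>" "y * of_nat N ^ (k + l) \<in> \<int>"
    using Ints_power_mono[OF k] Ints_power_mono[OF l] by auto
  then have "(x + y) * of_nat N ^ (k + l) \<in> \<int>" by (simp add: distrib_right)
  then show "x + y \<in> Z_inverted N" using Z_inverted_iff[OF N] by blast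
  have "(x * of_nat N ^ k) * (y * of_nat N ^ l) \<in> \<int>" using k l by simp
  then have "(x * y) * of_nat N ^ (k + l) \<in> \<int>" by (simp add: power_add ac_simps)
  then show "x * y \<in> Z_inverted N" using Z_inverted_iff[OF N] by blast
qed

lemma Z_inverted_sum: "N \<ge> 1 \<Longrightarrow> (\<And>i. i \<in> S \<Longrightarrow> f i \<in> Z_inverted N) \<Longrightarrow> sum f S \<in> Z_inverted N"
  by (induction S rule: infinite_finite_induct) (auto simp: Ints_Z_inverted Z_inverted_closed)

lemma inverse_Z_inverted: "N \<ge> 1 \<Longrightarrow> inverse (of_nat N) ^ k \<in> Z_inverted N"
  using Z_inverted_iff[of N] by (auto simp: power_mult_distrib[symmetric] intro!: exI[of _ k])

lemma common_exponent:
  assumes N: "N \<ge> 1" and v: "set v \<subseteq> Z_inverted N"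
  shows "\<exists>k. \<forall>l\<ge>k. \<forall>x\<in>set v. x * of_nat N ^ l \<in> \<int>"
  using v
proof (induction v)
  case (Cons x v)
  then obtain k where k: "\<forall>l\<ge>k. \<forall>x\<in>set v. x * of_nat N ^ l \<in> \<int>" by auto
  obtain m where m: "x * of_nat N ^ m \<in> \<int>" using Cons.prems Z_inverted_iff[OF N] by auto
  then show ?case using k Ints_power_mono[OF m] by (intro exI[of _ "max k m"]) auto
qed auto

lemma common_int_denominator:
  "\<exists>d::nat. d > 0 \<and> (\<forall>x\<in>set (v :: rat list). of_nat d * x \<in> \<int>)"
proof (induction v)
  case (Cons x v)
  then obtain d where d: "d > 0" "\<forall>x\<in>set v. of_nat d * x \<in> \<int>" by blast
  obtain a b where ab: "x = of_int a / of_int b" "b > 0"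
    by (cases x) (auto simp: Fract_of_int_quotient)
  have "of_nat (d * nat b) * x = of_int (int d * a)" using ab by simp
  then have "of_nat (d * nat b) * x \<in> \<int>" by (metis Ints_of_int)
  moreover have "of_nat (d * nat b) * y \<in> \<int>" if "y \<in> set v" for y
  proof -
    have "of_nat (d * nat b) * y = of_nat (nat b) * (of_nat d * y)" by simp
    then show ?thesis using d that by (metis Ints_mult Ints_of_nat)
  qed
  ultimately show ?case using d ab by (intro exI[of _ "d * nat b"]) auto
qed (auto intro: exI[of _ 1])

text \<open>The bound is given for all large exponents so that it can be combined with other lower
  bounds on the exponent.\<close>

lemma power_archimedean:
  assumes "q > 1"
  shows "\<exists>k. \<forall>l\<ge>k. (x::rat) \<le> q ^ l"
proof -
  have "1 < real_of_rat q" using assms by simp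
  then obtain k where "real_of_rat x < real_of_rat q ^ k" using real_arch_pow by blast
  then have k: "x < q ^ k" by (simp add: of_rat_less flip: of_rat_power)
  have "x \<le> q ^ l" if "k \<le> l" for l
  proof -
    have "q ^ k \<le> q ^ l" using that assms by (intro power_increasing) auto
    then show ?thesis using k by linarith
  qed
  then show ?thesis by blast
qed

text \<open>The l1 norm is submultiplicative under substitution. This closes both \<open>A_N\<close>
  and, later, the graded ring under composition.\<close>

lemma sum_abs_qlin:
  assumes "\<And>x. x \<in> set xs \<Longrightarrow> (\<Sum>j<n. \<bar>x ! j\<bar>) \<le> c"
  shows "(\<Sum>j<n. \<bar>qlin n t xs ! j\<bar>) \<le> (\<Sum>i<length xs. \<bar>t ! i\<bar>) * c"
proof -
  have "(\<Sum>j<n. \<bar>qlin n t xs ! j\<bar>) \<le> (\<Sum>j<n. \<Sum>i<length xs. \<bar>t ! i\<bar> * \<bar>xs ! i ! j\<bar>)"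
  proof (rule sum_mono)
    fix j assume "j \<in> {..<n}"
    then show "\<bar>qlin n t xs ! j\<bar> \<le> (\<Sum>i<length xs. \<bar>t ! i\<bar> * \<bar>xs ! i ! j\<bar>)"
      using sum_abs[of "\<lambda>i. t ! i * xs ! i ! j" "{..<length xs}"] by (simp add: abs_mult)
  qed
  also have "\<dots> = (\<Sum>i<length xs. \<bar>t ! i\<bar> * (\<Sum>j<n. \<bar>xs ! i ! j\<bar>))"
    by (subst sum.swap) (simp add: sum_distrib_left)
  also have "\<dots> \<le> (\<Sum>i<length xs. \<bar>t ! i\<bar> * c)"
    by (rule sum_mono, rule mult_left_mono) (use assms in auto)
  finally show ?thesis by (simp add: sum_distrib_right)
qed

lemma B_coeffs_iff: "v \<in> B_coeffs N n \<longleftrightarrow> length v = n \<and> (\<forall>x\<in>set v. x \<in> Z_inverted N)"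
  by (auto simp: B_coeffs_def coeff_lists_def)

lemma B_coeffs_nth: "v \<in> B_coeffs N n \<longleftrightarrow> length v = n \<and> (\<forall>i<n. v ! i \<in> Z_inverted N)"
  by (auto simp: B_coeffs_iff all_set_conv_all_nth)

lemma Z_coeffs_iff: "v \<in> Z_coeffs n \<longleftrightarrow> length v = n \<and> (\<forall>x\<in>set v. x \<in> \<int>)"
  by (auto simp: Z_coeffs_def coeff_lists_def)

lemma A_coeffs_iff: "v \<in> A_coeffs N n \<longleftrightarrow> v \<in> B_coeffs N n \<and> (\<Sum>i<n. \<bar>v ! i\<bar>) \<le> 1"
  by (auto simp: A_coeffs_def B_coeffs_def Zinf_lists_def coeff_lists_def)

lemma qnum_B: "qnum (B_coeffs N) = Z_inverted N"
  by (auto simp: qnum_def B_coeffs_iff One_nat_def)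

lemma qnum_Z: "qnum Z_coeffs = \<int>"
  by (auto simp: qnum_def Z_coeffs_iff One_nat_def)

lemma qnum_A: "qnum (A_coeffs N) = {r \<in> Z_inverted N. \<bar>r\<bar> \<le> 1}"
  by (auto simp: qnum_def A_coeffs_iff B_coeffs_iff One_nat_def)

lemma qlin_B: "N \<ge> 1 \<Longrightarrow> t \<in> B_coeffs N (length xs) \<Longrightarrow> set xs \<subseteq> B_coeffs N n \<Longrightarrow> qlin n t xs \<in> B_coeffs N n"
proof -
  assume N: "N \<ge> 1" and t: "t \<in> B_coeffs N (length xs)" and xs: "set xs \<subseteq> B_coeffs N n"
  have "qlin n t xs ! j \<in> Z_inverted N" if j: "j < n" for j
  proof -
    have "t ! i * xs ! i ! j \<in> Z_inverted N" if i: "i < length xs" for i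
      using t subsetD[OF xs nth_mem[OF i]] i j Z_inverted_closed(2)[OF N] by (simp add: B_coeffs_nth)
    then show ?thesis using j by (auto intro!: Z_inverted_sum[OF N])
  qed
  then show ?thesis by (simp add: B_coeffs_nth)
qed

lemma qvar_B: "qvar n i \<in> B_coeffs N n"
  by (auto simp: B_coeffs_nth Ints_Z_inverted)

lemma qmonad_B:
  assumes N: "N \<ge> 1"
  shows "qmonad (B_coeffs N)"
  unfolding qmonad_def
proof (intro conjI allI impI ballI)
  show "\<And>n v. v \<in> B_coeffs N n \<Longrightarrow> length v = n" by (simp add: B_coeffs_iff)
  show "\<And>n i. qvar n i \<in> B_coeffs N n" by (rule qvar_B)
  show "\<And>n t xs. t \<in> B_coeffs N (length xs) \<and> set xs \<subseteq> B_coeffs N n \<Longrightarrow> qlin n t xs \<in> B_coeffs N n"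
    using qlin_B[OF N] by blast
  show "[] \<in> B_coeffs N 0" by (simp add: B_coeffs_iff)
  fix v :: "rat list"
  obtain d :: nat where d: "d > 0" "\<forall>x\<in>set v. of_nat d * x \<in> \<int>" using common_int_denominator by blast
  then show "\<exists>s\<in>qnum (B_coeffs N). s \<noteq> 0 \<and> qscale s v \<in> B_coeffs N (length v)"
    unfolding qnum_B by (intro bexI[of _ "of_nat d"]) (auto simp: B_coeffs_iff qscale_def intro: Ints_Z_inverted)
qed

lemma qmonad_Z: "qmonad Z_coeffs"
  using qmonad_B[of 1] B_coeffs_1 by simp

lemma qmonad_A:
  assumes N: "N \<ge> 2"
  shows "qmonad (A_coeffs N)"
  unfolding qmonad_def
proof (intro conjI allI impI ballI)
  have N1: "N \<ge> 1" using N by simp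
  show "\<And>n v. v \<in> A_coeffs N n \<Longrightarrow> length v = n" by (simp add: A_coeffs_iff B_coeffs_iff)
  show "qvar n i \<in> A_coeffs N n" if "i < n" for n i
  proof -
    have "(\<Sum>j<n. \<bar>qvar n i ! j\<bar>) = (\<Sum>j<n. if j = i then 1 else 0)" by (intro sum.cong) auto
    then show ?thesis using that qvar_B by (simp add: A_coeffs_iff)
  qed
  show "[] \<in> A_coeffs N 0" by (simp add: A_coeffs_iff B_coeffs_iff)
  show "qlin n t xs \<in> A_coeffs N n" if *: "t \<in> A_coeffs N (length xs) \<and> set xs \<subseteq> A_coeffs N n" for n t xs
  proof -
    have "qlin n t xs \<in> B_coeffs N n" using * by (intro qlin_B[OF N1]) (auto simp: A_coeffs_iff)
    moreover have "(\<Sum>j<n. \<bar>qlin n t xs ! j\<bar>) \<le> 1"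
    proof -
      have "(\<Sum>j<n. \<bar>qlin n t xs ! j\<bar>) \<le> (\<Sum>i<length xs. \<bar>t ! i\<bar>) * 1"
        using * by (intro sum_abs_qlin) (auto simp: A_coeffs_iff)
      also have "\<dots> \<le> 1" using * by (simp add: A_coeffs_iff)
      finally show ?thesis .
    qed
    ultimately show ?thesis by (simp add: A_coeffs_iff)
  qed
  fix v :: "rat list"
  obtain d :: nat where d: "d > 0" "\<forall>x\<in>set v. of_nat d * x \<in> \<int>" using common_int_denominator by blast
  \<comment> \<open>For the last clause of \<open>qmonad\<close> the multiplier is
    \<open>d / N^k\<close>: \<open>d\<close> clears the denominators, and \<open>k\<close> is so
    large that the multiplier and the scaled vector both have norm at most \<open>1\<close>. Here
    powers of \<open>N\<close> must be unbounded.\<close>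
  obtain k where k: "of_nat d \<le> (of_nat N :: rat) ^ k" "(\<Sum>i<length v. \<bar>of_nat d * v ! i\<bar>) \<le> of_nat N ^ k"
    using power_archimedean[of "of_nat N" "of_nat d"]
      power_archimedean[of "of_nat N" "\<Sum>i<length v. \<bar>of_nat d * v ! i\<bar>"] N
    by simp (meson linear order_refl)
  let ?s = "of_nat d * inverse (of_nat N) ^ k :: rat"
  have Nk: "(of_nat N :: rat) ^ k > 0" using N by simp
  have s: "?s = of_nat d / of_nat N ^ k" by (simp add: power_inverse divide_inverse)
  have "?s \<in> qnum (A_coeffs N)"
  proof -
    have "\<bar>?s\<bar> \<le> 1" unfolding s using k(1) Nk by simp
    moreover have "?s \<in> Z_inverted N"
      by (rule Z_inverted_closed(2)[OF N1 Ints_Z_inverted inverse_Z_inverted[OF N1]]) simp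
    ultimately show ?thesis unfolding qnum_A by blast
  qed
  moreover have "qscale ?s v \<in> B_coeffs N (length v)"
  proof -
    have "?s * x \<in> Z_inverted N" if "x \<in> set v" for x
    proof -
      have "?s * x = (of_nat d * x) * inverse (of_nat N) ^ k" by simp
      then show ?thesis
        using d that inverse_Z_inverted[OF N1] Z_inverted_closed(2)[OF N1 Ints_Z_inverted] by metis
    qed
    then show ?thesis by (simp add: B_coeffs_iff qscale_def)
  qed
  moreover have "(\<Sum>i<length v. \<bar>qscale ?s v ! i\<bar>) \<le> 1"
  proof -
    have "(\<Sum>i<length v. \<bar>qscale ?s v ! i\<bar>) = (\<Sum>i<length v. \<bar>of_nat d * v ! i\<bar>) / of_nat N ^ k"
      unfolding s sum_divide_distrib by (intro sum.cong) (auto simp: abs_mult)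
    then show ?thesis using k(2) Nk by simp
  qed
  ultimately show "\<exists>s\<in>qnum (A_coeffs N). s \<noteq> 0 \<and> qscale s v \<in> A_coeffs N (length v)"
    using d N by (intro bexI[of _ ?s]) (auto simp: A_coeffs_iff)
qed

text \<open>\<open>[1, 1]\<close> is addition and \<open>-1\<close> is negation, so \<open>L\<close>
  contains all integers, and integral vectors are sums of integral multiples of the
  variables.\<close>

lemma Z_coeffs_subset:
  assumes L: "qmonad L" and "[1, 1] \<in> L 2" "-1 \<in> qnum L"
  shows "Z_coeffs n \<subseteq> L n"
proof
  have add: "map2 (+) x y \<in> L n" if "x \<in> L n" "y \<in> L n" for x y n
  proof -
    have l: "length x = n" "length y = n" using that qmonad_length[OF L] by auto
    have "map2 (+) x y = qlin n [1, 1] [x, y]"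
      using l by (intro nth_equalityI) (auto simp: numeral_2_eq_2)
    then show ?thesis using qmonad_lin[OF L assms(2), of "[x, y]" n] that by simp
  qed
  have num_add: "r + s \<in> qnum L" if "r \<in> qnum L" "s \<in> qnum L" for r s
    using add[of "[r]" 1 "[s]"] that by (simp add: qnum_def)
  have "of_nat k \<in> qnum L" for k
    by (induction k) (auto simp: qnum_zero[OF L] qnum_one[OF L] num_add)
  then have nats: "of_nat k \<in> qnum L" "- of_nat k \<in> qnum L" for k
    using qnum_mult[OF L assms(3), of "of_nat k"] by auto
  have ints: "r \<in> qnum L" if r: "r \<in> \<int>" for r
  proof -
    obtain z where "r = of_int z" using r by (rule Ints_cases)
    then show ?thesis using nats by (cases z) (auto simp del: of_nat_Suc)
  qed
  fix v assume v: "v \<in> Z_coeffs n"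
  then have l: "length v = n" by (simp add: Z_coeffs_iff)
  \<comment> \<open>Induction on the number \<open>m\<close> of coordinates of \<open>v\<close>
    already filled in, the others being \<open>0\<close>.\<close>
  have "map (\<lambda>j. if j < m then v ! j else 0) [0..<n] \<in> L n" if "m \<le> n" for m
    using that
  proof (induction m)
    case 0
    then show ?case using qmonad_replicate_0[OF L, of n] by (simp add: map_replicate_const)
  next
    case (Suc m)
    let ?w = "map (\<lambda>j. if j < m then v ! j else 0) [0..<n]"
    have "v ! m \<in> \<int>" using v Suc.prems l by (simp add: Z_coeffs_iff)
    then have "qscale (v ! m) (qvar n m) \<in> L n"
      using ints qmonad_qscale[OF L] qmonad_var[OF L] Suc.prems by simp
    then have "map2 (+) ?w (qscale (v ! m) (qvar n m)) \<in> L n" using Suc add by simp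
    moreover have "map2 (+) ?w (qscale (v ! m) (qvar n m)) = map (\<lambda>j. if j < Suc m then v ! j else 0) [0..<n]"
      by (rule nth_equalityI) (auto simp: less_Suc_eq)
    ultimately show ?case by simp
  qed
  from this[of n] have "map (\<lambda>j. if j < n then v ! j else 0) [0..<n] \<in> L n" by simp
  moreover have "map (\<lambda>j. if j < n then v ! j else 0) [0..<n] = v" using l by (intro nth_equalityI) auto
  ultimately show "v \<in> L n" by simp
qed

lemma B_scale:
  assumes N: "N \<ge> 1" and v: "v \<in> B_coeffs N n"
  shows "\<exists>k. \<forall>l\<ge>k. qscale (of_nat N ^ l) v \<in> Z_coeffs n"
  using common_exponent[OF N, of v] v unfolding B_coeffs_iff Z_coeffs_iff
  by (auto simp: qscale_def mult.commute subset_iff)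

lemma B_coeffs_subset:
  assumes L: "qmonad L" and Z: "\<And>n. Z_coeffs n \<subseteq> L n" and N: "N \<ge> 1" "inverse (of_nat N) \<in> qnum L"
  shows "B_coeffs N n \<subseteq> L n"
proof
  fix v assume "v \<in> B_coeffs N n"
  then obtain k where k: "qscale (of_nat N ^ k) v \<in> Z_coeffs n" using B_scale[OF N(1)] by blast
  have "qscale (inverse (of_nat N) ^ k) (qscale (of_nat N ^ k) v) \<in> L n"
    using qmonad_qscale[OF L qnum_power[OF L N(2)]] k Z by blast
  then show "v \<in> L n" using N(1) by (simp flip: power_mult_distrib)
qed

lemma Z_subset_B: "Z_coeffs n \<subseteq> B_coeffs N n"
  by (auto simp: Z_coeffs_iff B_coeffs_iff Ints_Z_inverted)

lemma A_subset_B: "A_coeffs N n \<subseteq> B_coeffs N n"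
  by (auto simp: A_coeffs_iff)

lemma one_one_Z: "[1, 1] \<in> Z_coeffs 2"
  by (simp add: Z_coeffs_iff)

lemma minus_one_A: "-1 \<in> qnum (A_coeffs N)"
  by (simp add: qnum_A Ints_Z_inverted)

lemma inverse_A: "N \<ge> 1 \<Longrightarrow> inverse (of_nat N) ^ k \<in> qnum (A_coeffs N)"
  using inverse_Z_inverted[of N k] by (simp add: qnum_A power_inverse field_simps)

lemma qnum_mono: "(\<And>n. C n \<subseteq> D n) \<Longrightarrow> qnum C \<subseteq> qnum D"
  by (auto simp: qnum_def)

lemma qunits_I: "r \<in> qnum L \<Longrightarrow> inverse r \<in> qnum L \<Longrightarrow> r \<noteq> 0 \<Longrightarrow> r \<in> qunits L"
  by (simp add: qunits_def)

lemma qunits_inverse: "r \<in> qunits L \<Longrightarrow> inverse r \<in> qunits L"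
  by (simp add: qunits_def)

lemma of_nat_unit:
  assumes L: "qmonad L" and Z: "\<And>n. Z_coeffs n \<subseteq> L n" and N: "N \<ge> 1" "inverse (of_nat N) \<in> qnum L"
  shows "of_nat N ^ k \<in> qunits L" "inverse (of_nat N) ^ k \<in> qunits L"
proof -
  have "of_nat N ^ k \<in> qnum L" using qnum_mono[of Z_coeffs L, OF Z] by (auto simp: qnum_Z)
  moreover have "inverse (of_nat N) ^ k \<in> qnum L" by (rule qnum_power[OF L N(2)])
  ultimately show "of_nat N ^ k \<in> qunits L" using N by (intro qunits_I) (auto simp: power_inverse)
  from qunits_inverse[OF this] show "inverse (of_nat N) ^ k \<in> qunits L" by (simp add: power_inverse)
qed

lemma A_scale:
  assumes N: "N \<ge> 2" and v: "v \<in> B_coeffs N n"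
  shows "\<exists>k. qscale (inverse (of_nat N) ^ k) v \<in> A_coeffs N n"
proof -
  obtain k where k: "(\<Sum>i<n. \<bar>v ! i\<bar>) \<le> of_nat N ^ k" using power_archimedean[of "of_nat N"] N by fastforce
  have Nk: "(of_nat N :: rat) ^ k > 0" and N1: "N \<ge> 1" using N by simp_all
  have l: "length v = n" using v by (simp add: B_coeffs_iff)
  have "(\<Sum>i<n. \<bar>qscale (inverse (of_nat N) ^ k) v ! i\<bar>) = (\<Sum>i<n. \<bar>v ! i\<bar>) / of_nat N ^ k"
    unfolding sum_divide_distrib using l by (intro sum.cong) (auto simp: abs_mult power_inverse field_simps)
  also have "\<dots> \<le> 1" using k Nk by simp
  finally have "(\<Sum>i<n. \<bar>qscale (inverse (of_nat N) ^ k) v ! i\<bar>) \<le> 1" .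
  moreover have "qscale (inverse (of_nat N) ^ k) v \<in> B_coeffs N n"
    using qmonad_qscale[OF qmonad_B[OF N1] _ v] inverse_Z_inverted[OF N1] by (simp add: qnum_B)
  ultimately show ?thesis by (auto simp: A_coeffs_iff)
qed

section \<open>Comparison of the local rings of \<open>Z\<close>, \<open>B_N\<close> and
  \<open>A_N\<close>\<close>

lemma one_unit: "qmonad C \<Longrightarrow> qlocal L \<Longrightarrow> 1 \<in> qnum C \<inter> qunits L"
  using qnum_one qlocal_qmonad by (auto simp: qunits_def)

text \<open>Powers of \<open>N\<close> turn vectors over \<open>Z[1/N]\<close> into integral ones
  and are units in \<open>L\<close>, so \<open>stalks_transfer\<close> applies.\<close>

lemma stalks_B_Z:
  assumes N: "N \<ge> 1" and L: "L \<in> stalks (B_coeffs N)"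
  shows "L \<in> stalks Z_coeffs" "inverse (of_nat N) \<in> qnum L"
proof -
  note sup = stalks_superset[OF qmonad_B[OF N] L]
  note loc = stalks_qlocal[OF qmonad_B[OF N] L]
  show inv: "inverse (of_nat N) \<in> qnum L"
    using inverse_Z_inverted[OF N, of 1] qnum_mono[of "B_coeffs N" L, OF sup] by (auto simp: qnum_B)
  have ZL: "Z_coeffs n \<subseteq> L n" for n using Z_subset_B sup by blast
  show "L \<in> stalks Z_coeffs"
  proof (rule stalks_transfer[OF qmonad_Z qmonad_B[OF N] L ZL])
    fix n d assume "d \<in> B_coeffs N n"
    then obtain k where "qscale (of_nat N ^ k) d \<in> Z_coeffs n" using B_scale[OF N] by blast
    then show "\<exists>s\<in>qnum Z_coeffs \<inter> qunits L. qscale s d \<in> Z_coeffs n"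
      using of_nat_unit[OF qlocal_qmonad[OF loc] ZL N inv] by (intro bexI[of _ "of_nat N ^ k"]) (auto simp: qnum_Z)
  qed
qed

lemma stalks_Z_B:
  assumes N: "N \<ge> 1" and L: "L \<in> stalks Z_coeffs" "inverse (of_nat N) \<in> qnum L"
  shows "L \<in> stalks (B_coeffs N)"
proof -
  note sup = stalks_superset[OF qmonad_Z L(1)] and loc = stalks_qlocal[OF qmonad_Z L(1)]
  show ?thesis
  proof (rule stalks_transfer[OF qmonad_B[OF N] qmonad_Z L(1)])
    show "B_coeffs N n \<subseteq> L n" for n by (rule B_coeffs_subset[OF qlocal_qmonad[OF loc] sup N L(2)])
    fix n d assume "d \<in> Z_coeffs n"
    then show "\<exists>s\<in>qnum (B_coeffs N) \<inter> qunits L. qscale s d \<in> B_coeffs N n"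
      using one_unit[OF qmonad_B[OF N] loc] Z_subset_B by (intro bexI[of _ 1]) auto
  qed
qed

text \<open>Powers of \<open>1/N\<close> bring an integral vector into \<open>A_N\<close>, and they
  are units in \<open>L\<close>. The part of \<open>Spec Z\<close> where \<open>N\<close> is
  invertible thus lies in \<open>Spec A_N\<close>.\<close>

lemma stalks_Z_A:
  assumes N: "N \<ge> 2" and L: "L \<in> stalks Z_coeffs" "inverse (of_nat N) \<in> qnum L"
  shows "L \<in> stalks (A_coeffs N)"
proof -
  have N1: "N \<ge> 1" using N by simp
  note sup = stalks_superset[OF qmonad_Z L(1)] and loc = stalks_qlocal[OF qmonad_Z L(1)]
  show ?thesis
  proof (rule stalks_transfer[OF qmonad_A[OF N] qmonad_Z L(1)])
    show "A_coeffs N n \<subseteq> L n" for n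
      using B_coeffs_subset[OF qlocal_qmonad[OF loc] sup N1 L(2)] A_subset_B by blast
    fix n d assume "d \<in> Z_coeffs n"
    then obtain k where "qscale (inverse (of_nat N) ^ k) d \<in> A_coeffs N n"
      using A_scale[OF N, of d n] Z_subset_B[of n N] by blast
    then show "\<exists>s\<in>qnum (A_coeffs N) \<inter> qunits L. qscale s d \<in> A_coeffs N n"
      using of_nat_unit(2)[OF qlocal_qmonad[OF loc] sup N1 L(2)] inverse_A[OF N1]
      by (intro bexI[of _ "inverse (of_nat N) ^ k"]) auto
  qed
qed

lemma stalks_A_inverse:
  assumes N: "N \<ge> 2" and L: "L \<in> stalks (A_coeffs N)"
  shows "inverse (of_nat N) \<in> qnum L"
  using inverse_A[of N 1] qnum_mono[of "A_coeffs N" L, OF stalks_superset[OF qmonad_A[OF N] L]] N by auto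

text \<open>\<open>[1, 1]\<close> and \<open>-1\<close>, which \<open>A_N\<close> contains, generate
  \<open>Z\<close> inside \<open>L\<close>; powers of \<open>N\<close> are then units that clear
  denominators. So the single operation \<open>[1, 1]\<close> separates the points over
  \<open>Z\<close> from infinity.\<close>

lemma stalks_A_Z:
  assumes N: "N \<ge> 2" and L: "L \<in> stalks (A_coeffs N)" "[1, 1] \<in> L 2"
  shows "L \<in> stalks Z_coeffs"
proof -
  have N1: "N \<ge> 1" using N by simp
  note sup = stalks_superset[OF qmonad_A[OF N] L(1)] and loc = stalks_qlocal[OF qmonad_A[OF N] L(1)]
  have ZL: "Z_coeffs n \<subseteq> L n" for n
    using Z_coeffs_subset[OF qlocal_qmonad[OF loc] L(2)] minus_one_A[of N] qnum_mono[of "A_coeffs N" L, OF sup] by blast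
  show ?thesis
  proof (rule stalks_transfer[OF qmonad_Z qmonad_A[OF N] L(1) ZL])
    fix n d assume "d \<in> A_coeffs N n"
    then obtain k where "qscale (of_nat N ^ k) d \<in> Z_coeffs n" using B_scale[OF N1] A_subset_B by blast
    then show "\<exists>s\<in>qnum Z_coeffs \<inter> qunits L. qscale s d \<in> Z_coeffs n"
      using of_nat_unit[OF qlocal_qmonad[OF loc] ZL N1 stalks_A_inverse[OF N L(1)]]
      by (intro bexI[of _ "of_nat N ^ k"]) (auto simp: qnum_Z)
  qed
qed

lemma one_one_not_A: "[1, 1] \<notin> A_coeffs N 2"
  by (simp add: A_coeffs_iff numeral_2_eq_2)

lemma qunits_A: "r \<in> qunits (A_coeffs N) \<Longrightarrow> r = 1 \<or> r = -1"
proof -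
  assume "r \<in> qunits (A_coeffs N)"
  then have "\<bar>r\<bar> \<le> 1" "\<bar>inverse r\<bar> \<le> 1" "r \<noteq> 0" by (auto simp: qunits_def qnum_A)
  then have "\<bar>r\<bar> = 1" by (simp add: field_simps abs_inverse)
  then show ?thesis by linarith
qed

lemma pm_one_scale: "r = 1 \<or> r = -1 \<Longrightarrow> v \<in> A_coeffs N n \<Longrightarrow> qscale r v \<in> A_coeffs N n"
  if "N \<ge> 2" for r
  using qmonad_qscale[OF qmonad_A[OF that] minus_one_A] by auto

text \<open>Outside the ideal of all \<open>r\<close> with \<open>\<bar>r\<bar> < 1\<close> there
  are only \<open>1\<close> and \<open>-1\<close>, so localizing there changes nothing.\<close>

lemma infinity_stalk:
  assumes N: "N \<ge> 2"
  shows "A_coeffs N \<in> stalks (A_coeffs N)"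
proof -
  note A = qmonad_A[OF N]
  let ?p = "{r \<in> qnum (A_coeffs N). \<bar>r\<bar> < 1}"
  have p: "qprime (A_coeffs N) ?p"
    unfolding qprime_def
  proof (intro conjI allI impI ballI)
    show "1 \<notin> ?p" by simp
    fix r s assume "r \<in> qnum (A_coeffs N) - ?p" "s \<in> qnum (A_coeffs N) - ?p"
    then have "\<bar>r\<bar> = 1" "\<bar>s\<bar> = 1" by (auto simp: qnum_A)
    then show "r * s \<notin> ?p" by (simp add: abs_mult)
  next
    fix t rs assume *: "t \<in> A_coeffs N (length rs) \<and> set rs \<subseteq> ?p"
    have "\<bar>\<Sum>i<length rs. t ! i * rs ! i\<bar> < 1"
    \<comment> \<open>The strict inequality of sums needs one nonzero coefficient; without one the
      sum is \<open>0\<close>.\<close>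
    proof (cases "\<exists>i<length rs. t ! i \<noteq> 0")
      case True
      then obtain i where i: "i < length rs" "t ! i \<noteq> 0" by blast
      have rs: "\<bar>rs ! i\<bar> < 1" if "i < length rs" for i
        using subsetD[OF conjunct2[OF *] nth_mem[OF that]] by simp
      have "\<bar>\<Sum>i<length rs. t ! i * rs ! i\<bar> \<le> (\<Sum>i<length rs. \<bar>t ! i\<bar> * \<bar>rs ! i\<bar>)"
        using sum_abs[of "\<lambda>i. t ! i * rs ! i"] by (simp add: abs_mult)
      also have "\<dots> < (\<Sum>i<length rs. \<bar>t ! i\<bar> * 1)"
      proof (rule sum_strict_mono_ex1)
        show "\<forall>i\<in>{..<length rs}. \<bar>t ! i\<bar> * \<bar>rs ! i\<bar> \<le> \<bar>t ! i\<bar> * 1"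
          using rs by (intro ballI mult_left_mono) (auto intro: less_imp_le)
        show "\<exists>i\<in>{..<length rs}. \<bar>t ! i\<bar> * \<bar>rs ! i\<bar> < \<bar>t ! i\<bar> * 1"
          using rs i by (intro bexI[of _ i] mult_strict_left_mono) auto
      qed simp
      also have "\<dots> \<le> 1" using * by (simp add: A_coeffs_iff)
      finally show ?thesis .
    qed simp
    then show "(\<Sum>i<length rs. t ! i * rs ! i) \<in> ?p"
      using * by (auto intro!: qnum_sum[OF A])
  qed blast
  have "qstalk (A_coeffs N) ?p n = A_coeffs N n" for n
  proof
    show "A_coeffs N n \<subseteq> qstalk (A_coeffs N) ?p n" by (rule subset_qstalk[OF A p])
    show "qstalk (A_coeffs N) ?p n \<subseteq> A_coeffs N n"
    proof
      fix v assume "v \<in> qstalk (A_coeffs N) ?p n"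
      then obtain x s where v: "v = qscale (inverse s) x" "x \<in> A_coeffs N n" "s \<in> qnum (A_coeffs N) - ?p"
        by (auto simp: qstalk_def)
      then have "\<bar>s\<bar> = 1" by (auto simp: qnum_A)
      then have "inverse s = 1 \<or> inverse s = -1" by (metis abs_1 abs_eq_iff inverse_1 inverse_minus_eq)
      then show "v \<in> A_coeffs N n" using v pm_one_scale[OF N] by blast
    qed
  qed
  then have "A_coeffs N = qstalk (A_coeffs N) ?p" by auto
  then show ?thesis using p unfolding stalks_def by blast
qed

lemma infinity_not_Z: "A_coeffs N \<notin> stalks Z_coeffs"
  using stalks_superset[OF qmonad_Z, of "A_coeffs N" 2] one_one_Z one_one_not_A by blast

text \<open>If \<open>1/N\<close> were outside \<open>p\<close>, division of
  \<open>[1/N, 1/N]\<close> by it would give \<open>[1, 1]\<close>, and \<open>L\<close> would lie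
  over \<open>Z\<close>. So \<open>1/N\<close> is in \<open>p\<close>, and then so is every
  \<open>s\<close> with \<open>\<bar>s\<bar> < 1\<close>, because some power of \<open>s\<close> is
  a multiple of \<open>1/N\<close> in \<open>A_N\<close>. Only \<open>1\<close> and
  \<open>-1\<close> remain to be inverted.\<close>

lemma stalks_A_infinity:
  assumes N: "N \<ge> 2" and L: "L \<in> stalks (A_coeffs N)" "L \<notin> stalks Z_coeffs"
  shows "L = A_coeffs N"
proof -
  note A = qmonad_A[OF N]
  have N1: "N \<ge> 1" using N by simp
  obtain p where p: "qprime (A_coeffs N) p" "L = qstalk (A_coeffs N) p" using L(1) by (auto simp: stalks_def)
  note inv = inverse_A[OF N1, of 1, simplified]
  have Np: "inverse (of_nat N) \<in> p"
  proof (rule ccontr)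
    assume "inverse (of_nat N) \<notin> p"
    then have *: "inverse (of_nat N) \<in> qnum (A_coeffs N) - p" using inv by simp
    \<comment> \<open>The norm \<open>2/N\<close> is at most \<open>1\<close> because
      \<open>N \<ge> 2\<close>.\<close>
    have "[inverse (of_nat N), inverse (of_nat N)] \<in> A_coeffs N 2"
      using inverse_Z_inverted[OF N1, of 1] N
      by (auto simp: A_coeffs_iff B_coeffs_iff numeral_2_eq_2 field_simps)
    then have "[1, 1] \<in> L 2"
      unfolding p(2) qstalk_iff[OF A p(1)] using * by (intro bexI[of _ "inverse (of_nat N)"]) (auto simp: qscale_def)
    then show False using stalks_A_Z[OF N L(1)] L(2) by blast
  qed
  have out: "s = 1 \<or> s = -1" if s: "s \<in> qnum (A_coeffs N) - p" for s
  proof -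
    have "\<bar>s\<bar> = 1"
    proof (rule ccontr)
      assume "\<bar>s\<bar> \<noteq> 1"
      then have "\<bar>s\<bar> < 1" using s by (auto simp: qnum_A)
      have "\<exists>k. \<bar>s\<bar> ^ k < inverse (of_nat N)"
      proof -
        have abs: "\<bar>real_of_rat s\<bar> = real_of_rat \<bar>s\<bar>" by (simp add: abs_if of_rat_minus)
        have "inverse (of_nat N :: real) > 0" "\<bar>real_of_rat s\<bar> < 1" using N \<open>\<bar>s\<bar> < 1\<close> unfolding abs by simp_all
        then obtain k where "\<bar>real_of_rat s\<bar> ^ k < inverse (of_nat N)" using real_arch_pow_inv by blast
        moreover have "\<bar>real_of_rat s\<bar> ^ k = real_of_rat (\<bar>s\<bar> ^ k)"
          "inverse (of_nat N) = real_of_rat (inverse (of_nat N))"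
          unfolding abs by (simp_all add: of_rat_power of_rat_inverse)
        ultimately show ?thesis using of_rat_less by metis
      qed
      then obtain k where k: "\<bar>s\<bar> ^ k < inverse (of_nat N)" by blast
      have "s ^ k * of_nat N \<in> qnum (A_coeffs N)"
      proof -
        have "\<bar>s ^ k * of_nat N\<bar> \<le> 1" using k N by (simp add: abs_mult power_abs field_simps)
        moreover have "s ^ k \<in> Z_inverted N" using qnum_power[OF A, of s k] s by (simp add: qnum_A)
        ultimately show ?thesis using Z_inverted_closed(2)[OF N1] by (simp add: qnum_A Ints_Z_inverted)
      qed
      then have "(s ^ k * of_nat N) * inverse (of_nat N) \<in> p" using qprime_absorb[OF A p(1)] Np by blast
      moreover have "(s ^ k * of_nat N) * inverse (of_nat N) = s ^ k" using N by simp
      ultimately have "s ^ k \<in> p" by metis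
      moreover have "s ^ k \<in> qnum (A_coeffs N) - p"
        using s qprime_mult[OF A p(1)] qprime_one[OF A p(1)] by (induction k) auto
      ultimately show False by blast
    qed
    then show ?thesis by linarith
  qed
  have "L n = A_coeffs N n" for n
  proof
    show "A_coeffs N n \<subseteq> L n" by (rule stalks_superset[OF A L(1)])
    show "L n \<subseteq> A_coeffs N n"
    proof
      fix v assume "v \<in> L n"
      then obtain x s where "v = qscale (inverse s) x" "x \<in> A_coeffs N n" "s \<in> qnum (A_coeffs N) - p"
        unfolding p(2) by (auto simp: qstalk_def)
      then show "v \<in> A_coeffs N n" using out[of s] pm_one_scale[OF N] by auto
    qed
  qed
  then show ?thesis by auto
qed

lemma qring_linear:
  assumes C: "qmonad C"
  shows "qring (linear_monad C) (\<lambda>_ v. v) C"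
proof
  show "qmonad C" by (rule C)
  show "app (linear_monad C) n t xs \<in> car (linear_monad C) n"
    if "t \<in> car (linear_monad C) (length xs)" "set xs \<subseteq> car (linear_monad C) n" for n t xs
    using qmonad_lin[OF C _ refl, of t xs n] that by (simp add: linear_monad_def qlin_def)
qed (use qmonad_var[OF C] in \<open>simp_all add: linear_monad_def qvar_def qlin_def bij_betw_def inj_on_def\<close>)

lemma qring_B: "N \<ge> 1 \<Longrightarrow> qring (B_ring N) (\<lambda>_ v. v) (B_coeffs N)"
  using qring_linear[OF qmonad_B] by (simp add: B_ring_def ring_monad_def B_coeffs_def)

lemma qring_Z: "qring Z_ring (\<lambda>_ v. v) Z_coeffs"
  using qring_linear[OF qmonad_Z] by (simp add: Z_ring_def ring_monad_def Z_coeffs_def)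

lemma qring_A: "N \<ge> 2 \<Longrightarrow> qring (A_ring N) (\<lambda>_ v. v) (A_coeffs N)"
  using qring_linear[OF qmonad_A] unfolding A_ring_def A_coeffs_def[abs_def] by simp

section \<open>The schemes SpecZhat and the transition morphisms\<close>

abbreviation idv :: "nat \<Rightarrow> rat list \<Rightarrow> rat list" where
  "idv \<equiv> \<lambda>_ v. v"

fun chart_coeffs :: "nat \<Rightarrow> chart \<Rightarrow> nat \<Rightarrow> rat list set" where
  "chart_coeffs N FinChart = Z_coeffs"
| "chart_coeffs N InfChart = A_coeffs N"

definition hat_ev :: "nat \<Rightarrow> hat_section \<Rightarrow> hat_point \<Rightarrow> rat list" where
  "hat_ev = glue_data.gev (\<lambda>_. spec_ev idv)"

definition hat_St :: "nat \<Rightarrow> hat_point \<Rightarrow> nat \<Rightarrow> rat list set" where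
  "hat_St N = glue_data.gSt (\<lambda>c. spec_St idv (chart_coeffs N c))"

definition hat_stalks :: "nat \<Rightarrow> (nat \<Rightarrow> rat list set) set" where
  "hat_stalks N = stalks Z_coeffs \<union> stalks (A_coeffs N)"

lemma qring_chart: "N \<ge> 2 \<Longrightarrow> qring (chart_ring N c) idv (chart_coeffs N c)"
  by (cases c) (auto simp: qring_Z qring_A)

lemma car_rings: "car Z_ring = Z_coeffs" "car (A_ring N) = A_coeffs N" "car (B_ring N) = B_coeffs N"
  by (auto simp: Z_ring_def A_ring_def B_ring_def ring_monad_def linear_monad_def Z_coeffs_def
    A_coeffs_def B_coeffs_def)

lemma chart_subset_B: "chart_coeffs N c n \<subseteq> B_coeffs N n"
  by (cases c) (use Z_subset_B A_subset_B in auto)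

lemma qring_mor_chart:
  assumes "N \<ge> 2"
  shows "qring_mor (chart_ring N c) idv (chart_coeffs N c) (B_ring N) idv (B_coeffs N) (\<lambda>n x. x)"
proof -
  interpret A: qring "chart_ring N c" idv "chart_coeffs N c" by (rule qring_chart[OF assms])
  interpret B: qring "B_ring N" idv "B_coeffs N" using assms by (intro qring_B) simp
  show ?thesis
    by unfold_locales (use chart_subset_B[of N c] in \<open>cases c; auto simp: car_rings\<close>)+
qed

lemma stalks_B_chart: "N \<ge> 2 \<Longrightarrow> L \<in> stalks (B_coeffs N) \<Longrightarrow> L \<in> stalks (chart_coeffs N c)"
  using stalks_B_Z[of N L] stalks_Z_A[of N L] by (cases c) auto

lemma one_one_stalk_Z: "L \<in> stalks Z_coeffs \<Longrightarrow> [1, 1] \<in> L 2"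
  using stalks_superset[OF qmonad_Z] one_one_Z by blast

text \<open>Here and in the next two lemmas, the points belonging to \<open>Z\<close>,
  \<open>A_N\<close> or \<open>B_a\<close> are singled out by one or two elements of their local
  rings; this is what makes these sets open.\<close>

lemma stalk_Z_iff:
  assumes "N \<ge> 2" "L \<in> hat_stalks N"
  shows "L \<in> stalks Z_coeffs \<longleftrightarrow> [1, 1] \<in> L 2"
  using assms one_one_stalk_Z stalks_A_Z by (auto simp: hat_stalks_def)

lemma stalk_A_iff:
  assumes "N \<ge> 2" "L \<in> hat_stalks N"
  shows "L \<in> stalks (A_coeffs N) \<longleftrightarrow> [inverse (of_nat N)] \<in> L 1"
  using assms stalks_Z_A stalks_A_inverse by (auto simp: hat_stalks_def qnum_def)

lemma stalk_B_iff:
  assumes "N \<ge> 2" "L \<in> hat_stalks N" "a \<ge> 1"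
  shows "L \<in> stalks (B_coeffs a) \<longleftrightarrow> [1, 1] \<in> L 2 \<and> [inverse (of_nat a)] \<in> L 1"
  using stalk_Z_iff[OF assms(1,2)] stalks_B_Z[OF assms(3)] stalks_Z_B[OF assms(3)] by (auto simp: qnum_def)

context zspace
begin

text \<open>Stated for any space with these local rings, since it serves \<open>SpecZhat N\<close>
  and \<open>Proj\<close> alike.\<close>

lemma chart_of_hat_stalks:
  assumes N: "N \<ge> 2" and St: "St ` pts X = hat_stalks N"
  shows "chart (chart_coeffs N c)"
proof -
  have mem: "St m \<in> hat_stalks N" if "m \<in> pts X" for m using St that by blast
  have "chart_dom (chart_coeffs N c) =
      {m \<in> pts X. (case c of FinChart \<Rightarrow> [1, 1] \<in> St m 2 | InfChart \<Rightarrow> [inverse (of_nat N)] \<in> St m 1)}"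
    unfolding chart_dom_def using mem stalk_Z_iff[OF N] stalk_A_iff[OF N] by (cases c) auto
  then have "openin (topo X) (chart_dom (chart_coeffs N c))"
    using openin_dom by (cases c) simp_all
  moreover have "stalks (chart_coeffs N c) \<subseteq> hat_stalks N" by (cases c) (auto simp: hat_stalks_def)
  ultimately show ?thesis
    unfolding chart_def St using qring.C[OF qring_chart[OF N]] by blast
qed

lemma chart_dom_of_hat_stalks:
  assumes St: "St ` pts X = hat_stalks N" and m: "m \<in> pts X"
  obtains c where "m \<in> chart_dom (chart_coeffs N c)"
proof -
  have "St m \<in> stalks Z_coeffs \<or> St m \<in> stalks (A_coeffs N)"
    using St m by (auto simp: hat_stalks_def)
  then show ?thesis
    using that[of FinChart] that[of InfChart] m by (auto simp: chart_dom_def)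
qed

end

text \<open>Supplies an injection along which rings are copied into the type of sections; any other
  would do.\<close>

lemma inj_section: "inj (\<lambda>(v :: rat list) (_ :: chart) (_ :: q_point). {(v, v)})"
  by (rule injI) (auto simp: fun_eq_iff)

context
  fixes N :: nat assumes N: "N \<ge> 2"
begin

lemma chart_spec_stalks: "spec_St idv (chart_coeffs N c) ` prime_ideals (chart_ring N c) = stalks (chart_coeffs N c)"
  by (rule qring.St_stalks[OF qring_chart[OF N]])

lemma chart_stalks_hat: "L \<in> stalks (chart_coeffs N c) \<Longrightarrow> L \<in> hat_stalks N"
  by (cases c) (auto simp: hat_stalks_def)

lemma chart_stalks_open:
  obtains F where "finite F" "\<And>L. L \<in> hat_stalks N \<Longrightarrow> L \<in> stalks (chart_coeffs N c) \<longleftrightarrow> F \<subseteq> Sigma UNIV L"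
proof (cases c)
  case FinChart
  then show ?thesis using that[of "{(2, [1, 1])}"] stalk_Z_iff[OF N] by simp
next
  case InfChart
  then show ?thesis using that[of "{(1, [inverse (of_nat N)])}"] stalk_A_iff[OF N] by simp
qed

lemma glue_data_hat:
  "glue_data UNIV (\<lambda>c. Spec (chart_ring N c)) (UNIV :: unit set) (\<lambda>_. Spec (B_ring N))
     (\<lambda>_. FinChart) (\<lambda>_. InfChart) (\<lambda>_. overlap_mor N FinChart) (\<lambda>_. overlap_mor N InfChart)
     (\<lambda>_. spec_ev idv) (\<lambda>c. spec_St idv (chart_coeffs N c)) (\<lambda>_. spec_ev idv) (\<lambda>_. spec_St idv (B_coeffs N))"
proof (rule glue_data.intro)
  have N1: "N \<ge> 1" using N by simp
  interpret B: qring "B_ring N" idv "B_coeffs N" by (rule qring_B[OF N1])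
  note top = qring.topspace_Spec[OF qring_chart[OF N]] B.topspace_Spec
  show "zspace (Spec (chart_ring N c)) (spec_ev idv) (spec_St idv (chart_coeffs N c))" for c
    by (rule qring.zspace_Spec[OF qring_chart[OF N]])
  show "zspace (Spec (B_ring N)) (spec_ev idv) (spec_St idv (B_coeffs N))" by (rule B.zspace_Spec)
  have mor: "zmor (Spec (B_ring N)) (spec_ev idv) (Spec (chart_ring N c)) (spec_ev idv) (overlap_mor N c)" for c
    unfolding overlap_mor_def by (rule qring_mor.zmor_Spec_mor[OF qring_mor_chart[OF N]])
  then show "zmor (Spec (B_ring N)) (spec_ev idv) (Spec (chart_ring N FinChart)) (spec_ev idv) (overlap_mor N FinChart)"
    "zmor (Spec (B_ring N)) (spec_ev idv) (Spec (chart_ring N InfChart)) (spec_ev idv) (overlap_mor N InfChart)" by blast+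
  have St: "spec_St idv (chart_coeffs N c) (pt (overlap_mor N c) w) = spec_St idv (B_coeffs N) w"
    if w: "w \<in> pts (Spec (B_ring N))" for c w
    unfolding overlap_mor_def
  proof (rule qring_mor.St_f[OF qring_mor_chart[OF N]])
    show w': "w \<in> prime_ideals (B_ring N)" using w top by simp
    show "B.St w \<in> stalks (chart_coeffs N c)"
      using w' B.St_stalks by (intro stalks_B_chart[OF N]) blast
  qed
  show "spec_St idv (chart_coeffs N FinChart) (pt (overlap_mor N FinChart) w) = spec_St idv (B_coeffs N) w"
    "spec_St idv (chart_coeffs N InfChart) (pt (overlap_mor N InfChart) w) = spec_St idv (B_coeffs N) w"
    if "w \<in> pts (Spec (B_ring N))" for w using St[OF that] by blast+
  show "i = j \<or> (\<exists>k\<in>UNIV. \<exists>w\<in>pts (Spec (B_ring N)). spec_St idv (B_coeffs N) w = spec_St idv (chart_coeffs N i) x \<and>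
        (FinChart = i \<and> InfChart = j \<or> FinChart = j \<and> InfChart = i))"
    if x: "x \<in> pts (Spec (chart_ring N i))" and y: "y \<in> pts (Spec (chart_ring N j))"
      and eq: "spec_St idv (chart_coeffs N i) x = spec_St idv (chart_coeffs N j) y" for i j x y
  proof (cases "i = j")
    case False
    let ?L = "spec_St idv (chart_coeffs N i) x"
    have L: "?L \<in> stalks (chart_coeffs N i)" "?L \<in> stalks (chart_coeffs N j)"
      using x y eq chart_spec_stalks unfolding top by blast+
    then have "?L \<in> stalks Z_coeffs" "?L \<in> stalks (A_coeffs N)" using False by (cases i; cases j; auto)+
    \<comment> \<open>A local ring common to both charts is one over \<open>Z\<close> that contains
      \<open>1/N\<close>.\<close>
    then have "?L \<in> stalks (B_coeffs N)" using stalks_Z_B[OF N1] stalks_A_inverse[OF N] by blast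
    then obtain w where w: "w \<in> prime_ideals (B_ring N)" "spec_St idv (B_coeffs N) w = ?L"
      using B.St_stalks by (metis imageE)
    have "FinChart = i \<and> InfChart = j \<or> FinChart = j \<and> InfChart = i" using False by (cases i; cases j; auto)
    then show ?thesis using w top by auto
  qed simp
  show "\<exists>F. finite F \<and> F \<subseteq> Sigma UNIV (spec_St idv (chart_coeffs N i) x) \<and>
      (\<forall>j\<in>UNIV. \<forall>y\<in>pts (Spec (chart_ring N j)). F \<subseteq> Sigma UNIV (spec_St idv (chart_coeffs N j) y) \<longrightarrow>
        spec_St idv (chart_coeffs N j) y \<in> spec_St idv (chart_coeffs N i) ` pts (Spec (chart_ring N i)))"
    if x: "x \<in> pts (Spec (chart_ring N i))" for i x
  proof -
    obtain F where F: "finite F" "\<And>L. L \<in> hat_stalks N \<Longrightarrow> L \<in> stalks (chart_coeffs N i) \<longleftrightarrow> F \<subseteq> Sigma UNIV L"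
      using chart_stalks_open[of i] by blast
    have mem: "spec_St idv (chart_coeffs N j) y \<in> stalks (chart_coeffs N j)" if "y \<in> prime_ideals (chart_ring N j)" for j y
      using that chart_spec_stalks by blast
    show ?thesis
      unfolding top chart_spec_stalks
    proof (intro exI[of _ F] conjI ballI impI)
      show "F \<subseteq> Sigma UNIV (spec_St idv (chart_coeffs N i) x)"
        using F(2) mem chart_stalks_hat x unfolding top by blast
      show "spec_St idv (chart_coeffs N j) y \<in> stalks (chart_coeffs N i)"
        if "y \<in> prime_ideals (chart_ring N j)" "F \<subseteq> Sigma UNIV (spec_St idv (chart_coeffs N j) y)" for j y
        using F(2) mem chart_stalks_hat that by blast
    qed (rule F(1))
  qed
qed simp_all

interpretation glue_hat: glue_data UNIV "\<lambda>c. Spec (chart_ring N c)" "UNIV :: unit set" "\<lambda>_. Spec (B_ring N)"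
     "\<lambda>_. FinChart" "\<lambda>_. InfChart" "\<lambda>_. overlap_mor N FinChart" "\<lambda>_. overlap_mor N InfChart"
     "\<lambda>_. spec_ev idv" "\<lambda>c. spec_St idv (chart_coeffs N c)" "\<lambda>_. spec_ev idv" "\<lambda>_. spec_St idv (B_coeffs N)"
  by (rule glue_data_hat)

lemma G_hat: "glue_hat.G = SpecZhat N"
  by (simp add: glue_hat.G_def SpecZhat_def)

lemma zspace_hat: "zspace (SpecZhat N) hat_ev (hat_St N)"
  using glue_hat.zspace_glue by (simp add: G_hat hat_ev_def hat_St_def)

lemma hat_St_image: "hat_St N ` pts (SpecZhat N) = hat_stalks N"
proof -
  have "hat_St N ` pts (SpecZhat N) = (\<Union>c. stalks (chart_coeffs N c))"
    using glue_hat.gSt_image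
    by (simp add: G_hat hat_St_def qring.topspace_Spec[OF qring_chart[OF N]] chart_spec_stalks)
  also have "\<dots> = hat_stalks N"
  proof -
    have UNIV: "(UNIV :: chart set) = {FinChart, InfChart}" using chart.exhaust by auto
    show ?thesis unfolding UNIV hat_stalks_def by simp
  qed
  finally show ?thesis .
qed

lemma zmor_chart_incl: "zmor (Spec (chart_ring N c)) (spec_ev idv) (SpecZhat N) hat_ev (chart_incl N c)"
  using glue_hat.zmor_glue_incl(1)[of c] by (simp add: G_hat hat_ev_def chart_incl_def)

lemma hat_St_chart_incl:
  "P \<in> prime_ideals (chart_ring N c) \<Longrightarrow> hat_St N (pt (chart_incl N c) P) = spec_St idv (chart_coeffs N c) P"
  using glue_hat.zmor_glue_incl(2)[of c P]
  by (simp add: G_hat hat_St_def chart_incl_def qring.topspace_Spec[OF qring_chart[OF N]])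

interpretation zspace "SpecZhat N" hat_ev "hat_St N" by (rule zspace_hat)

lemma hat_St_mem: "m \<in> pts (SpecZhat N) \<Longrightarrow> hat_St N m \<in> hat_stalks N"
  using hat_St_image by blast

lemma hat_chart: "zspace.chart (SpecZhat N) (hat_St N) (chart_coeffs N c)"
  by (rule chart_of_hat_stalks[OF N hat_St_image])

lemma hat_chart_ex:
  assumes "m \<in> pts (SpecZhat N)"
  obtains c where "m \<in> zspace.chart_dom (SpecZhat N) (hat_St N) (chart_coeffs N c)"
  by (rule chart_dom_of_hat_stalks[OF hat_St_image assms])

lemma hat_chart_dom:
  "zspace.chart_dom (SpecZhat N) (hat_St N) (chart_coeffs N c) = pt (chart_incl N c) ` prime_ideals (chart_ring N c)"
proof (intro equalityI subsetI)
  fix m assume m: "m \<in> chart_dom (chart_coeffs N c)"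
  then have "hat_St N m \<in> stalks (chart_coeffs N c)" by (simp add: chart_dom_def)
  then obtain P where P: "P \<in> prime_ideals (chart_ring N c)" "hat_St N m = spec_St idv (chart_coeffs N c) P"
    using chart_spec_stalks by (metis imageE)
  then have "hat_St N (pt (chart_incl N c) P) = hat_St N m" using hat_St_chart_incl by simp
  moreover have "pt (chart_incl N c) P \<in> pts (SpecZhat N)"
    using zmor_pt[OF zmor_chart_incl] P(1) qring.topspace_Spec[OF qring_chart[OF N]] by blast
  ultimately have "pt (chart_incl N c) P = m" using inj_onD[OF inj_St] m by (simp add: chart_dom_def)
  then show "m \<in> pt (chart_incl N c) ` prime_ideals (chart_ring N c)" using P(1) by blast
next
  fix m assume "m \<in> pt (chart_incl N c) ` prime_ideals (chart_ring N c)"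
  then obtain P where P: "P \<in> prime_ideals (chart_ring N c)" "m = pt (chart_incl N c) P" by blast
  then show "m \<in> chart_dom (chart_coeffs N c)"
    using hat_St_chart_incl[OF P(1)] chart_spec_stalks zmor_pt[OF zmor_chart_incl, of P c]
      qring.topspace_Spec[OF qring_chart[OF N], of c]
    unfolding chart_dom_def by blast
qed

lemma hat_scheme: "generalized_scheme (SpecZhat N)"
proof (rule generalized_scheme[OF inj_section])
  fix m assume "m \<in> pts (SpecZhat N)"
  then show "\<exists>C. chart C \<and> m \<in> chart_dom C" using hat_chart hat_chart_ex by metis
qed

text \<open>\<open>[]\<close> is a nullary operation of every local ring, so it defines a global
  constant.\<close>

lemma hat_over_F1: "scheme_over_F1 (SpecZhat N)"
proof -
  have "\<exists>s\<in>car (sec (SpecZhat N) (pts (SpecZhat N))) 0. \<forall>x\<in>pts (SpecZhat N). hat_ev 0 s x = []"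
    by (rule sec_ex) (auto intro: qmonad_nil[OF qlocal_qmonad[OF qlocal_St]])
  then show ?thesis using hat_scheme unfolding scheme_over_F1_def by blast
qed

end

section \<open>Transition morphisms\<close>

definition transition_stalk :: "nat \<Rightarrow> (nat \<Rightarrow> rat list set) \<Rightarrow> nat \<Rightarrow> rat list set" where
  "transition_stalk N L = (if L \<in> stalks Z_coeffs then L else A_coeffs N)"

text \<open>The transition morphisms, characterized by their effect on local rings.\<close>

definition canonical :: "nat \<Rightarrow> nat \<Rightarrow> hat_mor \<Rightarrow> bool" where
  "canonical N N' f \<longleftrightarrow> zmor (SpecZhat N') hat_ev (SpecZhat N) hat_ev f \<and>
     (\<forall>m\<in>pts (SpecZhat N'). hat_St N (pt f m) = transition_stalk N (hat_St N' m))"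

lemma zspace_pair_hat: "N \<ge> 2 \<Longrightarrow> N' \<ge> 2 \<Longrightarrow> zspace_pair (SpecZhat N') hat_ev (hat_St N') (SpecZhat N) hat_ev (hat_St N)"
  by (simp add: zspace_pair_def zspace_hat)

lemma canonical_eq:
  assumes N: "N \<ge> 2" "N' \<ge> 2" and f: "canonical N N' f" and g: "canonical N N' g"
  shows "mor_eq (SpecZhat N') (SpecZhat N) f g"
proof -
  interpret zspace_pair "SpecZhat N'" hat_ev "hat_St N'" "SpecZhat N" hat_ev "hat_St N"
    by (rule zspace_pair_hat[OF N])
  have fg: "zmor (SpecZhat N') hat_ev (SpecZhat N) hat_ev f" "zmor (SpecZhat N') hat_ev (SpecZhat N) hat_ev g"
    using f g by (simp_all add: canonical_def)
  show ?thesis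
  proof (rule zmor_eqI[OF fg])
    fix m assume m: "m \<in> pts (SpecZhat N')"
    then have "hat_St N (pt f m) = hat_St N (pt g m)" using f g by (simp add: canonical_def)
    then show "pt f m = pt g m"
      using inj_onD[OF Y.inj_St] zmor_pt[OF fg(1) m] zmor_pt[OF fg(2) m] by blast
  qed
qed

lemma canonical_comp:
  assumes "N' \<ge> 2" and f: "canonical N N' f" and g: "canonical N' N'' g"
  shows "canonical N N'' (comp_mor (SpecZhat N') f g)"
  unfolding canonical_def
proof (intro conjI ballI)
  have fg: "zmor (SpecZhat N') hat_ev (SpecZhat N) hat_ev f" "zmor (SpecZhat N'') hat_ev (SpecZhat N') hat_ev g"
    using f g by (simp_all add: canonical_def)
  show "zmor (SpecZhat N'') hat_ev (SpecZhat N) hat_ev (comp_mor (SpecZhat N') f g)"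
    by (rule zmor_comp[OF fg(2,1)])
  fix m assume m: "m \<in> pts (SpecZhat N'')"
  \<comment> \<open>The point at infinity of the middle space is not over \<open>Z\<close> either,
    so \<open>f\<close> sends it on to infinity.\<close>
  then show "hat_St N (pt (comp_mor (SpecZhat N') f g) m) = transition_stalk N (hat_St N'' m)"
    using f g zmor_pt[OF fg(2) m] infinity_not_Z
    by (simp add: canonical_def comp_mor_def transition_stalk_def)
qed

text \<open>The only local ring of \<open>SpecZhat N\<close> that is not over \<open>Z\<close> is
  \<open>A_N\<close> itself, so \<open>transition_stalk N\<close> fixes all of them.\<close>

lemma canonical_id: "N \<ge> 2 \<Longrightarrow> canonical N N id_mor"
  using hat_St_mem[of N] stalks_A_infinity[of N] zmor_id
  by (auto simp: canonical_def id_mor_def transition_stalk_def hat_stalks_def)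

lemma Z_inverted_mult: "N \<ge> 1 \<Longrightarrow> M \<ge> 1 \<Longrightarrow> Z_inverted N \<subseteq> Z_inverted (N * M)"
proof
  fix x assume *: "N \<ge> 1" "M \<ge> 1" "x \<in> Z_inverted N"
  then obtain k where "x * of_nat N ^ k \<in> \<int>" using Z_inverted_iff by blast
  then have "(x * of_nat N ^ k) * of_nat M ^ k \<in> \<int>" by simp
  then have "x * of_nat (N * M) ^ k \<in> \<int>" by (simp add: power_mult_distrib mult.assoc)
  moreover have "1 \<le> N * M" using * by (cases N; cases M) auto
  ultimately show "x \<in> Z_inverted (N * M)" using Z_inverted_iff by blast
qed

lemma A_mult: "N \<ge> 1 \<Longrightarrow> M \<ge> 1 \<Longrightarrow> A_coeffs N n \<subseteq> A_coeffs (N * M) n"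
  using subsetD[OF Z_inverted_mult[of N M]] by (auto simp: A_coeffs_iff B_coeffs_iff)

text \<open>\<open>1/N\<close> is \<open>M\<close> times \<open>1/(N M)\<close>, and a local ring
  over \<open>Z\<close> contains \<open>M\<close>.\<close>

lemma stalks_A_mult_B:
  assumes N: "N \<ge> 2" "M \<ge> 1" and L: "L \<in> stalks (A_coeffs (N * M))" "L \<in> stalks Z_coeffs"
  shows "L \<in> stalks (B_coeffs N)"
proof -
  have NM: "N * M \<ge> 2" using N by (metis le_trans mult_le_mono mult.right_neutral order_refl)
  have N1: "N \<ge> 1" using N by simp
  note loc = stalks_qlocal[OF qmonad_Z L(2)]
  have "of_nat M \<in> qnum L" using qnum_mono[of Z_coeffs L, OF stalks_superset[OF qmonad_Z L(2)]] by (auto simp: qnum_Z)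
  then have "of_nat M * inverse (of_nat (N * M)) \<in> qnum L"
    using qnum_mult[OF qlocal_qmonad[OF loc]] stalks_A_inverse[OF NM L(1)] by blast
  moreover have "of_nat M * inverse (of_nat (N * M)) = (inverse (of_nat N) :: rat)" using N(2) by (simp add: field_simps)
  ultimately have "inverse (of_nat N) \<in> qnum L" by metis
  then show ?thesis by (rule stalks_Z_B[OF N1 L(2)])
qed

context
  fixes N M :: nat assumes N: "N \<ge> 2" and M: "M \<ge> 1"
begin

lemma product_ge_2: "N * M \<ge> 2"
  using N M by (metis le_trans mult_le_mono mult.right_neutral order_refl)

interpretation zspace_pair "SpecZhat (N * M)" hat_ev "hat_St (N * M)" "SpecZhat N" hat_ev "hat_St N"
  by (rule zspace_pair_hat[OF N product_ge_2])

lemma stalk_infinity: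
  assumes "m \<in> pts (SpecZhat (N * M))" "hat_St (N * M) m \<notin> stalks Z_coeffs"
  shows "hat_St (N * M) m = A_coeffs (N * M)"
  using hat_St_mem[OF product_ge_2 assms(1)] stalks_A_infinity[OF product_ge_2 _ assms(2)] assms(2) by (auto simp: hat_stalks_def)

lemma transition_stalk_subset:
  "m \<in> pts (SpecZhat (N * M)) \<Longrightarrow> transition_stalk N (hat_St (N * M) m) n \<subseteq> hat_St (N * M) m n"
  using stalk_infinity[of m] A_mult[of N M n] N M by (auto simp: transition_stalk_def)

lemma canonical_ex: "\<exists>f. canonical N (N * M) f"
proof -
  let ?T = "pts (SpecZhat (N * M))"
  define h where "h m = (SOME m'. m' \<in> pts (SpecZhat N) \<and>
     hat_St N m' = transition_stalk N (hat_St (N * M) m))" for m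
  have h: "h m \<in> pts (SpecZhat N) \<and> hat_St N (h m) = transition_stalk N (hat_St (N * M) m)" if "m \<in> ?T" for m
  proof -
    have "transition_stalk N (hat_St (N * M) m) \<in> hat_stalks N"
      using infinity_stalk[OF N] by (auto simp: transition_stalk_def hat_stalks_def)
    then have "\<exists>m'. m' \<in> pts (SpecZhat N) \<and> hat_St N m' = transition_stalk N (hat_St (N * M) m)"
      unfolding hat_St_image[OF N, symmetric] by force
    then show ?thesis unfolding h_def by (rule someI_ex)
  qed
  have "continuous_map (topo (SpecZhat (N * M))) (topo (SpecZhat N)) h"
    unfolding continuous_map
  proof (intro conjI allI impI)
    show "h ` ?T \<subseteq> pts (SpecZhat N)" using h by blast
    fix V assume V: "openin (topo (SpecZhat N)) V"
    show "openin (topo (SpecZhat (N * M))) {m \<in> ?T. h m \<in> V}"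
    proof (rule X.zopenI)
      fix m assume "m \<in> {m \<in> ?T. h m \<in> V}"
      then have m: "m \<in> ?T" "h m \<in> V" by auto
      obtain F where F: "finite F" "F \<subseteq> Sigma UNIV (hat_St N (h m))"
         "\<And>y. y \<in> pts (SpecZhat N) \<Longrightarrow> F \<subseteq> Sigma UNIV (hat_St N y) \<Longrightarrow> y \<in> V"
        using Y.zopenE[OF V m(2)] by metis
      show "\<exists>F. finite F \<and> F \<subseteq> Sigma UNIV (hat_St (N * M) m) \<and>
          (\<forall>y\<in>?T. F \<subseteq> Sigma UNIV (hat_St (N * M) y) \<longrightarrow> y \<in> {m \<in> ?T. h m \<in> V})"
      proof (cases "hat_St (N * M) m \<in> stalks Z_coeffs")
        \<comment> \<open>Adding \<open>[1, 1]\<close> to the conditions confines the neighbourhood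
          to \<open>Spec Z\<close>, where \<open>h\<close> preserves local rings.\<close>
        case True
        have "h y \<in> V" if y: "y \<in> ?T" "insert (2, [1, 1]) F \<subseteq> Sigma UNIV (hat_St (N * M) y)" for y
        proof -
          have "hat_St (N * M) y \<in> stalks Z_coeffs" using stalk_Z_iff[OF product_ge_2 hat_St_mem[OF product_ge_2 y(1)]] y(2) by simp
          then have "hat_St N (h y) = hat_St (N * M) y" using h[OF y(1)] by (simp add: transition_stalk_def)
          then show ?thesis using F(3) h[OF y(1)] y(2) by simp
        qed
        moreover have "hat_St N (h m) = hat_St (N * M) m" using h[OF m(1)] True by (simp add: transition_stalk_def)
        ultimately show ?thesis
          using F(1,2) one_one_stalk_Z[OF True] by (intro exI[of _ "insert (2, [1, 1]) F"]) auto
      next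
        \<comment> \<open>At infinity all of \<open>Spec A_NM\<close> serves as the neighbourhood:
          the elements of \<open>F\<close> lie in \<open>A_N\<close>, which is contained in the
          local ring at every image point.\<close>
        case False
        then have hm: "hat_St N (h m) = A_coeffs N" "hat_St (N * M) m = A_coeffs (N * M)"
          using h[OF m(1)] stalk_infinity[OF m(1)] by (simp_all add: transition_stalk_def)
        have "h y \<in> V" if y: "y \<in> ?T" "{(1, [inverse (of_nat (N * M))])} \<subseteq> Sigma UNIV (hat_St (N * M) y)" for y
        proof -
          have "hat_St (N * M) y \<in> stalks (A_coeffs (N * M))"
            using stalk_A_iff[OF product_ge_2 hat_St_mem[OF product_ge_2 y(1)]] y(2) by simp
          then have "A_coeffs N n \<subseteq> hat_St N (h y) n" for n
            using h[OF y(1)] stalks_A_mult_B[OF N M] stalks_superset[OF qmonad_B, of N] N A_subset_B[of N n]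
            by (fastforce simp: transition_stalk_def)
          then have "F \<subseteq> Sigma UNIV (hat_St N (h y))" using F(2) unfolding hm by (meson Sigma_mono subset_refl subset_trans)
          then show ?thesis using F(3) h[OF y(1)] by simp
        qed
        moreover have "[inverse (of_nat (N * M))] \<in> hat_St (N * M) m 1"
          unfolding hm using stalks_A_inverse[OF product_ge_2 infinity_stalk[OF product_ge_2]] by (simp add: qnum_def)
        ultimately show ?thesis by (intro exI[of _ "{(1, [inverse (of_nat (N * M))])}"]) auto
      qed
    qed blast
  qed
  moreover have "hat_St N (h m) n \<subseteq> hat_St (N * M) m n" if "m \<in> ?T" for m n
    using h[OF that] transition_stalk_subset[OF that] by simp
  ultimately obtain f where "zmor (SpecZhat (N * M)) hat_ev (SpecZhat N) hat_ev f" "pt f = h"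
    by (rule zmor_ex)
  then show ?thesis using h unfolding canonical_def by blast
qed

lemma canonical_scheme_morphism:
  assumes f: "canonical N (N * M) f"
  shows "scheme_morphism (SpecZhat (N * M)) (SpecZhat N) f"
proof -
  have zf: "zmor (SpecZhat (N * M)) hat_ev (SpecZhat N) hat_ev f" using f by (simp add: canonical_def)
  have Stf: "hat_St N (pt f m) = transition_stalk N (hat_St (N * M) m)" if "m \<in> pts (SpecZhat (N * M))" for m
    using f that by (simp add: canonical_def)
  have N1: "N \<ge> 1" using N by simp
  show ?thesis
  proof (rule zmor_scheme_morphism[OF zf inj_section inj_section])
    fix m assume m: "m \<in> pts (SpecZhat (N * M))"
    obtain c where c: "m \<in> X.chart_dom (chart_coeffs (N * M) c)" using hat_chart_ex[OF product_ge_2 m] .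
    have sub: "chart_coeffs N c n \<subseteq> chart_coeffs (N * M) c n" for n
      using A_mult[OF N1 M] by (cases c) auto
    have "pt f y \<in> Y.chart_dom (chart_coeffs N c) \<and>
      qnum (chart_coeffs N c) \<inter> qunits (hat_St (N * M) y) \<subseteq> qunits (hat_St N (pt f y))"
      if y: "y \<in> X.chart_dom (chart_coeffs (N * M) c)" for y
    proof -
      have yT: "y \<in> pts (SpecZhat (N * M))" and yS: "hat_St (N * M) y \<in> stalks (chart_coeffs (N * M) c)"
        using y by (simp_all add: X.chart_dom_def)
      note S = Stf[OF yT]
      show ?thesis
      proof (cases "hat_St (N * M) y \<in> stalks Z_coeffs")
        case True
        then have eq: "hat_St N (pt f y) = hat_St (N * M) y" using S by (simp add: transition_stalk_def)
        have "hat_St (N * M) y \<in> stalks (chart_coeffs N c)"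
        proof (cases c)
          case InfChart
          then have "hat_St (N * M) y \<in> stalks (B_coeffs N)" using stalks_A_mult_B[OF N M _ True] yS by simp
          then show ?thesis by (rule stalks_B_chart[OF N])
        qed (use True in simp)
        then show ?thesis using eq zmor_pt[OF zf yT] by (simp add: Y.chart_dom_def)
      next
        case False
        then have eq: "hat_St N (pt f y) = A_coeffs N" "hat_St (N * M) y = A_coeffs (N * M)"
          using S stalk_infinity[OF yT] by (simp_all add: transition_stalk_def)
        have c: "c = InfChart" using False yS by (cases c) auto
        \<comment> \<open>At infinity the map of local rings is the inclusion of \<open>A_N\<close>
          in \<open>A_NM\<close>; it is local because the only units of \<open>A_NM\<close> are
          \<open>1\<close> and \<open>-1\<close>.\<close>
        have "qunits (A_coeffs (N * M)) \<subseteq> qunits (A_coeffs N)"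
        proof
          fix r assume "r \<in> qunits (A_coeffs (N * M))"
          then have "r = 1 \<or> r = -1" by (rule qunits_A)
          then show "r \<in> qunits (A_coeffs N)"
            using minus_one_A[of N] qnum_one[OF qmonad_A[OF N]] by (auto simp: qunits_def)
        qed
        then show ?thesis
          unfolding Y.chart_dom_def using eq c infinity_stalk[OF N] zmor_pt[OF zf yT] by auto
      qed
    qed
    then show "\<exists>C D. X.chart C \<and> Y.chart D \<and> m \<in> X.chart_dom C \<and> (\<forall>n. D n \<subseteq> C n) \<and>
      (\<forall>y\<in>X.chart_dom C. pt f y \<in> Y.chart_dom D \<and>
        qnum D \<inter> qunits (hat_St (N * M) y) \<subseteq> qunits (hat_St N (pt f y)))"
      using hat_chart[OF product_ge_2, of c] hat_chart[OF N, of c] c sub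
      by (intro exI[of _ "chart_coeffs (N * M) c"] exI[of _ "chart_coeffs N c"]) blast
  qed
qed

lemma chart_open_eq: "chart_open L = zspace.chart_dom (SpecZhat L) (hat_St L) (A_coeffs L)" if "L \<ge> 2"
  using hat_chart_dom[OF that, of InfChart] by (simp add: chart_open_def)

lemma zmor_BN_incl: "zmor (Spec (B_ring N)) (spec_ev idv) (SpecZhat (N * M)) hat_ev (BN_incl N M)"
  unfolding BN_incl_def
proof (rule zmor_comp)
  show "zmor (Spec (B_ring N)) (spec_ev idv) (Spec Z_ring) (spec_ev idv) (overlap_mor N FinChart)"
    using qring_mor.zmor_Spec_mor[OF qring_mor_chart[OF N, of FinChart]] by (simp add: overlap_mor_def)
  show "zmor (Spec Z_ring) (spec_ev idv) (SpecZhat (N * M)) hat_ev (chart_incl (N * M) FinChart)"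
    using zmor_chart_incl[OF product_ge_2, of FinChart] by simp
qed

lemma hat_St_BN_incl:
  assumes P: "P \<in> prime_ideals (B_ring N)"
  shows "hat_St (N * M) (pt (BN_incl N M) P) = spec_St idv (B_coeffs N) P"
proof -
  have N1: "N \<ge> 1" using N by simp
  let ?Q = "pt (overlap_mor N FinChart) P"
  have *: "spec_St idv (B_coeffs N) P \<in> stalks (B_coeffs N)"
    using qring.St_stalks[OF qring_B[OF N1]] P by blast
  have "spec_St idv Z_coeffs ?Q = spec_St idv (B_coeffs N) P"
    using qring_mor.St_f[OF qring_mor_chart[OF N, of FinChart] P] stalks_B_Z(1)[OF N1 *]
    by (simp add: overlap_mor_def)
  moreover have "?Q \<in> prime_ideals Z_ring"
    using qring_mor.f_prime(1)[OF qring_mor_chart[OF N, of FinChart] P] by (simp add: overlap_mor_def)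
  ultimately show ?thesis
    using hat_St_chart_incl[OF product_ge_2, of ?Q FinChart] * by (simp add: BN_incl_def comp_mor_def)
qed

lemma V2_eq: "V2 N M = {m \<in> pts (SpecZhat (N * M)).
    hat_St (N * M) m \<in> stalks (A_coeffs (N * M)) \<or> hat_St (N * M) m \<in> stalks (B_coeffs N)}"
proof -
  have N1: "N \<ge> 1" using N by simp
  note B_stalks = qring.St_stalks[OF qring_B[OF N1]]
  have "pt (BN_incl N M) ` prime_ideals (B_ring N) = {m \<in> pts (SpecZhat (N * M)). hat_St (N * M) m \<in> stalks (B_coeffs N)}"
  proof (intro equalityI subsetI)
    fix m assume "m \<in> pt (BN_incl N M) ` prime_ideals (B_ring N)"
    then obtain P where P: "P \<in> prime_ideals (B_ring N)" "m = pt (BN_incl N M) P" by blast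
    then have "hat_St (N * M) m \<in> stalks (B_coeffs N)" using hat_St_BN_incl B_stalks by blast
    then show "m \<in> {m \<in> pts (SpecZhat (N * M)). hat_St (N * M) m \<in> stalks (B_coeffs N)}"
      using P zmor_pt[OF zmor_BN_incl] qring.topspace_Spec[OF qring_B[OF N1]] by blast
  next
    fix m assume m: "m \<in> {m \<in> pts (SpecZhat (N * M)). hat_St (N * M) m \<in> stalks (B_coeffs N)}"
    then obtain P where P: "P \<in> prime_ideals (B_ring N)" "spec_St idv (B_coeffs N) P = hat_St (N * M) m"
      using B_stalks by (metis (no_types, lifting) imageE mem_Collect_eq)
    then have "pt (BN_incl N M) P = m"
      using inj_onD[OF X.inj_St] hat_St_BN_incl m zmor_pt[OF zmor_BN_incl, of P] qring.topspace_Spec[OF qring_B[OF N1]] by auto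
    then show "m \<in> pt (BN_incl N M) ` prime_ideals (B_ring N)" using P by blast
  qed
  then show ?thesis unfolding V2_def chart_open_eq[OF product_ge_2] X.chart_dom_def by blast
qed

lemma openin_V2: "openin (topo (SpecZhat (N * M))) (V2 N M)"
proof -
  have N1: "N \<ge> 1" using N by simp
  have "V2 N M = {m \<in> pts (SpecZhat (N * M)). [inverse (of_nat (N * M))] \<in> hat_St (N * M) m 1} \<union>
    ({m \<in> pts (SpecZhat (N * M)). [1, 1] \<in> hat_St (N * M) m 2} \<inter>
     {m \<in> pts (SpecZhat (N * M)). [inverse (of_nat N)] \<in> hat_St (N * M) m 1})"
    unfolding V2_eq using stalk_A_iff[OF product_ge_2 hat_St_mem[OF product_ge_2]] stalk_B_iff[OF product_ge_2 hat_St_mem[OF product_ge_2] N1] by blast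
  then show ?thesis using X.openin_dom by (simp add: openin_Un openin_Int)
qed

text \<open>Equality of morphisms reduces to points and equality of sections to values: the pullback
  of the section \<open>a\<close> has the constant value \<open>a\<close> on both parts of
  \<open>V2 N M\<close>.\<close>

lemma is_transition_canonical:
  assumes f: "canonical N (N * M) f"
  shows "is_transition N M f"
  unfolding is_transition_def
proof (intro conjI allI ballI impI)
  have zf: "zmor (SpecZhat (N * M)) hat_ev (SpecZhat N) hat_ev f" using f by (simp add: canonical_def)
  have Stf: "hat_St N (pt f m) = transition_stalk N (hat_St (N * M) m)" if "m \<in> pts (SpecZhat (N * M))" for m
    using f that by (simp add: canonical_def)
  have N1: "N \<ge> 1" using N by simp
  show "scheme_morphism (SpecZhat (N * M)) (SpecZhat N) f" by (rule canonical_scheme_morphism[OF f])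
  interpret Z: qring Z_ring idv Z_coeffs by (rule qring_Z)
  interpret S: zspace "Spec Z_ring" "spec_ev idv" Z.St by (rule Z.zspace_Spec)
  interpret P: zspace_pair "Spec Z_ring" "spec_ev idv" Z.St "SpecZhat N" hat_ev "hat_St N" by unfold_locales
  have iN: "zmor (Spec Z_ring) (spec_ev idv) (SpecZhat N) hat_ev (chart_incl N FinChart)"
    using zmor_chart_incl[OF N, of FinChart] by simp
  have iNM: "zmor (Spec Z_ring) (spec_ev idv) (SpecZhat (N * M)) hat_ev (chart_incl (N * M) FinChart)"
    using zmor_chart_incl[OF product_ge_2, of FinChart] by simp
  show "mor_eq (Spec Z_ring) (SpecZhat N) (comp_mor (SpecZhat (N * M)) f (chart_incl (N * M) FinChart)) (chart_incl N FinChart)"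
  proof (rule P.zmor_eqI[OF zmor_comp[OF iNM zf] iN])
    fix P assume P: "P \<in> pts (Spec Z_ring)"
    then have PP: "P \<in> prime_ideals Z_ring" by simp
    have "Z.St P \<in> stalks Z_coeffs" using PP Z.St_stalks by blast
    then have "hat_St N (pt f (pt (chart_incl (N * M) FinChart) P)) = hat_St N (pt (chart_incl N FinChart) P)"
      using Stf[OF zmor_pt[OF iNM P]] hat_St_chart_incl[OF product_ge_2, of P FinChart] hat_St_chart_incl[OF N, of P FinChart] PP
      by (simp add: transition_stalk_def)
    then show "pt (comp_mor (SpecZhat (N * M)) f (chart_incl (N * M) FinChart)) P = pt (chart_incl N FinChart) P"
      using inj_onD[OF Y.inj_St] zmor_pt[OF zf zmor_pt[OF iNM P]] zmor_pt[OF iN P] by (simp add: comp_mor_def)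
  qed
  show fV2: "pt f ` V2 N M \<subseteq> chart_open N"
  proof
    fix y assume "y \<in> pt f ` V2 N M"
    then obtain m where m: "m \<in> pts (SpecZhat (N * M))" "y = pt f m"
      "hat_St (N * M) m \<in> stalks (A_coeffs (N * M)) \<or> hat_St (N * M) m \<in> stalks (B_coeffs N)"
      unfolding V2_eq by blast
    have "transition_stalk N (hat_St (N * M) m) \<in> stalks (A_coeffs N)"
    proof (cases "hat_St (N * M) m \<in> stalks Z_coeffs")
      case True
      then have "hat_St (N * M) m \<in> stalks (B_coeffs N)" using m(3) stalks_A_mult_B[OF N M] by blast
      then show ?thesis using stalks_B_chart[OF N, of _ InfChart] True by (simp add: transition_stalk_def)
    qed (simp add: transition_stalk_def infinity_stalk[OF N])
    then show "y \<in> chart_open N"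
      unfolding chart_open_eq[OF N] Y.chart_dom_def using Stf m zmor_pt[OF zf] by simp
  qed
  fix n a s
  assume a: "a \<in> car (A_ring N) n" and s: "s \<in> car (sec (SpecZhat N) (chart_open N)) n"
    and sa: "sh (chart_incl N InfChart) (chart_open N) n s = global_section (A_ring N) n a"
  interpret A: qring "A_ring N" idv "A_coeffs N" by (rule qring_A[OF N])
  interpret A': qring "A_ring (N * M)" idv "A_coeffs (N * M)" by (rule qring_A[OF product_ge_2])
  interpret B: qring "B_ring N" idv "B_coeffs N" by (rule qring_B[OF N1])
  interpret SA': zspace "Spec (A_ring (N * M))" "spec_ev idv" A'.St by (rule A'.zspace_Spec)
  interpret SB: zspace "Spec (B_ring N)" "spec_ev idv" B.St by (rule B.zspace_Spec)
  have CO: "openin (topo (SpecZhat N)) (chart_open N)"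
    using hat_chart[OF N, of InfChart] unfolding chart_open_eq[OF N] Y.chart_def by simp
  have jN: "zmor (Spec (A_ring N)) (spec_ev idv) (SpecZhat N) hat_ev (chart_incl N InfChart)"
    using zmor_chart_incl[OF N, of InfChart] by simp
  have jNM: "zmor (Spec (A_ring (N * M))) (spec_ev idv) (SpecZhat (N * M)) hat_ev (chart_incl (N * M) InfChart)"
    using zmor_chart_incl[OF product_ge_2, of InfChart] by simp
  have evs: "hat_ev n s y = a" if y: "y \<in> chart_open N" for y
  proof -
    obtain P where P: "P \<in> prime_ideals (A_ring N)" "y = pt (chart_incl N InfChart) P"
      using y unfolding chart_open_def by blast
    then have "P \<in> preim (Spec (A_ring N)) (chart_incl N InfChart) (chart_open N)"
      using y by (simp add: preim_def)
    from zmor_ev[OF jN CO s this] show ?thesis using P A.global_section(2)[OF a P(1)] sa by simp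
  qed
  let ?s' = "sh (restrict_mor (SpecZhat (N * M)) f (V2 N M)) (chart_open N) n s"
  let ?U = "preim (SpecZhat (N * M)) f (chart_open N)"
  have U: "openin (topo (SpecZhat (N * M))) ?U" by (rule zmor_preim[OF zf CO])
  have V2U: "V2 N M \<subseteq> ?U" using fV2 openin_subset[OF openin_V2] by (auto simp: preim_def)
  then have "V2 N M \<inter> ?U = V2 N M" by blast
  then have s'_eq: "?s' = res (SpecZhat (N * M)) ?U (V2 N M) n (sh f (chart_open N) n s)"
    by (simp add: restrict_mor_def)
  note fs = zmor_sh[OF zf CO s]
  have s': "?s' \<in> car (sec (SpecZhat (N * M)) (V2 N M)) n"
    unfolding s'_eq by (rule X.res_car[OF U openin_V2 V2U fs])
  have evs': "hat_ev n ?s' m = a" if "m \<in> V2 N M" for m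
    unfolding s'_eq X.ev_res[OF U openin_V2 V2U fs that]
    using zmor_ev[OF zf CO s subsetD[OF V2U that]] evs fV2 that by auto
  have 1: "sh (chart_incl (N * M) InfChart) (V2 N M) n ?s' = global_section (A_ring (N * M)) n a"
  proof -
    have a': "a \<in> car (A_ring (N * M)) n" using a A_mult[OF N1 M] by (auto simp: car_rings)
    have pre: "preim (Spec (A_ring (N * M))) (chart_incl (N * M) InfChart) (V2 N M) = prime_ideals (A_ring (N * M))"
      by (auto simp: preim_def V2_def chart_open_def)
    have sec: "sh (chart_incl (N * M) InfChart) (V2 N M) n ?s' \<in> car (sec (Spec (A_ring (N * M))) (prime_ideals (A_ring (N * M)))) n"
      using zmor_sh[OF jNM openin_V2 s'] unfolding pre .
    show ?thesis
    proof (rule SA'.sec_eqI[OF _ sec A'.global_section(1)[OF a']])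
      show "openin (topo (Spec (A_ring (N * M)))) (prime_ideals (A_ring (N * M)))"
        using openin_topspace[of "topo (Spec (A_ring (N * M)))"] by simp
      fix P assume P: "P \<in> prime_ideals (A_ring (N * M))"
      then have "P \<in> preim (Spec (A_ring (N * M))) (chart_incl (N * M) InfChart) (V2 N M)" using pre by simp
      from zmor_ev[OF jNM openin_V2 s' this] evs' this
      show "spec_ev idv n (sh (chart_incl (N * M) InfChart) (V2 N M) n ?s') P =
          spec_ev idv n (global_section (A_ring (N * M)) n a) P"
        using A'.global_section(2)[OF a' P] by (simp add: preim_def)
    qed
  qed
  have 2: "sh (BN_incl N M) (V2 N M) n ?s' = global_section (B_ring N) n a"
  proof -
    have a': "a \<in> car (B_ring N) n" using a A_subset_B by (auto simp: car_rings)
    have pre: "preim (Spec (B_ring N)) (BN_incl N M) (V2 N M) = prime_ideals (B_ring N)"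
      by (auto simp: preim_def V2_def)
    have sec: "sh (BN_incl N M) (V2 N M) n ?s' \<in> car (sec (Spec (B_ring N)) (prime_ideals (B_ring N))) n"
      using zmor_sh[OF zmor_BN_incl openin_V2 s'] unfolding pre .
    show ?thesis
    proof (rule SB.sec_eqI[OF _ sec B.global_section(1)[OF a']])
      show "openin (topo (Spec (B_ring N))) (prime_ideals (B_ring N))"
        using openin_topspace[of "topo (Spec (B_ring N))"] by simp
      fix P assume P: "P \<in> prime_ideals (B_ring N)"
      then have "P \<in> preim (Spec (B_ring N)) (BN_incl N M) (V2 N M)" using pre by simp
      from zmor_ev[OF zmor_BN_incl openin_V2 s' this] evs' this
      show "spec_ev idv n (sh (BN_incl N M) (V2 N M) n ?s') P = spec_ev idv n (global_section (B_ring N) n a) P"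
        using B.global_section(2)[OF a' P] by (simp add: preim_def)
    qed
  qed
  show "let s' = ?s' in sh (chart_incl (N * M) InfChart) (V2 N M) n s' = global_section (A_ring (N * M)) n a \<and>
         sh (BN_incl N M) (V2 N M) n s' = global_section (B_ring N) n a"
    using 1 2 by simp
qed

text \<open>Uniqueness. On \<open>Spec Z\<close> the morphism is prescribed. Every nonempty open set
  contains the generic point, which lies over \<open>Z\<close>, so values are preserved everywhere.
  Finally, the condition on \<open>V2 N M\<close> and the absence of \<open>[1, 1]\<close> from
  \<open>A_NM\<close> leave only infinity as the image of infinity.\<close>

lemma canonical_is_transition:
  assumes f: "is_transition N M f"
  shows "canonical N (N * M) f"
proof -
  have sm: "space_morphism (SpecZhat (N * M)) (SpecZhat N) f"
    and eq: "mor_eq (Spec Z_ring) (SpecZhat N) (comp_mor (SpecZhat (N * M)) f (chart_incl (N * M) FinChart)) (chart_incl N FinChart)"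
    and V2: "pt f ` V2 N M \<subseteq> chart_open N"
    using f by (simp_all add: is_transition_def scheme_morphism_def)
  interpret Z: qring Z_ring idv Z_coeffs by (rule qring_Z)
  let ?i = "chart_incl N FinChart" and ?j = "chart_incl (N * M) FinChart"
  have iN: "zmor (Spec Z_ring) (spec_ev idv) (SpecZhat N) hat_ev ?i"
    using zmor_chart_incl[OF N, of FinChart] by simp
  have iNM: "zmor (Spec Z_ring) (spec_ev idv) (SpecZhat (N * M)) hat_ev ?j"
    using zmor_chart_incl[OF product_ge_2, of FinChart] by simp
  have cont: "continuous_map (topo (SpecZhat (N * M))) (topo (SpecZhat N)) (pt f)"
    using sm by (simp add: space_morphism_def)
  have fin: "\<exists>P\<in>prime_ideals Z_ring. m = pt ?j P \<and> pt f m = pt ?i P \<and> hat_St N (pt f m) = hat_St (N * M) m"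
    if m: "m \<in> pts (SpecZhat (N * M))" and St: "hat_St (N * M) m \<in> stalks Z_coeffs" for m
  proof -
    have "m \<in> X.chart_dom (chart_coeffs (N * M) FinChart)" using m St by (simp add: X.chart_dom_def)
    then obtain P where P: "P \<in> prime_ideals Z_ring" "m = pt ?j P"
      unfolding hat_chart_dom[OF product_ge_2] by auto
    have "pt f m = pt ?i P" using eq P unfolding mor_eq_def by (simp add: comp_mor_def)
    then show ?thesis
      using P hat_St_chart_incl[OF product_ge_2, of P FinChart] hat_St_chart_incl[OF N, of P FinChart] by auto
  qed
  have zf: "zmor (SpecZhat (N * M)) hat_ev (SpecZhat N) hat_ev f"
    unfolding zmor_def
  proof (intro conjI allI ballI impI)
    show "continuous_map (topo (SpecZhat (N * M))) (topo (SpecZhat N)) (pt f)" by (rule cont)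
    fix V n s assume s: "s \<in> car (sec (SpecZhat N) V) n" and V: "openin (topo (SpecZhat N)) V"
    let ?U = "preim (SpecZhat (N * M)) f V"
    have U: "openin (topo (SpecZhat (N * M))) ?U" by (rule openin_preim[OF cont V])
    show fs: "sh f V n s \<in> car (sec (SpecZhat (N * M)) ?U) n"
    proof -
      have "ring_morphism (sec (SpecZhat N) V) (sec (SpecZhat (N * M)) ?U) (sh f V)"
        using sm V by (simp add: space_morphism_def)
      then show ?thesis using s by (simp add: ring_morphism_def)
    qed
    fix x assume x: "x \<in> ?U"
    \<comment> \<open>At the generic point the value of the pullback is known from
      \<open>Spec Z\<close>; constancy of values carries it to \<open>x\<close>.\<close>
    obtain z where z: "z \<in> ?U" "hat_St (N * M) z = qfull" using X.generic_open[OF U] x by blast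
    have zT: "z \<in> pts (SpecZhat (N * M))" using z by (simp add: preim_def)
    have "hat_St (N * M) z \<in> stalks Z_coeffs" using z(2) qfull_in_stalks[OF qmonad_Z] by simp
    then obtain P where P: "P \<in> prime_ideals Z_ring" "z = pt ?j P" "pt f z = pt ?i P" using fin[OF zT] by blast
    have PU: "P \<in> preim (Spec Z_ring) ?j ?U" and PV: "P \<in> preim (Spec Z_ring) ?i V"
      using P z by (auto simp: preim_def)
    have "hat_ev n (sh f V n s) x = hat_ev n (sh f V n s) z" by (rule X.ev_const[OF U fs x z(1)])
    also have "\<dots> = spec_ev idv n (sh ?j ?U n (sh f V n s)) P"
      using zmor_ev[OF iNM U fs PU] P(2) by simp
    also have "sh ?j ?U n (sh f V n s) = sh ?i V n s"
      using eq s V unfolding mor_eq_def by (simp add: comp_mor_def)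
    also have "spec_ev idv n (sh ?i V n s) P = hat_ev n s (pt f z)"
      using zmor_ev[OF iN V s PV] P(3) by simp
    also have "\<dots> = hat_ev n s (pt f x)"
      using Y.ev_const[OF V s] x z by (simp add: preim_def)
    finally show "hat_ev n (sh f V n s) x = hat_ev n s (pt f x)" .
  qed
  have "hat_St N (pt f m) = transition_stalk N (hat_St (N * M) m)" if m: "m \<in> pts (SpecZhat (N * M))" for m
  proof (cases "hat_St (N * M) m \<in> stalks Z_coeffs")
    case True
    then show ?thesis using fin[OF m] by (auto simp: transition_stalk_def)
  next
    case False
    have inf: "hat_St (N * M) m = A_coeffs (N * M)" by (rule stalk_infinity[OF m False])
    then have "m \<in> V2 N M" using m infinity_stalk[OF product_ge_2] by (simp add: V2_eq)
    then have "hat_St N (pt f m) \<in> stalks (A_coeffs N)"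
      using V2 unfolding chart_open_eq[OF N] Y.chart_dom_def by blast
    \<comment> \<open>By \<open>zmor_St\<close> the local ring at the image is contained in
      \<open>A_NM\<close>, which lacks \<open>[1, 1]\<close>.\<close>
    moreover have "hat_St N (pt f m) \<notin> stalks Z_coeffs"
      using zmor_St[OF zf m, of 2] one_one_stalk_Z one_one_not_A unfolding inf by blast
    ultimately show ?thesis using stalks_A_infinity[OF N] False by (simp add: transition_stalk_def)
  qed
  then show ?thesis using zf by (simp add: canonical_def)
qed

end

text \<open>Whatever morphism the choice in \<open>transition\<close> returns is canonical; for
  \<open>N' = N\<close> it is the identity by definition.\<close>

lemma canonical_transition:
  assumes N: "N \<ge> 2" "N' \<ge> 2" and dvd: "N dvd N'"
  shows "canonical N N' (transition N N')" and "scheme_morphism (SpecZhat N') (SpecZhat N) (transition N N')"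
proof -
  obtain M where M: "N' = N * M" using dvd by (auto simp: dvd_def)
  have M1: "M \<ge> 1" using M N by (cases M) auto
  show c: "canonical N N' (transition N N')"
  proof (cases "N' = N")
    case True
    then show ?thesis using canonical_id[OF N(1)] by (simp add: transition_def)
  next
    case False
    have "\<exists>f. is_transition N M f" using canonical_ex[OF N(1) M1] is_transition_canonical[OF N(1) M1] by blast
    then have "is_transition N M (SOME f. is_transition N M f)" by (rule someI_ex)
    moreover have "N' div N = M" using M N by simp
    ultimately show ?thesis
      using False canonical_is_transition[OF N(1) M1] M by (simp add: transition_def)
  qed
  show "scheme_morphism (SpecZhat N') (SpecZhat N) (transition N N')"
    using canonical_scheme_morphism[OF N(1) M1] c unfolding M .
qed

section \<open>The projective spectrum\<close>

text \<open>Division by \<open>N^d\<close> identifies degree \<open>d\<close> with the vectors of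
  \<open>A_N\<close> that \<open>N^d\<close> makes integral. So this is the Rees construction for
  \<open>A_N\<close> filtered by powers of \<open>N\<close> in the denominator; the element
  \<open>1\<close> of degree \<open>1\<close> corresponds to \<open>1/N\<close>, and the element
  \<open>N\<close> of degree \<open>1\<close> to \<open>1\<close>.\<close>

definition graded_Z :: "nat \<Rightarrow> rat list graded" where
  "graded_Z N = \<lparr>gcar = (\<lambda>d n. {v \<in> Z_coeffs n. (\<Sum>i<n. \<bar>v ! i\<bar>) \<le> of_nat N ^ d}),
     gvar = qvar, gapp = (\<lambda>d e. qlin)\<rparr>"

lemma gcar_iff: "v \<in> gcar (graded_Z N) d n \<longleftrightarrow> v \<in> Z_coeffs n \<and> (\<Sum>i<n. \<bar>v ! i\<bar>) \<le> of_nat N ^ d"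
  by (simp add: graded_Z_def)

lemma gcar_length: "v \<in> gcar (graded_Z N) d n \<Longrightarrow> length v = n"
  by (simp add: gcar_iff Z_coeffs_iff)

lemma gapp_eq [simp]: "gapp (graded_Z N) d e n t xs = qlin n t xs" and gvar_eq [simp]: "gvar (graded_Z N) = qvar"
  by (simp_all add: graded_Z_def)

lemma gcar_qlin:
  assumes N: "N \<ge> 1" and t: "t \<in> gcar (graded_Z N) d (length xs)" and xs: "set xs \<subseteq> gcar (graded_Z N) e n"
  shows "qlin n t xs \<in> gcar (graded_Z N) (d + e) n"
proof -
  have "qlin n t xs \<in> Z_coeffs n" using t xs by (intro qmonad_lin[OF qmonad_Z _ refl]) (auto simp: gcar_iff)
  moreover have "(\<Sum>j<n. \<bar>qlin n t xs ! j\<bar>) \<le> of_nat N ^ (d + e)"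
  proof -
    have "(\<Sum>j<n. \<bar>qlin n t xs ! j\<bar>) \<le> (\<Sum>i<length xs. \<bar>t ! i\<bar>) * of_nat N ^ e"
      using xs by (intro sum_abs_qlin) (auto simp: gcar_iff)
    also have "\<dots> \<le> of_nat N ^ d * of_nat N ^ e"
      using t by (intro mult_right_mono) (auto simp: gcar_iff)
    finally show ?thesis by (simp add: power_add)
  qed
  ultimately show ?thesis by (simp add: gcar_iff)
qed

lemma graded_Z:
  assumes N: "N \<ge> 1"
  shows "graded_generalized_ring (graded_Z N)"
  unfolding graded_generalized_ring_def gapp_eq gvar_eq
proof (intro conjI allI impI; (elim conjE)?)
  show "qvar n i \<in> gcar (graded_Z N) 0 n" if "i < n" for n i
  proof -
    have "(\<Sum>j<n. \<bar>qvar n i ! j\<bar>) = (\<Sum>j<n. if j = i then 1 else 0)" by (intro sum.cong) auto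
    then show ?thesis using that qmonad_var[OF qmonad_Z that] by (simp add: gcar_iff)
  qed
  show "qlin n t xs \<in> gcar (graded_Z N) (d + e) n"
    if "t \<in> gcar (graded_Z N) d (length xs)" "set xs \<subseteq> gcar (graded_Z N) e n" for d e n t xs
    by (rule gcar_qlin[OF N that])
  show "qlin n (qvar (length xs) i) xs = xs ! i" if "set xs \<subseteq> gcar (graded_Z N) e n" "i < length xs" for e n xs i
    using gcar_length[OF subsetD[OF that(1) nth_mem[OF that(2)]]] by (intro qlin_var that(2))
  show "qlin n t (map (qvar n) [0..<n]) = t" if "t \<in> gcar (graded_Z N) d n" for d n t
    by (rule qlin_vars[OF gcar_length[OF that]])
  show "qlin n (qlin m t xs) ys = qlin n t (map (\<lambda>x. qlin n x ys) xs)" if "length ys = m" for m n t xs ys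
    by (rule qlin_assoc[OF that])
  show "qlin l t (map (\<lambda>i. qlin l s (map (\<lambda>j. x i j) [0..<m])) [0..<n]) =
      qlin l s (map (\<lambda>j. qlin l t (map (\<lambda>i. x i j) [0..<n])) [0..<m])" for n m l t s x
    by (rule qlin_commute)
qed

lemma gcar_qscale:
  assumes N: "N \<ge> 1" and a: "[a] \<in> gcar (graded_Z N) d 1" and x: "x \<in> gcar (graded_Z N) e n"
  shows "qscale a x \<in> gcar (graded_Z N) (d + e) n"
  using gcar_qlin[OF N, of "[a]" d "[x]" e n] a x qlin_single[OF gcar_length[OF x], of a]
  by (simp add: One_nat_def)

lemma gcar_qscale_power:
  assumes N: "N \<ge> 1" and a: "[a] \<in> gcar (graded_Z N) d 1" and x: "x \<in> gcar (graded_Z N) e n"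
  shows "qscale (a ^ k) x \<in> gcar (graded_Z N) (k * d + e) n"
proof (induction k)
  case (Suc k)
  then show ?case using gcar_qscale[OF N a Suc] by (simp add: ac_simps)
qed (simp add: x)

lemma gcar_1_iff: "v \<in> gcar (graded_Z N) d 1 \<longleftrightarrow> (\<exists>a. v = [a] \<and> a \<in> \<int> \<and> \<bar>a\<bar> \<le> of_nat N ^ d)"
  by (auto simp: gcar_iff Z_coeffs_iff One_nat_def length_Suc_conv)

lemma gpow_scale_eq: "length x = n \<Longrightarrow> gpow_scale (graded_Z N) (d, [a]) k e n x = qscale (a ^ k) x"
  by (induction k) (simp_all add: qlin_single)

text \<open>The ring \<open>R\<^sub>(\<^sub>f\<^sub>)\<close> as a submonad of \<open>\<Sigma>\<^sub>\<rat>\<close>; homogeneous elements of \<open>|R|\<close> have the form \<open>f = (d, [a])\<close>.\<close>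

definition D_coeffs :: "nat \<Rightarrow> nat \<times> rat list \<Rightarrow> nat \<Rightarrow> rat list set" where
  "D_coeffs N f n = {qscale (inverse (hd (snd f)) ^ k) x | k x. x \<in> gcar (graded_Z N) (k * fst f) n}"

definition D_val :: "nat \<times> rat list \<Rightarrow> nat \<Rightarrow> (rat list \<times> nat) set \<Rightarrow> rat list" where
  "D_val f n c = (let z = SOME z. z \<in> c in qscale (inverse (hd (snd f)) ^ snd z) (fst z))"

abbreviation posZ :: "nat \<Rightarrow> (nat \<times> rat list) set" where
  "posZ N \<equiv> positive_elements (graded_Z N)"

lemma positive_iff: "f \<in> posZ N \<longleftrightarrow> (\<exists>d a. f = (d, [a]) \<and> d > 0 \<and> a \<in> \<int> \<and> \<bar>a\<bar> \<le> of_nat N ^ d)"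
  by (auto simp: positive_elements_def gcar_1_iff)

lemma gmult_eq: "gmult (graded_Z N) (d, [a]) (e, [b]) = (d + e, [a * b])"
  by (simp add: gmult_def qlin_single One_nat_def)

lemma gmult_positive:
  assumes N: "N \<ge> 1" and "f \<in> posZ N" "g \<in> posZ N"
  shows "gmult (graded_Z N) f g \<in> posZ N"
proof -
  obtain d a e b where *: "f = (d, [a])" "d > 0" "a \<in> \<int>" "\<bar>a\<bar> \<le> of_nat N ^ d"
    "g = (e, [b])" "b \<in> \<int>" "\<bar>b\<bar> \<le> of_nat N ^ e"
    using assms by (auto simp: positive_iff)
  then have "\<bar>a * b\<bar> \<le> of_nat N ^ (d + e)" unfolding abs_mult power_add by (intro mult_mono) auto
  then show ?thesis using * by (simp add: gmult_eq positive_iff)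
qed

section \<open>Degree-zero localization at a nonzero homogeneous element\<close>

context
  fixes N d :: nat and a :: rat
  assumes N: "N \<ge> 2" and d: "d > 0" and a_int: "a \<in> \<int>" and a_le: "\<bar>a\<bar> \<le> of_nat N ^ d" and a_nz: "a \<noteq> 0"
begin

lemma N_ge_1: "N \<ge> 1" using N by simp

lemma a_gcar: "[a] \<in> gcar (graded_Z N) d 1"
  using a_int a_le by (simp add: gcar_1_iff)

text \<open>The set of all fractions with rational value \<open>v\<close>, the homogeneous
  counterpart of \<open>fractions\<close>.\<close>

definition gset :: "nat \<Rightarrow> rat list \<Rightarrow> (rat list \<times> nat) set" where
  "gset n v = {(y, l). y \<in> gcar (graded_Z N) (l * d) n \<and> qscale (inverse a ^ l) y = v}"

text \<open>As \<open>a\<close> is nonzero its powers cancel, and equivalence of fractions becomes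
  equality of rational values.\<close>

lemma gfrac_gset:
  assumes x: "length x = n"
  shows "gfrac (graded_Z N) (d, [a]) n x k = gset n (qscale (inverse a ^ k) x)"
proof -
  have "qscale (a ^ m) (qscale (a ^ l) x) = qscale (a ^ m) (qscale (a ^ k) y) \<longleftrightarrow>
      qscale (inverse a ^ l) y = qscale (inverse a ^ k) x" for y l m
  proof
    assume "qscale (a ^ m) (qscale (a ^ l) x) = qscale (a ^ m) (qscale (a ^ k) y)"
    then have "qscale (inverse a ^ (m + k + l)) (qscale (a ^ m) (qscale (a ^ l) x)) =
        qscale (inverse a ^ (m + k + l)) (qscale (a ^ m) (qscale (a ^ k) y))" by simp
    then show "qscale (inverse a ^ l) y = qscale (inverse a ^ k) x"
      using a_nz by (simp add: power_add field_simps)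
  next
    assume "qscale (inverse a ^ l) y = qscale (inverse a ^ k) x"
    then have "qscale (a ^ (m + k + l)) (qscale (inverse a ^ l) y) = qscale (a ^ (m + k + l)) (qscale (inverse a ^ k) x)" by simp
    then show "qscale (a ^ m) (qscale (a ^ l) x) = qscale (a ^ m) (qscale (a ^ k) y)"
      using a_nz by (simp add: power_add field_simps)
  qed
  then show ?thesis
    using x unfolding gfrac_def gset_def by (auto simp: gpow_scale_eq gcar_length)
qed

lemma D_coeffs_iff: "v \<in> D_coeffs N (d, [a]) n \<longleftrightarrow> (\<exists>k. qscale (a ^ k) v \<in> gcar (graded_Z N) (k * d) n)"
proof
  assume "v \<in> D_coeffs N (d, [a]) n"
  then obtain k x where "v = qscale (inverse a ^ k) x" "x \<in> gcar (graded_Z N) (k * d) n"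
    by (auto simp: D_coeffs_def)
  then show "\<exists>k. qscale (a ^ k) v \<in> gcar (graded_Z N) (k * d) n"
    using a_nz by (intro exI[of _ k]) (simp flip: power_mult_distrib)
next
  assume "\<exists>k. qscale (a ^ k) v \<in> gcar (graded_Z N) (k * d) n"
  then obtain k where k: "qscale (a ^ k) v \<in> gcar (graded_Z N) (k * d) n" by blast
  have "v = qscale (inverse a ^ k) (qscale (a ^ k) v)" using a_nz by (simp flip: power_mult_distrib)
  then have "v \<in> {qscale (inverse a ^ k) x | k x. x \<in> gcar (graded_Z N) (k * d) n}" using k by blast
  then show "v \<in> D_coeffs N (d, [a]) n" by (simp add: D_coeffs_def)
qed

lemma D_denominator_mono:
  assumes "qscale (a ^ k) v \<in> gcar (graded_Z N) (k * d) n" "k \<le> l"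
  shows "qscale (a ^ l) v \<in> gcar (graded_Z N) (l * d) n"
  using gcar_qscale_power[OF N_ge_1 a_gcar assms(1), of "l - k"] assms(2)
  by (simp flip: power_add distrib_right)

lemma D_common_denominator:
  "set vs \<subseteq> D_coeffs N (d, [a]) n \<Longrightarrow> \<exists>k. \<forall>v\<in>set vs. qscale (a ^ k) v \<in> gcar (graded_Z N) (k * d) n"
proof (induction vs)
  case (Cons v vs)
  then obtain k l where "\<forall>v\<in>set vs. qscale (a ^ k) v \<in> gcar (graded_Z N) (k * d) n"
    "qscale (a ^ l) v \<in> gcar (graded_Z N) (l * d) n" by (auto simp: D_coeffs_iff)
  then show ?case using D_denominator_mono by (intro exI[of _ "max k l"]) auto
qed auto

lemma gset_inj: "v \<in> D_coeffs N (d, [a]) n \<Longrightarrow> gset n v = gset n w \<Longrightarrow> v = w"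
  unfolding D_coeffs_def gset_def by auto

lemma D_val_gset: "v \<in> D_coeffs N (d, [a]) n \<Longrightarrow> D_val (d, [a]) n (gset n v) = v"
proof -
  assume "v \<in> D_coeffs N (d, [a]) n"
  then have "\<exists>z. z \<in> gset n v" unfolding D_coeffs_def gset_def by auto
  then have "(SOME z. z \<in> gset n v) \<in> gset n v" by (rule someI_ex)
  then show ?thesis by (auto simp: D_val_def gset_def)
qed

abbreviation "H \<equiv> hom_localization (graded_Z N) (d, [a])"

lemma car_H: "car H n = gset n ` D_coeffs N (d, [a]) n"
proof -
  have "car H n = {gfrac (graded_Z N) (d, [a]) n x k | x k. x \<in> gcar (graded_Z N) (k * d) n}"
    by (simp add: hom_localization_def)
  also have "\<dots> = {gset n (qscale (inverse a ^ k) x) | x k. x \<in> gcar (graded_Z N) (k * d) n}"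
    using gfrac_gset gcar_length by (metis (no_types, lifting))
  also have "\<dots> = gset n ` D_coeffs N (d, [a]) n"
    by (auto simp: D_coeffs_def)
  finally show ?thesis .
qed

text \<open>As in \<open>app_stalk\<close>, the choice made by \<open>app\<close> is shown to be
  possible, by giving all arguments one exponent \<open>l\<close>, and to have only one
  outcome.\<close>

lemma app_H:
  assumes t: "t \<in> D_coeffs N (d, [a]) (length vs)" and vs: "set vs \<subseteq> D_coeffs N (d, [a]) n"
  shows "app H n (gset (length vs) t) (map (gset n) vs) = gset n (qlin n t vs)"
proof -
  let ?R = "\<lambda>c'. \<exists>b k bs l. b \<in> gcar (graded_Z N) (k * d) (length (map (gset n) vs)) \<and>
      set bs \<subseteq> gcar (graded_Z N) (l * d) n \<and>
      gset (length vs) t = gfrac (graded_Z N) (d, [a]) (length (map (gset n) vs)) b k \<and>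
      map (gset n) vs = map (\<lambda>b. gfrac (graded_Z N) (d, [a]) n b l) bs \<and>
      c' = gfrac (graded_Z N) (d, [a]) n (qlin n b bs) (k + l)"
  have uniq: "c' = gset n (qlin n t vs)" if c': "?R c'" for c'
  proof -
    obtain b k bs l where *: "b \<in> gcar (graded_Z N) (k * d) (length vs)" "set bs \<subseteq> gcar (graded_Z N) (l * d) n"
      "gset (length vs) t = gfrac (graded_Z N) (d, [a]) (length vs) b k"
      "map (gset n) vs = map (\<lambda>b. gfrac (graded_Z N) (d, [a]) n b l) bs"
      "c' = gfrac (graded_Z N) (d, [a]) n (qlin n b bs) (k + l)"
      using c' by auto
    have len: "length bs = length vs" using arg_cong[OF *(4), of length] by simp
    have t_eq: "t = qscale (inverse a ^ k) b"
      using gset_inj[OF t] *(3) gfrac_gset[OF gcar_length[OF *(1)]] by simp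
    have vs_eq: "vs = map (qscale (inverse a ^ l)) bs"
    proof (rule nth_equalityI)
      fix i assume i: "i < length vs"
      then have "length (bs ! i) = n" using *(2) len gcar_length by (metis nth_mem subsetD)
      then have "gset n (vs ! i) = gset n (qscale (inverse a ^ l) (bs ! i))"
        using arg_cong[OF *(4), of "\<lambda>xs. xs ! i"] len i gfrac_gset by simp
      then have "vs ! i = qscale (inverse a ^ l) (bs ! i)" by (rule gset_inj[OF subsetD[OF vs nth_mem[OF i]]])
      then show "vs ! i = map (qscale (inverse a ^ l)) bs ! i" using i len by simp
    qed (simp add: len)
    have "qlin n t vs = qlin n (qscale (inverse a ^ k) b) (map (qscale (inverse a ^ l)) bs)"
      by (rule arg_cong2[OF t_eq vs_eq])
    also have "\<dots> = qscale (inverse a ^ k * inverse a ^ l) (qlin n b bs)"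
      using *(1,2) gcar_length len by (intro qlin_qscale) auto
    finally show ?thesis using *(5) gfrac_gset by (simp add: power_add)
  qed
  have "\<exists>c'. ?R c'"
  proof -
    obtain k where k: "qscale (a ^ k) t \<in> gcar (graded_Z N) (k * d) (length vs)" using t by (auto simp: D_coeffs_iff)
    obtain l where l: "\<forall>v\<in>set vs. qscale (a ^ l) v \<in> gcar (graded_Z N) (l * d) n"
      using D_common_denominator[OF vs] by blast
    have "gset (length vs) t = gfrac (graded_Z N) (d, [a]) (length vs) (qscale (a ^ k) t) k"
      using gfrac_gset[OF gcar_length[OF k]] a_nz by (simp flip: power_mult_distrib)
    moreover have "map (gset n) vs = map (\<lambda>b. gfrac (graded_Z N) (d, [a]) n b l) (map (qscale (a ^ l)) vs)"
      using l gfrac_gset[OF gcar_length] a_nz by (auto simp flip: power_mult_distrib)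
    ultimately have "?R (gfrac (graded_Z N) (d, [a]) n (qlin n (qscale (a ^ k) t) (map (qscale (a ^ l)) vs)) (k + l))"
      using k l by (intro exI[of _ "qscale (a ^ k) t"] exI[of _ k] exI[of _ "map (qscale (a ^ l)) vs"] exI[of _ l]) auto
    then show ?thesis by blast
  qed
  then have "?R (SOME c'. ?R c')" by (rule someI_ex)
  then have "(SOME c'. ?R c') = gset n (qlin n t vs)" by (rule uniq)
  then show ?thesis by (simp add: hom_localization_def)
qed

lemma nat_abs: "nat \<lfloor>\<bar>a\<bar>\<rfloor> \<ge> 1" "of_nat (nat \<lfloor>\<bar>a\<bar>\<rfloor>) = \<bar>a\<bar>"
proof -
  obtain z where z: "a = of_int z" using a_int by (rule Ints_cases)
  have fl: "\<lfloor>\<bar>a\<bar>\<rfloor> = \<bar>z\<bar>" by (simp add: z flip: of_int_abs)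
  show "nat \<lfloor>\<bar>a\<bar>\<rfloor> \<ge> 1" "of_nat (nat \<lfloor>\<bar>a\<bar>\<rfloor>) = \<bar>a\<bar>"
    using a_nz unfolding fl by (auto simp: z)
qed

text \<open>A fraction \<open>x/a^k\<close> has norm at most \<open>(N^d / \<bar>a\<bar>)^k\<close>.
  If \<open>\<bar>a\<bar> < N^d\<close> this bound grows without limit in \<open>k\<close> and only
  the denominators matter. If \<open>\<bar>a\<bar> = N^d\<close> the bound is \<open>1\<close> for
  every \<open>k\<close>, and the denominators are the powers of \<open>N^d\<close>, which have the
  same effect as those of \<open>N\<close>.\<close>

lemma D_coeffs_eq: "D_coeffs N (d, [a]) = (if \<bar>a\<bar> < of_nat N ^ d then B_coeffs (nat \<lfloor>\<bar>a\<bar>\<rfloor>) else A_coeffs N)"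
proof -
  define m where "m = nat \<lfloor>\<bar>a\<bar>\<rfloor>"
  have am: "\<bar>a\<bar> = of_nat m" and m1: "m \<ge> 1" unfolding m_def by (rule nat_abs(2)[symmetric], rule nat_abs(1))
  have sum: "(\<Sum>i<n. \<bar>qscale (a ^ k) v ! i\<bar>) = \<bar>a\<bar> ^ k * (\<Sum>i<n. \<bar>v ! i\<bar>)" if "length v = n" for v n k
    using that by (simp add: abs_mult power_abs sum_distrib_left)
  \<comment> \<open>\<open>a\<close> may be negative, but its powers differ from those of
    \<open>m\<close> only by a sign.\<close>
  have ints: "a ^ k * x \<in> \<int> \<longleftrightarrow> x * of_nat m ^ k \<in> \<int>" for k x
  proof -
    have "a ^ k = of_nat m ^ k \<or> a ^ k = - (of_nat m ^ k)"
      using am by (metis abs_if power_minus minus_minus neg_one_even_power neg_one_odd_power mult_1 mult_minus1)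
    then show ?thesis by (auto simp: mult.commute)
  qed
  have D: "v \<in> D_coeffs N (d, [a]) n \<longleftrightarrow> length v = n \<and> (\<exists>k. (\<forall>x\<in>set v. x * of_nat m ^ k \<in> \<int>) \<and>
      \<bar>a\<bar> ^ k * (\<Sum>i<n. \<bar>v ! i\<bar>) \<le> of_nat N ^ (k * d))" for v n
    unfolding D_coeffs_iff gcar_iff Z_coeffs_iff using ints sum[of v n] by (auto simp: qscale_def)
  show ?thesis
  proof (cases "\<bar>a\<bar> < of_nat N ^ d")
    case True
    have "v \<in> D_coeffs N (d, [a]) n \<longleftrightarrow> v \<in> B_coeffs m n" for v n
    proof
      assume "v \<in> D_coeffs N (d, [a]) n"
      then show "v \<in> B_coeffs m n" unfolding D B_coeffs_iff using Z_inverted_iff[OF m1] by blast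
    next
      assume v: "v \<in> B_coeffs m n"
      obtain k where k: "\<forall>l\<ge>k. \<forall>x\<in>set v. x * of_nat m ^ l \<in> \<int>"
        using common_exponent[OF m1, of v] v by (auto simp: B_coeffs_iff)
      have "of_nat N ^ d / \<bar>a\<bar> > 1" using True a_nz by simp
      then obtain l where l: "\<forall>j\<ge>l. (\<Sum>i<n. \<bar>v ! i\<bar>) \<le> (of_nat N ^ d / \<bar>a\<bar>) ^ j"
        using power_archimedean by blast
      have "(\<Sum>i<n. \<bar>v ! i\<bar>) \<le> (of_nat N ^ d / \<bar>a\<bar>) ^ max k l" using l by simp
      then have "\<bar>a\<bar> ^ max k l * (\<Sum>i<n. \<bar>v ! i\<bar>) \<le> of_nat N ^ (max k l * d)"
        using a_nz by (simp add: power_divide field_simps power_mult[symmetric] mult.commute)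
      moreover have "\<forall>x\<in>set v. x * of_nat m ^ max k l \<in> \<int>" using k by simp
      ultimately show "v \<in> D_coeffs N (d, [a]) n" unfolding D using v by (auto simp: B_coeffs_iff)
    qed
    then show ?thesis using True unfolding m_def by (auto simp: fun_eq_iff)
  next
    case False
    then have eq: "\<bar>a\<bar> = of_nat N ^ d" using a_le by simp
    then have mN: "of_nat m = (of_nat N ^ d :: rat)" using am by simp
    have N0: "(of_nat N :: rat) > 0" using N by simp
    have "v \<in> D_coeffs N (d, [a]) n \<longleftrightarrow> v \<in> A_coeffs N n" for v n
    proof -
      have norm: "\<bar>a\<bar> ^ k * (\<Sum>i<n. \<bar>v ! i\<bar>) \<le> of_nat N ^ (k * d) \<longleftrightarrow> (\<Sum>i<n. \<bar>v ! i\<bar>) \<le> 1" for k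
        unfolding eq using N0 by (simp add: mult.commute[of k] flip: power_mult)
      have "(\<exists>k. \<forall>x\<in>set v. x * of_nat m ^ k \<in> \<int>) \<longleftrightarrow> (\<forall>x\<in>set v. x \<in> Z_inverted N)"
      proof
        assume "\<exists>k. \<forall>x\<in>set v. x * of_nat m ^ k \<in> \<int>"
        then show "\<forall>x\<in>set v. x \<in> Z_inverted N" unfolding mN Z_inverted_iff[OF N_ge_1] by (metis power_mult)
      next
        assume "\<forall>x\<in>set v. x \<in> Z_inverted N"
        then obtain k where k: "\<forall>l\<ge>k. \<forall>x\<in>set v. x * of_nat N ^ l \<in> \<int>"
          using common_exponent[OF N_ge_1, of v] by blast
        \<comment> \<open>Only exponents that are multiples of \<open>d\<close> are available; since
          \<open>d > 0\<close>, \<open>d * k\<close> is large enough.\<close>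
        have "k \<le> d * k" using d by simp
        then show "\<exists>k. \<forall>x\<in>set v. x * of_nat m ^ k \<in> \<int>"
          unfolding mN using k by (intro exI[of _ k]) (simp flip: power_mult)
      qed
      then show ?thesis unfolding D norm A_coeffs_iff B_coeffs_iff by blast
    qed
    then show ?thesis using False by (auto simp: fun_eq_iff)
  qed
qed

lemma qmonad_D: "qmonad (D_coeffs N (d, [a]))"
  unfolding D_coeffs_eq using qmonad_B[OF nat_abs(1)] qmonad_A[OF N] by simp

lemma qring_H: "qring H (D_val (d, [a])) (D_coeffs N (d, [a]))"
proof
  show "qmonad (D_coeffs N (d, [a]))" by (rule qmonad_D)
  show "bij_betw (D_val (d, [a]) n) (car H n) (D_coeffs N (d, [a]) n)" for n
    unfolding car_H using D_val_gset by (intro bij_betwI[of _ _ _ "gset n"]) auto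
  have var: "var H n i = gset n (qvar n i)" for n i
    using gfrac_gset[of "qvar n i" n 0] by (simp add: hom_localization_def)
  show "var H n i \<in> car H n" "D_val (d, [a]) n (var H n i) = qvar n i" if "i < n" for n i
    using qmonad_var[OF qmonad_D that] D_val_gset unfolding var car_H by auto
  fix t xs n assume "t \<in> car H (length xs)" "set xs \<subseteq> car H n"
  then obtain w where w: "t = gset (length xs) w" "w \<in> D_coeffs N (d, [a]) (length xs)"
    and xs: "set xs \<subseteq> gset n ` D_coeffs N (d, [a]) n" unfolding car_H by blast
  have "xs \<in> map (gset n) ` lists (D_coeffs N (d, [a]) n)" using xs by (auto simp: lists_image[symmetric])
  then obtain vs where vs: "xs = map (gset n) vs" "set vs \<subseteq> D_coeffs N (d, [a]) n" by auto
  have len: "length xs = length vs" using vs by simp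
  have app: "app H n t xs = gset n (qlin n w vs)"
    using app_H[OF _ vs(2), of w] w len vs(1) by simp
  have lin: "qlin n w vs \<in> D_coeffs N (d, [a]) n"
    using w len vs by (intro qmonad_lin[OF qmonad_D, of _ "length vs"]) auto
  show "app H n t xs \<in> car H n" unfolding app car_H using lin by blast
  have "map (D_val (d, [a]) n) xs = vs"
    using vs D_val_gset by (auto simp: comp_def intro!: map_idI)
  then show "D_val (d, [a]) n (app H n t xs) = qlin n (D_val (d, [a]) (length xs) t) (map (D_val (d, [a]) n) xs)"
    using app D_val_gset[OF lin] D_val_gset[OF w(2)] w(1) by simp
qed

text \<open>Among the local rings of \<open>SpecZhat N\<close>, those of the chart are detected by
  \<open>[1, 1]\<close> and \<open>1/\<bar>a\<bar>\<close>, or by \<open>1/N\<close>, all of which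
  belong to the ring of the chart. Membership thus reduces to inclusion, and intersections of charts
  become a question about rings.\<close>

lemma D_stalk_iff:
  assumes L: "L \<in> hat_stalks N"
  shows "L \<in> stalks (D_coeffs N (d, [a])) \<longleftrightarrow> (\<forall>n. D_coeffs N (d, [a]) n \<subseteq> L n)"
proof
  assume "L \<in> stalks (D_coeffs N (d, [a]))"
  then show "\<forall>n. D_coeffs N (d, [a]) n \<subseteq> L n" using stalks_superset[OF qmonad_D] by blast
next
  assume sub: "\<forall>n. D_coeffs N (d, [a]) n \<subseteq> L n"
  show "L \<in> stalks (D_coeffs N (d, [a]))"
  proof (cases "\<bar>a\<bar> < of_nat N ^ d")
    case True
    then have eq: "D_coeffs N (d, [a]) = B_coeffs (nat \<lfloor>\<bar>a\<bar>\<rfloor>)" by (simp add: D_coeffs_eq)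
    have "[1, 1] \<in> L 2" using sub one_one_Z Z_subset_B unfolding eq by blast
    moreover have "[inverse (of_nat (nat \<lfloor>\<bar>a\<bar>\<rfloor>))] \<in> L 1"
    proof -
      have "inverse (of_nat (nat \<lfloor>\<bar>a\<bar>\<rfloor>)) \<in> qnum (B_coeffs (nat \<lfloor>\<bar>a\<bar>\<rfloor>))"
        using inverse_Z_inverted[OF nat_abs(1), of 1] unfolding qnum_B power_one_right .
      then show ?thesis using sub unfolding eq qnum_def by blast
    qed
    ultimately show ?thesis unfolding eq using stalk_B_iff[OF N L nat_abs(1)] by blast
  next
    case False
    then have eq: "D_coeffs N (d, [a]) = A_coeffs N" by (simp add: D_coeffs_eq)
    have "[inverse (of_nat N)] \<in> L 1" using sub inverse_A[OF N_ge_1, of 1] unfolding eq by (auto simp: qnum_def)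
    then show ?thesis unfolding eq using stalk_A_iff[OF N L] by blast
  qed
qed

lemma D_stalks_hat: "stalks (D_coeffs N (d, [a])) \<subseteq> hat_stalks N"
  unfolding D_coeffs_eq hat_stalks_def using stalks_B_Z(1)[OF nat_abs(1)] by auto

lemma D_stalks_open:
  obtains F where "finite F" "\<And>L. L \<in> hat_stalks N \<Longrightarrow> L \<in> stalks (D_coeffs N (d, [a])) \<longleftrightarrow> F \<subseteq> Sigma UNIV L"
proof (cases "\<bar>a\<bar> < of_nat N ^ d")
  case True
  then show ?thesis
    using that[of "{(2, [1, 1]), (1, [inverse (of_nat (nat \<lfloor>\<bar>a\<bar>\<rfloor>))])}"] stalk_B_iff[OF N _ nat_abs(1)]
    by (simp add: D_coeffs_eq)
next
  case False
  then show ?thesis using that[of "{(1, [inverse (of_nat N)])}"] stalk_A_iff[OF N] by (simp add: D_coeffs_eq)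
qed

end

lemma D_coeffs_mult_subset:
  assumes N: "N \<ge> 2" and f: "(d, [a]) \<in> posZ N" "a \<noteq> 0" and g: "(e, [b]) \<in> posZ N" "b \<noteq> 0"
    and h: "h = (d + e, [a * b])" and x: "x \<in> gcar (graded_Z N) (k * d) n"
  shows "qscale (b ^ k) x \<in> gcar (graded_Z N) (k * fst h) n"
    "qscale (inverse (a * b) ^ k) (qscale (b ^ k) x) = qscale (inverse a ^ k) x"
proof -
  have "[b] \<in> gcar (graded_Z N) e 1" using g by (auto simp: positive_iff gcar_1_iff)
  then show "qscale (b ^ k) x \<in> gcar (graded_Z N) (k * fst h) n"
    using gcar_qscale_power[of N b e x "k * d" n k] x N h by (simp add: distrib_left add.commute)
  show "qscale (inverse (a * b) ^ k) (qscale (b ^ k) x) = qscale (inverse a ^ k) x"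
  proof -
    have "inverse (a * b) * b = inverse a" using g(2) by simp
    then have "inverse (a * b) ^ k * b ^ k = inverse a ^ k" by (metis power_mult_distrib)
    then show ?thesis by (simp only: qscale_qscale)
  qed
qed

lemma qring_mor_D:
  assumes N: "N \<ge> 2" and f: "(d, [a]) \<in> posZ N" "a \<noteq> 0" and g: "(e, [b]) \<in> posZ N" "b \<noteq> 0"
    and h: "h = (d + e, [a * b])"
  shows "qring_mor (hom_localization (graded_Z N) (d, [a])) (D_val (d, [a])) (D_coeffs N (d, [a]))
    (hom_localization (graded_Z N) h) (D_val h) (D_coeffs N h) (hom_localization_map (graded_Z N) (e, [b]) h)"
proof -
  have f': "d > 0" "a \<in> \<int>" "\<bar>a\<bar> \<le> of_nat N ^ d" using f by (auto simp: positive_iff)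
  have "gmult (graded_Z N) (d, [a]) (e, [b]) \<in> posZ N" using gmult_positive[OF _ f(1) g(1)] N by simp
  then have h': "d + e > 0" "a * b \<in> \<int>" "\<bar>a * b\<bar> \<le> of_nat N ^ (d + e)" "a * b \<noteq> 0"
    using f(2) g(2) by (auto simp: positive_iff gmult_eq)
  interpret A: qring "hom_localization (graded_Z N) (d, [a])" "D_val (d, [a])" "D_coeffs N (d, [a])"
    by (rule qring_H[OF N f' f(2)])
  interpret B: qring "hom_localization (graded_Z N) h" "D_val h" "D_coeffs N h"
    unfolding h by (rule qring_H[OF N h'])
  have *: "hom_localization_map (graded_Z N) (e, [b]) h n x \<in> car (hom_localization (graded_Z N) h) n \<and>
      D_val h n (hom_localization_map (graded_Z N) (e, [b]) h n x) = D_val (d, [a]) n x"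
    if x: "x \<in> car (hom_localization (graded_Z N) (d, [a])) n" for x n
  proof -
    obtain v where v: "x = gset N d a n v" "v \<in> D_coeffs N (d, [a]) n" using x car_H[OF N f' f(2)] by auto
    have "\<exists>z. z \<in> x" using v unfolding gset_def[OF N f' f(2)] D_coeffs_def by auto
    then have "(SOME z. z \<in> x) \<in> gset N d a n v" unfolding v(1) by (rule someI_ex)
    then obtain y k where z: "(SOME z. z \<in> x) = (y, k)" and y: "y \<in> gcar (graded_Z N) (k * d) n" "qscale (inverse a ^ k) y = v"
      unfolding gset_def[OF N f' f(2)] by auto
    note m = D_coeffs_mult_subset[OF N f g h y(1)]
    have "hom_localization_map (graded_Z N) (e, [b]) h n x = gfrac (graded_Z N) (d + e, [a * b]) n (qscale (b ^ k) y) k"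
      using z gcar_length[OF y(1)] unfolding h by (simp add: hom_localization_map_def gpow_scale_eq)
    also have "\<dots> = gset N (d + e) (a * b) n v"
      using gfrac_gset[OF N h', of "qscale (b ^ k) y" n k] gcar_length[OF y(1)] m(2) y(2) by simp
    finally have eq: "hom_localization_map (graded_Z N) (e, [b]) h n x = gset N (d + e) (a * b) n v" .
    have "v \<in> D_coeffs N h n"
      unfolding D_coeffs_def h using m y(2) unfolding h by (intro CollectI exI[of _ k] exI[of _ "qscale (b ^ k) y"]) auto
    then show ?thesis
      using eq v D_val_gset[OF N h'] D_val_gset[OF N f' f(2)] car_H[OF N h'] unfolding h by auto
  qed
  show ?thesis by unfold_locales (use * in auto)
qed

text \<open>On local rings this is the equality of \<open>D_+(fg)\<close> with the intersection of
  \<open>D_+(f)\<close> and \<open>D_+(g)\<close>. By \<open>D_stalk_iff\<close> it suffices that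
  the rings of \<open>f\<close> and \<open>g\<close> together generate that of
  \<open>fg\<close>.\<close>

lemma D_stalks_mult:
  assumes N: "N \<ge> 2" and f: "(d, [a]) \<in> posZ N" "a \<noteq> 0" and g: "(e, [b]) \<in> posZ N" "b \<noteq> 0"
  shows "stalks (D_coeffs N (d + e, [a * b])) = stalks (D_coeffs N (d, [a])) \<inter> stalks (D_coeffs N (e, [b]))"
proof -
  have f': "d > 0" "a \<in> \<int>" "\<bar>a\<bar> \<le> of_nat N ^ d" using f by (auto simp: positive_iff)
  have g': "e > 0" "b \<in> \<int>" "\<bar>b\<bar> \<le> of_nat N ^ e" using g by (auto simp: positive_iff)
  have "gmult (graded_Z N) (d, [a]) (e, [b]) \<in> posZ N" using gmult_positive[OF _ f(1) g(1)] N by simp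
  then have h': "d + e > 0" "a * b \<in> \<int>" "\<bar>a * b\<bar> \<le> of_nat N ^ (d + e)" "a * b \<noteq> 0"
    using f(2) g(2) by (auto simp: positive_iff gmult_eq)
  note iff = D_stalk_iff[OF N f' f(2)] D_stalk_iff[OF N g' g(2)] D_stalk_iff[OF N h']
  have sub: "D_coeffs N (d, [a]) n \<subseteq> D_coeffs N (d + e, [a * b]) n" "D_coeffs N (e, [b]) n \<subseteq> D_coeffs N (d + e, [a * b]) n" for n
    using qring_mor.C_subset_D[OF qring_mor_D[OF N f g refl]]
      qring_mor.C_subset_D[OF qring_mor_D[OF N g f refl]] by (simp_all add: add.commute mult.commute)
  have join: "D_coeffs N (d + e, [a * b]) n \<subseteq> L n" if L: "L \<in> hat_stalks N"
    "\<forall>n. D_coeffs N (d, [a]) n \<subseteq> L n" "\<forall>n. D_coeffs N (e, [b]) n \<subseteq> L n" for L n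
  proof
    fix v assume "v \<in> D_coeffs N (d + e, [a * b]) n"
    then obtain k x where v: "v = qscale (inverse (a * b) ^ k) x" "x \<in> gcar (graded_Z N) (k * (d + e)) n"
      unfolding D_coeffs_def by auto
    have mon: "qmonad L"
      using L(1) stalks_qlocal[OF qmonad_Z] stalks_qlocal[OF qmonad_A[OF N]] qlocal_qmonad by (auto simp: hat_stalks_def)
    have N1: "N \<ge> 1" using N by simp
    have b1: "[b] \<in> gcar (graded_Z N) e 1" "[a] \<in> gcar (graded_Z N) d 1" using f' g' by (auto simp: gcar_1_iff)
    obtain d' where d': "d = Suc d'" using f'(1) by (cases d) auto
    \<comment> \<open>With \<open>d = d' + 1\<close>, the fraction \<open>x / (a b)^k\<close> is the
      product of \<open>(a^e / b^d)^k\<close> and \<open>b^(k d') x / a^(k (1 + e))\<close>. Both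
      have degree \<open>0\<close>; the first lies in the ring of \<open>b\<close>, the second in
      the ring of \<open>a\<close>.\<close>
    have "qscale (b ^ (k * d')) x \<in> gcar (graded_Z N) ((k * d') * e + k * (d + e)) n"
      by (rule gcar_qscale_power[OF N1 b1(1) v(2)])
    also have "(k * d') * e + k * (d + e) = (k * (1 + e)) * d" by (simp add: d' algebra_simps)
    finally have "qscale (inverse a ^ (k * (1 + e))) (qscale (b ^ (k * d')) x) \<in> D_coeffs N (d, [a]) n"
      by (auto simp: D_coeffs_def simp del: qscale_qscale)
    then have 1: "qscale (inverse a ^ (k * (1 + e))) (qscale (b ^ (k * d')) x) \<in> L n" using L(2) by blast
    have "[1] \<in> gcar (graded_Z N) 0 1" by (simp add: gcar_1_iff)
    then have "qscale (a ^ e) [1] \<in> gcar (graded_Z N) (e * d + 0) 1" by (rule gcar_qscale_power[OF N1 b1(2)])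
    then have "qscale (inverse b ^ d) (qscale (a ^ e) [1]) \<in> D_coeffs N (e, [b]) 1"
      unfolding D_coeffs_def by (intro CollectI exI[of _ d] exI[of _ "qscale (a ^ e) [1]"]) (simp add: mult.commute)
    then have "inverse b ^ d * a ^ e \<in> qnum L" using L(3) by (auto simp: qnum_def)
    then have "qscale ((inverse b ^ d * a ^ e) ^ k) (qscale (inverse a ^ (k * (1 + e))) (qscale (b ^ (k * d')) x)) \<in> L n"
      using qmonad_qscale[OF mon qnum_power[OF mon] 1] by blast
    moreover have "(inverse b ^ d * a ^ e) ^ k * (inverse a ^ (k * (1 + e)) * b ^ (k * d')) = inverse (a * b) ^ k"
    proof -
      have "(inverse b ^ d * a ^ e) ^ k * (inverse a ^ (k * (1 + e)) * b ^ (k * d')) =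
          ((inverse b ^ d * a ^ e) * (inverse a ^ (1 + e) * b ^ d')) ^ k"
        by (simp add: power_mult_distrib power_mult[symmetric] mult.commute[of k])
      also have "(inverse b ^ d * a ^ e) * (inverse a ^ (1 + e) * b ^ d') = inverse (a * b)"
        using f(2) g(2) by (simp add: d' power_inverse power_add field_simps)
      finally show ?thesis .
    qed
    ultimately show "v \<in> L n" using v(1) by simp
  qed
  have "L \<in> stalks (D_coeffs N (d + e, [a * b])) \<longleftrightarrow> L \<in> stalks (D_coeffs N (d, [a])) \<and> L \<in> stalks (D_coeffs N (e, [b]))"
    if L: "L \<in> hat_stalks N" for L
    unfolding iff[OF L]
  proof (intro iffI conjI allI; (elim conjE)?)
    show "D_coeffs N (d, [a]) n \<subseteq> L n" if "\<forall>n. D_coeffs N (d + e, [a * b]) n \<subseteq> L n" for n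
      by (rule order_trans[OF sub(1)]) (use that in simp)
    show "D_coeffs N (e, [b]) n \<subseteq> L n" if "\<forall>n. D_coeffs N (d + e, [a * b]) n \<subseteq> L n" for n
      by (rule order_trans[OF sub(2)]) (use that in simp)
  qed (rule join[OF L])
  then show ?thesis
    using D_stalks_hat[OF N f' f(2)] D_stalks_hat[OF N h'] by (meson IntD1 IntD2 IntI equalityI subsetD subsetI)
qed

text \<open>Inverting \<open>0\<close> identifies all elements of a given arity. In particular
  \<open>1\<close> equals the value of the nullary operation, which lies in every ideal, so no ideal
  is prime.\<close>

lemma prime_ideals_hom_localization_zero: "prime_ideals (hom_localization (graded_Z N) (d, [0])) = {}"
proof (rule ccontr)
  let ?H = "hom_localization (graded_Z N) (d, [0])" and ?fr = "gfrac (graded_Z N) (d, [0])"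
  assume "prime_ideals ?H \<noteq> {}"
  then obtain P where P: "submodule ?H (free_module ?H 1) P" "submonoid ?H (car ?H 1 - P)"
    by (auto simp: prime_ideals_def prime_ideal_def)
  have gp: "gpow_scale (graded_Z N) (d, [0]) 1 e n x = qscale 0 x" if "length x = n" for e n x
    using gpow_scale_eq[OF that, of N d 0 1] by simp
  have triv: "?fr n x k = {(y, l). y \<in> gcar (graded_Z N) (l * d) n}" if "length x = n" for n x k
  proof -
    have "\<exists>m. gpow_scale (graded_Z N) (d, [0]) m ((l + k) * d) n (gpow_scale (graded_Z N) (d, [0]) l (k * d) n x) =
          gpow_scale (graded_Z N) (d, [0]) m ((k + l) * d) n (gpow_scale (graded_Z N) (d, [0]) k (l * d) n y)"
      if "y \<in> gcar (graded_Z N) (l * d) n" for y l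
    \<comment> \<open>One further multiplication by \<open>0\<close> makes both sides the zero
      vector.\<close>
    proof (intro exI[of _ 1])
      have "length y = n" using that gcar_length by blast
      then show "gpow_scale (graded_Z N) (d, [0]) 1 ((l + k) * d) n (gpow_scale (graded_Z N) (d, [0]) l (k * d) n x) =
          gpow_scale (graded_Z N) (d, [0]) 1 ((k + l) * d) n (gpow_scale (graded_Z N) (d, [0]) k (l * d) n y)"
        using \<open>length x = n\<close> by (simp add: gp gpow_scale_eq) (simp add: qscale_def list_eq_iff_nth_eq)
    qed
    then show ?thesis by (auto simp: gfrac_def)
  qed
  define c where "c = ?fr 0 [] 0"
  have nil: "[] \<in> gcar (graded_Z N) 0 0" by (simp add: gcar_iff Z_coeffs_iff)
  have c: "c \<in> car ?H 0" using nil unfolding c_def hom_localization_def by (auto intro!: exI[of _ "[]"] exI[of _ 0])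
  define R where "R c' \<longleftrightarrow> (\<exists>b k bs l. b \<in> gcar (graded_Z N) (k * d) 0 \<and> set bs \<subseteq> gcar (graded_Z N) (l * d) 1 \<and>
      c = ?fr 0 b k \<and> [] = map (\<lambda>b. ?fr 1 b l) bs \<and> c' = ?fr 1 (qlin 1 b bs) (k + l))" for c'
  have "R (?fr 1 (qlin 1 [] []) (0 + 0))"
    unfolding R_def
    by (rule exI[of _ "[]"], rule exI[of _ 0], rule exI[of _ "[]"], rule exI[of _ 0]) (use nil c_def in simp)
  then have R: "R (SOME c'. R c')" by (rule someI[of R])
  obtain b k bs l where "(SOME c'. R c') = ?fr 1 (qlin 1 b bs) (k + l)"
    using R unfolding R_def[of "SOME c'. R c'"] by blast
  moreover have "app ?H 1 c [] = (SOME c'. R c')" by (simp add: hom_localization_def R_def)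
  ultimately have "app ?H 1 c [] = ?fr 1 (qlin 1 b bs) (k + l)" by simp
  moreover have "munit ?H = ?fr 1 (qvar 1 0) 0" by (simp add: munit_def hom_localization_def)
  ultimately have "app ?H 1 c [] = munit ?H" by (simp add: triv)
  moreover have "app ?H 1 c [] \<in> P" using P(1) c by (auto simp: submodule_def free_module_def)
  moreover have "munit ?H \<notin> P" using P(2) by (auto simp: submonoid_def)
  ultimately show False by simp
qed

abbreviation D_St :: "nat \<Rightarrow> nat \<times> rat list \<Rightarrow> (rat list \<times> nat) set set \<Rightarrow> nat \<Rightarrow> rat list set" where
  "D_St N f \<equiv> spec_St (D_val f) (D_coeffs N f)"

abbreviation D_Spec where "D_Spec N f \<equiv> Spec (hom_localization (graded_Z N) f)"

context
  fixes N :: nat assumes N: "N \<ge> 2"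
begin

lemma posZ_cases:
  assumes "f \<in> posZ N"
  obtains d where "f = (d, [0])" | d a where "f = (d, [a])" "d > 0" "a \<in> \<int>" "\<bar>a\<bar> \<le> of_nat N ^ d" "a \<noteq> 0"
  using assms by (auto simp: positive_iff)

lemma D_zspace:
  assumes f: "f \<in> posZ N"
  shows "zspace (D_Spec N f) (spec_ev (D_val f)) (D_St N f)"
  using f
proof (cases rule: posZ_cases)
  case (1 d)
  then show ?thesis using zspace_Spec_empty(1)[OF prime_ideals_hom_localization_zero] by simp
next
  case (2 d a)
  then show ?thesis using qring.zspace_Spec[OF qring_H[OF N]] by simp
qed

lemma D_points:
  assumes f: "f \<in> posZ N"
  shows "D_St N f ` pts (D_Spec N f) = (if snd f = [0] then {} else stalks (D_coeffs N f))"
  using f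
proof (cases rule: posZ_cases)
  case (1 d)
  then show ?thesis using zspace_Spec_empty(2)[OF prime_ideals_hom_localization_zero] by simp
next
  case (2 d a)
  then show ?thesis
    using qring.St_stalks[OF qring_H[OF N]] qring.topspace_Spec[OF qring_H[OF N]] by simp
qed

lemma D_points_hat: "f \<in> posZ N \<Longrightarrow> x \<in> pts (D_Spec N f) \<Longrightarrow> D_St N f x \<in> hat_stalks N"
proof -
  assume f: "f \<in> posZ N" and x: "x \<in> pts (D_Spec N f)"
  have "D_St N f x \<in> D_St N f ` pts (D_Spec N f)" using x by blast
  then have L: "snd f \<noteq> [0]" "D_St N f x \<in> stalks (D_coeffs N f)" unfolding D_points[OF f] by (auto split: if_splits)
  from f show ?thesis
  proof (cases rule: posZ_cases)
    case (2 d a)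
    then show ?thesis using L D_stalks_hat[OF N 2(2-5)] by blast
  qed (use L in simp)
qed

lemma D_zmor:
  assumes f: "f \<in> posZ N" and g: "g \<in> posZ N" and h: "h = gmult (graded_Z N) f g \<or> h = gmult (graded_Z N) g f"
  defines "j \<equiv> Spec_mor (hom_localization (graded_Z N) f) (hom_localization (graded_Z N) h) (hom_localization_map (graded_Z N) g h)"
  shows "zmor (D_Spec N h) (spec_ev (D_val h)) (D_Spec N f) (spec_ev (D_val f)) j"
    and "w \<in> pts (D_Spec N h) \<Longrightarrow> D_St N f (pt j w) = D_St N h w"
proof -
  obtain d a e b where fg: "f = (d, [a])" "g = (e, [b])" using f g by (auto simp: positive_iff)
  have heq: "h = (d + e, [a * b])" using h fg by (auto simp: gmult_eq add.commute mult.commute)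
  have "zmor (D_Spec N h) (spec_ev (D_val h)) (D_Spec N f) (spec_ev (D_val f)) j \<and>
    (w \<in> pts (D_Spec N h) \<longrightarrow> D_St N f (pt j w) = D_St N h w)"
  proof (cases "a = 0 \<or> b = 0")
    case True
    then have h0: "h = (d + e, [0])" using heq by auto
    note e = zspace_Spec_empty(2)[OF prime_ideals_hom_localization_zero, of N "d + e", folded h0]
    note m = Spec_mor_empty[OF prime_ideals_hom_localization_zero[of N "d + e"], of "hom_localization (graded_Z N) f"
        "hom_localization_map (graded_Z N) g h", folded h0]
    have "continuous_map (topo (D_Spec N h)) (topo (D_Spec N f)) (pt j)"
      using e by (simp add: continuous_map_def)
    then show ?thesis using e m(1) unfolding j_def by (simp add: zmor_def m(2))
  next
    case False
    interpret m: qring_mor "hom_localization (graded_Z N) f" "D_val f" "D_coeffs N f" "hom_localization (graded_Z N) h"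
      "D_val h" "D_coeffs N h" "hom_localization_map (graded_Z N) g h"
      using qring_mor_D[OF N, of d a e b h] f g False heq unfolding fg by simp
    have "D_St N f (pt j w) = D_St N h w" if w: "w \<in> pts (D_Spec N h)" for w
      unfolding j_def
    proof (rule m.St_f)
      show w': "w \<in> prime_ideals (hom_localization (graded_Z N) h)" using w by simp
      have "D_St N h w \<in> stalks (D_coeffs N h)" using w' m.B.St_stalks by blast
      then show "D_St N h w \<in> stalks (D_coeffs N f)"
        using D_stalks_mult[OF N, of d a e b] f g False heq unfolding fg by blast
    qed
    then show ?thesis using m.zmor_Spec_mor unfolding j_def by blast
  qed
  then show "zmor (D_Spec N h) (spec_ev (D_val h)) (D_Spec N f) (spec_ev (D_val f)) j"
    "w \<in> pts (D_Spec N h) \<Longrightarrow> D_St N f (pt j w) = D_St N h w" by blast+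
qed

lemma glue_data_Proj:
  "glue_data (posZ N) (D_Spec N) (posZ N \<times> posZ N) (\<lambda>(f, g). D_Spec N (gmult (graded_Z N) f g)) fst snd
     (\<lambda>(f, g). Spec_mor (hom_localization (graded_Z N) f) (hom_localization (graded_Z N) (gmult (graded_Z N) f g))
          (hom_localization_map (graded_Z N) g (gmult (graded_Z N) f g)))
     (\<lambda>(f, g). Spec_mor (hom_localization (graded_Z N) g) (hom_localization (graded_Z N) (gmult (graded_Z N) f g))
          (hom_localization_map (graded_Z N) f (gmult (graded_Z N) f g)))
     (\<lambda>f. spec_ev (D_val f)) (D_St N)
     (\<lambda>(f, g). spec_ev (D_val (gmult (graded_Z N) f g))) (\<lambda>(f, g). D_St N (gmult (graded_Z N) f g))"
  (is "glue_data ?I ?X ?K ?W fst snd ?j1 ?j2 ?ev ?St ?evW ?StW")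
proof (rule glue_data.intro)
  have mult: "gmult (graded_Z N) f g \<in> ?I" if "f \<in> ?I" "g \<in> ?I" for f g
    using gmult_positive[OF _ that] N by simp
  show "zspace (?X f) (?ev f) (?St f)" if "f \<in> ?I" for f by (rule D_zspace[OF that])
  show "zspace (?W k) (?evW k) (?StW k)" if k: "k \<in> ?K" for k
    using D_zspace[OF mult, of "fst k" "snd k"] k by (simp add: case_prod_beta mem_Times_iff)
  show "fst k \<in> ?I" "snd k \<in> ?I" if "k \<in> ?K" for k using that by auto
  show "zmor (?W k) (?evW k) (?X (fst k)) (?ev (fst k)) (?j1 k)" if k: "k \<in> ?K" for k
    using D_zmor(1)[of "fst k" "snd k"] k by (simp add: case_prod_beta mem_Times_iff)
  show "zmor (?W k) (?evW k) (?X (snd k)) (?ev (snd k)) (?j2 k)" if k: "k \<in> ?K" for k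
    using D_zmor(1)[of "snd k" "fst k"] k by (simp add: case_prod_beta mem_Times_iff)
  show "?St (fst k) (pt (?j1 k) w) = ?StW k w" if k: "k \<in> ?K" and w: "w \<in> pts (?W k)" for k w
    using D_zmor(2)[of "fst k" "snd k"] k w by (simp add: case_prod_beta mem_Times_iff)
  show "?St (snd k) (pt (?j2 k) w) = ?StW k w" if k: "k \<in> ?K" and w: "w \<in> pts (?W k)" for k w
    using D_zmor(2)[of "snd k" "fst k"] k w by (simp add: case_prod_beta mem_Times_iff)
  show "f = g \<or> (\<exists>k\<in>?K. \<exists>w\<in>pts (?W k). ?StW k w = ?St f x \<and>
        (fst k = f \<and> snd k = g \<or> fst k = g \<and> snd k = f))"
    if f: "f \<in> ?I" and g: "g \<in> ?I" and x: "x \<in> pts (?X f)" and y: "y \<in> pts (?X g)"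
      and eq: "?St f x = ?St g y" for f g x y
  proof -
    have "?St f x \<in> ?St f ` pts (?X f)" "?St f x \<in> ?St g ` pts (?X g)"
      by (rule imageI[OF x], unfold eq, rule imageI[OF y])
    then have L: "snd f \<noteq> [0]" "?St f x \<in> stalks (D_coeffs N f)" "snd g \<noteq> [0]" "?St f x \<in> stalks (D_coeffs N g)"
      unfolding D_points[OF f] D_points[OF g] by (auto split: if_splits)
    obtain d a e b where fg: "f = (d, [a])" "g = (e, [b])" using f g by (auto simp: positive_iff)
    \<comment> \<open>A local ring common to both charts belongs to their product, which supplies
      the linking point of the overlap.\<close>
    have "?St f x \<in> stalks (D_coeffs N (gmult (graded_Z N) f g))"
      using D_stalks_mult[OF N, of d a e b] f g L unfolding fg gmult_eq by simp
    moreover have "snd (gmult (graded_Z N) f g) \<noteq> [0]" using L fg by (simp add: gmult_eq)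
    ultimately have "?St f x \<in> D_St N (gmult (graded_Z N) f g) ` pts (D_Spec N (gmult (graded_Z N) f g))"
      unfolding D_points[OF mult[OF f g]] by simp
    then obtain w where w: "?St f x = D_St N (gmult (graded_Z N) f g) w" "w \<in> pts (D_Spec N (gmult (graded_Z N) f g))"
      by (rule imageE)
    have "\<exists>w\<in>pts (?W (f, g)). ?StW (f, g) w = ?St f x \<and>
        (fst (f, g) = f \<and> snd (f, g) = g \<or> fst (f, g) = g \<and> snd (f, g) = f)"
      using w by (intro bexI[of _ w]) simp_all
    moreover have "(f, g) \<in> ?K" using f g by simp
    ultimately show ?thesis by (intro disjI2) (rule bexI)
  qed
  show "\<exists>F. finite F \<and> F \<subseteq> Sigma UNIV (?St f x) \<and> (\<forall>g\<in>?I. \<forall>y\<in>pts (?X g).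
        F \<subseteq> Sigma UNIV (?St g y) \<longrightarrow> ?St g y \<in> ?St f ` pts (?X f))"
    if f: "f \<in> ?I" and x: "x \<in> pts (?X f)" for f x
  proof -
    have "?St f x \<in> ?St f ` pts (?X f)" using x by blast
    then have L: "snd f \<noteq> [0]" "?St f x \<in> stalks (D_coeffs N f)" unfolding D_points[OF f] by (auto split: if_splits)
    obtain d a where fa: "f = (d, [a])" "d > 0" "a \<in> \<int>" "\<bar>a\<bar> \<le> of_nat N ^ d" "a \<noteq> 0"
      using f L(1) by (auto simp: positive_iff)
    obtain F where F: "finite F" "\<And>L. L \<in> hat_stalks N \<Longrightarrow> L \<in> stalks (D_coeffs N f) \<longleftrightarrow> F \<subseteq> Sigma UNIV L"
      using D_stalks_open[OF N fa(2-5)] fa(1) by metis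
    show ?thesis
      using F L D_points_hat f x unfolding D_points[OF f] by (intro exI[of _ F]) (simp add: L(1))
  qed
qed

interpretation glue_Proj: glue_data "posZ N" "D_Spec N" "posZ N \<times> posZ N"
     "\<lambda>(f, g). D_Spec N (gmult (graded_Z N) f g)" fst snd
     "\<lambda>(f, g). Spec_mor (hom_localization (graded_Z N) f) (hom_localization (graded_Z N) (gmult (graded_Z N) f g))
          (hom_localization_map (graded_Z N) g (gmult (graded_Z N) f g))"
     "\<lambda>(f, g). Spec_mor (hom_localization (graded_Z N) g) (hom_localization (graded_Z N) (gmult (graded_Z N) f g))
          (hom_localization_map (graded_Z N) f (gmult (graded_Z N) f g))"
     "\<lambda>f. spec_ev (D_val f)" "D_St N"
     "\<lambda>(f, g). spec_ev (D_val (gmult (graded_Z N) f g))" "\<lambda>(f, g). D_St N (gmult (graded_Z N) f g)"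
  by (rule glue_data_Proj)

lemma G_Proj: "glue_Proj.G = Proj (graded_Z N)"
  by (simp add: glue_Proj.G_def Proj_def)

lemma Proj_stalks: "glue_Proj.gSt ` pts (Proj (graded_Z N)) = hat_stalks N"
proof -
  have eq: "glue_Proj.gSt ` pts (Proj (graded_Z N)) =
      (\<Union>f\<in>posZ N. D_St N f ` pts (D_Spec N f))"
    using glue_Proj.gSt_image by (simp add: G_Proj)
  have N': "(1::rat) < of_nat N" "(1::rat) \<le> of_nat N" using N by simp_all
  \<comment> \<open>Two elements of degree \<open>1\<close> already account for all local rings:
    \<open>1\<close> gives \<open>Z\<close> and \<open>N\<close> gives \<open>A_N\<close>.\<close>
  have f1: "(1, [1]) \<in> posZ N" and fN: "(1, [of_nat N]) \<in> posZ N" using N' by (auto simp: positive_iff)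
  have "D_coeffs N (1, [1]) = Z_coeffs"
    using D_coeffs_eq[OF N, of 1 1] N' B_coeffs_1 by (simp add: One_nat_def)
  moreover have "D_coeffs N (1, [of_nat N]) = A_coeffs N"
    using D_coeffs_eq[OF N, of 1 "of_nat N"] N' by simp
  ultimately have "hat_stalks N = D_St N (1, [1]) ` pts (D_Spec N (1, [1])) \<union>
      D_St N (1, [of_nat N]) ` pts (D_Spec N (1, [of_nat N]))"
    unfolding D_points[OF f1] D_points[OF fN] hat_stalks_def using N' by auto
  then have "hat_stalks N \<subseteq> glue_Proj.gSt ` pts (Proj (graded_Z N))"
    unfolding eq using f1 fN by blast
  moreover have "glue_Proj.gSt ` pts (Proj (graded_Z N)) \<subseteq> hat_stalks N"
    unfolding eq using D_points_hat by blast
  ultimately show ?thesis by blast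
qed

lemma SpecZhat_Proj: "schemes_isomorphic (SpecZhat N) (Proj (graded_Z N))"
proof -
  have "zspace_pair (SpecZhat N) hat_ev (hat_St N) (Proj (graded_Z N)) glue_Proj.gev glue_Proj.gSt"
    using zspace_hat[OF N] glue_Proj.zspace_glue by (simp add: zspace_pair_def G_Proj)
  then interpret zspace_pair "SpecZhat N" hat_ev "hat_St N" "Proj (graded_Z N)" glue_Proj.gev glue_Proj.gSt .
  \<comment> \<open>Again an arbitrary injection of rational vectors into the type of
    sections.\<close>
  have inj: "inj (\<lambda>(v :: rat list) (_ :: nat \<times> rat list) (_ :: (rat list \<times> nat) set set).
      {({(v, 0 :: nat)}, {} :: (rat list \<times> nat) set)})"
    by (rule injI) (auto simp: fun_eq_iff)
  show ?thesis
  proof (rule zspaces_isomorphic[OF inj_section inj])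
    show "hat_St N ` pts (SpecZhat N) = glue_Proj.gSt ` pts (Proj (graded_Z N))"
      unfolding hat_St_image[OF N] Proj_stalks ..
    fix m assume m: "m \<in> pts (SpecZhat N)"
    obtain c where "m \<in> X.chart_dom (chart_coeffs N c)" using hat_chart_ex[OF N m] .
    then show "\<exists>C. X.chart C \<and> Y.chart C \<and> m \<in> X.chart_dom C"
      using hat_chart[OF N] Y.chart_of_hat_stalks[OF N Proj_stalks] by blast
  qed
qed

lemma SpecZhat_projective: "projective_scheme_over_F1 TYPE(rat list) (SpecZhat N)"
  unfolding projective_scheme_over_F1_def
  using hat_over_F1[OF N] SpecZhat_Proj graded_Z[of N] N by (metis one_le_numeral order_trans)

end

section \<open>The projective limit\<close>

lemma mor_eq_refl: "mor_eq X Y f f"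
  by (simp add: mor_eq_def)

lemma mor_eq_trans: "mor_eq X Y f g \<Longrightarrow> mor_eq X Y g h \<Longrightarrow> mor_eq X Y f h"
  by (simp add: mor_eq_def)

lemma mor_eq_sym: "mor_eq X Y f g \<Longrightarrow> mor_eq X Y g f"
  by (simp add: mor_eq_def)

lemma comp_id_right [simp]: "comp_mor X f id_mor = f"
  by (simp add: comp_mor_def id_mor_def)

text \<open>On this side the identity law holds only up to \<open>mor_eq\<close>:
  \<open>preim Y id_mor V\<close> is \<open>V\<close> for subsets of the points of \<open>Y\<close>,
  in particular for open sets.\<close>

lemma comp_id_left: "mor_eq X Y (comp_mor Y id_mor f) f"
proof -
  have "preim Y id_mor V = V" if "openin (topo Y) V" for V
    using openin_subset[OF that] by (auto simp: preim_def id_mor_def)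
  then show ?thesis by (auto simp: mor_eq_def comp_mor_def) (simp_all add: id_mor_def)
qed

lemma comp_comp_id_left: "mor_eq X Y (comp_mor Z (comp_mor Y id_mor f) g) (comp_mor Z f g)"
proof -
  have "preim Y id_mor V = V" if "openin (topo Y) V" for V
    using openin_subset[OF that] by (auto simp: preim_def id_mor_def)
  moreover have "pt (comp_mor Y id_mor f) = pt f" by (simp add: comp_mor_def id_mor_def)
  moreover from this have "preim Z (comp_mor Y id_mor f) V = preim Z f V" for V by (simp add: preim_def)
  ultimately show ?thesis
    unfolding mor_eq_def by (auto simp: comp_mor_def) (simp_all add: id_mor_def)
qed

lemma colim_eq_comp_id:
  assumes "pro_object T" "k \<in> idx T"
  shows "colim_eq T Y (k, comp_mor Y id_mor f) (k, f)"
proof -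
  have "le T k k" using assms by (simp add: pro_object_def)
  then show ?thesis
    unfolding colim_eq_def split_conv using assms(2) comp_comp_id_left by (intro bexI[of _ k] conjI)
qed

lemma colim_eq_cancel_id:
  assumes "colim_eq T Y (k, comp_mor Y id_mor f) z"
  shows "colim_eq T Y (k, f) z"
proof -
  obtain k' g where z: "z = (k', g)" by force
  obtain l where l: "l \<in> idx T" "le T k l" "le T k' l"
    and eq: "mor_eq (obj T l) Y (comp_mor (obj T k) (comp_mor Y id_mor f) (tr T k l)) (comp_mor (obj T k') g (tr T k' l))"
    using assms unfolding z colim_eq_def by auto
  show ?thesis
    unfolding z colim_eq_def split_conv
    using l mor_eq_trans[OF mor_eq_sym[OF comp_comp_id_left] eq] by blast
qed

lemma transition_refl: "transition N N = id_mor"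
  by (simp add: transition_def)

text \<open>The transitions are chosen separately for each pair of indices. They are compatible up
  to \<open>mor_eq\<close> because composites of canonical morphisms are canonical and canonical
  morphisms are unique.\<close>

lemma pro_object_compactification: "pro_object compactification"
  unfolding pro_object_def
proof (intro conjI ballI impI; (elim conjE)?)
  let ?D = compactification
  show "idx ?D \<noteq> {}" by (auto simp: compactification_def intro: exI[of _ 2])
  show "le ?D i i" for i by (simp add: compactification_def)
  show "le ?D i k" if "le ?D i j" "le ?D j k" for i j k using that by (auto simp: compactification_def)
  show "\<exists>k\<in>idx ?D. le ?D i k \<and> le ?D j k" if "i \<in> idx ?D" "j \<in> idx ?D" for i j
    using that by (intro bexI[of _ "i * j"]) (auto simp: compactification_def less_1_mult)
  show "generalized_scheme (obj ?D i)" if "i \<in> idx ?D" for i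
    using that hat_scheme[of i] by (simp add: compactification_def)
  show "scheme_morphism (obj ?D j) (obj ?D i) (tr ?D i j)" if "i \<in> idx ?D" "j \<in> idx ?D" "le ?D i j" for i j
    using that canonical_transition(2)[of i j] by (simp add: compactification_def)
  show "mor_eq (obj ?D i) (obj ?D i) (tr ?D i i) id_mor" for i
    by (simp add: compactification_def transition_refl mor_eq_refl)
  show "mor_eq (obj ?D k) (obj ?D i) (comp_mor (obj ?D j) (tr ?D i j) (tr ?D j k)) (tr ?D i k)"
    if "i \<in> idx ?D" "j \<in> idx ?D" "k \<in> idx ?D" and "le ?D i j" "le ?D j k" for i j k
  proof -
    have *: "i \<ge> 2" "j \<ge> 2" "k \<ge> 2" "i dvd j" "j dvd k" "i dvd k"
      using that by (auto simp: compactification_def)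
    show ?thesis
      using canonical_eq[OF *(1,3) canonical_comp[OF *(2)] canonical_transition(1)[OF *(1,3,6)]]
        canonical_transition(1)[OF *(1,2,4)] canonical_transition(1)[OF *(2,3,5)]
      by (simp add: compactification_def)
  qed
qed

text \<open>By definition a morphism from \<open>T\<close> to a pro-object \<open>P\<close> is a
  compatible family of elements of \<open>colim_k Hom(T_k, P_i)\<close>, and such a family is the
  same thing as a cone over the system \<open>P\<close>.\<close>

lemma pro_limit_of_itself:
  assumes P: "pro_object P" and id: "\<And>i. i \<in> idx P \<Longrightarrow> tr P i i = id_mor"
  shows "is_pro_limit (T :: ('k \<times> 'q \<times> 't) itself) P P (\<lambda>i _. (i, id_mor))"
  unfolding is_pro_limit_def
proof (intro conjI allI impI; (elim conjE)?)
  have refl: "le P i i" if "i \<in> idx P" for i using P that by (simp add: pro_object_def)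
  have id_scheme: "scheme_morphism (obj P i) (obj P i) id_mor" if "i \<in> idx P" for i
    using P id[OF that] refl[OF that] that unfolding pro_object_def by metis
  show "pro_object P" by (rule P)
  show "pro_cone P P (\<lambda>i _. (i, id_mor))"
    unfolding pro_cone_def
  proof (intro conjI ballI impI)
    fix i assume i: "i \<in> idx P"
    show "pro_morphism P (const_pro (obj P i)) (\<lambda>_. (i, id_mor))"
      using i id_scheme refl mor_eq_refl
      by (auto simp: pro_morphism_def const_pro_def colim_eq_def intro!: bexI[of _ i])
    fix j assume j: "j \<in> idx P" "le P i j"
    have "mor_eq (obj P j) (obj P i) (comp_mor (obj P i) id_mor (tr P i j)) (comp_mor (obj P j) (tr P i j) (tr P j j))"
      using comp_id_left id[OF j(1)] by simp
    then show "pro_eq P (const_pro (obj P i)) (\<lambda>_. (i, id_mor))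
        (pro_comp (const_pro (obj P j)) (const_mor (tr P i j)) (\<lambda>_. (j, id_mor)))"
      using j refl[OF j(1)]
      by (auto simp: pro_eq_def pro_comp_def const_pro_def const_mor_def colim_eq_def intro!: bexI[of _ j])
  qed
  fix T :: "('k, 'q, 't) prosys" and \<tau>
  assume T: "pro_object T" and \<tau>: "pro_cone P T \<tau>"
  \<comment> \<open>A constant pro-object has the single index \<open>()\<close>, so the cone
    provides exactly one representative for each \<open>i\<close>, and its compatibility is that of
    a morphism to \<open>P\<close>.\<close>
  define u where "u i = \<tau> i ()" for i
  have u1: "case u i of (k, g) \<Rightarrow> k \<in> idx T \<and> scheme_morphism (obj T k) (obj P i) g" if "i \<in> idx P" for i
    using \<tau> that by (auto simp: u_def pro_cone_def pro_morphism_def const_pro_def)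
  have u2: "colim_eq T (obj P i) (u i) (case u j of (k, g) \<Rightarrow> (k, comp_mor (obj P j) (tr P i j) g))"
    if "i \<in> idx P" "j \<in> idx P" "le P i j" for i j
    using \<tau> that by (auto simp: u_def pro_cone_def pro_eq_def pro_comp_def const_pro_def const_mor_def)
  have "pro_morphism T P u" unfolding pro_morphism_def by (intro conjI ballI impI u1 u2)
  moreover have "pro_eq T (const_pro (obj P i)) (pro_comp P (\<lambda>_. (i, id_mor)) u) (\<tau> i)" if i: "i \<in> idx P" for i
  proof -
    obtain k g where kg: "u i = (k, g)" by force
    then have "k \<in> idx T" using u1[OF i] by simp
    from colim_eq_comp_id[OF T this] kg show ?thesis
      by (simp add: pro_eq_def pro_comp_def const_pro_def u_def)
  qed
  moreover have "pro_eq T P v u"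
    if v: "pro_morphism T P v" "\<forall>i\<in>idx P. pro_eq T (const_pro (obj P i)) (pro_comp P (\<lambda>_. (i, id_mor)) v) (\<tau> i)" for v
    unfolding pro_eq_def
  proof
    fix i assume i: "i \<in> idx P"
    obtain k g where kg: "v i = (k, g)" by force
    have "pro_eq T (const_pro (obj P i)) (pro_comp P (\<lambda>_. (i, id_mor)) v) (\<tau> i)" using v(2) i by blast
    then have "colim_eq T (obj P i) (k, comp_mor (obj P i) id_mor g) (u i)"
      using kg by (simp add: pro_eq_def pro_comp_def const_pro_def u_def)
    then show "colim_eq T (obj P i) (v i) (u i)" unfolding kg by (rule colim_eq_cancel_id)
  qed
  ultimately show "\<exists>u. pro_morphism T P u \<and>
           (\<forall>i\<in>idx P. pro_eq T (const_pro (obj P i)) (pro_comp P (\<lambda>_. (i, id_mor)) u) (\<tau> i)) \<and>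
           (\<forall>v. pro_morphism T P v \<and>
              (\<forall>i\<in>idx P. pro_eq T (const_pro (obj P i)) (pro_comp P (\<lambda>_. (i, id_mor)) v) (\<tau> i)) \<longrightarrow>
              pro_eq T P v u)"
    by blast
qed

theorem mainTheorem1:
  shows "projective_pro_scheme_over_F1 TYPE(rat list) TYPE('k \<times> 'q \<times> 't)
           compactification compactification_proj compactification"
  unfolding projective_pro_scheme_over_F1_def
proof (intro conjI ballI)
  show "pro_object compactification" by (rule pro_object_compactification)
  show "projective_scheme_over_F1 TYPE(rat list) (obj compactification N)" if "N \<in> idx compactification" for N
    using that SpecZhat_projective[of N] by (simp add: compactification_def)
  have "compactification_proj = (\<lambda>N _. (N, id_mor))" by (simp add: compactification_proj_def fun_eq_iff)
  then show "is_pro_limit TYPE('k \<times> 'q \<times> 't) compactification compactification compactification_proj"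
    using pro_limit_of_itself[OF pro_object_compactification]
    by (simp add: compactification_def transition_refl)
qed

end
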